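(* There is an absolute constant $K>0$ such that for all integers $N\geqslant 1$, $$\left|\sum_{h/k \in \mathcal{F}_{100}} C_{hk1}(N) - \operatorname{Re}\left[(-2 z_0 e^{-\pi i z_0})\frac{w_0^{-N}}{N^2}\right]\right| \leqslant K\,\frac{|w_0|^{-N}}{N^3}.$$
   Context: For an integer $N\geqslant 1$ let $\mathcal{F}_N:=\{h/k : 1\leqslant k\leqslant N,\ 0\leqslant h<k,\ \gcd(h,k)=1\}$ (Farey fractions of order $N$ in $[0,1)$). The Rademacher coefficients $C_{hk\ell}(N)$ are defined by the partial fraction decomposition $$\prod_{j=1}^N \frac{1}{1-q^j}=\sum_{h/k\in\mathcal F_N}\ \sum_{\ell=1}^{\lfloor N/k\rfloor}\frac{C_{hk\ell}(N)}{(q-e^{2\pi i h/k})^\ell},$$ with the convention $C_{hk\ell}(N):=0$ when $\ell>\lfloor N/k\rfloor$ (in particular when $k>N$). $\operatorname{Li}_2$ denotes the principal branch of the dilogarithm (single-valued holomorphic on $\mathbb C\setminus[1,\infty)$, equal to $\sum_{n\ge1} z^n/n^2$ for $|z|\le1$), and $\log$ the principal logarithm. $w_0$ is the unique solution $w\in\mathbb C\setminus((-\infty,0]\cup[1,\infty))$ of $\operatorname{Li}_2(w)-2\pi i\log w=0$; numerically $w_0\approx 0.9161978-0.1824589i$. Set $z_0:=1+\log(1-w_0)/(2\pi i)$, so $w_0=1-e^{2\pi i z_0}$ and $1/2<\operatorname{Re}(z_0)<3/2$. *)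

theory Defs
  imports "HOL-Complex_Analysis.Complex_Analysis"
begin

text \<open>A Farey fraction \<open>h/k\<close> is represented by its unique pair \<open>(h, k)\<close> in lowest terms.\<close>

definition farey :: "nat \<Rightarrow> (nat \<times> nat) set" where
  "farey N = {(h, k). 1 \<le> k \<and> k \<le> N \<and> h < k \<and> coprime h k}"

text \<open>The decomposition is an identity of rational functions, required here at every \<open>q\<close> at which
  no denominator vanishes. The second conjunct is the convention that all other coefficients are 0.\<close>

definition is_rademacher_coeff :: "nat \<Rightarrow> (nat \<Rightarrow> nat \<Rightarrow> nat \<Rightarrow> complex) \<Rightarrow> bool" where
  "is_rademacher_coeff N C \<longleftrightarrow>
     (\<forall>q::complex. (\<forall>j\<in>{1..N}. q ^ j \<noteq> 1) \<longrightarrow>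
        (\<Prod>j=1..N. 1 / (1 - q ^ j)) =
        (\<Sum>(h, k)\<in>farey N. \<Sum>l=1..N div k.
           C h k l / (q - exp (2 * of_real pi * \<i> * of_nat h / of_nat k)) ^ l)) \<and>
     (\<forall>h k l. \<not> ((h, k) \<in> farey N \<and> 1 \<le> l \<and> l \<le> N div k) \<longrightarrow> C h k l = 0)"

definition rademacher_coeff :: "nat \<Rightarrow> nat \<Rightarrow> nat \<Rightarrow> nat \<Rightarrow> complex" where
  "rademacher_coeff N = (THE C. is_rademacher_coeff N C)"

definition is_dilog :: "(complex \<Rightarrow> complex) \<Rightarrow> bool" where
  "is_dilog f \<longleftrightarrow>
     f holomorphic_on - (of_real ` {1..}) \<and>
     (\<forall>z. cmod z \<le> 1 \<longrightarrow> (\<lambda>n. z ^ Suc n / of_nat (Suc n) ^ 2) sums f z)"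

text \<open>The choice operator only affects values on the cut \<open>(1, \<infinity>)\<close>; see \<open>is_dilog_unique\<close> below.\<close>

definition dilog :: "complex \<Rightarrow> complex" where
  "dilog = (SOME f. is_dilog f)"

definition w0 :: complex where
  "w0 = (THE w. w \<notin> of_real ` {..0} \<and> w \<notin> of_real ` {1..} \<and>
            dilog w - 2 * of_real pi * \<i> * Ln w = 0)"

definition z0 :: complex where
  "z0 = 1 + Ln (1 - w0) / (2 * of_real pi * \<i>)"


subsection \<open>Well-definedness of the dilogarithm\<close>

lemma closed_dilog_cut: "closed (complex_of_real ` {1..})"
  by (intro closed_injective_linear_image) 
     (auto intro!: bounded_linear.linear bounded_linear_of_real simp: inj_def)

lemma starlike_dilog_domain: "starlike (- complex_of_real ` {1..})"
  unfolding starlike_def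
proof (intro bexI[of _ 0] ballI subsetI)
  fix x y assume x: "x \<in> - complex_of_real ` {1..}" and "y \<in> closed_segment 0 x"
  then obtain u where u: "0 \<le> u" "u \<le> 1" "y = u *\<^sub>R x" by (auto simp: in_segment)
  show "y \<in> - complex_of_real ` {1..}"
  proof
    assume "y \<in> complex_of_real ` {1..}"
    then obtain r where r: "r \<ge> 1" "y = of_real r" by auto
    with u have "u \<noteq> 0" by auto
    then have "x = of_real (r / u)" using u r by (simp add: scaleR_conv_of_real field_simps)
    moreover have "r / u \<in> {1..}" using u r \<open>u \<noteq> 0\<close> by (simp add: field_simps)
    ultimately show False using x by blast
  qed
qed auto

lemma is_dilog_unique:
  assumes f: "is_dilog f" and g: "is_dilog g" and z: "z \<notin> of_real ` {1<..}"
  shows "f z = g z"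
proof -
  have eq: "f w = g w" if "cmod w \<le> 1" for w
    using f g that sums_unique2[of _ "f w" "g w"] unfolding is_dilog_def by blast
  show ?thesis
  proof (cases "z = 1")
    case True
    then show ?thesis using eq by simp
  next
    case False
    let ?S = "- complex_of_real ` {1..}"
    have "z \<in> ?S" using z False by (force simp: image_iff le_less)
    moreover have "ball 0 1 \<subseteq> ?S" by auto
    moreover have "connected ?S" using starlike_dilog_domain by (rule starlike_imp_connected)
    moreover have "open ?S" using closed_dilog_cut by (simp add: open_Compl)
    moreover have "f holomorphic_on ?S" "g holomorphic_on ?S"
      using f g unfolding is_dilog_def by blast+
    ultimately show ?thesis
      by (intro analytic_continuation_open[of "ball 0 1" ?S f g z]) (auto intro!: eq)
  qed
qed

lemma dilog_series_summable:
  assumes "cmod z \<le> 1"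
  shows "summable (\<lambda>n. z ^ n / of_nat n ^ 2)"
proof (rule summable_comparison_test')
  show "summable (\<lambda>n. 1 / real n ^ 2)" using inverse_power_summable[of 2] by (simp add: field_simps)
  show "cmod (z ^ n / of_nat n ^ 2) \<le> 1 / real n ^ 2" for n
    using assms by (simp add: norm_divide norm_power divide_right_mono power_le_one)
qed

lemma dilog_exists: "\<exists>f. is_dilog f"
proof -
  let ?S = "- complex_of_real ` {1..}"
  have oS: "open ?S" using closed_dilog_cut by (simp add: open_Compl)
  define L where "L = (\<lambda>z. - Ln (1 - z))"
  define g where "g = (\<lambda>z. if z = 0 then deriv L 0 else (L z - L 0) / (z - 0))"
  define P where "P = (\<lambda>z::complex. \<Sum>n. z ^ n / of_nat n ^ 2)"
  have L: "L holomorphic_on ?S" unfolding L_def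
  proof (intro holomorphic_intros)
    fix z assume z: "z \<in> ?S"
    show "1 - z \<notin> \<real>\<^sub>\<le>\<^sub>0"
    proof
      assume "1 - z \<in> \<real>\<^sub>\<le>\<^sub>0"
      then obtain r where "1 - z = of_real r" "r \<le> 0" by (auto elim: nonpos_Reals_cases)
      then have "z = of_real (1 - r)" by (simp add: algebra_simps)
      moreover have "1 - r \<in> {1..}" using \<open>r \<le> 0\<close> by simp
      ultimately show False using z by blast
    qed
  qed
  have g: "g holomorphic_on ?S" unfolding g_def using pole_lemma_open[OF L oS] .
  have "\<exists>F. \<forall>x\<in>?S. (F has_field_derivative g x) (at x)"
    by (rule holomorphic_starlike_primitive[where k = "{}"])
       (use g oS starlike_dilog_domain in
        \<open>auto intro: holomorphic_on_imp_continuous_on holomorphic_on_imp_differentiable_at\<close>)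
  then obtain F where F: "\<And>x. x \<in> ?S \<Longrightarrow> (F has_field_derivative g x) (at x)" by blast
  have dL: "deriv L 0 = 1" unfolding L_def
    by (rule DERIV_imp_deriv) (auto intro!: derivative_eq_intros)
  have dP: "(P has_field_derivative g z) (at z)" if z: "cmod z < 1" for z
  proof -
    let ?c = "\<lambda>n. 1 / of_nat n ^ 2 :: complex"
    have "((\<lambda>z. \<Sum>n. ?c n * z ^ n) has_field_derivative (\<Sum>n. diffs ?c n * z ^ n)) (at z)"
      by (rule termdiffs_strong'[where K = 1]) (use z dilog_series_summable in auto)
    moreover have d: "diffs ?c n = 1 / of_nat (Suc n)" for n
      by (simp add: diffs_def power2_eq_square field_simps del: of_nat_Suc)
    moreover have "(\<Sum>n. 1 / of_nat (Suc n) * z ^ n) = g z"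
    proof (cases "z = 0")
      case True
      show ?thesis unfolding True powser_zero by (simp add: g_def dL)
    next
      case False
      have "(\<lambda>n. - ((- (- z)) ^ n) / of_nat n) sums Ln (1 + - z)"
        by (rule Ln_series') (use z in auto)
      then have "(\<lambda>n. z ^ n / of_nat n) sums L z"
        unfolding L_def by (auto dest: sums_minus)
      then have "(\<lambda>n. z ^ Suc n / of_nat (Suc n)) sums L z"
        by (subst sums_Suc_iff) auto
      then have "(\<lambda>n. z ^ Suc n / of_nat (Suc n) / z) sums (L z / z)" by (rule sums_divide)
      then have "(\<lambda>n. 1 / of_nat (Suc n) * z ^ n) sums (L z / z)"
        using False by (simp add: field_simps del: of_nat_Suc)
      then show ?thesis using False by (simp add: sums_iff g_def L_def)
    qed
    ultimately show ?thesis by (simp add: P_def del: of_nat_Suc)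
  qed
  have "\<exists>c. \<forall>z\<in>ball 0 1. F z - P z = c"
  proof (rule has_field_derivative_zero_constant)
    fix z :: complex assume "z \<in> ball 0 1"
    then have "cmod z < 1" "z \<in> ?S" by auto
    then have "((\<lambda>z. F z - P z) has_field_derivative (g z - g z)) (at z)"
      by (intro DERIV_diff F dP)
    then show "((\<lambda>z. F z - P z) has_field_derivative 0) (at z within ball 0 1)"
      by (simp add: has_field_derivative_at_within)
  qed auto
  then obtain c where c: "\<And>z. cmod z < 1 \<Longrightarrow> F z - P z = c" by auto
  have contP: "continuous_on (cball 0 1) P"
    unfolding P_def
  proof (rule uniform_limit_theorem)
    show "uniform_limit (cball 0 1) (\<lambda>n z. \<Sum>i<n. z ^ i / of_nat i ^ 2)
            (\<lambda>z::complex. \<Sum>i. z ^ i / of_nat i ^ 2) sequentially"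
    proof (rule Weierstrass_m_test)
      show "summable (\<lambda>n. 1 / real n ^ 2)"
        using inverse_power_summable[of 2] by (simp add: field_simps)
      show "cmod (z ^ n / of_nat n ^ 2) \<le> 1 / real n ^ 2" if "z \<in> cball 0 1" for n z
        using that by (simp add: norm_divide norm_power divide_right_mono power_le_one)
    qed
    show "\<forall>\<^sub>F n in sequentially. continuous_on (cball 0 1) (\<lambda>z::complex. \<Sum>i<n. z ^ i / of_nat i ^ 2)"
      unfolding divide_inverse by (intro always_eventually allI continuous_intros)
  qed simp
  have eq: "F z - c = P z" if z: "cmod z \<le> 1" "z \<noteq> 1" for z
  proof -
    define s where "s = (\<lambda>n. of_real (real n / real (Suc n)) * z)"
    have r: "(\<lambda>n. real n / real (Suc n)) \<longlonglongrightarrow> 1" by (rule LIMSEQ_n_over_Suc_n)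
    have s: "s \<longlonglongrightarrow> z" unfolding s_def
      using tendsto_mult[OF tendsto_of_real[OF r] tendsto_const[of z]] by simp
    have sl: "cmod (s n) < 1" for n
    proof -
      have "cmod (s n) \<le> real n / real (Suc n) * 1"
        unfolding s_def norm_mult norm_of_real using z by (intro mult_mono) auto
      also have "\<dots> < 1" by simp
      finally show ?thesis .
    qed
    have "z \<in> ?S"
    proof
      assume "z \<in> complex_of_real ` {1..}"
      then obtain t where "t \<ge> 1" "z = of_real t" by auto
      with z show False by auto
    qed
    then have "isCont F z" using F DERIV_isCont by blast
    then have "(\<lambda>n. F (s n)) \<longlonglongrightarrow> F z" using s by (rule isCont_tendsto_compose)
    moreover have "(\<lambda>n. P (s n)) \<longlonglongrightarrow> P z"
      by (rule continuous_on_tendsto_compose[OF contP s]) (use z sl in \<open>auto intro!: always_eventually less_imp_le\<close>)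
    ultimately have "(\<lambda>n. F (s n) - P (s n)) \<longlonglongrightarrow> F z - P z" by (rule tendsto_diff)
    moreover have "(\<lambda>n. F (s n) - P (s n)) = (\<lambda>n. c)" using c sl by auto
    ultimately have "F z - P z = c" by (simp add: LIMSEQ_const_iff)
    then show ?thesis by (simp add: algebra_simps)
  qed
  define f where "f = (\<lambda>z. if z = 1 then P 1 else F z - c)"
  have "F holomorphic_on ?S" using F oS by (auto simp: holomorphic_on_open)
  then have "(\<lambda>z. F z - c) holomorphic_on ?S" by (intro holomorphic_intros)
  then have "f holomorphic_on ?S"
    by (rule holomorphic_transform) (force simp: f_def)
  moreover have "(\<lambda>n. z ^ Suc n / of_nat (Suc n) ^ 2) sums f z" if z: "cmod z \<le> 1" for z
  proof -
    have "f z = P z" using eq z by (auto simp: f_def)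
    moreover have "(\<lambda>n. z ^ n / of_nat n ^ 2) sums P z"
      using dilog_series_summable[OF z] unfolding P_def by (rule summable_sums)
    ultimately show ?thesis by (subst sums_Suc_iff) auto
  qed
  ultimately show ?thesis unfolding is_dilog_def by blast
qed

lemma is_dilog_dilog: "is_dilog dilog"
  unfolding dilog_def using dilog_exists by (rule someI_ex)

end

(*
  Write q(u) = zeta exp(2 pi i u / T) near a primitive k-th root of unity zeta = exp(2 pi i h / k).
  Substituting q = q(u) in the partial fractions and integrating along a loop around u = 0 that avoids
  the other poles, which lie on the real axis, only the term with l = 1 at zeta survives, so that
  C_{hk1}(N) is a contour integral of q'(u) times the product of the 1/(1 - q(u)^j).

  For k = 1 and T = N the product is P_N(u), the product of 1/(1 - exp(2 pi i j u / N)), and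
  the trapezoidal rule for the logarithm, after splitting off its singularity at u = 0, gives, uniformly
  on compact subsets of the closed upper half plane that avoid 0 and the real points of modulus at
  least 1,
     P_N(u) = exp(N f(u)) exp(L(u)/2) (1 + O(1/N)) / sqrt(2 pi N),
     f(u) = (Li_2(exp(2 pi i u)) - pi^2/6) / (2 pi i u).
  The saddle point of f is z_0, and f(z_0) = - log w_0.  The loop consists of a path g in the first
  quadrant on which Re f is maximal exactly at z_0, of its mirror image under u -> - conj u and of the
  negatives of both.  The mirror image contributes the conjugate, hence the real part; on the
  negatives the product is smaller by the factor exp(- pi (N + 1) Im u).  Laplace's method at z_0
  gives the main term.

  For k > 1 take T = k^2 M with M = floor(N/k).  Grouping the factors in blocks of k turns the product
  into P_M(u) up to a bounded factor, because the product of 1 - zeta^i y over a block is 1 - y^k.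
  Therefore C_{hk1}(N) = O(|w_0|^(-N/2)).
*)
theory Submission
  imports Defs "HOL-Probability.Probability" "HOL-Real_Asymp.Real_Asymp"
begin

section \<open>Partial fractions at roots of unity\<close>

text \<open>The main obstacle is to compare Re f with its saddle value along the whole path, and
  each piece needs its own argument. For k = 1 the poles are the real points N n / j with n nonzero,
  so the path has to start on the real axis between 0 and 1. It starts just left of 1, where f is
  close to f(1) = 0. On Re u = 1 the exponential is real, and Re f is a product of two increasing
  factors. On the ray through z_0 the comparison reduces to the modulus of 1 - exp(2 pi i r z_0), an
  elementary function of r. Far out the dilogarithm is almost 0, and explicit numbers decide; for
  them a positive lower bound of Re f(z_0) = - log |w_0| is required. This is why w_0 is located
  with explicit error bounds, through a function that expands distances by at least 2 pi below the
  real axis. The sign of the leading constant depends on a branch of a square root; it is settled by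
  the quadrants in which w_0, 1 - w_0 and - i z_0 lie.\<close>

definition pf_form :: "complex set \<Rightarrow> (complex \<Rightarrow> nat) \<Rightarrow> (complex \<Rightarrow> complex) \<Rightarrow> bool" where
  "pf_form S m f \<longleftrightarrow> (\<exists>c. \<forall>q. q \<notin> S \<longrightarrow> f q = (\<Sum>a\<in>S. \<Sum>l=1..m a. c a l / (q - a) ^ l))"

lemma pf_form_add:
  assumes "pf_form S m f" "pf_form S m g"
  shows "pf_form S m (\<lambda>q. f q + g q)"
proof -
  obtain c where "\<And>q. q \<notin> S \<Longrightarrow> f q = (\<Sum>a\<in>S. \<Sum>l=1..m a. c a l / (q - a) ^ l)"
    using assms(1) unfolding pf_form_def by blast
  moreover obtain d where "\<And>q. q \<notin> S \<Longrightarrow> g q = (\<Sum>a\<in>S. \<Sum>l=1..m a. d a l / (q - a) ^ l)"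
    using assms(2) unfolding pf_form_def by blast
  ultimately show ?thesis unfolding pf_form_def
    by (intro exI[of _ "\<lambda>a l. c a l + d a l"]) (simp add: add_divide_distrib sum.distrib)
qed

lemma pf_form_cmult:
  assumes "pf_form S m f"
  shows "pf_form S m (\<lambda>q. k * f q)"
proof -
  obtain c where "\<And>q. q \<notin> S \<Longrightarrow> f q = (\<Sum>a\<in>S. \<Sum>l=1..m a. c a l / (q - a) ^ l)"
    using assms unfolding pf_form_def by metis
  then show ?thesis unfolding pf_form_def
    by (intro exI[of _ "\<lambda>a l. k * c a l"]) (simp add: sum_distrib_left)
qed

lemma pf_form_sum:
  assumes "finite A" "\<And>i. i \<in> A \<Longrightarrow> pf_form S m (f i)"
  shows "pf_form S m (\<lambda>q. \<Sum>i\<in>A. f i q)"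
  using assms
proof (induction A rule: finite_induct)
  case empty
  show ?case unfolding pf_form_def by (intro exI[of _ "\<lambda>a l. 0"]) simp
next
  case (insert x F)
  then show ?case using pf_form_add[of S m "f x" "\<lambda>q. \<Sum>i\<in>F. f i q"] by simp
qed

lemma pf_form_cong:
  assumes "pf_form S m f" "\<And>q. q \<notin> S \<Longrightarrow> f q = g q"
  shows "pf_form S m g"
  using assms unfolding pf_form_def by auto

lemma pf_form_basis:
  assumes "finite S" "a \<in> S" "1 \<le> l" "l \<le> m a"
  shows "pf_form S m (\<lambda>q. 1 / (q - a) ^ l)"
proof -
  have "(\<Sum>b\<in>S. \<Sum>j=1..m b. (if b = a then if j = l then 1 else 0 else 0) / (q - b) ^ j) = 1 / (q - a) ^ l" for q
  proof -
    have "(\<Sum>b\<in>S. \<Sum>j=1..m b. (if b = a then if j = l then 1 else 0 else 0) / (q - b) ^ j)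
       = (\<Sum>b\<in>S. if b = a then (\<Sum>j=1..m a. if j = l then 1 / (q - a) ^ l else 0) else 0)"
    proof (intro sum.cong refl)
      fix b
      show "(\<Sum>j=1..m b. (if b = a then if j = l then 1 else 0 else 0) / (q - b) ^ j)
        = (if b = a then \<Sum>j=1..m a. if j = l then 1 / (q - a) ^ l else 0 else 0)"
      proof (cases "b = a")
        case True
        then show ?thesis by (simp only: if_True simp_thms) (intro sum.cong, auto)
      qed simp
    qed
    also have "\<dots> = (\<Sum>j=1..m a. if j = l then 1 / (q - a) ^ l else 0)"
      using assms by (simp only: sum.delta if_True)
    also have "\<dots> = 1 / (q - a) ^ l"
      using assms by (subst sum.delta) auto
    finally show ?thesis .
  qed
  then show ?thesis unfolding pf_form_def
    by (intro exI[of _ "\<lambda>b j. if b = a then if j = l then 1 else 0 else 0"]) simp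
qed

text \<open>Only the order allowed at \<open>b\<close> grows. For \<open>a \<noteq> b\<close> the
  identity 1/((q - a)(q - b)) = (1/(a - b)) (1/(q - a) - 1/(q - b)) trades one factor 1/(q - b) for
  a factor 1/(q - a) plus a term of smaller exponent, so induction on \<open>l\<close>
  applies.\<close>

lemma pf_form_basis_mult:
  assumes S: "finite S" "a \<in> S" "b \<in> S" and l: "1 \<le> l" "l \<le> m a"
  shows "pf_form S (m(b := Suc (m b))) (\<lambda>q. 1 / (q - a) ^ l * (1 / (q - b)))"
proof (cases "a = b")
  case True
  then show ?thesis
    using pf_form_basis[of S b "Suc l" "m(b := Suc (m b))"] S l by (simp add: mult.commute)
next
  case False
  have b: "pf_form S (m(b := Suc (m b))) (\<lambda>q. 1 / (q - b))"
    using pf_form_basis[of S b 1 "m(b := Suc (m b))"] S by simp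
  show ?thesis using l
  proof (induction l rule: dec_induct)
    case base
    have "pf_form S (m(b := Suc (m b))) (\<lambda>q. 1 / (q - a))"
      using pf_form_basis[of S a 1 "m(b := Suc (m b))"] S base False by simp
    then have "pf_form S (m(b := Suc (m b)))
        (\<lambda>q. 1 / (a - b) * (1 / (q - a)) + (- 1 / (a - b)) * (1 / (q - b)))"
      by (intro pf_form_add pf_form_cmult b)
    then show ?case
      by (rule pf_form_cong) (use S False in \<open>auto simp: divide_simps\<close>, (simp add: algebra_simps)?)
  next
    case (step n)
    have "pf_form S (m(b := Suc (m b))) (\<lambda>q. 1 / (q - a) ^ Suc n)"
      using pf_form_basis[of S a "Suc n" "m(b := Suc (m b))"] S step False by simp
    moreover have "pf_form S (m(b := Suc (m b))) (\<lambda>q. 1 / (q - a) ^ n * (1 / (q - b)))"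
      using step.IH step.prems by (meson Suc_leD)
    ultimately have "pf_form S (m(b := Suc (m b)))
        (\<lambda>q. 1 / (a - b) * (1 / (q - a) ^ Suc n) + (- 1 / (a - b)) * (1 / (q - a) ^ n * (1 / (q - b))))"
      by (intro pf_form_add pf_form_cmult)
    then show ?case
    proof (rule pf_form_cong)
      fix q assume "q \<notin> S"
      then have ne: "q - a \<noteq> 0" "q - b \<noteq> 0" "a - b \<noteq> 0" using S False by auto
      have "1 / (q - a) ^ Suc n * (1 / (q - b)) = 1 / (q - a) ^ n * (1 / (q - a) * (1 / (q - b)))"
        by simp
      also have "1 / (q - a) * (1 / (q - b)) = 1 / (a - b) * (1 / (q - a) - 1 / (q - b))"
        using ne by (simp add: field_simps)
      finally show "1 / (a - b) * (1 / (q - a) ^ Suc n) + (- 1 / (a - b)) * (1 / (q - a) ^ n * (1 / (q - b)))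
          = 1 / (q - a) ^ Suc n * (1 / (q - b))"
        by (simp add: algebra_simps)
    qed
  qed
qed

lemma pf_form_mult:
  assumes S: "finite S" "b \<in> S" and f: "pf_form S m f"
  shows "pf_form S (m(b := Suc (m b))) (\<lambda>q. f q * (1 / (q - b)))"
proof -
  obtain c where c: "\<And>q. q \<notin> S \<Longrightarrow> f q = (\<Sum>a\<in>S. \<Sum>l=1..m a. c a l / (q - a) ^ l)"
    using f unfolding pf_form_def by metis
  have "pf_form S (m(b := Suc (m b)))
     (\<lambda>q. \<Sum>a\<in>S. \<Sum>l=1..m a. c a l * (1 / (q - a) ^ l * (1 / (q - b))))"
    using S by (intro pf_form_sum pf_form_cmult pf_form_basis_mult) auto
  then show ?thesis
    by (rule pf_form_cong) (simp add: c sum_distrib_right sum_divide_distrib)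
qed

text \<open>One factor at a time. Since \<open>pf_form\<close> has no polynomial part, the empty
  product 1 is excluded, and the induction starts from a single factor.\<close>

lemma pf_form_prod:
  assumes "finite I" "I \<noteq> {}" "finite S" "\<rho> ` I \<subseteq> S"
  shows "pf_form S (\<lambda>a. card {i\<in>I. \<rho> i = a}) (\<lambda>q. \<Prod>i\<in>I. 1 / (q - \<rho> i))"
  using assms
proof (induction I rule: finite_ne_induct)
  case (singleton x)
  have "{i \<in> {x}. \<rho> i = \<rho> x} = {x}" by auto
  with singleton show ?case
    using pf_form_basis[of S "\<rho> x" 1 "\<lambda>a. card {i\<in>{x}. \<rho> i = a}"] by simp
next
  case (insert x F)
  have "(\<lambda>a. card {i\<in>insert x F. \<rho> i = a})
      = (\<lambda>a. card {i\<in>F. \<rho> i = a})(\<rho> x := Suc (card {i\<in>F. \<rho> i = \<rho> x}))"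
  proof
    fix a
    have "{i\<in>insert x F. \<rho> i = a} = (if \<rho> x = a then insert x {i\<in>F. \<rho> i = a} else {i\<in>F. \<rho> i = a})"
      by auto
    then show "card {i\<in>insert x F. \<rho> i = a}
      = ((\<lambda>a. card {i\<in>F. \<rho> i = a})(\<rho> x := Suc (card {i\<in>F. \<rho> i = \<rho> x}))) a"
      using insert by auto
  qed
  moreover have "pf_form S ((\<lambda>a. card {i\<in>F. \<rho> i = a})(\<rho> x := Suc (card {i\<in>F. \<rho> i = \<rho> x})))
      (\<lambda>q. (\<Prod>i\<in>F. 1 / (q - \<rho> i)) * (1 / (q - \<rho> x)))"
    using insert by (intro pf_form_mult) auto
  ultimately show ?case
    using insert by (simp add: mult.commute)
qed

text \<open>Downward induction on \<open>l\<close>: once the coefficients of higher order at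
  \<open>a\<close> vanish, multiplying by \<open>(q - a) ^ l\<close> and letting q tend to
  \<open>a\<close> isolates \<open>c a l\<close>. The second exceptional set \<open>S'\<close> is
  there because the decomposition is postulated only where no \<open>q ^ j\<close> equals 1.\<close>

lemma pf_coeff_unique:
  fixes c :: "complex \<Rightarrow> nat \<Rightarrow> complex"
  assumes S: "finite S" "finite S'" and a: "a \<in> S"
    and zero: "\<And>q. q \<notin> S' \<Longrightarrow> (\<Sum>a\<in>S. \<Sum>l=1..m a. c a l / (q - a) ^ l) = 0"
    and l: "1 \<le> l" "l \<le> m a"
  shows "c a l = 0"
  using l
proof (induction "m a - l" arbitrary: l rule: less_induct)
  case less
  have IH: "c a j = 0" if "l < j" "j \<le> m a" for j
    using less.hyps[of j] less.prems that by auto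
  let ?F = "\<lambda>q. \<Sum>b\<in>S. \<Sum>j=1..m b. (q - a) ^ l * (c b j / (q - b) ^ j)"
  have term_lim: "((\<lambda>q. (q - a) ^ l * (c b j / (q - b) ^ j)) \<longlongrightarrow> (if b = a \<and> j = l then c a l else 0)) (at a)"
    if j: "j \<in> {1..m b}" for b j
  proof (cases "b = a")
    case False
    have "((\<lambda>q. (q - a) ^ l * (c b j / (q - b) ^ j)) \<longlongrightarrow> (a - a) ^ l * (c b j / (a - b) ^ j)) (at a)"
      using False by (intro tendsto_intros) auto
    then show ?thesis using False less.prems by (simp add: power_0_left)
  next
    case b: True
    show ?thesis
    proof (cases "j \<le> l")
      case True
      have "((\<lambda>q. (q - a) ^ (l - j) * c a j) \<longlongrightarrow> (a - a) ^ (l - j) * c a j) (at a)"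
        by (intro tendsto_intros)
      moreover have "(a - a) ^ (l - j) * c a j = (if b = a \<and> j = l then c a l else 0)"
        using True b by (cases "j = l") simp_all
      ultimately have lim: "((\<lambda>q. (q - a) ^ (l - j) * c a j) \<longlongrightarrow> (if b = a \<and> j = l then c a l else 0)) (at a)"
        by (simp only:)
      have ev: "\<forall>\<^sub>F q in at a. (q - a) ^ (l - j) * c a j = (q - a) ^ l * (c b j / (q - b) ^ j)"
        unfolding eventually_at_filter
        by (rule always_eventually) (use True b in \<open>simp add: power_diff\<close>)
      show ?thesis by (rule Lim_transform_eventually[OF lim ev])
    next
      case False
      then show ?thesis using IH[of j] j b by simp
    qed
  qed
  have "(?F \<longlongrightarrow> (\<Sum>b\<in>S. \<Sum>j=1..m b. if b = a \<and> j = l then c a l else 0)) (at a)"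
    by (rule tendsto_sum, rule tendsto_sum, rule term_lim)
  moreover have "(\<Sum>b\<in>S. \<Sum>j=1..m b. if b = a \<and> j = l then c a l else 0) = c a l"
  proof -
    have "(\<Sum>j=1..m b. if b = a \<and> j = l then c a l else 0) = (if b = a then c a l else 0)" for b
      using less.prems by (cases "b = a") simp_all
    then show ?thesis using S a by simp
  qed
  ultimately have "(?F \<longlongrightarrow> c a l) (at a)" by simp
  moreover have "\<forall>\<^sub>F q in at a. ?F q = 0"
  proof -
    have "\<not> a islimpt S'" by (rule islimpt_finite[OF S(2)])
    then have "\<forall>\<^sub>F q in at a. q \<notin> S'" unfolding islimpt_iff_eventually by simp
    then show ?thesis
    proof eventually_elim
      case (elim q)
      show ?case using zero[OF elim] by (simp only: sum_distrib_left[symmetric] mult_zero_right)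
    qed
  qed
  ultimately have "((\<lambda>q. 0) \<longlongrightarrow> c a l) (at a)"
    by (rule Lim_transform_eventually)
  then show ?case by (simp add: tendsto_const_iff)
qed

section \<open>Farey fractions as roots of unity; existence and uniqueness of the Rademacher
  coefficients\<close>

definition farey_root :: "nat \<times> nat \<Rightarrow> complex" where
  "farey_root p = exp (2 * of_real pi * \<i> * of_nat (fst p) / of_nat (snd p))"

lemma finite_farey: "finite (farey N)"
  by (rule finite_subset[of _ "{..N} \<times> {..N}"]) (auto simp: farey_def)

text \<open>Coprimality turns \<open>k dvd h * j\<close> into \<open>k dvd j\<close>. The exact
  order \<open>k\<close> makes the order of the pole equal to the number of multiples of
  \<open>k\<close> up to \<open>N\<close>, which is \<open>N div k\<close>.\<close>

lemma farey_root_power_eq_1_iff: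
  assumes "(h, k) \<in> farey N"
  shows "farey_root (h, k) ^ j = 1 \<longleftrightarrow> k dvd j"
proof -
  have k: "k \<ge> 1" "coprime h k" using assms by (auto simp: farey_def)
  have "farey_root (h, k) ^ j = exp (2 * of_real pi * \<i> * of_nat (h * j) / of_nat k)"
    by (simp add: farey_root_def exp_of_nat_mult[symmetric] algebra_simps)
  also have "\<dots> = 1 \<longleftrightarrow> k dvd h * j"
    using complex_root_unity_eq_1[of k "h * j"] k by simp
  also have "\<dots> \<longleftrightarrow> k dvd j" using k by (simp add: coprime_commute coprime_dvd_mult_right_iff)
  finally show ?thesis .
qed

text \<open>Equal roots have equal order, so the two denominators divide each other; the numerator
  is then determined modulo the denominator.\<close>

lemma inj_on_farey_root: "inj_on farey_root (farey N)"
proof (rule inj_onI, clarify)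
  fix h k h' k' assume *: "(h, k) \<in> farey N" "(h', k') \<in> farey N" "farey_root (h, k) = farey_root (h', k')"
  have k: "k dvd k'" "k' dvd k"
    using farey_root_power_eq_1_iff[OF *(1), of k'] farey_root_power_eq_1_iff[OF *(2), of k']
      farey_root_power_eq_1_iff[OF *(1), of k] farey_root_power_eq_1_iff[OF *(2), of k] *(3) by auto
  then have kk: "k = k'" by (rule dvd_antisym)
  have "h mod k = h' mod k"
    using complex_root_unity_eq[of k h h'] * kk by (auto simp: farey_def farey_root_def cong_def)
  then show "h = h' \<and> k = k'" using * kk by (auto simp: farey_def)
qed

lemma ex_farey_root:
  assumes "r ^ j = 1" "1 \<le> j" "j \<le> N"
  shows "r \<in> farey_root ` farey N"
proof -
  obtain i where i: "i < j" "r = exp (2 * of_real pi * \<i> * of_nat i / of_nat j)"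
    using assms complex_roots_unity[of j] by auto
  define g where "g = gcd i j"
  have g: "g > 0" using assms by (simp add: g_def)
  obtain i' j' where ij: "i = i' * g" "j = j' * g" "coprime i' j'"
    using gcd_coprime_exists[of i j] g unfolding g_def by blast
  have "of_nat i / (of_nat j :: complex) = of_nat i' / of_nat j'"
    using g ij by simp
  then have "r = farey_root (i', j')"
    using i by (simp add: farey_root_def mult.assoc flip: times_divide_eq_right)
  moreover have "(i', j') \<in> farey N"
  proof -
    have "j' \<le> j' * g" using g by simp
    then have "j' \<le> N" using ij(2) assms(3) by linarith
    then show ?thesis using ij i g assms(2) by (auto simp: farey_def Suc_le_eq)
  qed
  ultimately show ?thesis by blast
qed

lemma card_multiples: "card {j\<in>{1..N}. k dvd j} = N div k" if "k \<ge> 1" for k N :: nat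
proof -
  have "{j\<in>{1..N}. k dvd j} = (\<lambda>i. k * i) ` {1..N div k}"
    using that by (auto simp: dvd_def image_iff less_eq_div_iff_mult_less_eq mult.commute Suc_le_eq)
  moreover have "inj_on (\<lambda>i. k * i) {1..N div k}" using that by (auto simp: inj_on_def)
  ultimately show ?thesis by (simp add: card_image)
qed

text \<open>Both sides are monic polynomials of degree \<open>j\<close> in \<open>q\<close> that
  agree at the \<open>j\<close> distinct roots of unity.\<close>

lemma prod_roots_unity:
  assumes "j \<ge> 1"
  shows "(\<Prod>r\<in>{r::complex. r ^ j = 1}. q - r) = q ^ j - 1"
proof -
  let ?R = "{r::complex. r ^ j = 1}"
  let ?p = "\<Prod>r\<in>?R. [:- r, 1:]"
  let ?q = "Polynomial.monom 1 j - 1 :: complex poly"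
  have fin: "finite ?R" using assms by (intro finite_roots_unity)
  have card: "card ?R = j" using assms by (rule card_complex_roots_unity)
  have deg: "degree ?p = j" using card by (simp add: degree_prod_eq_sum_degree)
  have "?p = ?q"
  proof (rule poly_eqI_degree_lead_coeff[where n = j and A = ?R])
    have "Polynomial.coeff ?p j = lead_coeff ?p" using deg by simp
    also have "\<dots> = 1" by (simp add: lead_coeff_prod)
    finally show "Polynomial.coeff ?p j = Polynomial.coeff ?q j" using assms by simp
    show "degree ?q \<le> j"
      by (intro degree_diff_le) (auto simp: degree_monom_le)
    show "poly ?p z = poly ?q z" if "z \<in> ?R" for z
      using that fin by (auto simp: poly_prod poly_monom prod_zero_iff)
  qed (use card deg in auto)
  then have "poly ?p q = poly ?q q" by simp
  then show ?thesis by (simp add: poly_prod poly_monom)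
qed

text \<open>The linear factors are indexed by pairs (j, r) with \<open>r ^ j = 1\<close>, so that a
  root shared by several factors \<open>1 - q ^ j\<close> is counted with its multiplicity. The sign
  \<open>(-1) ^ N\<close> comes from writing each \<open>1 - q ^ j\<close> as minus a monic
  polynomial.\<close>

lemma is_rademacher_coeff_exists:
  assumes N: "N \<ge> 1"
  shows "\<exists>C. is_rademacher_coeff N C"
proof -
  let ?S = "farey_root ` farey N"
  let ?R = "\<lambda>j. {r::complex. r ^ j = 1}"
  let ?I = "Sigma {1..N} ?R"
  have fR: "finite (?R j)" if "j \<in> {1..N}" for j using that by (intro finite_roots_unity) auto
  have fI: "finite ?I" using fR by auto
  have "(1, 1) \<in> ?I" using N by auto
  then have neI: "?I \<noteq> {}" by blast
  have fS: "finite ?S" using finite_farey by blast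
  have IS: "snd ` ?I \<subseteq> ?S" using ex_farey_root by auto
  from pf_form_prod[OF fI neI fS IS] obtain c where
    c: "\<forall>q. q \<notin> ?S \<longrightarrow> (\<Prod>i\<in>?I. 1 / (q - snd i)) =
      (\<Sum>a\<in>?S. \<Sum>l=1..card {i \<in> ?I. snd i = a}. c a l / (q - a) ^ l)"
    unfolding pf_form_def by blast
  have mult: "card {i \<in> ?I. snd i = farey_root (h, k)} = N div k" if hk: "(h, k) \<in> farey N" for h k
  proof -
    have "{i \<in> ?I. snd i = farey_root (h, k)} = (\<lambda>j. (j, farey_root (h, k))) ` {j\<in>{1..N}. k dvd j}"
      using farey_root_power_eq_1_iff[OF hk] by auto
    moreover have "inj_on (\<lambda>j. (j, farey_root (h, k))) {j\<in>{1..N}. k dvd j}" by (auto simp: inj_on_def)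
    moreover have "k \<ge> 1" using hk by (simp add: farey_def)
    ultimately show ?thesis by (simp only: card_image card_multiples)
  qed
  define C where "C = (\<lambda>h k l. if (h, k) \<in> farey N \<and> 1 \<le> l \<and> l \<le> N div k
      then (-1) ^ N * c (farey_root (h, k)) l else 0)"
  have "is_rademacher_coeff N C"
    unfolding is_rademacher_coeff_def
  proof (intro conjI allI impI)
    fix q :: complex assume q: "\<forall>j\<in>{1..N}. q ^ j \<noteq> 1"
    have qS: "q \<notin> ?S"
    proof
      assume "q \<in> ?S"
      then obtain h k where "(h, k) \<in> farey N" "q = farey_root (h, k)" by auto
      then show False using q farey_root_power_eq_1_iff[of h k N k] by (auto simp: farey_def)
    qed
    have "(\<Prod>j=1..N. 1 / (1 - q ^ j)) = (\<Prod>j=1..N. - (\<Prod>r\<in>?R j. 1 / (q - r)))"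
    proof (intro prod.cong refl)
      fix j assume j: "j \<in> {1..N}"
      have "(\<Prod>r\<in>?R j. 1 / (q - r)) = 1 / (q ^ j - 1)"
        using j by (simp add: prod_dividef prod_roots_unity)
      moreover have "1 / (1 - q ^ j) = 1 / (- (q ^ j - 1))" by simp
      ultimately show "1 / (1 - q ^ j) = - (\<Prod>r\<in>?R j. 1 / (q - r))"
        by (simp only: divide_minus_right)
    qed
    also have "\<dots> = (-1) ^ N * (\<Prod>j=1..N. \<Prod>r\<in>?R j. 1 / (q - r))"
      by (simp add: prod_uminus)
    also have "(\<Prod>j=1..N. \<Prod>r\<in>?R j. 1 / (q - r)) = (\<Prod>i\<in>?I. 1 / (q - snd i))"
      by (subst prod.Sigma) (use fR in \<open>auto simp: case_prod_unfold\<close>)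
    also have "\<dots> = (\<Sum>a\<in>?S. \<Sum>l=1..card {i \<in> ?I. snd i = a}. c a l / (q - a) ^ l)"
      using c qS by blast
    also have "\<dots> = (\<Sum>p\<in>farey N. \<Sum>l=1..card {i \<in> ?I. snd i = farey_root p}. c (farey_root p) l / (q - farey_root p) ^ l)"
      by (subst sum.reindex[OF inj_on_farey_root]) simp
    also have "(-1) ^ N * \<dots> = (\<Sum>(h, k)\<in>farey N. \<Sum>l=1..N div k.
           C h k l / (q - exp (2 * of_real pi * \<i> * of_nat h / of_nat k)) ^ l)"
      unfolding sum_distrib_left
    proof (intro sum.cong refl, clarify)
      fix h k assume hk: "(h, k) \<in> farey N"
      show "(\<Sum>n = 1..card {i \<in> ?I. snd i = farey_root (h, k)}. (- 1) ^ N * (c (farey_root (h, k)) n / (q - farey_root (h, k)) ^ n)) =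
        (\<Sum>l = 1..N div k. C h k l / (q - exp (2 * complex_of_real pi * \<i> * of_nat h / of_nat k)) ^ l)"
        unfolding mult[OF hk]
      proof (intro sum.cong refl)
        fix l assume "l \<in> {1..N div k}"
        then have "C h k l = (-1) ^ N * c (farey_root (h, k)) l" using hk by (simp add: C_def)
        then show "(- 1) ^ N * (c (farey_root (h, k)) l / (q - farey_root (h, k)) ^ l)
            = C h k l / (q - exp (2 * complex_of_real pi * \<i> * of_nat h / of_nat k)) ^ l"
          by (simp only: farey_root_def fst_conv snd_conv times_divide_eq_right)
      qed
    qed
    finally show "(\<Prod>j=1..N. 1 / (1 - q ^ j)) = (\<Sum>(h, k)\<in>farey N. \<Sum>l=1..N div k.
           C h k l / (q - exp (2 * of_real pi * \<i> * of_nat h / of_nat k)) ^ l)" .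
  qed (auto simp: C_def)
  then show ?thesis by blast
qed

lemma finite_unity_powers: "finite {q::complex. \<exists>j\<in>{1..N}. q ^ j = 1}"
proof -
  have "{q::complex. \<exists>j\<in>{1..N}. q ^ j = 1} = (\<Union>j\<in>{1..N}. {q. q ^ j = 1})" by auto
  then show ?thesis by (auto intro!: finite_roots_unity)
qed

lemma is_rademacher_coeff_unique:
  assumes C: "is_rademacher_coeff N C" and D: "is_rademacher_coeff N D"
  shows "C = D"
proof (intro ext)
  fix h k l
  show "C h k l = D h k l"
  proof (cases "(h, k) \<in> farey N \<and> 1 \<le> l \<and> l \<le> N div k")
    case False
    then show ?thesis using C D unfolding is_rademacher_coeff_def by metis
  next
    case True
    let ?S = "farey_root ` farey N"
    \<comment> \<open>The coefficients are indexed by pairs, the partial fractions by poles;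
      \<open>g\<close> recovers the pair from its pole.\<close>
    define g where "g = the_inv_into (farey N) farey_root"
    have g: "g (farey_root p) = p" if "p \<in> farey N" for p
      unfolding g_def using that by (rule the_inv_into_f_f[OF inj_on_farey_root])
    define c where "c = (\<lambda>a l. C (fst (g a)) (snd (g a)) l - D (fst (g a)) (snd (g a)) l)"
    have "c (farey_root (h, k)) l = 0"
    proof (rule pf_coeff_unique[where c = c and a = "farey_root (h, k)" and l = l and S = ?S and S' = "{q::complex. \<exists>j\<in>{1..N}. q ^ j = 1}" and m = "\<lambda>a. N div snd (g a)"])
      show "finite ?S" using finite_farey by blast
      show "finite {q::complex. \<exists>j\<in>{1..N}. q ^ j = 1}" by (rule finite_unity_powers)
      show "farey_root (h, k) \<in> ?S" "1 \<le> l" using True by auto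
      show "l \<le> N div snd (g (farey_root (h, k)))" using True g by simp
      fix q :: complex assume "q \<notin> {q. \<exists>j\<in>{1..N}. q ^ j = 1}"
      then have "(\<Sum>(h, k)\<in>farey N. \<Sum>l=1..N div k. C h k l / (q - exp (2 * of_real pi * \<i> * of_nat h / of_nat k)) ^ l)
        = (\<Sum>(h, k)\<in>farey N. \<Sum>l=1..N div k. D h k l / (q - exp (2 * of_real pi * \<i> * of_nat h / of_nat k)) ^ l)"
        using C D unfolding is_rademacher_coeff_def by auto
      then show "(\<Sum>a\<in>?S. \<Sum>l=1..N div snd (g a). c a l / (q - a) ^ l) = 0"
        by (simp add: sum.reindex[OF inj_on_farey_root] g c_def case_prod_unfold farey_root_def[symmetric]
            diff_divide_distrib sum_subtractf)
    qed
    then show ?thesis using True g by (simp add: c_def)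
  qed
qed

lemma is_rademacher_coeff_rademacher_coeff:
  assumes "N \<ge> 1"
  shows "is_rademacher_coeff N (rademacher_coeff N)"
  unfolding rademacher_coeff_def
  using is_rademacher_coeff_exists[OF assms] is_rademacher_coeff_unique
  by (intro theI'[of "is_rademacher_coeff N"]) blast

section \<open>Rademacher coefficients as contour integrals\<close>

text \<open>The plane without the real rays |x| \<ge> c. For c > 0 it is star-shaped about 0, which
  gives primitives and Cauchy's theorem for closed paths without any computation of winding
  numbers.\<close>

definition slit_plane :: "real \<Rightarrow> complex set" where
  "slit_plane c = {u. Im u \<noteq> 0 \<or> \<bar>Re u\<bar> < c}"

lemma open_slit_plane: "open (slit_plane c)"
proof -
  have "slit_plane c = {u. Im u < 0} \<union> {u. Im u > 0} \<union> {u. Re u < c} \<inter> {u. Re u > - c}"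
    unfolding slit_plane_def by auto
  also have "open \<dots>"
    by (intro open_Un open_Int open_halfspace_Im_lt open_halfspace_Im_gt open_halfspace_Re_lt open_halfspace_Re_gt)
  finally show ?thesis .
qed

lemma slit_plane_scale:
  assumes "u \<in> slit_plane c" "0 \<le> t" "t \<le> 1" "c > 0"
  shows "of_real t * u \<in> slit_plane c"
proof (cases "t = 0")
  case False
  have "t * \<bar>Re u\<bar> \<le> 1 * \<bar>Re u\<bar>" using assms by (intro mult_right_mono) auto
  then show ?thesis using assms False unfolding slit_plane_def by (auto simp: abs_mult)
qed (use assms in \<open>auto simp: slit_plane_def\<close>)

lemma starlike_slit_plane:
  assumes "c > 0"
  shows "starlike (slit_plane c)"
  unfolding starlike_def
proof (intro bexI[of _ 0] ballI subsetI)
  fix x y assume x: "x \<in> slit_plane c" and "y \<in> closed_segment 0 x"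
  then obtain t where "0 \<le> t" "t \<le> 1" "y = t *\<^sub>R x" by (auto simp: in_segment)
  then show "y \<in> slit_plane c" using slit_plane_scale[OF x] assms by (simp add: scaleR_conv_of_real)
qed (use assms in \<open>auto simp: slit_plane_def\<close>)

lemma slit_plane_mono: "c \<le> d \<Longrightarrow> slit_plane c \<subseteq> slit_plane d"
  by (auto simp: slit_plane_def)

definition local_param :: "nat \<times> nat \<Rightarrow> real \<Rightarrow> complex \<Rightarrow> complex" where
  "local_param p T u = farey_root p * exp (2 * of_real pi * \<i> * u / of_real T)"

lemma has_field_derivative_local_param [derivative_intros]:
  "(local_param p T has_field_derivative 2 * of_real pi * \<i> / of_real T * local_param p T u) (at u within A)"
  unfolding local_param_def[abs_def] by (cases "T = 0") (auto intro!: derivative_eq_intros)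

lemma holomorphic_on_local_param [holomorphic_intros]: "local_param p T holomorphic_on A"
  unfolding holomorphic_on_def field_differentiable_def using has_field_derivative_local_param by blast

lemma local_param_0 [simp]: "local_param p T 0 = farey_root p"
  by (simp add: local_param_def)

text \<open>If the power were 1, then j h / k + j u / T would be an integer. Hence u is real and j k
  u is a nonzero integer multiple of T, so |u| \<ge> T / (j k) \<ge> T / (N k) \<ge> c.\<close>

lemma local_param_power_neq_1:
  assumes hk: "(h, k) \<in> farey N" and T: "T > 0" and cT: "c * (real N * real k) \<le> T"
    and u: "u \<in> slit_plane c" "u \<noteq> 0" and j: "j \<in> {1..N}"
  shows "local_param (h, k) T u ^ j \<noteq> 1"
proof
  assume *: "local_param (h, k) T u ^ j = 1"
  have k: "k \<ge> 1" using hk by (simp add: farey_def)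
  let ?X = "2 * of_real pi * \<i> * (of_real (real j * real h / real k) + of_real (real j / T) * u)"
  have "local_param (h, k) T u ^ j
     = exp (of_nat j * (2 * of_real pi * \<i> * of_nat h / of_nat k)) * exp (of_nat j * (2 * of_real pi * \<i> * u / of_real T))"
    by (simp only: local_param_def farey_root_def power_mult_distrib exp_of_nat_mult fst_conv snd_conv)
  also have "\<dots> = exp ?X"
    by (simp add: exp_add[symmetric] algebra_simps)
  finally have "exp ?X = 1" using * by simp
  then have re: "Re ?X = 0" and "\<exists>n::int. Im ?X = of_int (2 * n) * pi"
    by (auto simp: exp_eq_1)
  then obtain n :: int where n: "Im ?X = of_int (2 * n) * pi" by blast
  have im0: "Im u = 0" using re T j by simp
  have "real j * real h / real k + real j / T * Re u = of_int n"
    using n by simp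
  then have "of_int n * (real k * T) = (real j * real h / real k + real j / T * Re u) * (real k * T)" by simp
  also have "\<dots> = real j * real h * T + real j * real k * Re u"
    using T k by (simp add: field_simps)
  finally have eq: "real j * real k * Re u = T * of_int (n * int k - int j * int h)"
    by (simp add: algebra_simps)
  have "u \<noteq> 0 \<longrightarrow> Re u \<noteq> 0" using im0 complex_eqI[of u 0] by auto
  then have "Re u \<noteq> 0" using u by simp
  then have "T * of_int (n * int k - int j * int h) \<noteq> 0" using eq[symmetric] j k by simp
  then have "n * int k - int j * int h \<noteq> 0" by (metis mult_zero_right of_int_0)
  then have "1 \<le> \<bar>n * int k - int j * int h\<bar>" by linarith
  then have "1 \<le> \<bar>real_of_int (n * int k - int j * int h)\<bar>" by linarith
  then have "T * 1 \<le> T * \<bar>real_of_int (n * int k - int j * int h)\<bar>" using T by (intro mult_left_mono) auto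
  also have "\<dots> = real j * real k * \<bar>Re u\<bar>"
  proof -
    have "\<bar>real j * real k * Re u\<bar> = \<bar>T * of_int (n * int k - int j * int h)\<bar>" using eq by simp
    then show ?thesis using T by (simp add: abs_mult)
  qed
  also have "\<dots> < real j * real k * c"
    using u im0 j k by (intro mult_strict_left_mono) (auto simp: slit_plane_def)
  also have "\<dots> \<le> real N * real k * c"
    using j u im0 by (intro mult_right_mono) (auto simp: slit_plane_def)
  finally show False using cT by (simp add: algebra_simps)
qed

text \<open>Write q(u) - q(0) = u B(u) with B zero-free. The logarithmic derivative is 1/u + B'/B,
  and B'/B is holomorphic on the star-shaped set, so it integrates to 0.\<close>

lemma contour_integral_logderiv:
  assumes S: "open S" "starlike S" and q: "q holomorphic_on S" and z: "0 \<in> S"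
    and nz: "\<And>u. u \<in> S \<Longrightarrow> u \<noteq> 0 \<Longrightarrow> q u \<noteq> q 0" and d0: "deriv q 0 \<noteq> 0"
    and g: "valid_path g" "path_image g \<subseteq> S - {0}" "pathfinish g = pathstart g"
    and w: "((\<lambda>u. 1 / u) has_contour_integral W) g"
  shows "((\<lambda>u. deriv q u / (q u - q 0)) has_contour_integral W) g"
proof -
  define B where "B = (\<lambda>u. if u = 0 then deriv q 0 else (q u - q 0) / (u - 0))"
  have B: "B holomorphic_on S" unfolding B_def using pole_lemma_open[OF q S(1)] .
  have B0: "B u \<noteq> 0" if "u \<in> S" for u using nz[OF that] d0 by (auto simp: B_def)
  have qB: "q = (\<lambda>u. q 0 + u * B u)" by (auto simp: B_def fun_eq_iff)
  have dq: "deriv q u = B u + u * deriv B u" if "u \<in> S" for u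
  proof -
    have "(B has_field_derivative deriv B u) (at u)" using holomorphic_derivI[OF B S(1) that] .
    then have "((\<lambda>u. q 0 + u * B u) has_field_derivative B u + u * deriv B u) (at u)"
      by (auto intro!: derivative_eq_intros)
    then show ?thesis using qB DERIV_imp_deriv by metis
  qed
  have "(\<lambda>u. deriv B u / B u) holomorphic_on S"
    using B B0 S(1) by (intro holomorphic_intros) auto
  then have "((\<lambda>u. deriv B u / B u) has_contour_integral 0) g"
    by (intro Cauchy_theorem_starlike_simple[OF S(1) S(2)]) (use g in auto)
  then have "((\<lambda>u. 1 / u + deriv B u / B u) has_contour_integral W + 0) g"
    using w by (intro has_contour_integral_add)
  then have "((\<lambda>u. 1 / u + deriv B u / B u) has_contour_integral W) g" by simp
  then show ?thesis
  proof (rule has_contour_integral_eq)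
    fix u assume "u \<in> path_image g"
    then have u: "u \<in> S" "u \<noteq> 0" using g by auto
    have "q u - q 0 = u * B u" using u by (simp add: B_def)
    then show "1 / u + deriv B u / B u = deriv q u / (q u - q 0)"
      using u B0[of u] dq[of u] by (simp add: field_simps)
  qed
qed

text \<open>The factor q' makes every term with l \<ge> 2 an exact derivative. A term with l = 1 at
  another pole is holomorphic on the slit plane, and the remaining one is a logarithmic derivative.
  The scale \<open>T\<close> stays free because k = 1 and k > 1 call for different choices.\<close>

lemma rademacher_coeff_contour_integral:
  assumes hk: "(h, k) \<in> farey N" and T: "T > 0" and c: "c > 0" and cT: "c * (real N * real k) \<le> T"
    and g: "valid_path g" "path_image g \<subseteq> slit_plane c - {0}" "pathfinish g = pathstart g"
    and w: "((\<lambda>u. 1 / u) has_contour_integral (2 * of_real pi * \<i>)) g"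
  shows "((\<lambda>u. 2 * of_real pi * \<i> / of_real T * local_param (h, k) T u *
              (\<Prod>j=1..N. 1 / (1 - local_param (h, k) T u ^ j)))
          has_contour_integral (2 * of_real pi * \<i> * rademacher_coeff N h k 1)) g"
proof -
  let ?C = "rademacher_coeff N"
  let ?q = "local_param (h, k) T"
  let ?q' = "\<lambda>u. 2 * of_real pi * \<i> / of_real T * ?q u"
  have N: "N \<ge> 1" "k \<ge> 1" "k \<le> N" using hk by (auto simp: farey_def)
  have rad: "is_rademacher_coeff N ?C" by (rule is_rademacher_coeff_rademacher_coeff[OF N(1)])
  have dq: "deriv ?q u = ?q' u" for u
    by (rule DERIV_imp_deriv) (rule has_field_derivative_local_param)
  have q1: "?q u ^ j \<noteq> 1" if "u \<in> slit_plane c - {0}" "j \<in> {1..N}" for u j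
    using local_param_power_neq_1[OF hk T cT] that by blast
  have q2: "?q u \<noteq> farey_root p" if "u \<in> slit_plane c - {0}" "p \<in> farey N" for u p
  proof -
    obtain h' k' where p: "p = (h', k')" by force
    have "farey_root p ^ k' = 1" using farey_root_power_eq_1_iff[of h' k' N k'] that p by simp
    moreover have "?q u ^ k' \<noteq> 1" using q1[OF that(1), of k'] that p by (auto simp: farey_def)
    ultimately show ?thesis by metis
  qed
  have z: "0 \<in> slit_plane c" using c by (simp add: slit_plane_def)
  have trm: "((\<lambda>u. ?q' u * (?C (fst p) (snd p) l / (?q u - farey_root p) ^ l)) has_contour_integral
      (if p = (h, k) \<and> l = 1 then 2 * of_real pi * \<i> * ?C h k 1 else 0)) g"
    if p: "p \<in> farey N" and l: "l \<in> {1..N div snd p}" for p l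
  proof -
    have "((\<lambda>u. ?q' u / (?q u - farey_root p) ^ l) has_contour_integral
      (if p = (h, k) \<and> l = 1 then 2 * of_real pi * \<i> else 0)) g"
    proof (cases "l = 1")
      case False
      then obtain m where m: "l = Suc m" "m \<ge> 1" using l by (cases l) auto
      let ?F = "\<lambda>u. - 1 / of_nat m * inverse ((?q u - farey_root p) ^ m)"
      have "(?F has_field_derivative ?q' u / (?q u - farey_root p) ^ l) (at u within slit_plane c - {0})"
        if "u \<in> slit_plane c - {0}" for u
      proof -
        have ne: "?q u - farey_root p \<noteq> 0" using q2[OF that p] by simp
        have "(?F has_field_derivative - 1 / of_nat m * (- (inverse ((?q u - farey_root p) ^ m)
            * (of_nat m * (?q' u * (?q u - farey_root p) ^ (m - Suc 0))) * inverse ((?q u - farey_root p) ^ m))))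
            (at u within slit_plane c - {0})"
          using ne by (auto intro!: derivative_eq_intros)
        moreover have "- 1 / of_nat m * (- (inverse ((?q u - farey_root p) ^ m)
            * (of_nat m * (?q' u * (?q u - farey_root p) ^ (m - Suc 0))) * inverse ((?q u - farey_root p) ^ m)))
            = ?q' u / (?q u - farey_root p) ^ l"
        proof -
          define X where "X = ?q u - farey_root p"
          have X: "X \<noteq> 0" using ne by (simp add: X_def)
          have "X ^ m = X * X ^ (m - Suc 0)" using m by (cases m) auto
          then have "- 1 / of_nat m * (- (inverse (X ^ m) * (of_nat m * (?q' u * X ^ (m - Suc 0))) * inverse (X ^ m))) = ?q' u / X ^ l"
            unfolding m(1) using m(2) X by (simp add: field_simps)
          then show ?thesis by (simp only: X_def)
        qed
        ultimately show ?thesis by simp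
      qed
      then have "((\<lambda>u. ?q' u / (?q u - farey_root p) ^ l) has_contour_integral (?F (pathfinish g) - ?F (pathstart g))) g"
        by (intro contour_integral_primitive) (use g in auto)
      then show ?thesis using g False by simp
    next
      case l1: True
      show ?thesis
      proof (cases "p = (h, k)")
        case False
        have "?q u \<noteq> farey_root p" if "u \<in> slit_plane c" for u
        proof (cases "u = 0")
          case True
          then show ?thesis using False inj_onD[OF inj_on_farey_root, of "(h, k)" p N] hk p by auto
        qed (use that q2 p in auto)
        then have "(\<lambda>u. ?q' u / (?q u - farey_root p) ^ l) holomorphic_on slit_plane c"
          by (intro holomorphic_intros) auto
        then have "((\<lambda>u. ?q' u / (?q u - farey_root p) ^ l) has_contour_integral 0) g"
          by (intro Cauchy_theorem_starlike_simple[OF open_slit_plane[of c] starlike_slit_plane[OF c]]) (use g in auto)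
        then show ?thesis using False by simp
      next
        case True
        have "((\<lambda>u. deriv ?q u / (?q u - ?q 0)) has_contour_integral (2 * of_real pi * \<i>)) g"
        proof (rule contour_integral_logderiv[OF open_slit_plane starlike_slit_plane[OF c] _ z _ _ g w])
          show "deriv ?q 0 \<noteq> 0" using T by (simp add: dq farey_root_def)
        qed (use q2 True p in \<open>auto intro: holomorphic_on_local_param\<close>)
        then show ?thesis using l1 True by (simp add: dq)
      qed
    qed
    then have "((\<lambda>u. ?C (fst p) (snd p) l * (?q' u / (?q u - farey_root p) ^ l)) has_contour_integral
       ?C (fst p) (snd p) l * (if p = (h, k) \<and> l = 1 then 2 * of_real pi * \<i> else 0)) g"
      by (rule has_contour_integral_lmul)
    moreover have "?C (fst p) (snd p) l * (if p = (h, k) \<and> l = 1 then 2 * of_real pi * \<i> else 0)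
       = (if p = (h, k) \<and> l = 1 then 2 * of_real pi * \<i> * ?C h k 1 else 0)" by auto
    ultimately show ?thesis by (simp add: mult_ac)
  qed
  have "((\<lambda>u. \<Sum>p\<in>farey N. \<Sum>l=1..N div snd p. ?q' u * (?C (fst p) (snd p) l / (?q u - farey_root p) ^ l))
     has_contour_integral (\<Sum>p\<in>farey N. \<Sum>l=1..N div snd p. if p = (h, k) \<and> l = 1 then 2 * of_real pi * \<i> * ?C h k 1 else 0)) g"
    by (intro has_contour_integral_sum trm finite_farey) auto
  also have "(\<Sum>p\<in>farey N. \<Sum>l=1..N div snd p. if p = (h, k) \<and> l = 1 then 2 * of_real pi * \<i> * ?C h k 1 else 0)
      = 2 * of_real pi * \<i> * ?C h k 1"
  proof -
    have "(\<Sum>l=1..N div snd p. if p = (h, k) \<and> l = 1 then 2 * of_real pi * \<i> * ?C h k 1 else 0)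
       = (if p = (h, k) then 2 * of_real pi * \<i> * ?C h k 1 else 0)" for p
      using N by (cases "p = (h, k)") (auto simp: div_greater_zero_iff Suc_le_eq)
    then show ?thesis using hk finite_farey by simp
  qed
  finally show ?thesis
  proof (rule has_contour_integral_eq)
    fix u assume "u \<in> path_image g"
    then have "u \<in> slit_plane c - {0}" using g by auto
    then have "\<forall>j\<in>{1..N}. ?q u ^ j \<noteq> 1" using q1 by blast
    then have "(\<Prod>j=1..N. 1 / (1 - ?q u ^ j)) =
        (\<Sum>(h, k)\<in>farey N. \<Sum>l=1..N div k. ?C h k l / (?q u - exp (2 * of_real pi * \<i> * of_nat h / of_nat k)) ^ l)"
      using rad unfolding is_rademacher_coeff_def by blast
    then show "(\<Sum>p\<in>farey N. \<Sum>l=1..N div snd p. ?q' u * (?C (fst p) (snd p) l / (?q u - farey_root p) ^ l))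
       = ?q' u * (\<Prod>j=1..N. 1 / (1 - ?q u ^ j))"
      by (simp only: sum_distrib_left case_prod_unfold farey_root_def)
  qed
qed

section \<open>The dilogarithm\<close>

abbreviation dilog_dom :: "complex set" where
  "dilog_dom \<equiv> - complex_of_real ` {1..}"

lemma in_dilog_dom_iff: "z \<in> dilog_dom \<longleftrightarrow> Im z \<noteq> 0 \<or> Re z < 1"
  by (auto simp: image_iff complex_eq_iff not_le)

lemma open_dilog_dom: "open dilog_dom"
  using closed_dilog_cut by (simp add: open_Compl)

lemma ball_subset_dilog_dom: "ball 0 1 \<subseteq> dilog_dom"
  by auto

lemma holomorphic_dilog: "dilog holomorphic_on dilog_dom"
  using is_dilog_dilog by (simp add: is_dilog_def)

lemma dilog_sums: "cmod z \<le> 1 \<Longrightarrow> (\<lambda>n. z ^ Suc n / of_nat (Suc n) ^ 2) sums dilog z"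
  using is_dilog_dilog by (simp add: is_dilog_def)

lemma dilog_0 [simp]: "dilog 0 = 0"
proof -
  have "(\<lambda>n. 0) sums dilog 0" using dilog_sums[of 0] by simp
  then show ?thesis using sums_unique2[OF sums_zero] by metis
qed

lemma dilog_1: "dilog 1 = of_real (pi ^ 2 / 6)"
proof -
  have "(\<lambda>n. complex_of_real (1 / real ((n + 1)\<^sup>2))) sums of_real (pi ^ 2 / 6)"
    using inverse_squares_sums by (rule sums_of_real)
  moreover have "(\<lambda>n. complex_of_real (1 / real ((n + 1)\<^sup>2))) = (\<lambda>n. 1 ^ Suc n / of_nat (Suc n) ^ 2)"
    by (auto simp: fun_eq_iff add_ac)
  moreover have "(\<lambda>n. 1 ^ Suc n / of_nat (Suc n) ^ 2) sums dilog 1" by (rule dilog_sums) simp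
  ultimately show ?thesis by (metis sums_unique2)
qed

lemma one_minus_notin_nonpos_Reals: "z \<in> dilog_dom \<Longrightarrow> 1 - z \<notin> \<real>\<^sub>\<le>\<^sub>0"
  unfolding in_dilog_dom_iff by (auto simp: complex_nonpos_Reals_iff)

lemma has_field_derivative_dilog_ball:
  assumes z: "cmod z < 1"
  shows "(dilog has_field_derivative (if z = 0 then 1 else - Ln (1 - z) / z)) (at z)"
proof -
  let ?c = "\<lambda>n. 1 / of_nat n ^ 2 :: complex"
  let ?g = "if z = 0 then 1 else - Ln (1 - z) / z"
  have P: "dilog w = (\<Sum>n. ?c n * w ^ n)" if "cmod w \<le> 1" for w
  proof -
    have "(\<lambda>n. ?c (Suc n) * w ^ Suc n) sums dilog w" using dilog_sums[OF that] by simp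
    then have "(\<lambda>n. ?c n * w ^ n) sums (dilog w + ?c 0 * w ^ 0)"
      by (rule sums_Suc[where f = "\<lambda>n. ?c n * w ^ n"])
    then show ?thesis by (simp add: sums_iff)
  qed
  have "((\<lambda>z. \<Sum>n. ?c n * z ^ n) has_field_derivative (\<Sum>n. diffs ?c n * z ^ n)) (at z)"
    by (rule termdiffs_strong'[where K = 1]) (use z dilog_series_summable in auto)
  moreover have d: "diffs ?c n = 1 / of_nat (Suc n)" for n
    by (simp add: diffs_def power2_eq_square field_simps del: of_nat_Suc)
  moreover have "(\<Sum>n. 1 / of_nat (Suc n) * z ^ n) = ?g"
  proof (cases "z = 0")
    case True
    show ?thesis unfolding True powser_zero by simp
  next
    case False
    have "(\<lambda>n. - ((- (- z)) ^ n) / of_nat n) sums Ln (1 + - z)"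
      by (rule Ln_series') (use z in auto)
    then have "(\<lambda>n. z ^ n / of_nat n) sums - Ln (1 - z)"
      by (auto dest: sums_minus)
    then have "(\<lambda>n. z ^ Suc n / of_nat (Suc n)) sums - Ln (1 - z)"
      by (subst sums_Suc_iff) auto
    then have "(\<lambda>n. z ^ Suc n / of_nat (Suc n) / z) sums (- Ln (1 - z) / z)" by (rule sums_divide)
    then have "(\<lambda>n. 1 / of_nat (Suc n) * z ^ n) sums (- Ln (1 - z) / z)"
      using False by (simp add: field_simps del: of_nat_Suc)
    then show ?thesis using False by (simp add: sums_iff)
  qed
  ultimately have "((\<lambda>z. \<Sum>n. ?c n * z ^ n) has_field_derivative ?g) (at z)"
    by (simp del: of_nat_Suc)
  then show ?thesis
  proof (rule has_field_derivative_transform_within_open)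
    show "open (ball (0::complex) 1)" "z \<in> ball 0 1" using z by auto
  qed (use P in auto)
qed

text \<open>The power series gives the derivative in the unit disc only. The quotient - Ln (1 - z) /
  z, completed at 0, is holomorphic on the whole domain, and the identity theorem extends the
  formula.\<close>

lemma has_field_derivative_dilog:
  assumes z: "z \<in> dilog_dom" "z \<noteq> 0"
  shows "(dilog has_field_derivative (- Ln (1 - z) / z)) (at z)"
proof -
  let ?L = "\<lambda>z. - Ln (1 - z)"
  define g where "g = (\<lambda>z. if z = 0 then deriv ?L 0 else (?L z - ?L 0) / (z - 0))"
  have L: "?L holomorphic_on dilog_dom"
    using one_minus_notin_nonpos_Reals by (intro holomorphic_intros) auto
  have g: "g holomorphic_on dilog_dom" unfolding g_def using pole_lemma_open[OF L open_dilog_dom] .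
  have dL: "deriv ?L 0 = 1"
    by (rule DERIV_imp_deriv) (auto intro!: derivative_eq_intros)
  have "deriv dilog z = g z"
  proof (rule analytic_continuation_open[of "ball 0 1" dilog_dom "deriv dilog" g z])
    show "deriv dilog holomorphic_on dilog_dom"
      by (intro holomorphic_deriv holomorphic_dilog open_dilog_dom)
    show "connected dilog_dom" using starlike_dilog_domain by (rule starlike_imp_connected)
    fix w :: complex assume "w \<in> ball 0 1"
    then show "deriv dilog w = g w"
      using has_field_derivative_dilog_ball[of w, THEN DERIV_imp_deriv] by (auto simp: g_def dL)
  qed (use z g open_dilog_dom ball_subset_dilog_dom in auto)
  then have "deriv dilog z = - Ln (1 - z) / z" using z by (simp add: g_def)
  then show ?thesis using holomorphic_derivI[OF holomorphic_dilog open_dilog_dom z(1)] by simp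
qed

lemma continuous_on_dilog_cball: "continuous_on (cball 0 1) dilog"
proof -
  have "continuous_on (cball 0 1) (\<lambda>z::complex. \<Sum>n. z ^ Suc n / of_nat (Suc n) ^ 2)"
  proof (rule uniform_limit_theorem)
    show "uniform_limit (cball 0 1) (\<lambda>n z. \<Sum>i<n. z ^ Suc i / of_nat (Suc i) ^ 2)
            (\<lambda>z::complex. \<Sum>i. z ^ Suc i / of_nat (Suc i) ^ 2) sequentially"
    proof (rule Weierstrass_m_test)
      show "summable (\<lambda>n. 1 / real (Suc n) ^ 2)"
        using inverse_squares_sums by (simp add: sums_iff add_ac)
      show "cmod (z ^ Suc n / of_nat (Suc n) ^ 2) \<le> 1 / real (Suc n) ^ 2" if "z \<in> cball 0 1" for n z
        using that by (simp add: norm_divide norm_power norm_mult divide_right_mono power_le_one mult_le_one del: of_nat_Suc)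
    qed
    show "\<forall>\<^sub>F n in sequentially. continuous_on (cball 0 1) (\<lambda>z::complex. \<Sum>i<n. z ^ Suc i / of_nat (Suc i) ^ 2)"
      unfolding divide_inverse by (intro always_eventually allI continuous_intros)
  qed simp
  then show ?thesis
    by (rule continuous_on_eq) (use dilog_sums in \<open>auto simp: sums_iff simp del: of_nat_Suc\<close>)
qed

text \<open>A linear zero beats a logarithm: near 0 the first factor is at most 2 |y|, the second at
  most |ln |y|| + pi.\<close>

lemma tendsto_Ln_one_minus_mult_Ln: "((\<lambda>y. Ln (1 - y) * Ln y) \<longlongrightarrow> 0) (at 0)"
proof (rule Lim_null_comparison)
  have nrm: "filterlim (\<lambda>y::complex. cmod y) (at_right 0) (at 0)"
  proof (rule tendsto_imp_filterlim_at_right)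
    show "((\<lambda>y::complex. cmod y) \<longlongrightarrow> 0) (at 0)" by (rule tendsto_norm_zero) (rule tendsto_ident_at)
    show "\<forall>\<^sub>F y::complex in at 0. 0 < cmod y" by (simp add: eventually_at_filter)
  qed
  have "((\<lambda>r::real. 2 * r * (\<bar>ln r\<bar> + pi)) \<longlongrightarrow> 0) (at_right 0)" by real_asymp
  then show "((\<lambda>y. 2 * cmod y * (\<bar>ln (cmod y)\<bar> + pi)) \<longlongrightarrow> 0) (at 0)"
    by (rule filterlim_compose[OF _ nrm])
  have "\<forall>\<^sub>F y::complex in at 0. y \<noteq> 0 \<and> cmod y < 1 / 2"
    unfolding eventually_at by (intro exI[of _ "1/2"]) auto
  then show "\<forall>\<^sub>F y in at 0. cmod (Ln (1 - y) * Ln y) \<le> 2 * cmod y * (\<bar>ln (cmod y)\<bar> + pi)"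
  proof eventually_elim
    case (elim y)
    have "cmod (Ln (1 + - y)) \<le> 2 * cmod (- y)"
      using elim by (intro norm_Ln_le) auto
    moreover have "cmod (Ln y) \<le> \<bar>ln (cmod y)\<bar> + pi"
      using cmod_le[of "Ln y"] elim mpi_less_Im_Ln[of y] Im_Ln_le_pi[of y] by simp
    ultimately show ?case unfolding norm_mult by (intro mult_mono) auto
  qed
qed

section \<open>The reflection formula of the dilogarithm\<close>

definition cut_plane :: "complex set" where
  "cut_plane = {z. Im z \<noteq> 0 \<or> 0 < Re z \<and> Re z < 1}"

lemma open_cut_plane: "open cut_plane"
proof -
  have "cut_plane = {u. Im u < 0} \<union> {u. Im u > 0} \<union> {u. Re u < 1} \<inter> {u. Re u > 0}"
    unfolding cut_plane_def by auto
  also have "open \<dots>"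
    by (intro open_Un open_Int open_halfspace_Im_lt open_halfspace_Im_gt open_halfspace_Re_lt open_halfspace_Re_gt)
  finally show ?thesis .
qed

lemma connected_cut_plane: "connected cut_plane"
proof (rule starlike_imp_connected)
  show "starlike cut_plane"
    unfolding starlike_def
  proof (intro bexI[of _ "1/2"] ballI subsetI)
    fix x y assume x: "x \<in> cut_plane" and "y \<in> closed_segment (1/2) x"
    then obtain t where t: "0 \<le> t" "t \<le> 1" "y = (1 - t) *\<^sub>R (1/2) + t *\<^sub>R x" by (auto simp: in_segment)
    show "y \<in> cut_plane"
    proof (cases "t = 0 \<or> Im x \<noteq> 0")
      case True
      then show ?thesis using t by (auto simp: cut_plane_def)
    next
      case False
      then have r: "0 < Re x" "Re x < 1" "t > 0" using x t by (auto simp: cut_plane_def)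
      have "Re y = (1 - t) / 2 + t * Re x" using t by simp
      moreover have "0 < t * Re x" "t * Re x < t * 1" using r by auto
      ultimately have "0 < Re y \<and> Re y < 1" using t(1,2) by (auto simp: field_simps)
      then show ?thesis by (simp add: cut_plane_def)
    qed
  qed (auto simp: cut_plane_def)
qed

lemma tendsto_dilog_0: "(dilog \<longlongrightarrow> 0) (at 0)"
proof -
  have "isCont dilog 0" by (rule DERIV_isCont[OF has_field_derivative_dilog_ball]) simp
  then show ?thesis unfolding isCont_def by (simp only: dilog_0)
qed

text \<open>The derivatives cancel, so the difference of the two sides is constant on the connected
  set \<open>cut_plane\<close>. The constant is read off along real t decreasing to 0, where
  \<open>dilog (1 - t)\<close> tends to \<open>dilog 1\<close> by continuity on the closed
  disc.\<close>

theorem dilog_reflection: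
  assumes z: "z \<in> cut_plane"
  shows "dilog z + dilog (1 - z) = of_real (pi ^ 2 / 6) - Ln z * Ln (1 - z)"
proof -
  define H where "H = (\<lambda>z. dilog z + dilog (1 - z) + Ln z * Ln (1 - z))"
  have dH: "(H has_field_derivative 0) (at x)" if x: "x \<in> cut_plane" for x
  proof -
    have x': "x \<in> dilog_dom" "x \<noteq> 0" "1 - x \<in> dilog_dom" "1 - x \<noteq> 0" "x \<notin> \<real>\<^sub>\<le>\<^sub>0" "1 - x \<notin> \<real>\<^sub>\<le>\<^sub>0"
      using x unfolding in_dilog_dom_iff by (auto simp: cut_plane_def complex_nonpos_Reals_iff complex_eq_iff)
    have "((\<lambda>z. 1 - z) has_field_derivative - 1) (at x)" by (auto intro!: derivative_eq_intros)
    from DERIV_chain2[where f = dilog, OF has_field_derivative_dilog[OF x'(3,4)] this]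
    have d2: "((\<lambda>z. dilog (1 - z)) has_field_derivative (- Ln (1 - (1 - x)) / (1 - x)) * - 1) (at x)" .
    have "((\<lambda>z. Ln z * Ln (1 - z)) has_field_derivative (inverse x * Ln (1 - x) + (- inverse (1 - x)) * Ln x)) (at x)"
      using x' by (auto intro!: derivative_eq_intros simp: field_simps)
    from DERIV_add[OF DERIV_add[OF has_field_derivative_dilog[OF x'(1,2)] d2] this]
    show ?thesis unfolding H_def using x' by (simp add: field_simps)
  qed
  have "H constant_on cut_plane"
    using dH connected_cut_plane open_cut_plane by (rule has_field_derivative_0_imp_constant_on)
  then obtain c where c: "\<And>x. x \<in> cut_plane \<Longrightarrow> H x = c" unfolding constant_on_def by blast
  have path: "filterlim (\<lambda>t::real. complex_of_real t) (at 0) (at_right 0)"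
    unfolding filterlim_at by (auto intro!: tendsto_eq_intros simp: eventually_at_filter)
  have "((\<lambda>t::real. H (of_real t)) \<longlongrightarrow> 0 + of_real (pi ^ 2 / 6) + 0) (at_right 0)"
    unfolding H_def
  proof (intro tendsto_add)
    show "((\<lambda>t::real. dilog (of_real t)) \<longlongrightarrow> 0) (at_right 0)"
      by (rule filterlim_compose[OF tendsto_dilog_0 path])
    show "((\<lambda>t::real. Ln (of_real t) * Ln (1 - of_real t)) \<longlongrightarrow> 0) (at_right 0)"
      using filterlim_compose[OF tendsto_Ln_one_minus_mult_Ln path] by (simp add: mult.commute)
    have "((\<lambda>t::real. dilog (1 - of_real t)) \<longlongrightarrow> dilog 1) (at_right 0)"
    proof (rule continuous_on_tendsto_compose[OF continuous_on_dilog_cball])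
      show "((\<lambda>t::real. 1 - complex_of_real t) \<longlongrightarrow> 1) (at_right 0)"
        by (auto intro!: tendsto_eq_intros)
      have "\<forall>\<^sub>F t::real in at_right 0. t \<in> {0<..<1}" by (rule eventually_at_right_real) simp
      then show "\<forall>\<^sub>F t in at_right 0. 1 - complex_of_real t \<in> cball 0 1"
      proof eventually_elim
        case (elim t)
        have "cmod (1 - complex_of_real t) = \<bar>1 - t\<bar>" by (metis norm_of_real of_real_1 of_real_diff)
        then show ?case using elim by simp
      qed
    qed simp
    then show "((\<lambda>t::real. dilog (1 - of_real t)) \<longlongrightarrow> of_real (pi ^ 2 / 6)) (at_right 0)"
      by (simp only: dilog_1)
  qed
  moreover have "((\<lambda>t::real. H (of_real t)) \<longlongrightarrow> c) (at_right 0)"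
  proof (rule tendsto_eventually)
    have "\<forall>\<^sub>F t::real in at_right 0. t \<in> {0<..<1}" by (rule eventually_at_right_real) simp
    then show "\<forall>\<^sub>F t::real in at_right 0. H (of_real t) = c"
      by eventually_elim (rule c, simp add: cut_plane_def)
  qed
  ultimately have "0 + of_real (pi ^ 2 / 6) + 0 = c"
    by (intro tendsto_unique[of "at_right (0::real)"]) auto
  then have "H z = of_real (pi ^ 2 / 6)" using c[OF z] by simp
  then show ?thesis unfolding H_def by (simp add: algebra_simps)
qed

text \<open>The series controls \<open>dilog\<close> near 1 only inside the closed disc. The
  reflection formula, solved for \<open>dilog z\<close>, gives the limit on all of
  \<open>cut_plane\<close>; this is needed for arguments exp (t s) of modulus above 1.\<close>

lemma tendsto_dilog_1: "(dilog \<longlongrightarrow> of_real (pi ^ 2 / 6)) (at 1 within cut_plane)"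
proof -
  have f: "filterlim (\<lambda>z::complex. 1 - z) (at 0) (at 1 within cut_plane)"
    unfolding filterlim_at by (auto intro!: tendsto_eq_intros simp: eventually_at_filter)
  have "((\<lambda>z. of_real (pi ^ 2 / 6) - Ln (1 - (1 - z)) * Ln (1 - z) - dilog (1 - z)) \<longlongrightarrow>
      of_real (pi ^ 2 / 6) - 0 - 0) (at 1 within cut_plane)"
    by (intro tendsto_diff tendsto_const filterlim_compose[OF tendsto_Ln_one_minus_mult_Ln f]
        filterlim_compose[OF tendsto_dilog_0 f])
  then have "((\<lambda>z. of_real (pi ^ 2 / 6) - Ln z * Ln (1 - z) - dilog (1 - z)) \<longlongrightarrow>
      of_real (pi ^ 2 / 6)) (at 1 within cut_plane)" by simp
  moreover have "\<forall>\<^sub>F z in at 1 within cut_plane. of_real (pi ^ 2 / 6) - Ln z * Ln (1 - z) - dilog (1 - z) = dilog z"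
    unfolding eventually_at_filter
    by (rule always_eventually) (auto dest!: dilog_reflection simp: algebra_simps)
  ultimately show ?thesis by (rule Lim_transform_eventually)
qed

lemma cmod_dilog_le:
  assumes "cmod z < 1"
  shows "cmod (dilog z) \<le> cmod z / (1 - cmod z)"
proof -
  have s: "(\<lambda>n. z ^ Suc n / of_nat (Suc n) ^ 2) sums dilog z" using dilog_sums assms by simp
  have g: "(\<lambda>n. cmod z * cmod z ^ n) sums (cmod z * (1 / (1 - cmod z)))"
    using assms by (intro sums_mult geometric_sums) simp
  have le: "cmod (z ^ Suc n / of_nat (Suc n) ^ 2) \<le> cmod z * cmod z ^ n" for n
  proof -
    have "cmod (z ^ Suc n / of_nat (Suc n) ^ 2) = cmod z * cmod z ^ n / real (Suc n) ^ 2"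
      by (simp add: norm_divide norm_power norm_mult del: of_nat_Suc)
    also have "\<dots> \<le> cmod z * cmod z ^ n / 1"
      by (intro divide_left_mono) auto
    finally show ?thesis by simp
  qed
  from norm_sums_le[OF s g le] show ?thesis by simp
qed

lemma dilog_of_real_mono:
  assumes "0 \<le> x" "x \<le> y" "y \<le> 1"
  shows "Re (dilog (of_real x)) \<le> Re (dilog (of_real y))"
proof (rule sums_le)
  have *: "(\<lambda>n. t ^ Suc n / real (Suc n) ^ 2) sums Re (dilog (of_real t))" if "0 \<le> t" "t \<le> 1" for t
  proof -
    have "(\<lambda>n. Re (of_real t ^ Suc n / of_nat (Suc n) ^ 2)) sums Re (dilog (of_real t))"
      using dilog_sums[of "of_real t"] that by (intro sums_Re) simp
    moreover have "Re (of_real t ^ Suc n / of_nat (Suc n) ^ 2) = t ^ Suc n / real (Suc n) ^ 2" for n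
      by (metis Re_complex_of_real of_real_divide of_real_of_nat_eq of_real_power)
    ultimately show ?thesis by simp
  qed
  show "(\<lambda>n. x ^ Suc n / real (Suc n) ^ 2) sums Re (dilog (of_real x))"
    "(\<lambda>n. y ^ Suc n / real (Suc n) ^ 2) sums Re (dilog (of_real y))" using * assms by auto
  show "x ^ Suc n / real (Suc n) ^ 2 \<le> y ^ Suc n / real (Suc n) ^ 2" for n
    using assms by (intro divide_right_mono power_mono) auto
qed

lemma Im_dilog_of_real:
  assumes "\<bar>x\<bar> \<le> 1"
  shows "Im (dilog (of_real x)) = 0"
proof -
  have "(\<lambda>n. Im (of_real x ^ Suc n / of_nat (Suc n) ^ 2)) sums Im (dilog (of_real x))"
    using dilog_sums[of "of_real x"] assms by (intro sums_Im) simp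
  moreover have "Im (of_real x ^ Suc n / of_nat (Suc n) ^ 2) = 0" for n
    by (metis Im_complex_of_real of_real_divide of_real_of_nat_eq of_real_power)
  ultimately have "(\<lambda>n. 0) sums Im (dilog (of_real x))" by simp
  then show ?thesis using sums_unique2[OF sums_zero] by metis
qed

lemma Ln_one_minus_Taylor:
  fixes z :: complex
  assumes z: "cmod z < 1"
  shows "cmod (Ln (1 - z) + (\<Sum>k<m. z ^ Suc k / of_nat (Suc k)))
           \<le> cmod z ^ Suc m / (real (Suc m) * (1 - cmod z))"
proof -
  have "(\<lambda>n. - ((- (- z)) ^ n) / of_nat n) sums Ln (1 + - z)"
    by (rule Ln_series') (use z in auto)
  then have "(\<lambda>n. z ^ n / of_nat n) sums - Ln (1 - z)"
    by (auto dest: sums_minus)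
  then have "(\<lambda>n. z ^ Suc n / of_nat (Suc n)) sums - Ln (1 - z)"
    by (subst sums_Suc_iff) auto
  then have s: "(\<lambda>n. z ^ Suc (n + m) / of_nat (Suc (n + m))) sums
      (- Ln (1 - z) - (\<Sum>k<m. z ^ Suc k / of_nat (Suc k)))"
    by (rule sums_split_initial_segment)
  have g: "(\<lambda>n. cmod z ^ Suc m / real (Suc m) * cmod z ^ n) sums (cmod z ^ Suc m / real (Suc m) * (1 / (1 - cmod z)))"
    using assms by (intro sums_mult geometric_sums) simp
  have le: "cmod (z ^ Suc (n + m) / of_nat (Suc (n + m))) \<le> cmod z ^ Suc m / real (Suc m) * cmod z ^ n" for n
  proof -
    have "cmod (z ^ Suc (n + m) / of_nat (Suc (n + m))) = cmod z ^ Suc m * cmod z ^ n / real (Suc (n + m))"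
      by (simp add: norm_divide norm_power norm_mult power_add mult_ac del: of_nat_Suc)
    also have "\<dots> \<le> cmod z ^ Suc m * cmod z ^ n / real (Suc m)"
      by (intro divide_left_mono) auto
    finally show ?thesis by simp
  qed
  have "cmod (- Ln (1 - z) - (\<Sum>k<m. z ^ Suc k / of_nat (Suc k))) \<le> cmod z ^ Suc m / real (Suc m) * (1 / (1 - cmod z))"
    by (rule norm_sums_le[OF s g le])
  moreover have "- Ln (1 - z) - (\<Sum>k<m. z ^ Suc k / of_nat (Suc k)) = - (Ln (1 - z) + (\<Sum>k<m. z ^ Suc k / of_nat (Suc k)))"
    by simp
  ultimately show ?thesis by (simp only: norm_minus_cancel times_divide_times_eq mult_1_right)
qed

lemma dilog_Taylor:
  fixes z :: complex
  assumes z: "cmod z < 1"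
  shows "cmod (dilog z - (\<Sum>k<m. z ^ Suc k / of_nat (Suc k) ^ 2))
           \<le> cmod z ^ Suc m / (real (Suc m) ^ 2 * (1 - cmod z))"
proof -
  have "(\<lambda>n. z ^ Suc n / of_nat (Suc n) ^ 2) sums dilog z" using dilog_sums z by simp
  then have s: "(\<lambda>n. z ^ Suc (n + m) / of_nat (Suc (n + m)) ^ 2) sums
      (dilog z - (\<Sum>k<m. z ^ Suc k / of_nat (Suc k) ^ 2))"
    by (rule sums_split_initial_segment)
  have g: "(\<lambda>n. cmod z ^ Suc m / real (Suc m) ^ 2 * cmod z ^ n) sums (cmod z ^ Suc m / real (Suc m) ^ 2 * (1 / (1 - cmod z)))"
    using assms by (intro sums_mult geometric_sums) simp
  have le: "cmod (z ^ Suc (n + m) / of_nat (Suc (n + m)) ^ 2) \<le> cmod z ^ Suc m / real (Suc m) ^ 2 * cmod z ^ n" for n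
  proof -
    have "cmod (z ^ Suc (n + m) / of_nat (Suc (n + m)) ^ 2) = cmod z ^ Suc m * cmod z ^ n / real (Suc (n + m)) ^ 2"
      by (simp add: norm_divide norm_power norm_mult power_add mult_ac del: of_nat_Suc)
    also have "\<dots> \<le> cmod z ^ Suc m * cmod z ^ n / real (Suc m) ^ 2"
      by (intro divide_left_mono power_mono) auto
    finally show ?thesis by simp
  qed
  have "cmod (dilog z - (\<Sum>k<m. z ^ Suc k / of_nat (Suc k) ^ 2)) \<le> cmod z ^ Suc m / real (Suc m) ^ 2 * (1 / (1 - cmod z))"
    by (rule norm_sums_le[OF s g le])
  then show ?thesis by (simp only: times_divide_times_eq mult_1_right)
qed

text \<open>\<open>w0 = exp s\<close> for the unique zero \<open>s\<close> of the function below in the strip \<open>\<bar>Im s\<bar> < \<pi>\<close>. Its derivative is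
  \<open>- 2 \<pi> i u\<close> with \<open>Re u\<close> between \<open>1/2\<close> and \<open>3/2\<close>: for \<open>Im s \<ge> 0\<close> integration from the origin
  excludes zeros, and for \<open>Im s < 0\<close> the function is expanding.\<close>

definition G_dilog :: "complex \<Rightarrow> complex" where
  "G_dilog s = dilog (exp s) - 2 * of_real pi * \<i> * s"

lemma exp_in_cut_plane:
  assumes "\<bar>Im s\<bar> < pi" "Im s \<noteq> 0 \<or> Re s < 0"
  shows "exp s \<in> cut_plane"
proof (cases "Im s = 0")
  case True
  then show ?thesis using assms by (simp add: cut_plane_def Re_exp)
next
  case False
  have "sin (Im s) \<noteq> 0"
  proof (cases "Im s > 0")
    case True
    then show ?thesis using sin_gt_zero[of "Im s"] assms by auto
  next
    case F: False
    then show ?thesis using sin_gt_zero[of "- Im s"] assms False by auto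
  qed
  then show ?thesis by (simp add: cut_plane_def Im_exp)
qed

lemma cut_plane_subset_dilog_dom: "z \<in> cut_plane \<Longrightarrow> z \<in> dilog_dom \<and> z \<noteq> 0"
  unfolding in_dilog_dom_iff by (auto simp: cut_plane_def)

lemma has_field_derivative_G_dilog:
  assumes "exp s \<in> cut_plane"
  shows "(G_dilog has_field_derivative (- Ln (1 - exp s) - 2 * of_real pi * \<i>)) (at s)"
proof -
  have d: "exp s \<in> dilog_dom" "exp s \<noteq> 0" using cut_plane_subset_dilog_dom[OF assms] by auto
  have "((\<lambda>s. dilog (exp s)) has_field_derivative (- Ln (1 - exp s) / exp s * exp s)) (at s)"
    by (rule DERIV_chain2[where f = dilog, OF has_field_derivative_dilog[OF d] DERIV_exp])
  then have "((\<lambda>s. dilog (exp s)) has_field_derivative (- Ln (1 - exp s))) (at s)"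
    by simp
  moreover have "((\<lambda>s. 2 * of_real pi * \<i> * s) has_field_derivative (2 * of_real pi * \<i>)) (at s)"
    by (auto intro!: derivative_eq_intros)
  ultimately show ?thesis unfolding G_dilog_def[abs_def] by (rule DERIV_diff)
qed

text \<open>After division by the direction \<open>d\<close>, the derivative along the segment is
  the complex derivative of \<open>G_dilog\<close> itself. The mean value theorem then turns a bound
  on its imaginary part into a bound on the increment.\<close>

lemma G_dilog_segment_mvt:
  assumes "\<And>t. t \<in> {a..b} \<Longrightarrow> exp (s1 + of_real t * d) \<in> cut_plane" and "a < b"
    and le: "\<And>t. t \<in> {a..b} \<Longrightarrow> Im (- Ln (1 - exp (s1 + of_real t * d)) - 2 * of_real pi * \<i>) \<le> - m"
    and d: "d \<noteq> 0"
  shows "Im (G_dilog (s1 + of_real b * d) / d) - Im (G_dilog (s1 + of_real a * d) / d) \<le> - m * (b - a)"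
proof -
  let ?f = "\<lambda>t. Im (G_dilog (s1 + of_real t * d) / d)"
  let ?g = "\<lambda>t. Im (- Ln (1 - exp (s1 + of_real t * d)) - 2 * of_real pi * \<i>)"
  have der: "(?f has_real_derivative ?g t) (at t)" if "t \<in> {a..b}" for t
  proof -
    have 1: "((\<lambda>z. s1 + z * d) has_field_derivative d) (at (of_real t))"
      by (auto intro!: derivative_eq_intros)
    have "((\<lambda>z. G_dilog (s1 + z * d)) has_field_derivative (- Ln (1 - exp (s1 + of_real t * d)) - 2 * of_real pi * \<i>) * d) (at (of_real t))"
      by (rule DERIV_chain2[where f = G_dilog, OF has_field_derivative_G_dilog[OF assms(1)[OF that]] 1])
    then have "((\<lambda>z. G_dilog (s1 + z * d) / d) has_field_derivative ((- Ln (1 - exp (s1 + of_real t * d)) - 2 * of_real pi * \<i>) * d / d)) (at (of_real t))"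
      by (rule DERIV_cdivide)
    then have "((\<lambda>z. G_dilog (s1 + z * d) / d) has_field_derivative (- Ln (1 - exp (s1 + of_real t * d)) - 2 * of_real pi * \<i>)) (at (of_real t))"
      using d by simp
    then have "((\<lambda>t. G_dilog (s1 + of_real t * d) / d) has_vector_derivative (- Ln (1 - exp (s1 + of_real t * d)) - 2 * of_real pi * \<i>)) (at t)"
      by (rule has_vector_derivative_real_field)
    from bounded_linear.has_vector_derivative[OF bounded_linear_Im this]
    show ?thesis by (simp add: has_real_derivative_iff_has_vector_derivative)
  qed
  obtain x where x: "a < x" "x < b" "?f b - ?f a = (b - a) * ?g x"
    using MVT2[OF \<open>a < b\<close>, of ?f ?g] der by auto
  have "(b - a) * ?g x \<le> (b - a) * - m" using x assms(2) by (intro mult_left_mono le) auto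
  then show ?thesis using x by (simp add: mult.commute)
qed

text \<open>The derivative of \<open>G_dilog\<close> has imaginary part at most - pi, because Im Ln
  > - pi. A zero \<open>s\<close> would therefore force Im (G (t s) / s) \<ge> pi (1 - t). As t
  tends to 0, G (t s) tends to pi^2 / 6, whereas Im (1 / s) \<le> 0 in the closed upper half
  plane.\<close>

lemma G_dilog_upper_nonzero:
  assumes s: "0 \<le> Im s" "Im s < pi" "Im s \<noteq> 0 \<or> Re s < 0"
  shows "G_dilog s \<noteq> 0"
proof
  assume zero: "G_dilog s = 0"
  have s0: "s \<noteq> 0" using s by auto
  have sc: "\<bar>Im (of_real t * s)\<bar> < pi" "Im (of_real t * s) \<noteq> 0 \<or> Re (of_real t * s) < 0" if "0 < t" "t \<le> 1" for t :: real
  proof -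
    have "t * Im s \<le> 1 * Im s" using that s by (intro mult_right_mono) auto
    then show "\<bar>Im (of_real t * s)\<bar> < pi" using that s by (simp add: abs_mult)
    show "Im (of_real t * s) \<noteq> 0 \<or> Re (of_real t * s) < 0"
      using that s by (auto simp: mult_pos_neg)
  qed
  have le: "pi * (1 - t) \<le> Im (G_dilog (of_real t * s) / s)" if t: "0 < t" "t < 1" for t
  proof -
    have "Im (G_dilog (0 + of_real 1 * s) / s) - Im (G_dilog (0 + of_real t * s) / s) \<le> - pi * (1 - t)"
    proof (rule G_dilog_segment_mvt)
      fix t' assume "t' \<in> {t..1}"
      then have e: "exp (of_real t' * s) \<in> cut_plane" using t by (intro exp_in_cut_plane sc) auto
      then show "exp (0 + of_real t' * s) \<in> cut_plane" by simp
      have "1 - exp (of_real t' * s) \<noteq> 0" using e by (auto simp: cut_plane_def complex_eq_iff)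
      then have "- pi < Im (Ln (1 - exp (of_real t' * s)))" by (rule mpi_less_Im_Ln)
      then show "Im (- Ln (1 - exp (0 + of_real t' * s)) - 2 * of_real pi * \<i>) \<le> - pi" by simp
    qed (use t s0 in auto)
    then show ?thesis using zero by simp
  qed
  have F: "filterlim (\<lambda>t::real. exp (of_real t * s)) (at 1 within cut_plane) (at_right 0)"
    unfolding filterlim_at
  proof
    have "((\<lambda>t::real. exp (of_real t * s)) \<longlongrightarrow> exp (of_real 0 * s)) (at_right 0)"
      by (intro tendsto_intros)
    then show "((\<lambda>t::real. exp (of_real t * s)) \<longlongrightarrow> 1) (at_right 0)" by simp
    have "\<forall>\<^sub>F t::real in at_right 0. t \<in> {0<..<1}" by (rule eventually_at_right_real) simp
    then show "\<forall>\<^sub>F t::real in at_right 0. exp (of_real t * s) \<in> cut_plane \<and> exp (of_real t * s) \<noteq> 1"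
    proof eventually_elim
      case (elim t)
      then have "exp (of_real t * s) \<in> cut_plane" by (intro exp_in_cut_plane sc) auto
      then show ?case by (auto simp: cut_plane_def)
    qed
  qed
  have "((\<lambda>t::real. Im ((dilog (exp (of_real t * s)) - 2 * of_real pi * \<i> * (of_real t * s)) / s)) \<longlongrightarrow>
     Im ((of_real (pi ^ 2 / 6) - 2 * of_real pi * \<i> * (of_real 0 * s)) / s)) (at_right 0)"
    using s0 by (intro tendsto_intros filterlim_compose[OF tendsto_dilog_1 F])
  then have lim: "((\<lambda>t::real. Im (G_dilog (of_real t * s) / s)) \<longlongrightarrow> Im (of_real (pi ^ 2 / 6) / s)) (at_right 0)"
    unfolding G_dilog_def by simp
  have "((\<lambda>t::real. pi * (1 - t)) \<longlongrightarrow> pi * (1 - 0)) (at_right 0)" by (intro tendsto_intros)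
  moreover have "\<forall>\<^sub>F t in at_right 0. pi * (1 - t) \<le> Im (G_dilog (of_real t * s) / s)"
  proof -
    have "\<forall>\<^sub>F t::real in at_right 0. t \<in> {0<..<1}" by (rule eventually_at_right_real) simp
    then show ?thesis by eventually_elim (use le in auto)
  qed
  ultimately have "pi * (1 - 0) \<le> Im (of_real (pi ^ 2 / 6) / s)"
    by (intro tendsto_le[OF _ lim]) auto
  moreover have "Im (of_real (pi ^ 2 / 6) / s) \<le> 0"
    using s by (simp add: Im_divide divide_nonpos_nonneg)
  ultimately show False using pi_gt_zero by simp
qed

text \<open>Below the real axis 1 - exp s lies in the upper half plane, so Im Ln (1 - exp s) > 0 and
  the derivative has imaginary part at most - 2 pi. This makes a zero unique and bounds
  \<open>G_dilog\<close> from below on a small circle.\<close>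

lemma G_dilog_lower_expanding:
  assumes s: "- pi < Im s1" "Im s1 < 0" "- pi < Im s2" "Im s2 < 0"
  shows "2 * pi * cmod (s2 - s1) \<le> cmod (G_dilog s2 - G_dilog s1)"
proof (cases "s1 = s2")
  case False
  define d where "d = s2 - s1"
  have d: "d \<noteq> 0" using False by (simp add: d_def)
  have "Im (G_dilog (s1 + of_real 1 * d) / d) - Im (G_dilog (s1 + of_real 0 * d) / d) \<le> - (2 * pi) * (1 - 0)"
  proof (rule G_dilog_segment_mvt)
    fix t :: real assume t: "t \<in> {0..1}"
    have "Im (s1 + of_real t * d) = (1 - t) * Im s1 + t * Im s2" by (simp add: d_def algebra_simps)
    moreover have "(1 - t) * Im s1 + t * Im s2 < 0"
      using convex_bound_lt[of "Im s1" 0 "Im s2" "1 - t" t] s t by simp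
    moreover have "- ((1 - t) * Im s1 + t * Im s2) < pi"
      using convex_bound_lt[of "- Im s1" pi "- Im s2" "1 - t" t] s t by simp
    ultimately have I: "Im (s1 + of_real t * d) < 0" "- pi < Im (s1 + of_real t * d)" by linarith+
    then show e: "exp (s1 + of_real t * d) \<in> cut_plane" by (intro exp_in_cut_plane) auto
    have "sin (- Im (s1 + of_real t * d)) > 0" using I by (intro sin_gt_zero) auto
    then have "exp (Re (s1 + of_real t * d)) * sin (Im (s1 + of_real t * d)) < 0"
      by (intro mult_pos_neg exp_gt_zero) (simp only: sin_minus neg_0_less_iff_less)
    then have "Im (1 - exp (s1 + of_real t * d)) > 0"
      by (simp only: minus_complex.sel Im_exp one_complex.sel)
    then have "0 < Im (Ln (1 - exp (s1 + of_real t * d)))" using Im_Ln_pos_lt_imp by blast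
    then show "Im (- Ln (1 - exp (s1 + of_real t * d)) - 2 * of_real pi * \<i>) \<le> - (2 * pi)" by simp
  qed (use d in auto)
  then have "2 * pi \<le> - Im ((G_dilog s2 - G_dilog s1) / d)" by (simp add: d_def diff_divide_distrib)
  also have "\<dots> \<le> cmod ((G_dilog s2 - G_dilog s1) / d)" using abs_Im_le_cmod by (meson abs_le_D2)
  finally show ?thesis using d by (simp add: norm_divide field_simps d_def)
qed auto

section \<open>Numerical location of w0\<close>

lemma ln_one_minus_Taylor:
  assumes "0 \<le> x" "x < (1::real)"
  shows "\<bar>ln (1 - x) + (\<Sum>k<m. x ^ Suc k / real (Suc k))\<bar> \<le> x ^ Suc m / (real (Suc m) * (1 - x))"
proof -
  have "Ln (1 - of_real x) = complex_of_real (ln (1 - x))"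
    using assms Ln_of_real[of "1 - x"] by simp
  then have "Ln (1 - of_real x) + (\<Sum>k<m. of_real x ^ Suc k / of_nat (Suc k))
     = complex_of_real (ln (1 - x) + (\<Sum>k<m. x ^ Suc k / real (Suc k)))"
    by (simp del: of_nat_Suc)
  then have "cmod (complex_of_real (ln (1 - x) + (\<Sum>k<m. x ^ Suc k / real (Suc k))))
     \<le> cmod (of_real x) ^ Suc m / (real (Suc m) * (1 - cmod (of_real x)))"
    using Ln_one_minus_Taylor[of "of_real x" m] assms by (metis abs_of_nonneg norm_of_real)
  then show ?thesis using assms by (simp only: norm_of_real abs_of_nonneg)
qed

lemma ln_81_425: "\<bar>ln (81 / 425 :: real) + (16576/10000)\<bar> \<le> (1/1000)"
proof -
  have a: "\<bar>ln (1 - 1/5 :: real) + (\<Sum>k<5. (1/5) ^ Suc k / real (Suc k))\<bar> \<le> (1/5) ^ Suc 5 / (real (Suc 5) * (1 - 1/5))"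
    by (rule ln_one_minus_Taylor) auto
  have b: "\<bar>ln (1 - 25403/278528 :: real) + (\<Sum>k<3. (25403/278528) ^ Suc k / real (Suc k))\<bar>
      \<le> (25403/278528) ^ Suc 3 / (real (Suc 3) * (1 - 25403/278528))"
    by (rule ln_one_minus_Taylor) auto
  \<comment> \<open>The power (4/5)^7 is within ten percent of 81/425, so both logarithms on the
    right come from short Taylor sums.\<close>
  have "(81 / 425 :: real) = (1 - 1/5) ^ 7 * (1 - 25403/278528)"
    by (simp add: field_simps)
  also have "ln \<dots> = ln ((1 - 1/5) ^ 7) + ln (1 - 25403/278528 :: real)"
    by (rule ln_mult_pos) auto
  also have "ln ((1 - 1/5) ^ 7 :: real) = 7 * ln (1 - 1/5)"
    by (subst ln_realpow) auto
  finally have "ln (81 / 425 :: real) = 7 * ln (1 - 1/5) + ln (1 - 25403/278528)" .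
  moreover have "\<bar>ln (1 - 1/5 :: real) + 41837/187500\<bar> \<le> 1/75000"
    using a by (simp add: eval_nat_numeral)
  moreover have "\<bar>ln (1 - 25403/278528 :: real) + (9563/100000)\<bar> \<le> (1/10000)"
  proof -
    have S: "(\<Sum>k<3. (25403/278528) ^ Suc k / real (Suc k)) = 6198129358668611 / 64822807527161856"
      by (simp add: eval_nat_numeral)
    have E: "(25403/278528) ^ Suc 3 / (real (Suc 3) * (1 - 25403/278528)) \<le> 1 / 20000"
      by (simp add: eval_nat_numeral)
    show ?thesis using b E unfolding S by linarith
  qed
  ultimately show ?thesis by linarith
qed

text \<open>An approximation of \<open>1 - w0\<close> that equals \<open>(81/425) i (1 - 2i/9)\<^sup>2\<close> and has modulus \<open>1/5\<close>, so that \<open>Ln y1\<close>,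
  \<open>Ln (1 - y1)\<close> and \<open>dilog y1\<close> are all given by short Taylor polynomials.\<close>

definition y1 :: complex where "y1 = Complex (36/425) (77/425)"

lemma cmod_y1: "cmod y1 = 1 / 5"
proof -
  have "cmod y1 = sqrt ((1/5)\<^sup>2)"
    unfolding y1_def complex_norm by (simp add: power2_eq_square)
  then show ?thesis by simp
qed

text \<open>The factorisation of \<open>y1\<close> gives a logarithm up to multiples of 2 pi i.
  Since the argument of 1 - 2i/9 lies between - pi/2 and 0, the candidate has imaginary part between
  - pi/2 and pi/2 and is the principal value.\<close>

lemma Ln_y1: "Ln y1 = \<i> * of_real (pi / 2) + of_real (ln (81 / 425)) + 2 * Ln (1 - Complex 0 (2/9))"
proof (rule Ln_unique)
  let ?l = "Ln (1 - Complex 0 (2/9))"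
  have ne: "1 - Complex 0 (2/9) \<noteq> 0" by (auto simp: complex_eq_iff)
  have "exp (\<i> * of_real (pi / 2) + of_real (ln (81 / 425)) + 2 * ?l)
     = exp (\<i> * of_real (pi / 2)) * exp (of_real (ln (81 / 425))) * exp ?l ^ 2"
    by (simp only: exp_add exp_double)
  also have "exp (\<i> * of_real (pi / 2)) = \<i>"
    by (simp only: cis_conv_exp[symmetric] cis_pi_half)
  also have "exp (complex_of_real (ln (81 / 425))) = of_real (81 / 425)"
  proof -
    have "exp (ln (81 / 425 :: real)) = 81 / 425" by (rule exp_ln) simp
    then show ?thesis by (simp only: exp_of_real)
  qed
  also have "exp ?l = 1 - Complex 0 (2/9)" using ne by simp
  also have "\<i> * of_real (81 / 425) * (1 - Complex 0 (2/9)) ^ 2 = y1"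
  proof -
    have "(1 - Complex 0 (2/9)) ^ 2 = Complex (77/81) (- 4/9)"
      by (simp add: complex_eq_iff power2_eq_square)
    then show ?thesis by (simp add: y1_def complex_eq_iff)
  qed
  finally show "exp (\<i> * of_real (pi / 2) + of_real (ln (81 / 425)) + 2 * ?l) = y1" .
  have "\<bar>Im ?l\<bar> < pi / 2" using ne by (intro Re_Ln_pos_lt_imp) auto
  moreover have "Im ?l < 0"
  proof -
    have "\<not> 0 \<le> Im (1 - Complex 0 (2/9))" by simp
    then show ?thesis using Im_Ln_pos_le[OF ne] Im_Ln_le_pi[OF ne] by linarith
  qed
  ultimately show "- pi < Im (\<i> * of_real (pi / 2) + of_real (ln (81 / 425)) + 2 * ?l)"
    "Im (\<i> * of_real (pi / 2) + of_real (ln (81 / 425)) + 2 * ?l) \<le> pi"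
    using pi_gt_zero by (auto simp: abs_if split: if_splits)
qed

text \<open>The shift by 2 pi i anticipates \<open>G_dilog\<close> at Ln (1 - y1): there the
  reflection formula and the linear term combine to the product of Ln (1 - y1) and Ln y1 + 2 pi
  i.\<close>

lemma Ln_y1_approx: "cmod (Ln y1 + 2 * of_real pi * \<i> - Complex (-(16083/10000)) (74169/10000)) \<le> (5/1000)"
proof -
  let ?l = "Ln (1 - Complex 0 (2/9))"
  let ?T = "Complex (2/81) (8/2187 - 2/9)"
  have c: "cmod (Complex 0 (2/9)) = 2/9" by (simp add: cmod_def)
  have "cmod (?l + (\<Sum>k<3. Complex 0 (2/9) ^ Suc k / of_nat (Suc k))) \<le> (2/9) ^ Suc 3 / (real (Suc 3) * (1 - 2/9))"
    using Ln_one_minus_Taylor[of "Complex 0 (2/9)" 3] unfolding c by simp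
  moreover have "(\<Sum>k<3. Complex 0 (2/9) ^ Suc k / of_nat (Suc k)) = - ?T"
    by (simp add: eval_nat_numeral complex_eq_iff Re_divide Im_divide)
  ultimately have 1: "cmod (?l - ?T) \<le> (8/10000)" by (simp add: eval_nat_numeral)
  have 2: "Ln y1 + 2 * of_real pi * \<i> - Complex (-(16083/10000)) (74169/10000)
     = 2 * (?l - ?T) + Complex (ln (81/425) + 4/81 + (16083/10000)) (5 * pi / 2 - 4/9 + 16/2187 - (74169/10000))"
    unfolding Ln_y1 by (simp add: complex_eq_iff)
  have "cmod (Complex (ln (81/425) + 4/81 + (16083/10000)) (5 * pi / 2 - 4/9 + 16/2187 - (74169/10000))) \<le> (2/1000) + (1/1000)"
  proof (rule order_trans[OF cmod_le add_mono], unfold complex.sel)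
    show "\<bar>ln (81/425) + (4/81 :: real) + (16083/10000)\<bar> \<le> (2/1000)" using ln_81_425 by linarith
    show "\<bar>5 * pi / 2 - 4/9 + 16/2187 - (74169/10000)\<bar> \<le> (1/1000)" using pi_approx by (simp add: abs_le_iff)
  qed
  moreover have "cmod (2 * (?l - ?T)) = 2 * cmod (?l - ?T)" by (simp only: norm_mult norm_numeral)
  ultimately show ?thesis unfolding 2 using 1
    by (intro order_trans[OF norm_triangle_ineq]) linarith
qed

lemma Ln_one_minus_y1_approx: "cmod (Ln (1 - y1) - Complex (-(693/10000)) (-(1956/10000))) \<le> (1/1000)"
proof -
  have "cmod (Ln (1 - y1) + (\<Sum>k<3. y1 ^ Suc k / of_nat (Suc k))) \<le> (1/5) ^ Suc 3 / (real (Suc 3) * (1 - 1/5))"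
    using Ln_one_minus_Taylor[of y1 3] unfolding cmod_y1 by simp
  then have 1: "cmod (Ln (1 - y1) + (\<Sum>k<3. y1 ^ Suc k / of_nat (Suc k))) \<le> (5/10000)"
    by (simp add: eval_nat_numeral)
  have "cmod ((\<Sum>k<3. y1 ^ Suc k / of_nat (Suc k)) + Complex (-(693/10000)) (-(1956/10000))) \<le> (1/10000) + (3/10000)"
    by (rule order_trans[OF cmod_le add_mono])
       (simp_all add: eval_nat_numeral y1_def Re_divide Im_divide)
  with 1 norm_triangle_ineq4[of "Ln (1 - y1) + (\<Sum>k<3. y1 ^ Suc k / of_nat (Suc k))"
      "(\<Sum>k<3. y1 ^ Suc k / of_nat (Suc k)) + Complex (-(693/10000)) (-(1956/10000))"]
  show ?thesis by simp
qed

lemma dilog_y1_approx: "cmod (dilog y1 - Complex (774/10000) (1885/10000)) \<le> (1/1000)"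
proof -
  have "cmod (dilog y1 - (\<Sum>k<3. y1 ^ Suc k / of_nat (Suc k) ^ 2)) \<le> (1/5) ^ Suc 3 / (real (Suc 3) ^ 2 * (1 - 1/5))"
    using dilog_Taylor[of y1 3] unfolding cmod_y1 by simp
  then have 1: "cmod (dilog y1 - (\<Sum>k<3. y1 ^ Suc k / of_nat (Suc k) ^ 2)) \<le> (2/10000)"
    by (simp add: eval_nat_numeral)
  have "cmod ((\<Sum>k<3. y1 ^ Suc k / of_nat (Suc k) ^ 2) - Complex (774/10000) (1885/10000)) \<le> (3/10000) + (3/10000)"
    by (rule order_trans[OF cmod_le add_mono])
       (simp_all add: eval_nat_numeral y1_def Re_divide Im_divide)
  with 1 norm_triangle_ineq[of "dilog y1 - (\<Sum>k<3. y1 ^ Suc k / of_nat (Suc k) ^ 2)"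
      "(\<Sum>k<3. y1 ^ Suc k / of_nat (Suc k) ^ 2) - Complex (774/10000) (1885/10000)"]
  show ?thesis by simp
qed

text \<open>Near the expected zero exp s is close to 1, where the series for \<open>dilog\<close>
  converges slowly. Reflection moves the evaluation to \<open>y1\<close>, of modulus 1/5.\<close>

lemma G_dilog_Ln_one_minus_y1: "cmod (G_dilog (Ln (1 - y1))) \<le> (3/100)"
proof -
  let ?L = "Ln (1 - y1)" and ?La = "Complex (-(693/10000)) (-(1956/10000))"
  let ?M = "Ln y1 + 2 * of_real pi * \<i>" and ?Ma = "Complex (-(16083/10000)) (74169/10000)"
  let ?Da = "Complex (774/10000) (1885/10000)"
  have c: "1 - y1 \<in> cut_plane" "1 - y1 \<noteq> 0" by (auto simp: cut_plane_def y1_def complex_eq_iff)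
  have "G_dilog ?L = dilog (1 - y1) - 2 * of_real pi * \<i> * ?L"
    using c by (simp add: G_dilog_def)
  also have "dilog (1 - y1) = of_real (pi ^ 2 / 6) - ?L * Ln y1 - dilog y1"
    using dilog_reflection[OF c(1)] by (simp add: algebra_simps)
  finally have G: "G_dilog ?L = (of_real (pi ^ 2 / 6) - ?Da - ?La * ?Ma) - (dilog y1 - ?Da) - (?L - ?La) * ?M - ?La * (?M - ?Ma)"
    by (simp add: algebra_simps)
  have pi2: "(98695/10000) \<le> pi ^ 2" "pi ^ 2 \<le> (98697/10000)"
    using power_mono[of "(314158/100000)" pi 2] power_mono[of pi "(31416/10000)" 2] pi_approx by (simp_all add: power2_eq_square)
  have 1: "cmod (of_real (pi ^ 2 / 6) - ?Da - ?La * ?Ma) \<le> (8/1000) + (12/1000)"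
    by (rule order_trans[OF cmod_le add_mono]) (use pi2 in \<open>simp_all add: abs_le_iff\<close>)
  have cMa: "cmod ?Ma \<le> (76/10)" unfolding complex_norm by (rule real_le_lsqrt) (simp_all add: power2_eq_square)
  have cLa: "cmod ?La \<le> (693/10000) + (1956/10000)" by (rule order_trans[OF cmod_le]) simp
  have "cmod ?M \<le> (76/10) + (5/1000)"
    using norm_triangle_ineq[of ?Ma "?M - ?Ma"] cMa Ln_y1_approx by simp
  then have 2: "cmod ((?L - ?La) * ?M) \<le> (1/1000) * ((76/10) + (5/1000))"
    unfolding norm_mult by (intro mult_mono Ln_one_minus_y1_approx) auto
  have 3: "cmod (?La * (?M - ?Ma)) \<le> ((693/10000) + (1956/10000)) * (5/1000)"
    unfolding norm_mult by (intro mult_mono Ln_y1_approx cLa) auto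
  have "cmod (G_dilog ?L) \<le> cmod (of_real (pi ^ 2 / 6) - ?Da - ?La * ?Ma) + cmod (dilog y1 - ?Da)
      + cmod ((?L - ?La) * ?M) + cmod (?La * (?M - ?Ma))"
    unfolding G by (intro order_trans[OF norm_triangle_ineq4 add_mono] order_refl)
  with 1 2 3 dilog_y1_approx show ?thesis by simp
qed

text \<open>Otherwise 1 / \<open>G_dilog\<close> would be holomorphic on the disc of radius 1/100.
  On the circle the expansion by 2 pi gives |G| \<ge> 0.0628 - 0.03, more than the bound 0.03 for
  |G| at the centre, against the maximum modulus principle.\<close>

lemma ex_G_dilog_zero: "\<exists>s. cmod (s - Ln (1 - y1)) \<le> (1/100) \<and> G_dilog s = 0"
proof (rule ccontr)
  let ?s = "Ln (1 - y1)"
  assume "\<not> ?thesis"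
  then have nz: "G_dilog s \<noteq> 0" if "s \<in> cball ?s (1/100)" for s
    using that by (auto simp: dist_norm norm_minus_commute)
  have im: "\<bar>Im ?s + (1956/10000)\<bar> \<le> (1/1000)"
    using abs_Im_le_cmod[of "?s - Complex (-(693/10000)) (-(1956/10000))"] Ln_one_minus_y1_approx by simp
  have strip: "- pi < Im s \<and> Im s < 0" if "s \<in> cball ?s (1/100)" for s
  proof -
    have "\<bar>Im s - Im ?s\<bar> \<le> (1/100)"
      using that abs_Im_le_cmod[of "s - ?s"] by (simp add: dist_norm norm_minus_commute)
    then show ?thesis using im pi_gt3 by (intro conjI) linarith+
  qed
  have hol: "G_dilog field_differentiable (at s)" if "s \<in> cball ?s (1/100)" for s
  proof -
    have "exp s \<in> cut_plane" using strip[OF that] by (intro exp_in_cut_plane) auto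
    then show ?thesis using has_field_derivative_G_dilog field_differentiable_def by blast
  qed
  have holi: "(\<lambda>s. inverse (G_dilog s)) holomorphic_on cball ?s (1/100)"
    unfolding holomorphic_on_def
    using field_differentiable_inverse[OF field_differentiable_at_within[OF hol] nz] by blast
  have cont: "continuous_on (closure (cball ?s (1/100))) (\<lambda>s. inverse (G_dilog s))"
    using holomorphic_on_imp_continuous_on[OF holi] by (simp only: closure_closed[OF closed_cball])
  have int: "(\<lambda>s. inverse (G_dilog s)) holomorphic_on interior (cball ?s (1/100))"
    by (rule holomorphic_on_subset[OF holi interior_subset])
  have "cmod (inverse (G_dilog ?s)) \<le> 1 / (327/10000)"
  proof (rule maximum_modulus_frontier[OF int cont bounded_cball])
    fix s assume "s \<in> frontier (cball ?s (1/100))"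
    then have s: "cmod (s - ?s) = (1/100)" "s \<in> cball ?s (1/100)"
      by (simp_all add: dist_norm norm_minus_commute frontier_cball)
    have "2 * pi * cmod (s - ?s) \<le> cmod (G_dilog s - G_dilog ?s)"
      using strip[OF s(2)] strip[of ?s] by (intro G_dilog_lower_expanding) simp_all
    then have "(628/10000) \<le> cmod (G_dilog s - G_dilog ?s)" unfolding s(1) using pi_approx by simp
    also have "\<dots> \<le> cmod (G_dilog s) + (3/100)"
      using norm_triangle_ineq4[of "G_dilog s" "G_dilog ?s"] G_dilog_Ln_one_minus_y1 by simp
    finally have "(327/10000) \<le> cmod (G_dilog s)" by simp
    then have "1 / cmod (G_dilog s) \<le> 1 / (327/10000)" by (intro divide_left_mono) auto
    then show "cmod (inverse (G_dilog s)) \<le> 1 / (327/10000)"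
      by (simp only: norm_inverse) (simp only: inverse_eq_divide)
  qed simp
  moreover have "1 / (3/100) \<le> cmod (inverse (G_dilog ?s))"
  proof -
    have "1 / (3/100) \<le> 1 / cmod (G_dilog ?s)"
      using G_dilog_Ln_one_minus_y1 nz[of ?s] by (intro divide_left_mono) auto
    then show ?thesis by (simp only: norm_inverse) (simp only: inverse_eq_divide)
  qed
  ultimately show False by simp
qed

text \<open>The zero found numerically is the only one: \<open>G_dilog_upper_nonzero\<close>
  excludes logarithms with nonnegative imaginary part, and the expansion property identifies any
  other zero with \<open>s\<close>. So the definite description of \<open>w0\<close> denotes, and it
  comes with an error bound.\<close>

lemma
  shows w0_cut_plane: "w0 \<in> cut_plane"
    and dilog_w0: "dilog w0 = 2 * of_real pi * \<i> * Ln w0"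
    and w0_approx: "cmod (Ln w0 - Ln (1 - y1)) \<le> (1/100)"
proof -
  obtain s where s: "cmod (s - Ln (1 - y1)) \<le> (1/100)" "G_dilog s = 0" using ex_G_dilog_zero by blast
  have cp: "w \<notin> of_real ` {..0} \<and> w \<notin> of_real ` {1..} \<longleftrightarrow> w \<in> cut_plane" for w
    by (auto simp: cut_plane_def image_iff complex_eq_iff not_le)
  have "\<bar>Im (Ln (1 - y1)) + (1956/10000)\<bar> \<le> (1/1000)"
    using abs_Im_le_cmod[of "Ln (1 - y1) - Complex (-(693/10000)) (-(1956/10000))"] Ln_one_minus_y1_approx by simp
  moreover have "\<bar>Im s - Im (Ln (1 - y1))\<bar> \<le> (1/100)" using s(1) abs_Im_le_cmod[of "s - Ln (1 - y1)"] by simp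
  ultimately have "- pi < Im s \<and> Im s < 0" using pi_gt3 by (intro conjI) linarith+
  then have ims: "- pi < Im s" "Im s < 0" by auto
  have Lns: "Ln (exp s) = s" using ims by simp
  have uniq: "w = exp s" if "w \<in> cut_plane" "dilog w - 2 * of_real pi * \<i> * Ln w = 0" for w
  proof -
    have w: "w \<noteq> 0" "Im w \<noteq> 0 \<or> 0 < Re w \<and> Re w < 1" using that by (auto simp: cut_plane_def)
    have G: "G_dilog (Ln w) = 0" using that w by (simp add: G_dilog_def)
    have "Im (Ln w) \<noteq> pi" using w Im_Ln_eq_pi[of w] by auto
    then have L: "- pi < Im (Ln w)" "Im (Ln w) < pi" using w mpi_less_Im_Ln Im_Ln_le_pi by (auto simp: less_le)
    have "Im (Ln w) < 0"
    proof (rule ccontr)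
      assume "\<not> Im (Ln w) < 0"
      then have n: "0 \<le> Im (Ln w)" by simp
      have "Re (Ln w) < 0" if "Im (Ln w) = 0"
      proof -
        have "Im w = 0" using that w Im_Ln_eq_0[of w] by auto
        then have "0 < Re w" "Re w < 1" "cmod w = \<bar>Re w\<bar>" using w by (auto simp: cmod_eq_Re)
        then show ?thesis using w by simp
      qed
      then show False using G_dilog_upper_nonzero[OF n L(2)] G by blast
    qed
    then have "2 * pi * cmod (Ln w - s) \<le> cmod (G_dilog (Ln w) - G_dilog s)"
      using L ims by (intro G_dilog_lower_expanding)
    then have "2 * pi * cmod (Ln w - s) \<le> 0" using G s by simp
    then have "cmod (Ln w - s) \<le> 0" using pi_gt_zero by (simp add: mult_le_0_iff)
    then have "Ln w = s" by simp
    then show ?thesis using w by (metis exp_Ln)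
  qed
  have ec: "exp s \<in> cut_plane" using ims by (intro exp_in_cut_plane) auto
  have ez: "dilog (exp s) - 2 * of_real pi * \<i> * Ln (exp s) = 0"
    unfolding Lns using s(2) by (simp add: G_dilog_def)
  have "w0 = exp s"
    unfolding w0_def
  proof (rule the_equality)
    show "exp s \<notin> of_real ` {..0} \<and> exp s \<notin> of_real ` {1..} \<and> dilog (exp s) - 2 * of_real pi * \<i> * Ln (exp s) = 0"
      using ec ez cp by blast
  qed (use uniq cp in blast)
  then show "w0 \<in> cut_plane" "dilog w0 = 2 * of_real pi * \<i> * Ln w0" "cmod (Ln w0 - Ln (1 - y1)) \<le> (1/100)"
    using ec ez Lns s by simp_all
qed

text \<open>The value 0.0693 less the two errors 0.01 and 0.001. This is the margin against which
  the far pieces of the contour are compared.\<close>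

lemma Re_Ln_w0: "Re (Ln w0) \<le> - (583/10000)"
proof -
  have "\<bar>Re (Ln w0) - Re (Ln (1 - y1))\<bar> \<le> (1/100)"
    using w0_approx abs_Re_le_cmod[of "Ln w0 - Ln (1 - y1)"] by simp
  moreover have "\<bar>Re (Ln (1 - y1)) + (693/10000)\<bar> \<le> (1/1000)"
    using abs_Re_le_cmod[of "Ln (1 - y1) - Complex (-(693/10000)) (-(1956/10000))"] Ln_one_minus_y1_approx by simp
  ultimately show ?thesis by linarith
qed

text \<open>Exponentiating costs the factor exp (1/100) \<le> 1.0101, so the error 1/100 of the
  logarithm becomes less than 0.0102.\<close>

lemma cmod_one_minus_w0_diff: "cmod ((1 - w0) - y1) \<le> (102/10000)"
proof -
  have ne: "w0 \<noteq> 0" "1 - y1 \<noteq> 0" using w0_cut_plane by (auto simp: cut_plane_def y1_def complex_eq_iff)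
  have "(1 - w0) - y1 = exp (Ln (1 - y1)) - exp (Ln w0)" using ne by simp
  also have "\<dots> = (1 - y1) * (1 - exp (Ln w0 - Ln (1 - y1)))"
    using ne by (simp add: exp_diff field_simps)
  finally have e: "(1 - w0) - y1 = (1 - y1) * (1 - exp (Ln w0 - Ln (1 - y1)))" .
  have "cmod (1 - y1) \<le> 1"
    unfolding y1_def by (simp add: cmod_def power2_eq_square)
  moreover have "cmod (1 - exp (Ln w0 - Ln (1 - y1))) \<le> (102/10000)"
  proof -
    let ?d = "Ln w0 - Ln (1 - y1)"
    have "cmod (exp ?d - (\<Sum>k\<le>0. ?d ^ k / fact k)) \<le> exp \<bar>Re ?d\<bar> * cmod ?d ^ Suc 0 / fact 0"
      by (rule Taylor_exp)
    then have "cmod (exp ?d - 1) \<le> exp \<bar>Re ?d\<bar> * cmod ?d" by simp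
    also have "\<dots> \<le> exp (1/100) * (1/100)"
      using w0_approx abs_Re_le_cmod[of ?d] by (intro mult_mono) auto
    also have "exp ((1/100)::real) \<le> 1 + (1/100) + (1/100)\<^sup>2" by (rule exp_bound) auto
    finally show ?thesis by (simp add: norm_minus_commute power2_eq_square)
  qed
  ultimately have "cmod ((1 - w0) - y1) \<le> 1 * (102/10000)" unfolding e norm_mult by (intro mult_mono) auto
  then show ?thesis by simp
qed

lemma one_minus_w0_bounds:
  "(1898/10000) \<le> cmod (1 - w0)" "cmod (1 - w0) \<le> (2102/10000)" "0 < Re (1 - w0)" "0 < Im (1 - w0)"
proof -
  note d = cmod_one_minus_w0_diff
  show "(1898/10000) \<le> cmod (1 - w0)"
    using norm_triangle_ineq2[of "y1" "1 - w0"] d cmod_y1 unfolding norm_minus_commute[of y1] by simp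
  show "cmod (1 - w0) \<le> (2102/10000)"
    using norm_triangle_ineq2[of "1 - w0" y1] d cmod_y1 by simp
  have "Re y1 = 36 / 425" "Im y1 = 77 / 425" by (simp_all add: y1_def)
  then have "0 < Re (1 - w0) \<and> 0 < Im (1 - w0)"
    using abs_Re_le_cmod[of "(1 - w0) - y1"] abs_Im_le_cmod[of "(1 - w0) - y1"] d
    unfolding minus_complex.sel by (intro conjI) linarith+
  then show "0 < Re (1 - w0)" "0 < Im (1 - w0)" by auto
qed

section \<open>Asymptotics of the finite product\<close>

text \<open>A factor 1 - exp (2 pi i v) of the product divided by its linear term at 0. Unlike the
  factor, it is zero-free on all of \<open>slit_plane 1\<close> and so has a holomorphic logarithm
  there.\<close>

definition sinc_factor :: "complex \<Rightarrow> complex" where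
  "sinc_factor v = (if v = 0 then 1 else (1 - exp (2 * of_real pi * \<i> * v)) / (- 2 * of_real pi * \<i> * v))"

lemma exp_2pi_i_eq_1_slit:
  assumes "v \<in> slit_plane 1" "exp (2 * of_real pi * \<i> * v) = 1"
  shows "v = 0"
proof -
  from assms(2) obtain n :: int where "Re (2 * of_real pi * \<i> * v) = 0" "Im (2 * of_real pi * \<i> * v) = of_int (2 * n) * pi"
    unfolding exp_eq_1 by blast
  then have v: "Im v = 0" "Re v = of_int n" by auto
  then have "\<bar>real_of_int n\<bar> < 1" using assms(1) by (simp add: slit_plane_def)
  then have "n = 0" by linarith
  then show ?thesis using v by (simp add: complex_eq_iff)
qed

lemma holomorphic_sinc_factor: "sinc_factor holomorphic_on slit_plane 1"
proof -
  let ?f = "\<lambda>v. (1 - exp (2 * of_real pi * \<i> * v)) / (- 2 * of_real pi * \<i>)"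
  have f: "?f holomorphic_on slit_plane 1" by (intro holomorphic_intros) auto
  have "(?f has_field_derivative 1) (at 0)"
    by (auto intro!: derivative_eq_intros)
  then have "deriv ?f 0 = 1" by (rule DERIV_imp_deriv)
  then have "sinc_factor = (\<lambda>v. if v = 0 then deriv ?f 0 else (?f v - ?f 0) / (v - 0))"
    by (auto simp: sinc_factor_def fun_eq_iff)
  then show ?thesis using pole_lemma_open[OF f open_slit_plane, of 0] by simp
qed

lemma sinc_factor_nonzero:
  assumes "v \<in> slit_plane 1"
  shows "sinc_factor v \<noteq> 0"
  using exp_2pi_i_eq_1_slit[OF assms] by (auto simp: sinc_factor_def)

lemma ex_log_sinc:
  "\<exists>h. h holomorphic_on slit_plane 1 \<and> h 0 = 0 \<and> (\<forall>v\<in>slit_plane 1. exp (h v) = 1 / sinc_factor v)"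
proof -
  have "contractible (slit_plane 1)" by (intro starlike_imp_contractible starlike_slit_plane) simp
  then obtain g where g: "g holomorphic_on slit_plane 1" "\<And>z. z \<in> slit_plane 1 \<Longrightarrow> sinc_factor z = exp (g z)"
    using contractible_imp_holomorphic_log[OF holomorphic_sinc_factor _ sinc_factor_nonzero] by blast
  have "0 \<in> slit_plane 1" by (simp add: slit_plane_def)
  then have g0: "exp (g 0) = 1" using g(2)[of 0] by (simp add: sinc_factor_def)
  show ?thesis
  proof (intro exI[of _ "\<lambda>v. g 0 - g v"] conjI ballI)
    show "(\<lambda>v. g 0 - g v) holomorphic_on slit_plane 1" by (intro holomorphic_intros g)
    show "exp (g 0 - g v) = 1 / sinc_factor v" if "v \<in> slit_plane 1" for v
      using g(2)[OF that] g0 by (simp add: exp_diff)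
  qed simp
qed

definition log_sinc :: "complex \<Rightarrow> complex" where
  "log_sinc = (SOME h. h holomorphic_on slit_plane 1 \<and> h 0 = 0 \<and> (\<forall>v\<in>slit_plane 1. exp (h v) = 1 / sinc_factor v))"

lemma
  shows holomorphic_log_sinc: "log_sinc holomorphic_on slit_plane 1"
    and log_sinc_0: "log_sinc 0 = 0"
    and exp_log_sinc: "v \<in> slit_plane 1 \<Longrightarrow> exp (log_sinc v) = 1 / sinc_factor v"
  using someI_ex[OF ex_log_sinc] unfolding log_sinc_def[symmetric] by auto

lemma ex_log_sinc_int:
  "\<exists>H. H 0 = 0 \<and> (\<forall>v\<in>slit_plane 1. (H has_field_derivative log_sinc v) (at v))"
proof -
  have "\<exists>H. \<forall>v\<in>slit_plane 1. (H has_field_derivative log_sinc v) (at v)"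
    by (rule holomorphic_starlike_primitive[where k = "{}"])
       (use holomorphic_log_sinc starlike_slit_plane[of 1] open_slit_plane in
        \<open>auto intro: holomorphic_on_imp_continuous_on holomorphic_on_imp_differentiable_at\<close>)
  then obtain H where H: "\<And>v. v \<in> slit_plane 1 \<Longrightarrow> (H has_field_derivative log_sinc v) (at v)" by blast
  have "((\<lambda>v. H v - H 0) has_field_derivative log_sinc v) (at v)" if "v \<in> slit_plane 1" for v
    using DERIV_diff[OF H[OF that] DERIV_const[of "H 0"]] by simp
  then show ?thesis by (intro exI[of _ "\<lambda>v. H v - H 0"]) simp
qed

definition log_sinc_int :: "complex \<Rightarrow> complex" where
  "log_sinc_int = (SOME H. H 0 = 0 \<and> (\<forall>v\<in>slit_plane 1. (H has_field_derivative log_sinc v) (at v)))"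

lemma
  shows log_sinc_int_0: "log_sinc_int 0 = 0"
    and has_field_derivative_log_sinc_int:
      "v \<in> slit_plane 1 \<Longrightarrow> (log_sinc_int has_field_derivative log_sinc v) (at v)"
  using someI_ex[OF ex_log_sinc_int] unfolding log_sinc_int_def[symmetric] by auto

text \<open>Taylor's formula of order two for the primitive and of order one for the value at the
  other end: in the trapezoidal combination the terms with the first derivative cancel, and each
  remainder contributes half of the bound.\<close>

lemma trapezoid_step:
  assumes seg: "closed_segment v w \<subseteq> slit_plane 1"
    and B: "\<And>x. x \<in> closed_segment v w \<Longrightarrow> cmod (deriv (deriv log_sinc) x) \<le> B"
  shows "cmod (log_sinc_int w - log_sinc_int v - (w - v) * (log_sinc v + log_sinc w) / 2) \<le> B * cmod (w - v) ^ 3"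
proof -
  let ?S = "closed_segment v w"
  define f where "f = (\<lambda>i::nat. if i = 0 then log_sinc_int else if i = 1 then log_sinc
      else if i = 2 then deriv log_sinc else deriv (deriv log_sinc))"
  have f: "(f i has_field_derivative f (Suc i) x) (at x within ?S)" if "x \<in> ?S" "i \<le> 2" for i x
  proof (rule has_field_derivative_at_within)
    have x: "x \<in> slit_plane 1" using that seg by blast
    have 0: "(log_sinc_int has_field_derivative log_sinc x) (at x)" by (rule has_field_derivative_log_sinc_int[OF x])
    have 1: "(log_sinc has_field_derivative deriv log_sinc x) (at x)"
      by (rule holomorphic_derivI[OF holomorphic_log_sinc open_slit_plane x])
    have 2: "(deriv log_sinc has_field_derivative deriv (deriv log_sinc) x) (at x)"
      by (rule holomorphic_derivI[OF holomorphic_deriv[OF holomorphic_log_sinc open_slit_plane] open_slit_plane x])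
    have "i = 0 \<or> i = 1 \<or> i = 2" using that by auto
    then show "(f i has_field_derivative f (Suc i) x) (at x)"
      using 0 1 2 by (auto simp: f_def)
  qed
  have vw: "v \<in> ?S" "w \<in> ?S" by auto
  have "cmod (f 0 w - (\<Sum>i\<le>2. f i v * (w - v) ^ i / fact i)) \<le> B * cmod (w - v) ^ Suc 2 / fact 2"
  proof (rule complex_Taylor[where S = ?S and n = 2 and f = f and B = B and w = v and z = w])
    show "cmod (f (Suc 2) x) \<le> B" if "x \<in> ?S" for x using B[OF that] by (simp add: f_def)
  qed (use f vw in auto)
  then have 1: "cmod (log_sinc_int w - (log_sinc_int v + log_sinc v * (w - v) + deriv log_sinc v * (w - v)\<^sup>2 / 2))
      \<le> B * cmod (w - v) ^ 3 / 2"
    by (simp add: f_def numeral_2_eq_2 eval_nat_numeral)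
  define g where "g = (\<lambda>i. f (Suc i))"
  have "cmod (g 0 w - (\<Sum>i\<le>1. g i v * (w - v) ^ i / fact i)) \<le> B * cmod (w - v) ^ Suc 1 / fact 1"
  proof (rule complex_Taylor[where S = ?S and n = 1 and f = g and B = B and w = v and z = w])
    show "cmod (g (Suc 1) x) \<le> B" if "x \<in> ?S" for x using B[OF that] by (simp add: f_def g_def)
    show "(g i has_field_derivative g (Suc i) x) (at x within ?S)" if "x \<in> ?S" "i \<le> 1" for i x
      unfolding g_def using that by (intro f) auto
  qed (use vw in auto)
  then have 2: "cmod (log_sinc w - (log_sinc v + deriv log_sinc v * (w - v))) \<le> B * cmod (w - v) ^ 2"
    by (simp add: g_def f_def numeral_2_eq_2 eval_nat_numeral)
  let ?R1 = "log_sinc_int w - (log_sinc_int v + log_sinc v * (w - v) + deriv log_sinc v * (w - v)\<^sup>2 / 2)"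
  let ?R2 = "log_sinc w - (log_sinc v + deriv log_sinc v * (w - v))"
  have "log_sinc_int w - log_sinc_int v - (w - v) * (log_sinc v + log_sinc w) / 2 = ?R1 - (w - v) / 2 * ?R2"
    by (simp add: field_simps power2_eq_square)
  also have "cmod \<dots> \<le> cmod ?R1 + cmod (w - v) / 2 * cmod ?R2"
    by (rule order_trans[OF norm_triangle_ineq4]) (simp add: norm_mult norm_divide)
  also have "\<dots> \<le> B * cmod (w - v) ^ 3 / 2 + cmod (w - v) / 2 * (B * cmod (w - v) ^ 2)"
    by (intro add_mono 1 mult_left_mono 2) auto
  also have "\<dots> = B * cmod (w - v) ^ 3" by (simp add: power2_eq_square power3_eq_cube)
  finally show ?thesis .
qed

text \<open>The node 0 contributes nothing because \<open>log_sinc 0 = 0\<close>, so the endpoint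
  correction is half the value at \<open>u\<close>. N errors of size (|u| / N)^3, multiplied by N /
  |u|, leave O(1/N).\<close>

lemma trapezoid_sum:
  assumes K: "compact K" "K \<subseteq> slit_plane 1"
  shows "\<exists>C\<ge>0. \<forall>N\<ge>1. \<forall>u\<in>K. u \<noteq> 0 \<longrightarrow>
     cmod ((\<Sum>j=1..N. log_sinc (of_nat j * u / of_nat N)) - (of_nat N * log_sinc_int u / u + log_sinc u / 2)) \<le> C / real N"
proof -
  \<comment> \<open>The star hull of \<open>K\<close> about 0 is compact and contains all nodes and
    steps, so one bound for the second derivative serves every N and u.\<close>
  define K' where "K' = (\<lambda>(t, u). of_real t * u) ` ({0..1::real} \<times> K)"
  have "compact K'" unfolding K'_def
    by (intro compact_continuous_image compact_Times K) (auto intro!: continuous_intros simp: case_prod_unfold)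
  have K'sub: "K' \<subseteq> slit_plane 1" using K slit_plane_scale[of _ 1] by (auto simp: K'_def)
  have "continuous_on K' (deriv (deriv log_sinc))"
    by (rule continuous_on_subset[OF holomorphic_on_imp_continuous_on K'sub])
       (intro holomorphic_deriv holomorphic_log_sinc open_slit_plane)
  then have "bounded (deriv (deriv log_sinc) ` K')"
    using \<open>compact K'\<close> compact_continuous_image compact_imp_bounded by blast
  then obtain B where B: "B > 0" "\<And>x. x \<in> K' \<Longrightarrow> cmod (deriv (deriv log_sinc) x) \<le> B" unfolding bounded_pos by blast
  obtain M where M: "M > 0" "\<And>u. u \<in> K \<Longrightarrow> cmod u \<le> M" using compact_imp_bounded[OF K(1)] unfolding bounded_pos by blast
  show ?thesis
  proof (intro exI[of _ "B * M\<^sup>2"] conjI allI impI ballI)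
    fix N :: nat and u assume N: "N \<ge> 1" and u: "u \<in> K" "u \<noteq> 0"
    define v where "v = (\<lambda>j. of_nat j * u / of_nat N)"
    have vK: "closed_segment (v j) (v (Suc j)) \<subseteq> K'" if "j < N" for j
    proof
      fix x assume "x \<in> closed_segment (v j) (v (Suc j))"
      then obtain s where s: "0 \<le> s" "s \<le> 1" "x = (1 - s) *\<^sub>R v j + s *\<^sub>R v (Suc j)" by (auto simp: in_segment)
      have "x = of_real ((real j + s) / real N) * u"
        using N unfolding s(3) v_def by (simp add: scaleR_conv_of_real field_simps)
      moreover have "(real j + s) / real N \<in> {0..1}" using s that N by (auto simp: field_simps)
      ultimately show "x \<in> K'" using u unfolding K'_def
        by (intro image_eqI[of _ _ "((real j + s) / real N, u)"]) (simp_all only: prod.case mem_Times_iff fst_conv snd_conv)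
    qed
    have dv: "v (Suc j) - v j = u / of_nat N" for j
      by (simp add: v_def add_divide_distrib[symmetric] diff_divide_distrib[symmetric] algebra_simps)
    have step: "cmod (log_sinc_int (v (Suc j)) - log_sinc_int (v j) - (u / of_nat N) * (log_sinc (v j) + log_sinc (v (Suc j))) / 2)
       \<le> B * (cmod u / real N) ^ 3" if "j \<in> {..<N}" for j
    proof -
      have "cmod (log_sinc_int (v (Suc j)) - log_sinc_int (v j) - (v (Suc j) - v j) * (log_sinc (v j) + log_sinc (v (Suc j))) / 2)
        \<le> B * cmod (v (Suc j) - v j) ^ 3"
        using vK[of j] that K'sub B by (intro trapezoid_step) auto
      then show ?thesis unfolding dv norm_divide norm_of_nat .
    qed
    have "(\<Sum>j<N. log_sinc_int (v (Suc j)) - log_sinc_int (v j)) = log_sinc_int (v N) - log_sinc_int (v 0)"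
      by (rule sum_lessThan_telescope)
    moreover have "v N = u" "v 0 = 0" using N by (simp_all add: v_def)
    ultimately have t1: "(\<Sum>j<N. log_sinc_int (v (Suc j))) - (\<Sum>j<N. log_sinc_int (v j)) = log_sinc_int u"
      by (simp only: sum_subtractf log_sinc_int_0 diff_zero)
    have s1: "(\<Sum>j<N. log_sinc (v (Suc j))) = (\<Sum>j=1..N. log_sinc (v j))"
      by (rule sum.reindex_bij_witness[of _ "\<lambda>j. j - 1" Suc]) auto
    have s2: "(\<Sum>j<N. log_sinc (v j)) = (\<Sum>j=1..N. log_sinc (v j)) - log_sinc u"
    proof -
      have "(\<Sum>j<N. log_sinc (v (Suc j)) - log_sinc (v j)) = log_sinc (v N) - log_sinc (v 0)"
        by (rule sum_lessThan_telescope)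
      then show ?thesis using N s1 by (simp add: v_def log_sinc_0 sum_subtractf algebra_simps)
    qed
    have "(\<Sum>j<N. log_sinc_int (v (Suc j)) - log_sinc_int (v j) - (u / of_nat N) * (log_sinc (v j) + log_sinc (v (Suc j))) / 2)
       = log_sinc_int u - (u / of_nat N) * ((\<Sum>j<N. log_sinc (v j)) + (\<Sum>j<N. log_sinc (v (Suc j)))) / 2"
      unfolding sum_subtractf t1 by (simp add: sum_distrib_left sum_divide_distrib sum.distrib distrib_left add_divide_distrib)
    also have "\<dots> = log_sinc_int u - (u / of_nat N) * ((\<Sum>j=1..N. log_sinc (v j)) - log_sinc u / 2)"
      unfolding s1 s2 by (simp add: field_simps)
    finally have e: "log_sinc_int u - (u / of_nat N) * ((\<Sum>j=1..N. log_sinc (v j)) - log_sinc u / 2)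
       = (\<Sum>j<N. log_sinc_int (v (Suc j)) - log_sinc_int (v j) - (u / of_nat N) * (log_sinc (v j) + log_sinc (v (Suc j))) / 2)" ..
    have "cmod (log_sinc_int u - (u / of_nat N) * ((\<Sum>j=1..N. log_sinc (v j)) - log_sinc u / 2)) \<le> (\<Sum>j<N. B * (cmod u / real N) ^ 3)"
      unfolding e by (intro order_trans[OF norm_sum] sum_mono step)
    also have "\<dots> = B * cmod u ^ 3 / (real N)\<^sup>2"
      using N by (simp add: power_divide power2_eq_square power3_eq_cube)
    finally have b: "cmod (log_sinc_int u - (u / of_nat N) * ((\<Sum>j=1..N. log_sinc (v j)) - log_sinc u / 2)) \<le> B * cmod u ^ 3 / (real N)\<^sup>2" .
    have "(\<Sum>j=1..N. log_sinc (v j)) - (of_nat N * log_sinc_int u / u + log_sinc u / 2)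
       = - (of_nat N / u) * (log_sinc_int u - (u / of_nat N) * ((\<Sum>j=1..N. log_sinc (v j)) - log_sinc u / 2))"
      using N u by (simp add: field_simps)
    then have "cmod ((\<Sum>j=1..N. log_sinc (v j)) - (of_nat N * log_sinc_int u / u + log_sinc u / 2))
       = real N / cmod u * cmod (log_sinc_int u - (u / of_nat N) * ((\<Sum>j=1..N. log_sinc (v j)) - log_sinc u / 2))"
      by (simp only: norm_mult norm_minus_cancel norm_divide norm_of_nat)
    also have "\<dots> \<le> real N / cmod u * (B * cmod u ^ 3 / (real N)\<^sup>2)"
      by (intro mult_left_mono b) auto
    also have "\<dots> = B * (cmod u)\<^sup>2 / real N"
      using N u by (simp add: power2_eq_square power3_eq_cube)
    also have "\<dots> \<le> B * M\<^sup>2 / real N"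
      using B M(2)[OF u(1)] by (intro divide_right_mono mult_left_mono power_mono) auto
    finally show "cmod ((\<Sum>j=1..N. log_sinc (of_nat j * u / of_nat N)) - (of_nat N * log_sinc_int u / u + log_sinc u / 2)) \<le> B * M\<^sup>2 / real N"
      unfolding v_def .
  qed (use B M in auto)
qed

definition euler_prod :: "nat \<Rightarrow> complex \<Rightarrow> complex" where
  "euler_prod N u = (\<Prod>j=1..N. 1 / (1 - exp (2 * of_real pi * \<i> * (of_nat j * u / of_nat N))))"

lemma scaled_in_slit_plane:
  assumes "u \<in> slit_plane 1" "j \<le> N"
  shows "of_nat j * u / of_nat N \<in> slit_plane 1"
proof (cases "N = 0")
  case False
  have "of_real (real j / real N) * u \<in> slit_plane 1"
    using assms False by (intro slit_plane_scale) auto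
  then show ?thesis by (simp add: mult_ac)
qed (simp add: slit_plane_def)

text \<open>Splitting off the linear term of each factor leaves the product of N / (j d) with d = -
  2 pi i u; its factor N^N / N! is evaluated separately in \<open>stirling_ratio\<close>.\<close>

lemma euler_prod_eq:
  assumes u: "u \<in> slit_plane 1" "u \<noteq> 0" and N: "N \<ge> 1"
  shows "euler_prod N u = exp (\<Sum>j=1..N. log_sinc (of_nat j * u / of_nat N)) * of_nat N ^ N / (fact N * (- 2 * of_real pi * \<i> * u) ^ N)"
proof -
  have t: "1 / (1 - exp (2 * of_real pi * \<i> * (of_nat j * u / of_nat N)))
      = exp (log_sinc (of_nat j * u / of_nat N)) * (of_nat N / (of_nat j * (- 2 * of_real pi * \<i> * u)))"
    if j: "j \<in> {1..N}" for j
  proof -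
    let ?v = "of_nat j * u / of_nat N"
    have v: "?v \<in> slit_plane 1" "?v \<noteq> 0" using scaled_in_slit_plane[OF u(1), of j N] j u by auto
    have "1 - exp (2 * of_real pi * \<i> * ?v) \<noteq> 0" using exp_2pi_i_eq_1_slit[OF v(1)] v(2) by auto
    then have "1 / (1 - exp (2 * of_real pi * \<i> * ?v)) = 1 / sinc_factor ?v * (1 / (- 2 * of_real pi * \<i> * ?v))"
      using v(2) by (simp add: sinc_factor_def)
    also have "1 / (- 2 * of_real pi * \<i> * ?v) = of_nat N / (of_nat j * (- 2 * of_real pi * \<i> * u))"
      by (simp add: mult_ac)
    finally show ?thesis using exp_log_sinc[OF v(1)] by simp
  qed
  have "euler_prod N u = (\<Prod>j=1..N. exp (log_sinc (of_nat j * u / of_nat N)) * (of_nat N / (of_nat j * (- 2 * of_real pi * \<i> * u))))"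
    unfolding euler_prod_def by (intro prod.cong t) auto
  also have "\<dots> = exp (\<Sum>j=1..N. log_sinc (of_nat j * u / of_nat N)) * (\<Prod>j=1..N. of_nat N / (of_nat j * (- 2 * of_real pi * \<i> * u)))"
    by (simp only: prod.distrib exp_sum finite_atLeastAtMost)
  also have "(\<Prod>j=1..N. of_nat N / (of_nat j * d)) = of_nat N ^ N / (fact N * d ^ N)" for d :: complex
    by (simp add: prod_dividef prod.distrib fact_prod)
  finally show ?thesis by (simp only: times_divide_eq_right)
qed

lemma euler_prod_asymp_fact:
  assumes K: "compact K" "K \<subseteq> slit_plane 1 - {0}"
  shows "\<exists>C\<ge>0. \<forall>N\<ge>1. \<forall>u\<in>K. \<exists>\<rho>. cmod \<rho> \<le> C / real N \<and>
     euler_prod N u = (exp (log_sinc_int u / u) / (- 2 * of_real pi * \<i> * u)) ^ N * exp (log_sinc u / 2 + \<rho>) * of_real (real N ^ N / fact N)"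
proof -
  have "K \<subseteq> slit_plane 1" using K by auto
  from trapezoid_sum[OF K(1) this] obtain C where C: "C \<ge> 0" "\<And>N u. N \<ge> 1 \<Longrightarrow> u \<in> K \<Longrightarrow> u \<noteq> 0 \<Longrightarrow>
     cmod ((\<Sum>j=1..N. log_sinc (of_nat j * u / of_nat N)) - (of_nat N * log_sinc_int u / u + log_sinc u / 2)) \<le> C / real N"
    by blast
  show ?thesis
  proof (intro exI[of _ C] conjI allI impI ballI)
    fix N :: nat and u assume N: "N \<ge> 1" and u: "u \<in> K"
    have u': "u \<in> slit_plane 1" "u \<noteq> 0" using u K by auto
    let ?\<rho> = "(\<Sum>j=1..N. log_sinc (of_nat j * u / of_nat N)) - (of_nat N * log_sinc_int u / u + log_sinc u / 2)"
    have "exp (\<Sum>j=1..N. log_sinc (of_nat j * u / of_nat N)) = exp (of_nat N * (log_sinc_int u / u) + (log_sinc u / 2 + ?\<rho>))"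
      by simp
    also have "\<dots> = exp (log_sinc_int u / u) ^ N * exp (log_sinc u / 2 + ?\<rho>)"
      by (simp only: exp_add exp_of_nat_mult)
    finally have e: "exp (\<Sum>j=1..N. log_sinc (of_nat j * u / of_nat N)) = exp (log_sinc_int u / u) ^ N * exp (log_sinc u / 2 + ?\<rho>)" .
    have alg: "A ^ N * E * n / (f * d ^ N) = (A / d) ^ N * E * (n / f)" for A E n f d :: complex
      by (simp add: power_divide)
    have "euler_prod N u = (exp (log_sinc_int u / u) / (- 2 * of_real pi * \<i> * u)) ^ N * exp (log_sinc u / 2 + ?\<rho>) * of_real (real N ^ N / fact N)"
      unfolding euler_prod_eq[OF u' N] e alg by simp
    then show "\<exists>\<rho>. cmod \<rho> \<le> C / real N \<and>
       euler_prod N u = (exp (log_sinc_int u / u) / (- 2 * of_real pi * \<i> * u)) ^ N * exp (log_sinc u / 2 + \<rho>) * of_real (real N ^ N / fact N)"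
      using C(2)[OF N u u'(2)] by blast
  qed (use C in auto)
qed

section \<open>The exact value of the product at u = 1/2\<close>

lemma norm_one_minus_exp_cnj_symm:
  "cmod (1 - exp (2 * of_real pi * \<i> * of_real ((2 - t) / 2))) = cmod (1 - exp (2 * of_real pi * \<i> * of_real (t / 2)))"
proof -
  have "exp (2 * of_real pi * \<i> * of_real ((2 - t) / 2)) = exp (2 * of_real pi * \<i>) * exp (- (2 * of_real pi * \<i> * of_real (t / 2)))"
  proof -
    have "2 * of_real pi * \<i> * of_real ((2 - t) / 2) = 2 * of_real pi * \<i> + - (2 * of_real pi * \<i> * of_real (t / 2))"
      by (simp add: field_simps)
    then show ?thesis by (simp only: exp_add)
  qed
  also have "\<dots> = cnj (exp (2 * of_real pi * \<i> * of_real (t / 2)))"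
    by (simp add: exp_cnj)
  finally show ?thesis by (metis complex_cnj_diff complex_cnj_one complex_mod_cnj)
qed

text \<open>Divide \<open>q ^ M - 1\<close> by \<open>q - 1\<close> in two ways, as a geometric sum
  and as a product over the other roots, and let q tend to 1.\<close>

lemma prod_one_minus_roots_unity:
  assumes M: "M \<ge> 1"
  shows "(\<Prod>j=1..<M. 1 - exp (2 * of_real pi * \<i> * of_nat j / of_nat M)) = of_nat M"
proof -
  let ?w = "\<lambda>j. exp (2 * of_real pi * \<i> * of_nat j / of_nat M)"
  have inj: "inj_on ?w {..<M}"
    by (rule inj_onI) (use complex_root_unity_eq[of M] M in \<open>auto simp: cong_def\<close>)
  have R: "{r::complex. r ^ M = 1} = ?w ` {..<M}"
    using complex_roots_unity[OF M] by auto
  have P: "(\<Prod>j<M. q - ?w j) = q ^ M - 1" for q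
    using prod_roots_unity[OF M, of q] unfolding R by (simp add: prod.reindex[OF inj])
  have split: "(\<Prod>j<M. q - ?w j) = (q - 1) * (\<Prod>j=1..<M. q - ?w j)" for q
  proof -
    have "{..<M} = insert 0 {1..<M}" using M by auto
    then show ?thesis by simp
  qed
  have l1: "((\<lambda>q. \<Prod>j=1..<M. q - ?w j) \<longlongrightarrow> (\<Prod>j=1..<M. 1 - ?w j)) (at 1)"
    by (intro tendsto_intros)
  have l2: "((\<lambda>q. \<Sum>i<M. q ^ i) \<longlongrightarrow> (\<Sum>i<M. 1 ^ i)) (at (1::complex))"
    by (intro tendsto_intros)
  have ev: "\<forall>\<^sub>F q in at (1::complex). (\<Sum>i<M. q ^ i) = (\<Prod>j=1..<M. q - ?w j)"
    unfolding eventually_at_filter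
  proof (rule always_eventually, intro allI impI)
    fix q :: complex assume "q \<noteq> 1"
    moreover have "(q - 1) * (\<Prod>j=1..<M. q - ?w j) = (q - 1) * (\<Sum>i<M. q ^ i)"
      using P[of q] split[of q] power_diff_1_eq[of q M] by simp
    ultimately show "(\<Sum>i<M. q ^ i) = (\<Prod>j=1..<M. q - ?w j)" by simp
  qed
  have "(\<Prod>j=1..<M. 1 - ?w j) = (\<Sum>i<M. 1 ^ i)"
    by (rule tendsto_unique[OF _ l1 Lim_transform_eventually[OF l2 ev]]) simp
  then show ?thesis by simp
qed

text \<open>The factors come from the first half of the 2N-th roots of unity, and the product over
  all nontrivial ones is 2N. The factors for j and 2N - j have equal modulus and the middle one is
  2, so the first N - 1 multiply to sqrt N.\<close>

lemma norm_euler_prod_half: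
  assumes N: "N \<ge> 1"
  shows "cmod (euler_prod N (1/2)) = 1 / (2 * sqrt (real N))"
proof -
  define a where "a = (\<lambda>j. cmod (1 - exp (2 * of_real pi * \<i> * of_nat j / of_nat (2 * N))))"
  have "(\<Prod>j=1..<2*N. a j) = cmod (\<Prod>j=1..<2*N. 1 - exp (2 * of_real pi * \<i> * of_nat j / of_nat (2 * N)))"
    by (simp add: a_def prod_norm)
  also have "\<dots> = 2 * real N"
    using prod_one_minus_roots_unity[of "2 * N"] N by simp
  finally have 1: "(\<Prod>j=1..<2*N. a j) = 2 * real N" .
  have sym: "a (2 * N - j) = a j" if "j \<in> {1..<N}" for j
  proof -
    have e: "of_nat (2 * N - j) / of_nat (2 * N) = complex_of_real ((2 - real j / real N) / 2)"
      "of_nat j / of_nat (2 * N) = complex_of_real (real j / real N / 2)"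
      using that N by (simp_all add: of_nat_diff field_simps)
    show ?thesis unfolding a_def times_divide_eq_right[symmetric] e by (rule norm_one_minus_exp_cnj_symm)
  qed
  have aN: "a N = 2"
  proof -
    have "2 * of_real pi * \<i> * of_nat N / of_nat (2 * N) = of_real pi * \<i>" using N by simp
    then show ?thesis unfolding a_def by simp
  qed
  have "{1..<2*N} = {1..<N} \<union> ({N} \<union> {N<..<2*N})" using N by auto
  then have "(\<Prod>j=1..<2*N. a j) = (\<Prod>j=1..<N. a j) * (a N * (\<Prod>j\<in>{N<..<2*N}. a j))"
    by (simp only:) (subst prod.union_disjoint; auto)
  also have "(\<Prod>j\<in>{N<..<2*N}. a j) = (\<Prod>j=1..<N. a (2 * N - j))"
    by (rule prod.reindex_bij_witness[of _ "\<lambda>j. 2 * N - j" "\<lambda>j. 2 * N - j"]) auto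
  also have "\<dots> = (\<Prod>j=1..<N. a j)" by (intro prod.cong sym) auto
  finally have "(\<Prod>j=1..<N. a j)\<^sup>2 = real N" using 1 aN by (simp add: power2_eq_square)
  moreover have "(\<Prod>j=1..<N. a j) \<ge> 0" by (intro prod_nonneg) (simp add: a_def)
  ultimately have 2: "(\<Prod>j=1..<N. a j) = sqrt (real N)" by (metis real_sqrt_unique)
  have "{1..N} = insert N {1..<N}" using N by auto
  then have "(\<Prod>j=1..N. a j) = 2 * sqrt (real N)" using 2 aN by simp
  moreover have "cmod (euler_prod N (1/2)) = (\<Prod>j=1..N. 1 / a j)"
    unfolding euler_prod_def prod_norm[symmetric] a_def by (simp add: norm_divide mult_ac)
  ultimately show ?thesis by (simp add: prod_dividef)
qed

section \<open>The phase function and the asymptotics of the product in the closed upper half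
  plane\<close>

definition phase :: "complex \<Rightarrow> complex" where
  "phase u = (dilog (exp (2 * of_real pi * \<i> * u)) - of_real (pi ^ 2 / 6)) / (2 * of_real pi * \<i> * u)"

lemma cmod_exp_2pi_i: "cmod (exp (2 * of_real pi * \<i> * u)) = exp (- (2 * pi * Im u))"
  by simp

lemma continuous_on_phase: "continuous_on {u. Im u \<ge> 0 \<and> u \<noteq> 0} phase"
proof -
  have "continuous_on {u. Im u \<ge> 0 \<and> u \<noteq> 0} (\<lambda>u. dilog (exp (2 * of_real pi * \<i> * u)))"
    by (rule continuous_on_compose2[OF continuous_on_dilog_cball])
       (auto intro!: continuous_intros simp del: norm_exp_eq_Re simp: cmod_exp_2pi_i)
  then show ?thesis unfolding phase_def by (intro continuous_intros) auto
qed

lemma in_slit_plane_upper: "Im v > 0 \<Longrightarrow> v \<in> slit_plane c"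
  by (simp add: slit_plane_def)

lemma one_minus_exp_upper:
  assumes "Im v > 0"
  shows "1 - exp (2 * of_real pi * \<i> * v) \<notin> \<real>\<^sub>\<le>\<^sub>0" "exp (2 * of_real pi * \<i> * v) \<in> dilog_dom"
    "cmod (exp (2 * of_real pi * \<i> * v)) < 1"
proof -
  show c: "cmod (exp (2 * of_real pi * \<i> * v)) < 1"
    using assms unfolding cmod_exp_2pi_i by simp
  then have "Re (exp (2 * of_real pi * \<i> * v)) < 1" using complex_Re_le_cmod le_less_trans by blast
  then show "1 - exp (2 * of_real pi * \<i> * v) \<notin> \<real>\<^sub>\<le>\<^sub>0" by (auto simp: complex_nonpos_Reals_iff)
  show "exp (2 * of_real pi * \<i> * v) \<in> dilog_dom" using c ball_subset_dilog_dom by fastforce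
qed

lemma minus_2pi_i_upper:
  assumes "Im v > 0"
  shows "- 2 * of_real pi * \<i> * v \<notin> \<real>\<^sub>\<le>\<^sub>0"
  using assms by (auto simp: complex_nonpos_Reals_iff mult_le_0_iff not_le)

lemma convex_upper: "convex {v. Im v > 0}" and open_upper: "open {v. Im v > 0}" and connected_upper: "connected {v. Im v > 0}"
proof -
  show c: "convex {v. Im v > 0}" using convex_halfspace_Im_gt[of 0] by simp
  show "open {v. Im v > 0}" using open_halfspace_Im_gt[of 0] by simp
  show "connected {v. Im v > 0}" using c by (rule convex_connected)
qed

lemma filterlim_i_times: "filterlim (\<lambda>y::real. \<i> * of_real y) (nhds 0) (at_right 0)"
proof -
  have "((\<lambda>y::real. \<i> * of_real y) \<longlongrightarrow> \<i> * of_real 0) (at_right 0)" by (intro tendsto_intros)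
  then show ?thesis by simp
qed

lemma eventually_pos_at_right: "\<forall>\<^sub>F y::real in at_right 0. 0 < y"
  by (simp add: eventually_at_filter)

text \<open>The exponential of the difference is identically 1, so the difference is constant on the
  upper half plane. Along i y with y decreasing to 0 both principal logarithms are real, and the
  constant is seen to be 0.\<close>

lemma log_sinc_upper:
  assumes v: "Im v > 0"
  shows "log_sinc v = Ln (- 2 * of_real pi * \<i> * v) - Ln (1 - exp (2 * of_real pi * \<i> * v))"
proof -
  define D where "D = (\<lambda>v. log_sinc v - Ln (- 2 * of_real pi * \<i> * v) + Ln (1 - exp (2 * of_real pi * \<i> * v)))"
  have hD: "D holomorphic_on {v. Im v > 0}"
  proof -
    have "log_sinc holomorphic_on {v. Im v > 0}"
      by (rule holomorphic_on_subset[OF holomorphic_log_sinc]) (auto simp: slit_plane_def)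
    then show ?thesis unfolding D_def
      using one_minus_exp_upper(1) minus_2pi_i_upper by (intro holomorphic_intros) auto
  qed
  have eD: "exp (D x) = 1" if "Im x > 0" for x
  proof -
    have "x \<noteq> 0" using that by auto
    then have n: "- 2 * of_real pi * \<i> * x \<noteq> 0" "1 - exp (2 * of_real pi * \<i> * x) \<noteq> 0"
      using one_minus_exp_upper(1)[OF that] by auto
    have "exp (D x) = exp (log_sinc x) / (- 2 * of_real pi * \<i> * x) * (1 - exp (2 * of_real pi * \<i> * x))"
      unfolding D_def by (simp only: exp_add exp_diff exp_Ln[OF n(1)] exp_Ln[OF n(2)])
    also have "\<dots> = 1"
      using exp_log_sinc[OF in_slit_plane_upper[OF that]] n \<open>x \<noteq> 0\<close> by (simp add: sinc_factor_def)
    finally show ?thesis .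
  qed
  have "(D has_field_derivative 0) (at x)" if x: "x \<in> {v. Im v > 0}" for x
  proof -
    have d: "(D has_field_derivative deriv D x) (at x)" by (rule holomorphic_derivI[OF hD open_upper x])
    have "((\<lambda>x. exp (D x)) has_field_derivative exp (D x) * deriv D x) (at x)"
      by (rule DERIV_chain2[OF DERIV_exp d])
    moreover have "((\<lambda>x. exp (D x)) has_field_derivative 0) (at x)"
      by (rule has_field_derivative_transform_within_open[OF DERIV_const[of 1] open_upper x]) (use eD in auto)
    ultimately have "exp (D x) * deriv D x = 0" by (rule DERIV_unique)
    then show ?thesis using d by simp
  qed
  from has_field_derivative_0_imp_constant_on[OF this connected_upper open_upper]
  obtain c where c: "\<And>x. Im x > 0 \<Longrightarrow> D x = c" unfolding constant_on_def by auto
  have "isCont log_sinc 0"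
    using DERIV_isCont holomorphic_derivI[OF holomorphic_log_sinc open_slit_plane, of 0] by (auto simp: slit_plane_def)
  then have "((\<lambda>y::real. log_sinc (\<i> * of_real y)) \<longlongrightarrow> log_sinc 0) (at_right 0)"
    using filterlim_i_times by (rule isCont_tendsto_compose)
  moreover have "((\<lambda>y::real. complex_of_real (ln (1 - exp (- (2 * pi * y))) - ln (2 * pi * y))) \<longlongrightarrow> of_real 0) (at_right 0)"
    by (intro tendsto_of_real) real_asymp
  ultimately have "((\<lambda>y::real. log_sinc (\<i> * of_real y) + complex_of_real (ln (1 - exp (- (2 * pi * y))) - ln (2 * pi * y))) \<longlongrightarrow> log_sinc 0 + of_real 0) (at_right 0)"
    by (rule tendsto_add)
  moreover have "\<forall>\<^sub>F y::real in at_right 0. log_sinc (\<i> * of_real y) + complex_of_real (ln (1 - exp (- (2 * pi * y))) - ln (2 * pi * y)) = c"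
    using eventually_pos_at_right
  proof eventually_elim
    case (elim y)
    have "- 2 * of_real pi * \<i> * (\<i> * of_real y) = complex_of_real (2 * pi * y)" by simp
    moreover have "2 * of_real pi * \<i> * (\<i> * of_real y) = complex_of_real (- (2 * pi * y))" by simp
    moreover have "1 - exp (complex_of_real (- (2 * pi * y))) = complex_of_real (1 - exp (- (2 * pi * y)))"
      by (simp only: exp_of_real of_real_diff of_real_1)
    moreover have "Ln (complex_of_real (2 * pi * y)) = of_real (ln (2 * pi * y))"
      "Ln (complex_of_real (1 - exp (- (2 * pi * y)))) = of_real (ln (1 - exp (- (2 * pi * y))))"
      using elim by (intro Ln_of_real; simp)+
    ultimately have "D (\<i> * of_real y) = log_sinc (\<i> * of_real y) - of_real (ln (2 * pi * y)) + of_real (ln (1 - exp (- (2 * pi * y))))"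
      unfolding D_def by (simp only:)
    moreover have "D (\<i> * of_real y) = c" using elim by (intro c) simp
    ultimately show ?case by simp
  qed
  ultimately have "((\<lambda>y::real. c) \<longlongrightarrow> log_sinc 0 + of_real 0) (at_right 0)" by (rule Lim_transform_eventually)
  then have "c = 0" using log_sinc_0 by (simp add: tendsto_const_iff)
  then show ?thesis using c[OF v] unfolding D_def by (simp add: algebra_simps)
qed

text \<open>The same scheme one integration higher. The derivative of the difference vanishes, y ln
  y tends to 0, and the constant comes from \<open>dilog 1\<close>; this is how pi^2 / 6 enters
  \<open>phase\<close>.\<close>

lemma log_sinc_int_upper:
  assumes v: "Im v > 0"
  shows "log_sinc_int v / v = phase v + Ln (- 2 * of_real pi * \<i> * v) - 1"
proof -
  define D where "D = (\<lambda>v. log_sinc_int v - dilog (exp (2 * of_real pi * \<i> * v)) / (2 * of_real pi * \<i>) - v * Ln (- 2 * of_real pi * \<i> * v) + v)"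
  have "(D has_field_derivative 0) (at x)" if "x \<in> {v. Im v > 0}" for x
  proof -
    have x: "Im x > 0" using that by simp
    then have x0: "x \<noteq> 0" by auto
    note d = has_field_derivative_log_sinc_int[OF in_slit_plane_upper[OF x]]
    have e: "((\<lambda>v. exp (2 * of_real pi * \<i> * v)) has_field_derivative 2 * of_real pi * \<i> * exp (2 * of_real pi * \<i> * x)) (at x)"
      by (auto intro!: derivative_eq_intros)
    have "((\<lambda>v. dilog (exp (2 * of_real pi * \<i> * v))) has_field_derivative
       (- Ln (1 - exp (2 * of_real pi * \<i> * x)) / exp (2 * of_real pi * \<i> * x)) * (2 * of_real pi * \<i> * exp (2 * of_real pi * \<i> * x))) (at x)"
      by (rule DERIV_chain2[where f = dilog, OF has_field_derivative_dilog[OF one_minus_exp_upper(2)[OF x] exp_not_eq_zero] e])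
    then have d2: "((\<lambda>v. dilog (exp (2 * of_real pi * \<i> * v)) / (2 * of_real pi * \<i>)) has_field_derivative
       (- Ln (1 - exp (2 * of_real pi * \<i> * x)) / exp (2 * of_real pi * \<i> * x)) * (2 * of_real pi * \<i> * exp (2 * of_real pi * \<i> * x)) / (2 * of_real pi * \<i>)) (at x)"
      by (rule DERIV_cdivide)
    have d3: "((\<lambda>v. v * Ln (- 2 * of_real pi * \<i> * v)) has_field_derivative Ln (- 2 * of_real pi * \<i> * x) + 1) (at x)"
      using minus_2pi_i_upper[OF x] x0 by (auto intro!: derivative_eq_intros simp: field_simps)
    have "(D has_field_derivative (log_sinc x - (- Ln (1 - exp (2 * of_real pi * \<i> * x)) / exp (2 * of_real pi * \<i> * x)) * (2 * of_real pi * \<i> * exp (2 * of_real pi * \<i> * x)) / (2 * of_real pi * \<i>)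
       - (Ln (- 2 * of_real pi * \<i> * x) + 1) + 1)) (at x)"
      unfolding D_def by (intro DERIV_add DERIV_diff d d2 d3 DERIV_ident)
    then show ?thesis unfolding log_sinc_upper[OF x] by simp
  qed
  from has_field_derivative_0_imp_constant_on[OF this connected_upper open_upper]
  obtain c where c: "\<And>x. Im x > 0 \<Longrightarrow> D x = c" unfolding constant_on_def by auto
  have "isCont log_sinc_int 0"
    by (rule DERIV_isCont[OF has_field_derivative_log_sinc_int]) (simp add: slit_plane_def)
  then have l1: "((\<lambda>y::real. log_sinc_int (\<i> * of_real y)) \<longlongrightarrow> log_sinc_int 0) (at_right 0)"
    using filterlim_i_times by (rule isCont_tendsto_compose)
  have l2: "((\<lambda>y::real. dilog (exp (2 * of_real pi * \<i> * (\<i> * of_real y)))) \<longlongrightarrow> dilog 1) (at_right 0)"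
  proof (rule continuous_on_tendsto_compose[OF continuous_on_dilog_cball])
    have "((\<lambda>y::real. exp (2 * of_real pi * \<i> * (\<i> * of_real y))) \<longlongrightarrow> exp (2 * of_real pi * \<i> * 0)) (at_right 0)"
      by (intro tendsto_intros filterlim_i_times)
    then show "((\<lambda>y::real. exp (2 * of_real pi * \<i> * (\<i> * of_real y))) \<longlongrightarrow> 1) (at_right 0)" by simp
    show "\<forall>\<^sub>F y::real in at_right 0. exp (2 * of_real pi * \<i> * (\<i> * of_real y)) \<in> cball 0 1"
      using eventually_pos_at_right by eventually_elim simp
  qed simp
  have l3: "((\<lambda>y::real. \<i> * complex_of_real (y * ln (2 * pi * y))) \<longlongrightarrow> \<i> * of_real 0) (at_right 0)"
    by (intro tendsto_mult tendsto_const tendsto_of_real) real_asymp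
  have "((\<lambda>y::real. log_sinc_int (\<i> * of_real y) - dilog (exp (2 * of_real pi * \<i> * (\<i> * of_real y))) / (2 * of_real pi * \<i>)
     - \<i> * complex_of_real (y * ln (2 * pi * y)) + \<i> * of_real y) \<longlongrightarrow> log_sinc_int 0 - dilog 1 / (2 * of_real pi * \<i>) - \<i> * of_real 0 + 0) (at_right 0)"
    by (intro tendsto_add tendsto_diff tendsto_divide tendsto_const l1 l2 l3 filterlim_i_times) auto
  moreover have "\<forall>\<^sub>F y::real in at_right 0. log_sinc_int (\<i> * of_real y) - dilog (exp (2 * of_real pi * \<i> * (\<i> * of_real y))) / (2 * of_real pi * \<i>)
     - \<i> * complex_of_real (y * ln (2 * pi * y)) + \<i> * of_real y = c"
    using eventually_pos_at_right
  proof eventually_elim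
    case (elim y)
    have "- 2 * of_real pi * \<i> * (\<i> * of_real y) = complex_of_real (2 * pi * y)" by simp
    moreover have "Ln (complex_of_real (2 * pi * y)) = of_real (ln (2 * pi * y))"
      using elim by (intro Ln_of_real) simp
    ultimately have L: "Ln (- 2 * of_real pi * \<i> * (\<i> * of_real y)) = of_real (ln (2 * pi * y))" by (simp only:)
    have "D (\<i> * of_real y) = c" using elim by (intro c) simp
    then show ?case unfolding D_def L by (simp add: mult.assoc)
  qed
  ultimately have "((\<lambda>y::real. c) \<longlongrightarrow> log_sinc_int 0 - dilog 1 / (2 * of_real pi * \<i>) - \<i> * of_real 0 + 0) (at_right 0)"
    by (rule Lim_transform_eventually)
  then have "c = - of_real (pi ^ 2 / 6) / (2 * of_real pi * \<i>)"
    by (simp add: tendsto_const_iff log_sinc_int_0 dilog_1)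
  then have "D v = - of_real (pi ^ 2 / 6) / (2 * of_real pi * \<i>)" using c[OF v] by simp
  then have *: "log_sinc_int v = (dilog (exp (2 * of_real pi * \<i> * v)) - of_real (pi ^ 2 / 6)) / (2 * of_real pi * \<i>) + v * Ln (- 2 * of_real pi * \<i> * v) - v"
  proof -
    have "l = (d - P) / c + m - x" if "l - d / c - m + x = - P / c" for l d P c m x :: complex
    proof -
      have "l = (l - d / c - m + x) + d / c + m - x" by simp
      then show ?thesis unfolding that by (simp add: diff_divide_distrib)
    qed
    from this[OF \<open>D v = _\<close>[unfolded D_def]] show ?thesis .
  qed
  have "v \<noteq> 0" using v by auto
  then show ?thesis unfolding * phase_def by (simp add: add_divide_distrib diff_divide_distrib)
qed

text \<open>For Im u > 0 this is the preceding formula exponentiated. Both sides are continuous up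
  to the nonzero real points of the slit plane, one of which is the start of the contour, so the
  equality persists there.\<close>

lemma exp_phase:
  assumes u: "Im u \<ge> 0" "u \<in> slit_plane 1" "u \<noteq> 0"
  shows "exp (log_sinc_int u / u) / (- 2 * of_real pi * \<i> * u) = exp (phase u - 1)"
proof -
  have upper: "exp (log_sinc_int v / v) / (- 2 * of_real pi * \<i> * v) = exp (phase v - 1)" if v: "Im v > 0" for v
  proof -
    have n: "- 2 * of_real pi * \<i> * v \<noteq> 0" using v by auto
    have "exp (log_sinc_int v / v) = exp (phase v - 1) * exp (Ln (- 2 * of_real pi * \<i> * v))"
      unfolding log_sinc_int_upper[OF v] exp_add[symmetric] by (simp add: algebra_simps)
    then show ?thesis using n unfolding exp_Ln[OF n] by simp
  qed
  show ?thesis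
  proof (cases "Im u > 0")
    case False
    have f: "((\<lambda>y::real. u + \<i> * of_real y) \<longlongrightarrow> u) (at_right 0)"
      using tendsto_add[OF tendsto_const filterlim_i_times, of u] by simp
    have "isCont log_sinc_int u" by (rule DERIV_isCont[OF has_field_derivative_log_sinc_int[OF u(2)]])
    then have "((\<lambda>y::real. log_sinc_int (u + \<i> * of_real y)) \<longlongrightarrow> log_sinc_int u) (at_right 0)"
      using f by (rule isCont_tendsto_compose)
    then have l1: "((\<lambda>y::real. exp (log_sinc_int (u + \<i> * of_real y) / (u + \<i> * of_real y)) / (- 2 * of_real pi * \<i> * (u + \<i> * of_real y)))
        \<longlongrightarrow> exp (log_sinc_int u / u) / (- 2 * of_real pi * \<i> * u)) (at_right 0)"
      using u(3) by (intro tendsto_intros f) auto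
    have "((\<lambda>y::real. phase (u + \<i> * of_real y)) \<longlongrightarrow> phase u) (at_right 0)"
    proof (rule continuous_on_tendsto_compose[OF continuous_on_phase f])
      show "\<forall>\<^sub>F y::real in at_right 0. u + \<i> * of_real y \<in> {u. Im u \<ge> 0 \<and> u \<noteq> 0}"
        using eventually_pos_at_right by eventually_elim (use u in \<open>auto simp: complex_eq_iff\<close>)
    qed (use u in auto)
    then have l2: "((\<lambda>y::real. exp (phase (u + \<i> * of_real y) - 1)) \<longlongrightarrow> exp (phase u - 1)) (at_right 0)"
      by (intro tendsto_intros)
    have ev: "\<forall>\<^sub>F y::real in at_right 0. exp (log_sinc_int (u + \<i> * of_real y) / (u + \<i> * of_real y)) / (- 2 * of_real pi * \<i> * (u + \<i> * of_real y))
        = exp (phase (u + \<i> * of_real y) - 1)"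
      using eventually_pos_at_right by eventually_elim (rule upper, use u in simp)
    show ?thesis
      by (rule tendsto_unique[OF _ Lim_transform_eventually[OF l1 ev] l2]) simp
  qed (rule upper)
qed

text \<open>At \<open>u = 1/2\<close> the product is known exactly, so its general asymptotics contains Stirling's formula.\<close>

lemma stirling_ratio:
  "\<exists>C\<ge>0. \<forall>N\<ge>1. \<exists>r. \<bar>r\<bar> \<le> C / real N \<and> real N ^ N / fact N = exp (real N) / sqrt (2 * pi * real N) * exp r"
proof -
  have half: "1/2 \<in> slit_plane 1" "(1/2::complex) \<noteq> 0" by (auto simp: slit_plane_def)
  have "{1/2} \<subseteq> slit_plane 1 - {0}" using half by auto
  from euler_prod_asymp_fact[OF compact_sing this] obtain C where C: "C \<ge> 0" "\<And>N. N \<ge> 1 \<Longrightarrow> \<exists>\<rho>. cmod \<rho> \<le> C / real N \<and>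
     euler_prod N (1/2) = (exp (log_sinc_int (1/2) / (1/2)) / (- 2 * of_real pi * \<i> * (1/2))) ^ N * exp (log_sinc (1/2) / 2 + \<rho>) * of_real (real N ^ N / fact N)"
    by auto
  \<comment> \<open>\<open>dilog (-1)\<close> is real and the denominator is pi i, so
    \<open>phase (1/2)\<close> is purely imaginary and drops out of the modulus.\<close>
  have ph: "Re (phase (1/2)) = 0"
  proof -
    have e: "exp (2 * of_real pi * \<i> * (1/2)) = complex_of_real (-1)" by simp
    have "Im (dilog (complex_of_real (-1))) = 0" by (rule Im_dilog_of_real) simp
    then show ?thesis unfolding phase_def e by (simp add: Re_divide)
  qed
  have A: "cmod (exp (log_sinc_int (1/2) / (1/2)) / (- 2 * of_real pi * \<i> * (1/2))) = exp (-1)"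
    using exp_phase[of "1/2"] half ph by (simp del: of_real_minus)
  have B: "cmod (exp (log_sinc (1/2) / 2)) = sqrt (pi / 2)"
  proof -
    have "exp (log_sinc (1/2) / 2) ^ 2 = exp (log_sinc (1/2))" by (simp add: exp_double[symmetric])
    then have "cmod (exp (log_sinc (1/2) / 2)) ^ 2 = cmod (exp (log_sinc (1/2)))" by (metis norm_power)
    also have "\<dots> = pi / 2"
      unfolding exp_log_sinc[OF half(1)] by (simp add: sinc_factor_def norm_divide norm_mult)
    finally show ?thesis by (metis norm_ge_zero real_sqrt_unique)
  qed
  show ?thesis
  proof (rule exI[of _ C], rule conjI[OF C(1)], intro allI impI)
    fix N :: nat assume N: "N \<ge> 1"
    obtain \<rho> where \<rho>: "cmod \<rho> \<le> C / real N" "euler_prod N (1/2) = (exp (log_sinc_int (1/2) / (1/2)) / (- 2 * of_real pi * \<i> * (1/2))) ^ N * exp (log_sinc (1/2) / 2 + \<rho>) * of_real (real N ^ N / fact N)"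
      using C(2)[OF N] by blast
    have "cmod (euler_prod N (1/2)) = exp (-1) ^ N * (sqrt (pi / 2) * exp (Re \<rho>)) * (real N ^ N / fact N)"
      unfolding \<rho>(2) norm_mult norm_power A exp_add B norm_exp_eq_Re[of \<rho>] norm_of_real by simp
    then have "1 / (2 * sqrt (real N)) = exp (- real N) * sqrt (pi / 2) * exp (Re \<rho>) * (real N ^ N / fact N)"
      unfolding norm_euler_prod_half[OF N] by (simp add: exp_of_nat_mult[symmetric])
    moreover have "X = c / s * ep * en" if "c = em * s * er * X" "em * ep = 1" "er * en = 1" "s \<noteq> 0" for c em s er X ep en :: real
    proof -
      have "c / s * ep * en = (em * ep) * (er * en) * X" using that(1,4) by simp
      then show ?thesis using that by simp
    qed
    moreover have "exp (- real N) * exp (real N) = 1" "exp (Re \<rho>) * exp (- Re \<rho>) = 1" "sqrt (pi / 2) \<noteq> 0"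
      by (simp_all add: exp_add[symmetric])
    ultimately have "real N ^ N / fact N = (1 / (2 * sqrt (real N))) / sqrt (pi / 2) * exp (real N) * exp (- Re \<rho>)"
      by metis
    also have "(1 / (2 * sqrt (real N))) / sqrt (pi / 2) = 1 / sqrt (2 * pi * real N)"
    proof -
      have "2 * sqrt (real N) * sqrt (pi / 2) = sqrt (4 * real N * (pi / 2))"
        by (simp only: real_sqrt_mult) simp
      also have "4 * real N * (pi / 2) = 2 * pi * real N" by simp
      finally show ?thesis by simp
    qed
    finally have "real N ^ N / fact N = exp (real N) / sqrt (2 * pi * real N) * exp (- Re \<rho>)" by simp
    moreover have "\<bar>- Re \<rho>\<bar> \<le> C / real N" using \<rho>(1) abs_Re_le_cmod[of \<rho>] by simp
    ultimately show "\<exists>r. \<bar>r\<bar> \<le> C / real N \<and> real N ^ N / fact N = exp (real N) / sqrt (2 * pi * real N) * exp r" by blast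
  qed
qed

text \<open>\<open>exp_phase\<close> leaves a factor exp (- N), which cancels against the factor exp
  N in N^N / N!.\<close>

lemma euler_prod_asymp:
  assumes K: "compact K" "K \<subseteq> {u. Im u \<ge> 0} \<inter> slit_plane 1 - {0}"
  shows "\<exists>C\<ge>0. \<forall>N\<ge>1. \<forall>u\<in>K. \<exists>\<rho>. cmod \<rho> \<le> C / real N \<and>
     euler_prod N u = exp (of_nat N * phase u) * exp (log_sinc u / 2) * exp \<rho> / of_real (sqrt (2 * pi * real N))"
proof -
  have "K \<subseteq> slit_plane 1 - {0}" using K by auto
  from euler_prod_asymp_fact[OF K(1) this] obtain C1 where C1: "C1 \<ge> 0" "\<And>N u. N \<ge> 1 \<Longrightarrow> u \<in> K \<Longrightarrow> \<exists>\<rho>. cmod \<rho> \<le> C1 / real N \<and>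
     euler_prod N u = (exp (log_sinc_int u / u) / (- 2 * of_real pi * \<i> * u)) ^ N * exp (log_sinc u / 2 + \<rho>) * of_real (real N ^ N / fact N)"
    by blast
  from stirling_ratio obtain C2 where C2: "C2 \<ge> 0" "\<And>N. N \<ge> 1 \<Longrightarrow> \<exists>r. \<bar>r\<bar> \<le> C2 / real N \<and> real N ^ N / fact N = exp (real N) / sqrt (2 * pi * real N) * exp r"
    by blast
  show ?thesis
  proof (intro exI[of _ "C1 + C2"] conjI allI impI ballI)
    fix N :: nat and u assume N: "N \<ge> 1" and u: "u \<in> K"
    obtain \<rho> where \<rho>: "cmod \<rho> \<le> C1 / real N" 
      "euler_prod N u = (exp (log_sinc_int u / u) / (- 2 * of_real pi * \<i> * u)) ^ N * exp (log_sinc u / 2 + \<rho>) * of_real (real N ^ N / fact N)"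
      using C1(2)[OF N u] by blast
    obtain r where r: "\<bar>r\<bar> \<le> C2 / real N" "real N ^ N / fact N = exp (real N) / sqrt (2 * pi * real N) * exp r"
      using C2(2)[OF N] by blast
    have ph: "exp (log_sinc_int u / u) / (- 2 * of_real pi * \<i> * u) = exp (phase u - 1)"
      using u K by (intro exp_phase) auto
    have "exp (phase u - 1) ^ N = exp (of_nat N * phase u) * exp (- of_nat N)"
      by (simp add: exp_of_nat_mult[symmetric] exp_add[symmetric] algebra_simps)
    then have "euler_prod N u = exp (of_nat N * phase u) * exp (- of_nat N) * (exp (log_sinc u / 2) * exp \<rho>) *
        (exp (of_nat N) / of_real (sqrt (2 * pi * real N)) * exp (of_real r))"
      unfolding \<rho>(2) ph r(2) by (simp add: exp_add exp_of_real[symmetric])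
    also have "\<dots> = exp (of_nat N * phase u) * exp (log_sinc u / 2) * exp (\<rho> + of_real r) / of_real (sqrt (2 * pi * real N))"
      by (simp add: exp_add exp_minus)
    finally have "euler_prod N u = exp (of_nat N * phase u) * exp (log_sinc u / 2) * exp (\<rho> + of_real r) / of_real (sqrt (2 * pi * real N))" .
    moreover have "cmod (\<rho> + of_real r) \<le> (C1 + C2) / real N"
      using norm_triangle_ineq[of \<rho> "of_real r"] \<rho>(1) r(1) by (simp add: add_divide_distrib)
    ultimately show "\<exists>\<rho>. cmod \<rho> \<le> (C1 + C2) / real N \<and>
     euler_prod N u = exp (of_nat N * phase u) * exp (log_sinc u / 2) * exp \<rho> / of_real (sqrt (2 * pi * real N))" by blast
  qed (use C1 C2 in simp)
qed

lemma euler_prod_cnj: "euler_prod N (- cnj u) = cnj (euler_prod N u)"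
  unfolding euler_prod_def by (simp add: exp_cnj)

text \<open>Each factor satisfies 1 - 1/x = - (1 - x) / x with x = exp (2 pi i j u / N), and the
  exponents j add up to N (N + 1) / 2.\<close>

lemma cmod_euler_prod_minus:
  assumes N: "N \<ge> 1"
  shows "cmod (euler_prod N (- u)) = exp (- (pi * Im u * (real N + 1))) * cmod (euler_prod N u)"
proof -
  have t: "cmod (1 / (1 - exp (2 * of_real pi * \<i> * (of_nat j * (- u) / of_nat N))))
     = exp (- (2 * pi * Im u / real N) * real j) * cmod (1 / (1 - exp (2 * of_real pi * \<i> * (of_nat j * u / of_nat N))))" for j
  proof -
    let ?X = "2 * of_real pi * \<i> * (of_nat j * u / of_nat N)"
    have "1 - exp (- ?X) = - exp (- ?X) * (1 - exp ?X)" by (simp add: algebra_simps exp_minus)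
    then have "cmod (1 - exp (- ?X)) = cmod (exp (- ?X)) * cmod (1 - exp ?X)" by (simp only: norm_mult norm_minus_cancel)
    also have "cmod (exp (- ?X)) = exp ((2 * pi * Im u / real N) * real j)"
      by (simp add: mult_ac)
    finally have "cmod (1 - exp (- ?X)) = exp ((2 * pi * Im u / real N) * real j) * cmod (1 - exp ?X)" .
    moreover have "2 * of_real pi * \<i> * (of_nat j * (- u) / of_nat N) = - ?X" by simp
    moreover have "1 / (exp A * m) = exp (- A) * (1 / m)" for A m :: real
      by (simp add: exp_minus inverse_eq_divide)
    ultimately show ?thesis by (simp only: norm_divide norm_one mult_minus_left)
  qed
  have "cmod (euler_prod N (- u)) = (\<Prod>j=1..N. exp (- (2 * pi * Im u / real N) * real j)) * cmod (euler_prod N u)"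
    unfolding euler_prod_def prod_norm[symmetric] t by (simp only: prod.distrib)
  also have "(\<Prod>j=1..N. exp (- (2 * pi * Im u / real N) * real j)) = exp (- (2 * pi * Im u / real N) * (\<Sum>j=1..N. real j))"
    by (simp only: exp_sum[symmetric] finite_atLeastAtMost sum_distrib_left)
  also have "(\<Sum>j=1..N. real j) = real N * (real N + 1) / 2"
    by (induction N) (auto simp: field_simps)
  also have "- (2 * pi * Im u / real N) * (real N * (real N + 1) / 2) = - (pi * Im u * (real N + 1))"
    using N by simp
  finally show ?thesis .
qed

section \<open>Laplace's method\<close>

lemma gaussian_moment_integrals:
  assumes N: "N > (0::real)"
  shows "((\<lambda>t. exp (- (N * t\<^sup>2))) has_integral sqrt (pi / N)) UNIV"
    and "((\<lambda>t. t\<^sup>2 * exp (- (N * t\<^sup>2))) has_integral sqrt (pi / N) / (2 * N)) UNIV"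
proof -
  \<comment> \<open>Variance 1 / (2 N) makes exp (- N t^2) a multiple of a normal density, whose
    even moments are known.\<close>
  define \<sigma> where "\<sigma> = 1 / sqrt (2 * N)"
  have \<sigma>: "\<sigma> > 0" "\<sigma>\<^sup>2 = 1 / (2 * N)" using N by (auto simp: \<sigma>_def power_divide)
  have nd: "normal_density 0 \<sigma> t = exp (- (N * t\<^sup>2)) / sqrt (pi / N)" for t
    using N unfolding normal_density_def \<sigma>(2) by simp
  have *: "((\<lambda>t. exp (- (N * t\<^sup>2)) / sqrt (pi / N) * t ^ (2 * k)) has_integral (fact (2 * k) / ((4 * N) ^ k * fact k))) UNIV" for k
  proof -
    have "has_bochner_integral lborel (\<lambda>t. normal_density 0 \<sigma> t * (t - 0) ^ (2 * k)) (fact (2 * k) / ((2 / \<sigma>\<^sup>2) ^ k * fact k))"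
      using \<sigma>(1) by (rule normal_moment_even)
    then have "has_bochner_integral lborel (\<lambda>t. exp (- (N * t\<^sup>2)) / sqrt (pi / N) * t ^ (2 * k)) (fact (2 * k) / ((4 * N) ^ k * fact k))"
      unfolding nd \<sigma>(2) by simp
    then have i: "integrable lborel (\<lambda>t. exp (- (N * t\<^sup>2)) / sqrt (pi / N) * t ^ (2 * k))"
      and v: "integral\<^sup>L lborel (\<lambda>t. exp (- (N * t\<^sup>2)) / sqrt (pi / N) * t ^ (2 * k)) = fact (2 * k) / ((4 * N) ^ k * fact k)"
      unfolding has_bochner_integral_iff by auto
    show ?thesis using has_integral_integral_lborel[OF i] unfolding v .
  qed
  have s: "sqrt (pi / N) > 0" using N by simp
  from has_integral_mult_left[OF *[of 0], of "sqrt (pi / N)"] s N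
  show "((\<lambda>t. exp (- (N * t\<^sup>2))) has_integral sqrt (pi / N)) UNIV" by simp
  from has_integral_mult_left[OF *[of 1], of "sqrt (pi / N)"] s N
  show "((\<lambda>t. t\<^sup>2 * exp (- (N * t\<^sup>2))) has_integral sqrt (pi / N) / (2 * N)) UNIV"
    by (simp add: mult_ac fact_2)
qed

text \<open>Outside the interval t^2 / d^2 \<ge> 1, so the missing tail is at most the second moment
  over d^2. The first moment need not vanish, since the interval may be asymmetric, but it has an
  explicit antiderivative.\<close>

lemma gaussian_integral_interval:
  assumes N: "N \<ge> (1::real)" and d: "d > 0" "d \<le> m" "d \<le> p"
  shows "\<bar>integral {-m..p} (\<lambda>t. exp (- (N * t\<^sup>2))) - sqrt (pi / N)\<bar> \<le> sqrt pi / (2 * d\<^sup>2) / (N * sqrt N)"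
    and "integral {-m..p} (\<lambda>t. t\<^sup>2 * exp (- (N * t\<^sup>2))) \<le> sqrt pi / 2 / (N * sqrt N)"
    and "\<bar>integral {-m..p} (\<lambda>t. t * exp (- (N * t\<^sup>2)))\<bar> \<le> 1 / (2 * d\<^sup>2) / (N * sqrt N)"
proof -
  let ?e = "\<lambda>t. exp (- (N * t\<^sup>2))"
  have N0: "N > 0" using N by simp
  note g = gaussian_moment_integrals[OF N0]
  have sN: "sqrt (pi / N) / (2 * N) = sqrt pi / 2 / (N * sqrt N)"
    using N by (simp add: real_sqrt_divide field_simps)
  have ion: "?e integrable_on {-m..p}" "(\<lambda>t. t\<^sup>2 * ?e t) integrable_on {-m..p}" "(\<lambda>t. t * ?e t) integrable_on {-m..p}"
    by (auto intro!: integrable_continuous_real continuous_intros)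
  have le: "integral {-m..p} ?e \<le> integral UNIV ?e"
    using g(1) ion(1) by (intro integral_subset_le) auto
  have "integral UNIV ?e \<le> integral UNIV (\<lambda>t. (if t \<in> {-m..p} then ?e t else 0) + 1 / d\<^sup>2 * (t\<^sup>2 * ?e t))"
  proof (rule integral_le)
    have "(\<lambda>t. if t \<in> {-m..p} then ?e t else 0) integrable_on UNIV"
      using ion(1) by (simp only: integrable_restrict_UNIV)
    moreover have "(\<lambda>t. 1 / d\<^sup>2 * (t\<^sup>2 * ?e t)) integrable_on UNIV"
      by (rule has_integral_integrable[OF has_integral_mult_right[OF g(2)]])
    ultimately show "(\<lambda>t. (if t \<in> {-m..p} then ?e t else 0) + 1 / d\<^sup>2 * (t\<^sup>2 * ?e t)) integrable_on UNIV"
      by (rule integrable_add)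
    fix t :: real
    show "?e t \<le> (if t \<in> {-m..p} then ?e t else 0) + 1 / d\<^sup>2 * (t\<^sup>2 * ?e t)"
    proof (cases "t \<in> {-m..p}")
      case False
      then have "d \<le> \<bar>t\<bar>" using d by auto
      then have "d\<^sup>2 \<le> t\<^sup>2" using d by (metis abs_le_square_iff abs_of_pos)
      then have "1 \<le> t\<^sup>2 / d\<^sup>2" using d by simp
      then have "1 * ?e t \<le> t\<^sup>2 / d\<^sup>2 * ?e t" by (intro mult_right_mono) auto
      then show ?thesis using False by simp
    qed simp
  qed (use g in auto)
  also have "\<dots> = integral {-m..p} ?e + 1 / d\<^sup>2 * (sqrt (pi / N) / (2 * N))"
  proof -
    have "((\<lambda>t. if t \<in> {-m..p} then ?e t else 0) has_integral integral {-m..p} ?e) UNIV"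
      unfolding has_integral_restrict_UNIV by (rule integrable_integral[OF ion(1)])
    from has_integral_add[OF this has_integral_mult_right[OF g(2), of "1 / d\<^sup>2"]]
    show ?thesis by (rule integral_unique)
  qed
  finally have "integral UNIV ?e \<le> integral {-m..p} ?e + 1 / d\<^sup>2 * (sqrt (pi / N) / (2 * N))" .
  moreover have "integral UNIV ?e = sqrt (pi / N)" using g(1) by (rule integral_unique)
  ultimately show "\<bar>integral {-m..p} ?e - sqrt (pi / N)\<bar> \<le> sqrt pi / (2 * d\<^sup>2) / (N * sqrt N)"
    using le unfolding sN by (simp add: field_simps)
  have "integral {-m..p} (\<lambda>t. t\<^sup>2 * ?e t) \<le> integral UNIV (\<lambda>t. t\<^sup>2 * ?e t)"
    using g(2) ion(2) by (intro integral_subset_le) auto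
  also have "\<dots> = sqrt pi / 2 / (N * sqrt N)" using g(2) unfolding sN by (rule integral_unique)
  finally show "integral {-m..p} (\<lambda>t. t\<^sup>2 * ?e t) \<le> sqrt pi / 2 / (N * sqrt N)" .
  have "((\<lambda>t. t * ?e t) has_integral (- ?e p / (2 * N)) - (- ?e (- m) / (2 * N))) {-m..p}"
    using d N0
    by (intro fundamental_theorem_of_calculus)
       (auto intro!: derivative_eq_intros simp: has_real_derivative_iff_has_vector_derivative[symmetric])
  then have "integral {-m..p} (\<lambda>t. t * ?e t) = (?e m - ?e p) / (2 * N)"
    by (simp add: integral_unique diff_divide_distrib)
  moreover have "\<bar>?e m - ?e p\<bar> \<le> 1 / (N * d\<^sup>2)"
  proof -
    have "0 \<le> ?e x \<and> ?e x \<le> 1 / (N * d\<^sup>2)" if "d \<le> x" for x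
    proof -
      have "N * d\<^sup>2 \<le> N * x\<^sup>2" using N d that by (intro mult_left_mono power_mono) auto
      also have "\<dots> \<le> exp (N * x\<^sup>2)" using exp_ge_add_one_self[of "N * x\<^sup>2"] by linarith
      finally have "1 / exp (N * x\<^sup>2) \<le> 1 / (N * d\<^sup>2)" using N d by (intro divide_left_mono) auto
      then show ?thesis by (simp add: exp_minus inverse_eq_divide)
    qed
    from this[OF d(2)] this[OF d(3)] show ?thesis by linarith
  qed
  ultimately have "\<bar>integral {-m..p} (\<lambda>t. t * ?e t)\<bar> \<le> 1 / (N * d\<^sup>2) / (2 * N)"
    using N divide_right_mono[of "\<bar>?e m - ?e p\<bar>" "1 / (N * d\<^sup>2)" "2 * N"] by (simp only: abs_divide) simp
  also have "\<dots> = 1 / (2 * d\<^sup>2) / (N * N)" by simp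
  also have "\<dots> \<le> 1 / (2 * d\<^sup>2) / (N * sqrt N)"
    using N d real_sqrt_le_mono[of N "N\<^sup>2"] by (intro divide_left_mono mult_left_mono) (auto simp: self_le_power power2_eq_square)
  finally show "\<bar>integral {-m..p} (\<lambda>t. t * ?e t)\<bar> \<le> 1 / (2 * d\<^sup>2) / (N * sqrt N)" .
qed

text \<open>Removing the singularity of a difference quotient twice writes the Taylor remainder as
  z^2 times a holomorphic function, which is bounded on compact sets.\<close>

lemma quadratic_remainder:
  assumes f: "f holomorphic_on ball 0 \<rho>" and \<rho>: "\<rho> > 0"
  obtains \<theta> where "\<theta> holomorphic_on ball 0 \<rho>" "\<And>z. z \<in> ball 0 \<rho> \<Longrightarrow> f z = f 0 + deriv f 0 * z + z\<^sup>2 * \<theta> z"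
proof -
  define f1 where "f1 = (\<lambda>z. if z = 0 then deriv f 0 else (f z - f 0) / (z - 0))"
  have f1: "f1 holomorphic_on ball 0 \<rho>" unfolding f1_def using pole_lemma_open[OF f open_ball] .
  define \<theta> where "\<theta> = (\<lambda>z. if z = 0 then deriv f1 0 else (f1 z - f1 0) / (z - 0))"
  have "\<theta> holomorphic_on ball 0 \<rho>" unfolding \<theta>_def using pole_lemma_open[OF f1 open_ball] .
  moreover have "f z = f 0 + deriv f 0 * z + z\<^sup>2 * \<theta> z" for z
    by (auto simp: \<theta>_def f1_def power2_eq_square field_simps)
  ultimately show ?thesis using that by blast
qed

text \<open>The constant term of \<open>f\<close> gives the main term; the linear and the quadratic
  part are O(N^(-3/2)) by the moment bounds.\<close>

lemma gaussian_times_holomorphic: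
  assumes f: "f holomorphic_on ball 0 \<rho>" and m: "0 < m" "m < \<rho>" and p: "0 < p" "p < \<rho>"
  shows "\<exists>C. \<forall>N\<ge>1. cmod (contour_integral (linepath (- of_real m) (of_real p)) (\<lambda>z. exp (- (of_real N * z\<^sup>2)) * f z)
            - f 0 * of_real (sqrt (pi / N))) \<le> C / (N * sqrt N)"
proof -
  obtain \<theta> where \<theta>: "\<theta> holomorphic_on ball 0 \<rho>" "\<And>z. z \<in> ball 0 \<rho> \<Longrightarrow> f z = f 0 + deriv f 0 * z + z\<^sup>2 * \<theta> z"
    using quadratic_remainder[OF f] m by (metis less_trans)
  have sub: "complex_of_real ` {-m..p} \<subseteq> ball 0 \<rho>" using m p by auto
  have c\<theta>: "continuous_on {-m..p} (\<lambda>t. \<theta> (of_real t))"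
    by (rule continuous_on_compose2[OF holomorphic_on_imp_continuous_on[OF \<theta>(1)] _ sub]) (intro continuous_intros)
  then have "compact ((\<lambda>t. \<theta> (of_real t)) ` {-m..p})" by (intro compact_continuous_image) auto
  then obtain M where M: "\<And>t. t \<in> {-m..p} \<Longrightarrow> cmod (\<theta> (of_real t)) \<le> M" "M \<ge> 0"
    using compact_imp_bounded bounded_pos by (metis image_eqI less_imp_le)
  define d where "d = min m p"
  have d: "d > 0" "d \<le> m" "d \<le> p" using m p by (auto simp: d_def)
  let ?C = "cmod (f 0) * (sqrt pi / (2 * d\<^sup>2)) + cmod (deriv f 0) * (1 / (2 * d\<^sup>2)) + M * (sqrt pi / 2)"
  show ?thesis
  proof (intro exI[of _ ?C] allI impI)
    fix N :: real assume N: "N \<ge> 1"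
    let ?e = "\<lambda>t. exp (- (N * t\<^sup>2))"
    note gi = gaussian_integral_interval[OF N d]
    have ion: "?e integrable_on {-m..p}" "(\<lambda>t. t\<^sup>2 * ?e t) integrable_on {-m..p}" "(\<lambda>t. t * ?e t) integrable_on {-m..p}"
      by (auto intro!: integrable_continuous_real continuous_intros)
    have ion\<theta>: "(\<lambda>t. of_real (t\<^sup>2 * ?e t) * \<theta> (of_real t)) integrable_on {-m..p}"
      by (intro integrable_continuous_real continuous_intros c\<theta>)
    define J where "J = integral {-m..p} (\<lambda>t. of_real (t\<^sup>2 * ?e t) * \<theta> (of_real t))"
    have "cmod J \<le> integral {-m..p} (\<lambda>t. M * (t\<^sup>2 * ?e t))"
      unfolding J_def
    proof (rule integral_norm_bound_integral[OF ion\<theta>])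
      show "(\<lambda>t. M * (t\<^sup>2 * ?e t)) integrable_on {-m..p}"
        by (intro integrable_continuous_real continuous_intros)
      fix t assume t: "t \<in> {-m..p}"
      have "(t\<^sup>2 * ?e t) * cmod (\<theta> (of_real t)) \<le> (t\<^sup>2 * ?e t) * M"
        by (intro mult_left_mono M t) auto
      then show "cmod (of_real (t\<^sup>2 * ?e t) * \<theta> (of_real t)) \<le> M * (t\<^sup>2 * ?e t)"
        by (simp only: norm_mult norm_of_real abs_of_nonneg zero_le_power2 mult_nonneg_nonneg exp_ge_zero mult.commute)
    qed
    also have "\<dots> = M * integral {-m..p} (\<lambda>t. t\<^sup>2 * ?e t)" by (rule integral_mult_right)
    also have "\<dots> \<le> M * (sqrt pi / 2 / (N * sqrt N))" by (intro mult_left_mono gi M)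
    finally have J: "cmod J \<le> M * (sqrt pi / 2 / (N * sqrt N))" .
    have h1: "((\<lambda>t. f 0 * of_real (?e t)) has_integral f 0 * of_real (integral {-m..p} ?e)) {-m..p}"
      using ion(1) by (intro has_integral_mult_right has_integral_of_real integrable_integral)
    have h2: "((\<lambda>t. deriv f 0 * of_real (t * ?e t)) has_integral deriv f 0 * of_real (integral {-m..p} (\<lambda>t. t * ?e t))) {-m..p}"
      using ion(3) by (intro has_integral_mult_right has_integral_of_real integrable_integral)
    have h3: "((\<lambda>t. of_real (t\<^sup>2 * ?e t) * \<theta> (of_real t)) has_integral J) {-m..p}"
      unfolding J_def by (rule integrable_integral[OF ion\<theta>])
    let ?I = "f 0 * of_real (integral {-m..p} ?e) + deriv f 0 * of_real (integral {-m..p} (\<lambda>t. t * ?e t)) + J"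
    have "((\<lambda>t. exp (- (of_real N * (of_real t)\<^sup>2)) * f (of_real t)) has_integral ?I) {-m..p}"
    proof (rule has_integral_eq[OF _ has_integral_add[OF has_integral_add[OF h1 h2] h3]])
      fix t assume t: "t \<in> {-m..p}"
      have "exp (- (complex_of_real N * (of_real t)\<^sup>2)) = of_real (?e t)" by (simp add: exp_of_real[symmetric])
      moreover have "f (of_real t) = f 0 + deriv f 0 * of_real t + (of_real t)\<^sup>2 * \<theta> (of_real t)"
        using \<theta>(2) sub t by blast
      ultimately show "f 0 * of_real (?e t) + deriv f 0 * of_real (t * ?e t) + of_real (t\<^sup>2 * ?e t) * \<theta> (of_real t)
         = exp (- (of_real N * (of_real t)\<^sup>2)) * f (of_real t)"
        by (simp add: algebra_simps)
    qed
    then have "((\<lambda>z. exp (- (of_real N * z\<^sup>2)) * f z) has_contour_integral ?I) (linepath (of_real (- m)) (of_real p))"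
      using m p by (subst has_contour_integral_linepath_Reals_iff) auto
    then have I: "contour_integral (linepath (- of_real m) (of_real p)) (\<lambda>z. exp (- (of_real N * z\<^sup>2)) * f z) = ?I"
      using contour_integral_unique by simp
    have "cmod (?I - f 0 * of_real (sqrt (pi / N))) =
       cmod (f 0 * of_real (integral {-m..p} ?e - sqrt (pi / N)) + deriv f 0 * of_real (integral {-m..p} (\<lambda>t. t * ?e t)) + J)"
      by (simp add: algebra_simps)
    also have "\<dots> \<le> cmod (f 0) * \<bar>integral {-m..p} ?e - sqrt (pi / N)\<bar> + cmod (deriv f 0) * \<bar>integral {-m..p} (\<lambda>t. t * ?e t)\<bar> + cmod J"
      by (intro order_trans[OF norm_triangle_ineq] add_mono order_refl order_trans[OF norm_triangle_ineq])
         (simp_all only: norm_mult norm_of_real order_refl)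
    also have "\<dots> \<le> cmod (f 0) * (sqrt pi / (2 * d\<^sup>2) / (N * sqrt N)) + cmod (deriv f 0) * (1 / (2 * d\<^sup>2) / (N * sqrt N))
        + M * (sqrt pi / 2 / (N * sqrt N))"
      by (intro add_mono mult_left_mono gi J) auto
    also have "\<dots> = ?C / (N * sqrt N)" by (simp add: add_divide_distrib)
    finally show "cmod (contour_integral (linepath (- of_real m) (of_real p)) (\<lambda>z. exp (- (of_real N * z\<^sup>2)) * f z)
            - f 0 * of_real (sqrt (pi / N))) \<le> ?C / (N * sqrt N)"
      unfolding I .
  qed
qed

lemma gaussian_decay_bound:
  assumes N: "N \<ge> (1::real)" and e: "e > 0"
  shows "exp (- (N * e)) \<le> 2 / e\<^sup>2 / (N * sqrt N)"
proof -
  have "(N * e)\<^sup>2 / 2 \<le> exp (N * e)"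
  proof -
    have "0 \<le> N * e" using N e by simp
    then show ?thesis using exp_lower_Taylor_quadratic[of "N * e"] by linarith
  qed
  then have "1 / exp (N * e) \<le> 1 / ((N * e)\<^sup>2 / 2)"
    using N e by (intro divide_left_mono) auto
  also have "\<dots> = 2 / e\<^sup>2 / (N * N)" by (simp add: power2_eq_square)
  also have "\<dots> \<le> 2 / e\<^sup>2 / (N * sqrt N)"
  proof (intro divide_left_mono mult_left_mono)
    have "1 * N \<le> N * N" using N by (intro mult_right_mono) auto
    then show "sqrt N \<le> N" using N by (intro real_le_lsqrt) (auto simp: power2_eq_square)
  qed (use N e in auto)
  finally show ?thesis by (simp add: exp_minus inverse_eq_divide)
qed

text \<open>The substitution w = z csqrt (- k z) turns the exponent into - N w^2 and is invertible
  near 0. The image of the segment is a curve whose ends may lie off the real axis. Expressing all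
  integrals as differences of one primitive in a disc of the w-plane compares this curve with a real
  interval and two vertical pieces.\<close>

lemma laplace_segment:
  assumes R: "R > 0" and k: "k holomorphic_on ball 0 R" and \<psi>: "\<psi> holomorphic_on ball 0 R" and k0: "Re (k 0) < 0"
  shows "\<exists>d0>0. \<forall>\<delta>. 0 < \<delta> \<and> \<delta> < d0 \<longrightarrow>
    (\<forall>z\<in>cball 0 \<delta>. Re (k z) \<le> Re (k 0) / 2) \<and>
    (\<exists>C. \<forall>N\<ge>1. cmod (contour_integral (linepath (- of_real \<delta>) (of_real \<delta>)) (\<lambda>z. exp (of_real N * (z\<^sup>2 * k z)) * \<psi> z)
            - \<psi> 0 / csqrt (- k 0) * of_real (sqrt (pi / N))) \<le> C / (N * sqrt N))"
proof -
  have "isCont k 0"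
    by (rule continuous_on_interior[OF holomorphic_on_imp_continuous_on[OF k]]) (use R in simp)
  then have "\<exists>r>0. \<forall>z. dist z 0 < r \<longrightarrow> dist (k z) (k 0) < - Re (k 0) / 2"
    using k0 unfolding continuous_at_eps_delta by simp
  then obtain r0 where r0: "r0 > 0" "\<And>z. dist z 0 < r0 \<Longrightarrow> dist (k z) (k 0) < - Re (k 0) / 2" by blast
  define r where "r = min r0 R"
  have r: "r > 0" "ball 0 r \<subseteq> ball (0::complex) R" using r0 R by (auto simp: r_def)
  have Rek: "Re (k z) \<le> Re (k 0) / 2" if "z \<in> ball 0 r" for z
  proof -
    have "dist (k z) (k 0) < - Re (k 0) / 2" using r0(2)[of z] that by (simp add: r_def dist_commute)
    then have "\<bar>Re (k z - k 0)\<bar> < - Re (k 0) / 2" unfolding dist_norm using abs_Re_le_cmod le_less_trans by blast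
    then show ?thesis by (simp add: abs_less_iff)
  qed
  have Rek': "Re (- k z) > 0" if "z \<in> ball 0 r" for z using Rek[OF that] k0 by simp
  define \<xi> where "\<xi> = (\<lambda>z. z * csqrt (- k z))"
  have kr: "k holomorphic_on ball 0 r" "\<psi> holomorphic_on ball 0 r" using k \<psi> r holomorphic_on_subset by blast+
  have npos: "- k z \<notin> \<real>\<^sub>\<le>\<^sub>0" if "z \<in> ball 0 r" for z
    using Rek'[OF that] by (auto simp: complex_nonpos_Reals_iff)
  have hol\<xi>: "\<xi> holomorphic_on ball 0 r" unfolding \<xi>_def
    by (intro holomorphic_intros kr) (use npos in auto)
  have \<xi>sq: "- (\<xi> z)\<^sup>2 = z\<^sup>2 * k z" for z by (simp add: \<xi>_def power_mult_distrib)
  have Recs: "Re (csqrt (- k z)) > 0" if "z \<in> ball 0 r" for z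
  proof -
    have "Re (- k z) = Re ((csqrt (- k z))\<^sup>2)" by (simp only: power2_csqrt)
    also have "\<dots> = (Re (csqrt (- k z)))\<^sup>2 - (Im (csqrt (- k z)))\<^sup>2" by (rule Re_power2)
    finally have "0 < (Re (csqrt (- k z)))\<^sup>2" using Rek'[OF that] zero_le_power2[of "Im (csqrt (- k z))"] by linarith
    then have "Re (csqrt (- k z)) \<noteq> 0" by auto
    then show ?thesis using Re_csqrt[of "- k z"] by linarith
  qed
  have d\<xi>: "deriv \<xi> 0 = csqrt (- k 0)"
  proof -
    have "(\<lambda>z. csqrt (- k z)) holomorphic_on ball 0 r"
      by (intro holomorphic_intros kr) (use npos in auto)
    from holomorphic_derivI[OF this open_ball, of 0] r(1)
    have "((\<lambda>z. csqrt (- k z)) has_field_derivative deriv (\<lambda>z. csqrt (- k z)) 0) (at 0)" by simp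
    from DERIV_mult[OF DERIV_ident this]
    have "(\<xi> has_field_derivative 1 * csqrt (- k 0) + deriv (\<lambda>z. csqrt (- k z)) 0 * 0) (at 0)"
      unfolding \<xi>_def .
    from DERIV_imp_deriv[OF this] show ?thesis by simp
  qed
  have zr: "0 \<in> ball (0::complex) r" using r by simp
  have cs0: "csqrt (- k 0) \<noteq> 0" using Recs[OF zr] by auto
  have dn: "deriv \<xi> 0 \<noteq> 0" using d\<xi> cs0 by simp
  obtain r2 where r2: "r2 > 0" "ball 0 r2 \<subseteq> ball (0::complex) r" "open (\<xi> ` ball 0 r2)" "inj_on \<xi> (ball 0 r2)"
    by (rule has_complex_derivative_locally_invertible[OF hol\<xi> zr open_ball dn])
  have hol\<xi>2: "\<xi> holomorphic_on ball 0 r2" using hol\<xi> r2 holomorphic_on_subset by blast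
  obtain \<eta> where \<eta>: "\<eta> holomorphic_on (\<xi> ` ball 0 r2)"
     "\<And>z. z \<in> ball 0 r2 \<Longrightarrow> deriv \<xi> z * deriv \<eta> (\<xi> z) = 1"
     "\<And>z. z \<in> ball 0 r2 \<Longrightarrow> \<eta> (\<xi> z) = z"
  proof (rule holomorphic_has_inverse[OF hol\<xi>2 open_ball r2(4)])
    fix g assume "g holomorphic_on \<xi> ` ball 0 r2" "\<And>z. z \<in> ball 0 r2 \<Longrightarrow> deriv \<xi> z * deriv g (\<xi> z) = 1"
      "\<And>z. z \<in> ball 0 r2 \<Longrightarrow> g (\<xi> z) = z"
    then show ?thesis by (rule that)
  qed
  have \<xi>0: "\<xi> 0 = 0" by (simp add: \<xi>_def)
  have "0 \<in> \<xi> ` ball 0 r2" using r2 \<xi>0 by force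
  then obtain \<rho> where \<rho>: "\<rho> > 0" "ball 0 \<rho> \<subseteq> \<xi> ` ball 0 r2" using r2(3) open_contains_ball by blast
  define F where "F = (\<lambda>w. \<psi> (\<eta> w) * deriv \<eta> w)"
  have hol\<eta>: "\<eta> holomorphic_on ball 0 \<rho>" using \<eta>(1) \<rho>(2) holomorphic_on_subset by blast
  have \<eta>im: "\<eta> w \<in> ball 0 r2" if "w \<in> ball 0 \<rho>" for w
    using that \<rho>(2) \<eta>(3) by force
  have holF: "F holomorphic_on ball 0 \<rho>"
  proof -
    have "(\<psi> \<circ> \<eta>) holomorphic_on ball 0 \<rho>"
      by (rule holomorphic_on_compose_gen[OF hol\<eta> kr(2)]) (use \<eta>im r2 in auto)
    moreover have "deriv \<eta> holomorphic_on ball 0 \<rho>" by (rule holomorphic_deriv[OF hol\<eta> open_ball])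
    ultimately show ?thesis unfolding F_def o_def by (rule holomorphic_on_mult)
  qed
  have F0: "F 0 = \<psi> 0 / csqrt (- k 0)"
  proof -
    have z2: "0 \<in> ball (0::complex) r2" using r2(1) by simp
    have "csqrt (- k 0) * deriv \<eta> 0 = 1" "\<eta> 0 = 0" using \<eta>(2)[OF z2] \<eta>(3)[OF z2] unfolding \<xi>0 d\<xi> .
    then show ?thesis unfolding F_def using cs0 by (simp only: eq_divide_eq if_False mult.assoc) (simp add: mult.commute)
  qed
  have "isCont \<xi> 0"
    by (rule continuous_on_interior[OF holomorphic_on_imp_continuous_on[OF hol\<xi>]]) (use r in simp)
  then have "\<exists>e>0. \<forall>z. dist z 0 < e \<longrightarrow> dist (\<xi> z) (\<xi> 0) < \<rho>"
    using \<rho> unfolding continuous_at_eps_delta by simp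
  then obtain d1 where d1: "d1 > 0" "\<And>z. dist z 0 < d1 \<Longrightarrow> dist (\<xi> z) (\<xi> 0) < \<rho>" by blast
  define d0 where "d0 = min d1 r2"
  show ?thesis
  proof (rule exI[of _ d0], intro conjI allI impI)
    show "d0 > 0" using d1 r2 by (simp add: d0_def)
    fix \<delta> assume \<delta>: "0 < \<delta> \<and> \<delta> < d0"
    have sub: "cball 0 \<delta> \<subseteq> ball (0::complex) d0" "ball (0::complex) d0 \<subseteq> ball 0 r2" "ball (0::complex) d0 \<subseteq> ball 0 r"
      using \<delta> r2 by (auto simp: d0_def)
    show "\<forall>z\<in>cball 0 \<delta>. Re (k z) \<le> Re (k 0) / 2" using Rek sub by blast
    have \<xi>im: "\<xi> z \<in> ball 0 \<rho>" if "z \<in> ball 0 d0" for z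
      using d1(2)[of z] that by (simp add: d0_def \<xi>0 dist_commute)
    have inb: "complex_of_real \<delta> \<in> ball 0 d0" "- complex_of_real \<delta> \<in> ball 0 d0" using \<delta> by auto
    define wp wm where "wp = \<xi> (of_real \<delta>)" and "wm = \<xi> (- of_real \<delta>)"
    define p m where "p = Re wp" and "m = - Re wm"
    have wb: "wp \<in> ball 0 \<rho>" "wm \<in> ball 0 \<rho>" unfolding wp_def wm_def by (intro \<xi>im inb)+
    have memb: "complex_of_real \<delta> \<in> ball 0 r" "- complex_of_real \<delta> \<in> ball 0 r" using sub inb by blast+
    have "p = \<delta> * Re (csqrt (- k (of_real \<delta>)))" "m = \<delta> * Re (csqrt (- k (- of_real \<delta>)))"
      by (simp_all add: p_def m_def wp_def wm_def \<xi>_def del: csqrt.simps)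
    then have pm: "0 < p" "0 < m" using Recs[OF memb(1)] Recs[OF memb(2)] \<delta> by simp_all
    have p: "0 < p" "p < \<rho>" using pm wb(1) abs_Re_le_cmod[of wp] by (auto simp: p_def)
    have m: "0 < m" "m < \<rho>" using pm wb(2) abs_Re_le_cmod[of wm] by (auto simp: m_def)
    obtain C1 where C1: "\<And>N. N \<ge> 1 \<Longrightarrow> cmod (contour_integral (linepath (- of_real m) (of_real p)) (\<lambda>z. exp (- (of_real N * z\<^sup>2)) * F z)
            - F 0 * of_real (sqrt (pi / N))) \<le> C1 / (N * sqrt N)"
      using gaussian_times_holomorphic[OF holF m p] by blast
    define e where "e = \<delta>\<^sup>2 * (- Re (k 0) / 2)"
    have e: "e > 0" unfolding e_def by (rule mult_pos_pos) (use \<delta> k0 in auto)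
    have Resq: "e \<le> Re (wp\<^sup>2)" "e \<le> Re (wm\<^sup>2)"
    proof -
      have "\<delta>\<^sup>2 * (- Re (k 0) / 2) \<le> \<delta>\<^sup>2 * (- Re (k (of_real \<delta>)))" "\<delta>\<^sup>2 * (- Re (k 0) / 2) \<le> \<delta>\<^sup>2 * (- Re (k (- of_real \<delta>)))"
        using Rek[OF memb(1)] Rek[OF memb(2)] by (intro mult_left_mono; simp)+
      moreover have "wp\<^sup>2 = - (of_real (\<delta>\<^sup>2) * k (of_real \<delta>))" "wm\<^sup>2 = - (of_real (\<delta>\<^sup>2) * k (- of_real \<delta>))"
        by (simp_all add: wp_def wm_def \<xi>_def power_mult_distrib del: csqrt.simps)
      ultimately show "e \<le> Re (wp\<^sup>2)" "e \<le> Re (wm\<^sup>2)" by (simp_all add: e_def)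
    qed
    \<comment> \<open>Moving vertically towards the real axis shrinks the imaginary part, so Re
      (z^2) only grows. On the vertical pieces the Gaussian therefore stays below exp (- N
      e).\<close>
    have seg: "e \<le> Re (z\<^sup>2)" "z \<in> ball 0 \<rho>" if z: "z \<in> closed_segment (of_real (Re w)) w" and w: "w \<in> ball 0 \<rho>" "e \<le> Re (w\<^sup>2)" for z w
    proof -
      obtain u where u: "0 \<le> u" "u \<le> 1" "z = (1 - u) *\<^sub>R of_real (Re w) + u *\<^sub>R w" using z by (auto simp: in_segment)
      have z2: "Re z = Re w" "Im z = u * Im w" unfolding u(3) by (simp_all add: algebra_simps)
      have "\<bar>Im z\<bar> \<le> \<bar>Im w\<bar>" unfolding z2 using u by (simp add: abs_mult mult_left_le_one_le)
      then have i2: "(Im z)\<^sup>2 \<le> (Im w)\<^sup>2" by (simp add: abs_le_square_iff)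
      then show "e \<le> Re (z\<^sup>2)" using w(2) z2 by (simp add: power2_eq_square)
      have "cmod z \<le> cmod w" unfolding cmod_def using i2 z2 by simp
      then show "z \<in> ball 0 \<rho>" using w(1) by simp
    qed
    have "compact (closed_segment (of_real (Re wp)) wp \<union> closed_segment (of_real (Re wm)) wm)" by (intro compact_Un compact_segment)
    moreover have subs: "closed_segment (of_real (Re wp)) wp \<union> closed_segment (of_real (Re wm)) wm \<subseteq> ball 0 \<rho>"
      using seg(2) wb Resq by blast
    ultimately have "bounded (F ` (closed_segment (of_real (Re wp)) wp \<union> closed_segment (of_real (Re wm)) wm))"
      by (intro compact_imp_bounded compact_continuous_image continuous_on_subset[OF holomorphic_on_imp_continuous_on[OF holF]])
    then obtain B where B: "B > 0" "\<And>z. z \<in> closed_segment (of_real (Re wp)) wp \<union> closed_segment (of_real (Re wm)) wm \<Longrightarrow> cmod (F z) \<le> B"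
      unfolding bounded_pos by blast
    let ?C = "C1 + B * (2 / e\<^sup>2) * (cmod (wp - of_real p) + cmod (wm + of_real m))"
    show "\<exists>C. \<forall>N\<ge>1. cmod (contour_integral (linepath (- of_real \<delta>) (of_real \<delta>)) (\<lambda>z. exp (of_real N * (z\<^sup>2 * k z)) * \<psi> z)
            - \<psi> 0 / csqrt (- k 0) * of_real (sqrt (pi / N))) \<le> C / (N * sqrt N)"
    proof (intro exI[of _ ?C] allI impI)
      fix N :: real assume N: "N \<ge> 1"
      let ?G = "\<lambda>w. exp (- (of_real N * w\<^sup>2)) * F w"
      have holG: "?G holomorphic_on ball 0 \<rho>" by (intro holomorphic_intros holF)
      have "\<exists>\<Phi>. \<forall>x\<in>ball 0 \<rho>. (\<Phi> has_field_derivative ?G x) (at x within ball 0 \<rho>)"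
      proof (rule holomorphic_convex_primitive'[OF convex_ball open_ball holG])
        fix \<Phi> assume "\<And>x. x \<in> ball 0 \<rho> \<Longrightarrow> (\<Phi> has_field_derivative ?G x) (at x within ball 0 \<rho>)"
        then show ?thesis by (intro exI[of _ \<Phi>] ballI)
      qed
      then obtain \<Phi> where \<Phi>0: "\<forall>x\<in>ball 0 \<rho>. (\<Phi> has_field_derivative ?G x) (at x within ball 0 \<rho>)"
        by (rule exE)
      note \<Phi> = bspec[OF \<Phi>0]
      have \<Phi>': "(\<Phi> has_field_derivative ?G x) (at x)" if "x \<in> ball 0 \<rho>" for x
        using \<Phi>[OF that] at_within_open[OF that open_ball] by simp
      have cint: "(?G has_contour_integral \<Phi> b - \<Phi> a) (linepath a b)" if "closed_segment a b \<subseteq> ball 0 \<rho>" for a b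
        using contour_integral_primitive[of "ball 0 \<rho>" \<Phi> ?G "linepath a b"] \<Phi> that by auto
      have bnd: "cmod (\<Phi> w - \<Phi> (of_real (Re w))) \<le> B * (2 / e\<^sup>2) / (N * sqrt N) * cmod (w - of_real (Re w))"
        if w: "w = wp \<or> w = wm" for w
      proof (rule has_contour_integral_bound_linepath[OF cint])
        show "closed_segment (complex_of_real (Re w)) w \<subseteq> ball 0 \<rho>" using subs w by blast
        show "0 \<le> B * (2 / e\<^sup>2) / (N * sqrt N)" using B N by simp
        fix z assume z: "z \<in> closed_segment (complex_of_real (Re w)) w"
        have "e \<le> Re (z\<^sup>2)" using seg(1)[OF z] w wb Resq by blast
        then have "N * e \<le> N * Re (z\<^sup>2)" using N by (intro mult_left_mono) auto
        then have "cmod (exp (- (of_real N * z\<^sup>2))) \<le> exp (- (N * e))" by simp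
        also have "\<dots> \<le> 2 / e\<^sup>2 / (N * sqrt N)" by (rule gaussian_decay_bound[OF N e])
        finally have "cmod (exp (- (of_real N * z\<^sup>2))) \<le> 2 / e\<^sup>2 / (N * sqrt N)" .
        moreover have "cmod (F z) \<le> B" using B(2) z w by blast
        ultimately have "cmod (?G z) \<le> 2 / e\<^sup>2 / (N * sqrt N) * B"
          unfolding norm_mult using N by (intro mult_mono) auto
        then show "cmod (?G z) \<le> B * (2 / e\<^sup>2) / (N * sqrt N)" by (simp add: mult_ac)
      qed
      \<comment> \<open>Since \<open>\<eta>\<close> inverts \<open>\<xi>\<close>, the chain rule
        makes \<open>\<Phi> (\<xi> z)\<close> a primitive of the original integrand.\<close>
      have "((\<lambda>z. exp (of_real N * (z\<^sup>2 * k z)) * \<psi> z) has_contour_integral \<Phi> wp - \<Phi> wm) (linepath (- of_real \<delta>) (of_real \<delta>))"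
      proof -
        have "((\<lambda>z. \<Phi> (\<xi> z)) has_field_derivative exp (of_real N * (z\<^sup>2 * k z)) * \<psi> z) (at z within ball 0 d0)"
          if z: "z \<in> ball 0 d0" for z
        proof -
          have z2: "z \<in> ball 0 r2" using z sub by blast
          have "(\<xi> has_field_derivative deriv \<xi> z) (at z within ball 0 d0)"
            using holomorphic_derivI[OF hol\<xi>2 open_ball z2] by (rule has_field_derivative_at_within)
          from DERIV_chain2[where f = \<Phi>, OF \<Phi>'[OF \<xi>im[OF z]] this]
          have "((\<lambda>z. \<Phi> (\<xi> z)) has_field_derivative ?G (\<xi> z) * deriv \<xi> z) (at z within ball 0 d0)" .
          moreover have "?G (\<xi> z) * deriv \<xi> z = exp (of_real N * (- (\<xi> z)\<^sup>2)) * \<psi> (\<eta> (\<xi> z)) * (deriv \<xi> z * deriv \<eta> (\<xi> z))"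
            by (simp add: F_def mult_ac)
          ultimately show ?thesis unfolding \<eta>(2)[OF z2] \<eta>(3)[OF z2] \<xi>sq by simp
        qed
        from contour_integral_primitive[of "ball 0 d0" "\<lambda>z. \<Phi> (\<xi> z)", OF this, of "linepath (- of_real \<delta>) (of_real \<delta>)"]
        have "path_image (linepath (- complex_of_real \<delta>) (of_real \<delta>)) \<subseteq> ball 0 d0 \<Longrightarrow> ?thesis"
          by (simp add: wp_def wm_def)
        moreover have "closed_segment (- complex_of_real \<delta>) (of_real \<delta>) \<subseteq> ball 0 d0"
          using inb by (intro closed_segment_subset) auto
        ultimately show ?thesis by simp
      qed
      then have I: "contour_integral (linepath (- of_real \<delta>) (of_real \<delta>)) (\<lambda>z. exp (of_real N * (z\<^sup>2 * k z)) * \<psi> z) = \<Phi> wp - \<Phi> wm"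
        by (rule contour_integral_unique)
      have "closed_segment (- complex_of_real m) (of_real p) \<subseteq> ball 0 \<rho>"
        using m p by (intro closed_segment_subset) auto
      then have M: "contour_integral (linepath (- of_real m) (of_real p)) ?G = \<Phi> (of_real p) - \<Phi> (- of_real m)"
        using cint by (intro contour_integral_unique)
      have b1: "cmod (\<Phi> wp - \<Phi> (of_real p)) \<le> B * (2 / e\<^sup>2) / (N * sqrt N) * cmod (wp - of_real p)"
        using bnd[of wp] by (simp add: p_def)
      have b2: "cmod (\<Phi> wm - \<Phi> (- of_real m)) \<le> B * (2 / e\<^sup>2) / (N * sqrt N) * cmod (wm + of_real m)"
        using bnd[of wm] by (simp add: m_def)
      have b3: "cmod (\<Phi> (of_real p) - \<Phi> (- of_real m) - F 0 * of_real (sqrt (pi / N))) \<le> C1 / (N * sqrt N)"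
        using C1[OF N] unfolding M .
      have "\<Phi> wp - \<Phi> wm - F 0 * of_real (sqrt (pi / N)) = (\<Phi> wp - \<Phi> (of_real p)) - (\<Phi> wm - \<Phi> (- of_real m))
          + (\<Phi> (of_real p) - \<Phi> (- of_real m) - F 0 * of_real (sqrt (pi / N)))" by simp
      also have "cmod \<dots> \<le> cmod (\<Phi> wp - \<Phi> (of_real p)) + cmod (\<Phi> wm - \<Phi> (- of_real m)) + cmod (\<Phi> (of_real p) - \<Phi> (- of_real m) - F 0 * of_real (sqrt (pi / N)))"
        by (intro order_trans[OF norm_triangle_ineq] add_mono order_refl norm_triangle_ineq4)
      also have "\<dots> \<le> B * (2 / e\<^sup>2) / (N * sqrt N) * cmod (wp - of_real p) + B * (2 / e\<^sup>2) / (N * sqrt N) * cmod (wm + of_real m) + C1 / (N * sqrt N)"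
        by (intro add_mono b1 b2 b3)
      also have "\<dots> = ?C / (N * sqrt N)" by (simp add: add_divide_distrib distrib_left)
      finally show "cmod (contour_integral (linepath (- of_real \<delta>) (of_real \<delta>)) (\<lambda>z. exp (of_real N * (z\<^sup>2 * k z)) * \<psi> z)
            - \<psi> 0 / csqrt (- k 0) * of_real (sqrt (pi / N))) \<le> ?C / (N * sqrt N)"
        unfolding I F0 .
    qed
  qed
qed

section \<open>The phase function along the contour\<close>

lemma one_minus_w0_nonzero: "1 - w0 \<noteq> 0" "w0 \<noteq> 0"
  using w0_cut_plane by (auto simp: cut_plane_def)

lemma exp_z0: "exp (2 * of_real pi * \<i> * z0) = 1 - w0"
proof -
  have "2 * of_real pi * \<i> * z0 = 2 * of_real pi * \<i> + Ln (1 - w0)"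
    by (simp add: z0_def field_simps)
  then show ?thesis using one_minus_w0_nonzero by (simp add: exp_add)
qed

lemma Re_z0: "Re z0 = 1 + Im (Ln (1 - w0)) / (2 * pi)" and Im_z0: "Im z0 = - ln (cmod (1 - w0)) / (2 * pi)"
  using one_minus_w0_nonzero by (simp_all add: z0_def Re_divide Im_divide power2_eq_square field_simps)

lemma exp_Im_z0: "exp (- (2 * pi * Im z0)) = cmod (1 - w0)"
  using one_minus_w0_nonzero by (simp add: Im_z0)

text \<open>1 - w0 lies in the open first quadrant, so its argument divided by 2 pi is between 0 and
  1/4.\<close>

lemma Re_z0_bounds: "1 < Re z0" "Re z0 < 5/4"
proof -
  have "0 < Im (Ln (1 - w0))" using Im_Ln_pos_lt_imp one_minus_w0_bounds(4) by blast
  moreover have "\<bar>Im (Ln (1 - w0))\<bar> < pi / 2"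
    using one_minus_w0_nonzero(1) one_minus_w0_bounds(3) by (intro Re_Ln_pos_lt_imp)
  ultimately show "1 < Re z0" "Re z0 < 5/4" unfolding Re_z0 by (auto simp: field_simps)
qed

text \<open>The upper bound comes from |1 - w0| \<ge> 0.1898, a number close to 81/425, whose
  logarithm is already estimated.\<close>

lemma Im_z0_bounds: "0 < Im z0" "Im z0 \<le> 265/1000"
proof -
  have "0 < cmod (1 - w0)" using one_minus_w0_nonzero by simp
  moreover have "cmod (1 - w0) < 1" using one_minus_w0_bounds(2) by linarith
  ultimately have "ln (cmod (1 - w0)) < 0" by (rule ln_less_zero)
  then show "0 < Im z0" unfolding Im_z0 by (simp add: divide_less_0_iff)
  have "ln (81/425) + ln ((1898/10000) * (425/81)) = ln ((1898/10000)::real)"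
    by (subst ln_mult_pos[symmetric]) auto
  moreover have "- (5/1000) \<le> ln ((1898/10000) * (425/81) :: real)"
  proof -
    have P: "1 - inverse a \<le> ln a" if "a > 0" for a :: real
      using ln_le_minus_one[of "inverse a"] that by (simp add: ln_inverse)
    show ?thesis by (rule order_trans[OF _ P]) simp_all
  qed
  moreover have "ln ((1898/10000)::real) \<le> ln (cmod (1 - w0))" using one_minus_w0_bounds by (subst ln_le_cancel_iff) auto
  ultimately have "- (1664/1000) \<le> ln (cmod (1 - w0))" using ln_81_425 by linarith
  then show "Im z0 \<le> 265/1000" unfolding Im_z0 using pi_approx by (simp add: field_simps)
qed

lemma z0_nonzero: "z0 \<noteq> 0" using Im_z0_bounds by auto

text \<open>Reflection at \<open>w0\<close> together with the defining equation leaves the product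
  of - Ln w0 and 2 pi i + Ln (1 - w0), and the second factor is 2 pi i z0.\<close>

lemma phase_z0: "phase z0 = - Ln w0"
proof -
  have "dilog w0 + dilog (1 - w0) = of_real (pi ^ 2 / 6) - Ln w0 * Ln (1 - w0)"
    by (rule dilog_reflection[OF w0_cut_plane])
  then have "dilog (1 - w0) - of_real (pi ^ 2 / 6) = - Ln w0 * (2 * of_real pi * \<i> + Ln (1 - w0))"
    unfolding dilog_w0 by (simp add: algebra_simps)
  also have "2 * of_real pi * \<i> + Ln (1 - w0) = 2 * of_real pi * \<i> * z0"
    by (simp add: z0_def field_simps)
  finally show ?thesis unfolding phase_def exp_z0 using z0_nonzero by simp
qed

lemma Re_phase_z0: "583/10000 \<le> Re (phase z0)" "Re (phase z0) = - ln (cmod w0)"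
  using Re_Ln_w0 one_minus_w0_nonzero unfolding phase_z0 by (auto simp: minus_le_iff)

lemma cmod_w0_less_1: "cmod w0 < 1"
proof -
  have "ln (cmod w0) < 0" using Re_phase_z0 by simp
  then show ?thesis using one_minus_w0_nonzero(2) by simp
qed

text \<open>Along the ray through \<open>z0\<close>, the derivative of \<open>r * Re (phase (r z0) - phase z0)\<close> is
  \<open>ln (cmod w0) - ln (cmod (ray_w r))\<close>.\<close>

definition ray_w :: "real \<Rightarrow> complex" where
  "ray_w r = 1 - exp (2 * of_real pi * \<i> * (of_real r * z0))"

lemma ray_w_1: "ray_w 1 = w0" by (simp add: ray_w_def exp_z0)

lemma cmod_ray_w_sq:
  "(cmod (ray_w r))\<^sup>2 = 1 - 2 * (exp (- (2 * pi * r * Im z0)) * cos (2 * pi * r * Re z0)) + (exp (- (2 * pi * r * Im z0)))\<^sup>2"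
proof -
  let ?\<rho> = "exp (- (2 * pi * r * Im z0))" and ?\<theta> = "2 * pi * r * Re z0"
  have "Re (ray_w r) = 1 - ?\<rho> * cos ?\<theta>" "Im (ray_w r) = - (?\<rho> * sin ?\<theta>)"
    unfolding ray_w_def by (simp_all add: Re_exp Im_exp mult_ac)
  then have "(cmod (ray_w r))\<^sup>2 = (1 - ?\<rho> * cos ?\<theta>)\<^sup>2 + (?\<rho> * sin ?\<theta>)\<^sup>2" by (simp add: cmod_power2)
  also have "(1 - a * c)\<^sup>2 + (a * d)\<^sup>2 = 1 - 2 * (a * c) + a\<^sup>2 * (c\<^sup>2 + d\<^sup>2)" for a c d :: real
    by (simp add: power2_eq_square algebra_simps)
  finally show ?thesis by (simp only: sin_cos_squared_add2 mult_1_right)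
qed

lemma shift_cos_sin: "cos x = cos (x - 2 * pi)" "sin x = sin (x - 2 * (pi::real))"
  by (simp_all add: cos_diff sin_diff)

text \<open>With z0 = x + i y, modulus rho of the exponential and a its angle reduced by 2 pi, the
  squared modulus has a derivative of the sign of y cos a + x sin a - y rho. For a between 0 and
  pi/2 this is positive, as cos a + sin a \<ge> 1, x \<ge> y and rho < 1.\<close>

lemma ray_w_strict_mono:
  assumes r: "1 \<le> r * Re z0" "r < s" "s * Re z0 \<le> 5/4"
  shows "cmod (ray_w r) < cmod (ray_w s)"
proof -
  have x0: "Re z0 > 0" using Re_z0_bounds by simp
  let ?\<rho> = "\<lambda>r. exp (- (2 * pi * r * Im z0))" and ?\<theta> = "\<lambda>r. 2 * pi * r * Re z0"
  let ?S = "\<lambda>r. 1 - 2 * (?\<rho> r * cos (?\<theta> r)) + (?\<rho> r)\<^sup>2"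
  let ?S' = "\<lambda>r. 4 * pi * ?\<rho> r * (Im z0 * cos (?\<theta> r) + Re z0 * sin (?\<theta> r) - Im z0 * ?\<rho> r)"
  have der: "(?S has_real_derivative ?S' t) (at t)" for t
    by (auto intro!: derivative_eq_intros simp: algebra_simps power2_eq_square)
  obtain t where t: "r < t" "t < s" "?S s - ?S r = (s - r) * ?S' t"
    using MVT2[OF r(2), of ?S ?S'] der by blast
  have "r * Re z0 < t * Re z0" "t * Re z0 < s * Re z0" using t x0 by simp_all
  then have tx: "1 < t * Re z0" "t * Re z0 < 5/4" using r by linarith+
  then have t0: "t > 0" using x0 by (metis less_trans zero_less_mult_pos2 zero_less_one)
  define \<alpha> where "\<alpha> = ?\<theta> t - 2 * pi"
  have \<alpha>eq: "\<alpha> = 2 * pi * (t * Re z0 - 1)" by (simp add: \<alpha>_def algebra_simps)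
  have "0 < \<alpha>" "\<alpha> < pi / 2" unfolding \<alpha>eq using tx by (auto simp: field_simps)
  then have cs: "0 \<le> cos \<alpha>" "0 \<le> sin \<alpha>" by (auto intro: cos_ge_zero sin_ge_zero)
  have "1 = (cos \<alpha>)\<^sup>2 + (sin \<alpha>)\<^sup>2" by simp
  also have "\<dots> \<le> cos \<alpha> + sin \<alpha>"
    using cs by (intro add_mono) (auto simp: power2_eq_square mult_left_le_one_le)
  finally have "Im z0 * 1 \<le> Im z0 * (cos \<alpha> + sin \<alpha>)" using Im_z0_bounds by (intro mult_left_mono) auto
  also have "\<dots> \<le> Im z0 * cos \<alpha> + Re z0 * sin \<alpha>"
  proof -
    have "Im z0 * sin \<alpha> \<le> Re z0 * sin \<alpha>" using cs Im_z0_bounds Re_z0_bounds by (intro mult_right_mono) auto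
    then show ?thesis by (simp add: distrib_left)
  qed
  finally have 1: "Im z0 \<le> Im z0 * cos \<alpha> + Re z0 * sin \<alpha>" by simp
  have "?\<rho> t < 1" using t0 Im_z0_bounds by simp
  then have "Im z0 * ?\<rho> t < Im z0 * 1" using Im_z0_bounds by (intro mult_strict_left_mono) auto
  with 1 have "0 < Im z0 * cos \<alpha> + Re z0 * sin \<alpha> - Im z0 * ?\<rho> t" by simp
  moreover have "cos (?\<theta> t) = cos \<alpha>" "sin (?\<theta> t) = sin \<alpha>" unfolding \<alpha>_def by (rule shift_cos_sin)+
  ultimately have "0 < ?S' t" by (metis exp_gt_zero mult_pos_pos pi_gt_zero zero_less_numeral)
  then have "0 < (s - r) * ?S' t" by (rule mult_pos_pos[rotated]) (use r(2) in simp)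
  then have "0 < ?S s - ?S r" unfolding t(3) .
  then have "?S r < ?S s" by (simp only: diff_gt_0_iff_gt)
  then have "(cmod (ray_w r))\<^sup>2 < (cmod (ray_w s))\<^sup>2" unfolding cmod_ray_w_sq .
  then show ?thesis by (rule power2_less_imp_less) simp
qed

text \<open>Between 5/4 and 7/4 the cosine of the angle is nonpositive, so the mixed term only
  increases the squared modulus above 1.\<close>

lemma ray_w_ge_1:
  assumes r: "5/4 \<le> r * Re z0" "r * Re z0 \<le> 7/4"
  shows "1 \<le> cmod (ray_w r)"
proof -
  define \<alpha> where "\<alpha> = 2 * pi * r * Re z0 - 2 * pi"
  have \<alpha>eq: "\<alpha> = 2 * pi * (r * Re z0 - 1)" by (simp add: \<alpha>_def algebra_simps)
  have "pi / 2 \<le> \<alpha>" "\<alpha> \<le> 3 * pi / 2" unfolding \<alpha>eq using r by (auto simp: field_simps)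
  then have "0 \<le> cos (\<alpha> - pi)" by (intro cos_ge_zero) auto
  then have "cos (2 * pi * r * Re z0) \<le> 0"
  proof -
    have "cos (2 * pi * r * Re z0) = cos \<alpha>" unfolding \<alpha>_def by (rule shift_cos_sin)
    moreover have "cos (\<alpha> - pi) = - cos \<alpha>" by (simp add: cos_diff)
    ultimately show ?thesis using \<open>0 \<le> cos (\<alpha> - pi)\<close> by linarith
  qed
  then have "exp (- (2 * pi * r * Im z0)) * cos (2 * pi * r * Re z0) \<le> 0" by (simp add: mult_nonneg_nonpos)
  then have "1\<^sup>2 \<le> (cmod (ray_w r))\<^sup>2" unfolding cmod_ray_w_sq one_power2
    using zero_le_power2[of "exp (- (2 * pi * r * Im z0))"] by linarith
  then show ?thesis by (rule power2_le_imp_le) simp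
qed

lemma Re_of_real_i_inverse: "Re (of_real a * (\<i> * inverse u)) = a * (Im u / (cmod u)\<^sup>2)"
  by (simp add: cmod_power2)

lemma far_bound_numeric:
  assumes "0 \<le> A" "0 < B"
  shows "pi / 12 * A + (12/88) / (2 * pi * B) \<le> (3142/1000) / 12 * A + (12/88) / (2 * (3141/1000) * B)"
proof (rule add_mono)
  show "pi / 12 * A \<le> (3142/1000) / 12 * A" using pi_approx assms by (intro mult_right_mono) auto
  have "2 * (3141/1000) * B \<le> 2 * pi * B" using pi_approx assms by (intro mult_right_mono) auto
  then show "(12/88) / (2 * pi * B) \<le> (12/88) / (2 * (3141/1000) * B)" using assms by (intro frac_le) auto
qed

text \<open>When the exponential is small, \<open>phase u\<close> is nearly i pi / (12 u), with real
  part pi / 12 times Im u / |u|^2. The constant 12/88 is 0.12 / (1 - 0.12), from the geometric bound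
  on \<open>dilog\<close>.\<close>

lemma Re_phase_far:
  assumes "Im u > 0" "exp (- (2 * pi * Im u)) \<le> 12/100" and R: "R > 0" "R \<le> cmod u"
    and k: "Im u / (cmod u)\<^sup>2 \<le> k"
  shows "Re (phase u) \<le> pi / 12 * k + (12/88) / (2 * pi * R)"
proof -
  let ?e = "exp (2 * of_real pi * \<i> * u)"
  have u0: "u \<noteq> 0" using assms by auto
  have "cmod (dilog ?e) \<le> cmod ?e / (1 - cmod ?e)"
    using one_minus_exp_upper(3)[OF assms(1)] by (rule cmod_dilog_le)
  also have "\<dots> \<le> (12/100) / (1 - 12/100)"
    using assms(2) unfolding cmod_exp_2pi_i by (intro frac_le) auto
  finally have d: "cmod (dilog ?e) \<le> 12/88" by simp
  have "phase u = - (of_real (pi ^ 2 / 6) / (2 * of_real pi * \<i> * u)) + dilog ?e / (2 * of_real pi * \<i> * u)"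
    by (simp add: phase_def diff_divide_distrib)
  then have "Re (phase u) = Re (- (of_real (pi ^ 2 / 6) / (2 * of_real pi * \<i> * u))) + Re (dilog ?e / (2 * of_real pi * \<i> * u))" by simp
  moreover have "Re (- (of_real (pi ^ 2 / 6) / (2 * of_real pi * \<i> * u))) = pi / 12 * (Im u / (cmod u)\<^sup>2)"
  proof -
    have "- (of_real (pi ^ 2 / 6) / (2 * of_real pi * \<i> * u)) = of_real (pi / 12) * (\<i> * inverse u)"
      using u0 by (simp add: field_simps power2_eq_square)
    then show ?thesis by (simp only: Re_of_real_i_inverse)
  qed
  moreover have "Re (dilog ?e / (2 * of_real pi * \<i> * u)) \<le> (12/88) / (2 * pi * R)"
  proof -
    have "Re (dilog ?e / (2 * of_real pi * \<i> * u)) \<le> cmod (dilog ?e) / (2 * pi * cmod u)"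
      by (rule order_trans[OF complex_Re_le_cmod]) (simp add: norm_divide norm_mult)
    also have "\<dots> \<le> (12/88) / (2 * pi * R)"
      using d R by (intro frac_le mult_left_mono) auto
    finally show ?thesis .
  qed
  moreover have "pi / 12 * (Im u / (cmod u)\<^sup>2) \<le> pi / 12 * k" using k by (intro mult_left_mono) auto
  ultimately show ?thesis by linarith
qed

text \<open>This amounts to |1 - w0|^(7/5) \<le> 0.12, checked in integer powers as 0.2102^7 \<le>
  0.12^5. The factor 7/5 is what r Re z0 > 7/4 and Re z0 < 5/4 imply for r.\<close>

lemma exp_far_small:
  assumes "7/5 * Im z0 \<le> y"
  shows "exp (- (2 * pi * y)) \<le> 12/100"
proof -
  have "exp (- (2 * pi * y)) ^ 5 \<le> (exp (- (2 * pi * (7/5 * Im z0)))) ^ 5"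
    using assms by (intro power_mono) auto
  also have "\<dots> = (exp (- (2 * pi * Im z0))) ^ 7"
    by (simp add: exp_of_nat_mult[symmetric])
  also have "\<dots> \<le> (2102/10000) ^ 7"
    unfolding exp_Im_z0 using one_minus_w0_bounds by (intro power_mono) auto
  also have "\<dots> \<le> (12/100) ^ 5" by (simp add: eval_nat_numeral)
  finally show ?thesis by (rule power_le_imp_le_base[of _ 4, simplified]) simp
qed

text \<open>Up to r Re z0 = 7/4, the function t (Re phase (t z0) - Re phase z0) vanishes at t = 1,
  where its derivative changes from positive to negative: |ray_w t| first increases through |w0| and
  later is at least 1 > |w0|. Beyond 7/4 the far estimate applies.\<close>

lemma Re_phase_ray:
  assumes r: "1 \<le> r * Re z0" "r \<noteq> 1"
  shows "Re (phase (of_real r * z0)) < Re (phase z0)"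
proof (cases "r * Re z0 \<le> 7/4")
  case False
  have x0: "Re z0 > 0" using Re_z0_bounds by simp
  have r75: "7/5 \<le> r"
  proof (rule ccontr)
    assume "\<not> 7/5 \<le> r"
    then have "r * Re z0 \<le> 7/5 * (5/4)" using x0 Re_z0_bounds by (intro mult_mono) auto
    then show False using False by simp
  qed
  let ?u = "of_real r * z0"
  have "7/5 * Im z0 \<le> r * Im z0" using r75 Im_z0_bounds by (intro mult_right_mono) auto
  then have e: "exp (- (2 * pi * Im ?u)) \<le> 12/100" by (intro exp_far_small) simp
  have "7/4 \<le> \<bar>Re ?u\<bar>" using False by simp
  then have R: "7/4 \<le> cmod ?u" using abs_Re_le_cmod order_trans by blast
  have "Im ?u / (cmod ?u)\<^sup>2 \<le> (265/1000) * (4/7)"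
  proof -
    have "Im ?u / (cmod ?u)\<^sup>2 \<le> Im ?u / (Re ?u)\<^sup>2"
      using False Im_z0_bounds r75 x0 by (intro frac_le) (auto simp: cmod_power2)
    also have "\<dots> = Im z0 / Re z0 / (r * Re z0)"
      using r75 x0 by (simp add: power2_eq_square field_simps)
    also have "\<dots> \<le> (265/1000) / 1 / (7/4)"
      using False Im_z0_bounds Re_z0_bounds by (intro frac_le) auto
    finally show ?thesis by simp
  qed
  then have "Re (phase ?u) \<le> pi / 12 * ((265/1000) * (4/7)) + (12/88) / (2 * pi * (7/4))"
    using Im_z0_bounds r75 by (intro Re_phase_far e R) auto
  also have "\<dots> \<le> (3142/1000) / 12 * ((265/1000) * (4/7)) + (12/88) / (2 * (3141/1000) * (7/4))"
    by (rule far_bound_numeric) auto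
  also have "\<dots> < 583/10000" by simp
  finally show ?thesis using Re_phase_z0 by simp
next
  case r74: True
  have x0: "Re z0 > 0" using Re_z0_bounds by simp
  have rpos: "t > 0" if "1 \<le> t * Re z0" for t using that x0 by (metis less_le_trans zero_less_mult_pos2 zero_less_one)
  let ?f = "\<lambda>t. t * Re (phase (of_real t * z0)) - t * Re (phase z0)"
  let ?f' = "\<lambda>t. ln (cmod w0) - ln (cmod (ray_w t))"
  have der: "(?f has_real_derivative ?f' t) (at t)" if t: "t > 0" for t
  proof -
    define c where "c = 2 * of_real pi * \<i> * z0"
    have c0: "c \<noteq> 0" using z0_nonzero by (simp add: c_def)
    define g where "g = (\<lambda>s. (dilog (exp (c * s)) - of_real (pi ^ 2 / 6)) / c)"
    have up: "Im (of_real t * z0) > 0" using t Im_z0_bounds by simp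
    have ec: "exp (2 * of_real pi * \<i> * (of_real t * z0)) = exp (c * of_real t)" by (simp add: c_def mult_ac)
    note oe = one_minus_exp_upper[OF up, unfolded ec]
    have d1: "((\<lambda>s. exp (c * s)) has_field_derivative c * exp (c * of_real t)) (at (of_real t))"
      by (auto intro!: derivative_eq_intros)
    have "((\<lambda>s. dilog (exp (c * s))) has_field_derivative (- Ln (1 - exp (c * of_real t)) / exp (c * of_real t)) * (c * exp (c * of_real t))) (at (of_real t))"
      by (rule DERIV_chain2[where f = dilog, OF has_field_derivative_dilog[OF oe(2) exp_not_eq_zero] d1])
    then have "((\<lambda>s. dilog (exp (c * s)) - of_real (pi ^ 2 / 6)) has_field_derivative (- Ln (1 - exp (c * of_real t)) / exp (c * of_real t)) * (c * exp (c * of_real t)) - 0) (at (of_real t))"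
      by (intro DERIV_diff DERIV_const)
    then have "(g has_field_derivative ((- Ln (1 - exp (c * of_real t)) / exp (c * of_real t)) * (c * exp (c * of_real t)) - 0) / c) (at (of_real t))"
      unfolding g_def by (rule DERIV_cdivide)
    then have "(g has_field_derivative - Ln (1 - exp (c * of_real t))) (at (of_real t))" using c0 by simp
    then have "((\<lambda>s. g (of_real s)) has_vector_derivative - Ln (1 - exp (c * of_real t))) (at t)"
      by (rule has_vector_derivative_real_field)
    from bounded_linear.has_vector_derivative[OF bounded_linear_Re this]
    have "((\<lambda>s. Re (g (of_real s))) has_real_derivative Re (- Ln (1 - exp (c * of_real t)))) (at t)"
      by (simp add: has_real_derivative_iff_has_vector_derivative)
    moreover have "Re (- Ln (1 - exp (c * of_real t))) = - ln (cmod (ray_w t))"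
    proof -
      have "1 - exp (c * of_real t) \<noteq> 0" using oe(1) by auto
      from Re_Ln[OF this] show ?thesis unfolding ray_w_def ec by (simp only: uminus_complex.sel)
    qed
    moreover have "((\<lambda>s. s * Re (phase z0)) has_real_derivative Re (phase z0)) (at t)"
      by (auto intro!: derivative_eq_intros)
    ultimately have "((\<lambda>s. Re (g (of_real s)) - s * Re (phase z0)) has_real_derivative - ln (cmod (ray_w t)) - Re (phase z0)) (at t)"
      by (simp only: DERIV_diff)
    then have "((\<lambda>s. Re (g (of_real s)) - s * Re (phase z0)) has_real_derivative ?f' t) (at t)"
      unfolding Re_phase_z0(2) by simp
    then show ?thesis
    proof (rule has_field_derivative_transform_within_open[where S = "{0<..}"])
      fix s :: real assume s: "s \<in> {0<..}"
      have "g (of_real s) = of_real s * phase (of_real s * z0)"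
        using s z0_nonzero by (simp add: g_def phase_def c_def mult_ac)
      then show "Re (g (of_real s)) - s * Re (phase z0) = ?f s" by simp
    qed (use t in auto)
  qed
  have f1: "?f 1 = 0" by simp
  have w0pos: "0 < cmod w0" using one_minus_w0_nonzero by simp
  have "?f r < 0"
  proof (cases "r < 1")
    case True
    have "\<exists>t. r < t \<and> t < 1 \<and> ?f 1 - ?f r = (1 - r) * ?f' t"
      by (rule MVT2[OF True der]) (use rpos[OF r(1)] in simp)
    then obtain t where t: "r < t" "t < 1" "?f 1 - ?f r = (1 - r) * ?f' t" by blast
    have "r * Re z0 < t * Re z0" using t x0 by simp
    then have t1: "1 \<le> t * Re z0" using r by linarith
    have "cmod (ray_w t) < cmod (ray_w 1)"
      using t t1 Re_z0_bounds by (intro ray_w_strict_mono) auto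
    moreover have "0 < cmod (ray_w t)"
      using one_minus_exp_upper(1)[of "of_real t * z0"] rpos[OF t1] Im_z0_bounds by (auto simp: ray_w_def)
    ultimately have "0 < ?f' t" unfolding ray_w_1 using w0pos by simp
    then have "0 < (1 - r) * ?f' t" using True by simp
    then show ?thesis using t(3) f1 by linarith
  next
    case False
    then have r1: "1 < r" using r by simp
    have "\<exists>t. 1 < t \<and> t < r \<and> ?f r - ?f 1 = (r - 1) * ?f' t"
      by (rule MVT2[OF r1 der]) simp
    then obtain t where t: "1 < t" "t < r" "?f r - ?f 1 = (r - 1) * ?f' t" by blast
    have tx: "1 * Re z0 < t * Re z0" "t * Re z0 < r * Re z0" using t x0 by simp_all
    have "cmod w0 < cmod (ray_w t)"
    proof (cases "t * Re z0 \<le> 5/4")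
      case True
      have "cmod (ray_w 1) < cmod (ray_w t)"
        using t True Re_z0_bounds by (intro ray_w_strict_mono) auto
      then show ?thesis by (simp only: ray_w_1)
    next
      case False
      then have "1 \<le> cmod (ray_w t)" using tx r74 by (intro ray_w_ge_1) auto
      then show ?thesis using cmod_w0_less_1 by linarith
    qed
    then have "ln (cmod w0) < ln (cmod (ray_w t))" using w0pos by (subst ln_less_cancel_iff) linarith+
    then have "?f' t < 0" by simp
    then have "(r - 1) * ?f' t < 0" using r1 by (simp add: mult_pos_neg)
    then show ?thesis using t(3) f1 by linarith
  qed
  then have "r * Re (phase (of_real r * z0)) < r * Re (phase z0)" by simp
  then show ?thesis using rpos[OF r(1)] by simp
qed

text \<open>On the two sides of the square |u| \<ge> 5 and Im u / |u|^2 \<le> 1/5. The far estimate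
  is then below 0.0568, just under the bound 0.0583 for the saddle value.\<close>

lemma Re_phase_outer:
  assumes "Re u = 5 \<and> 5 * (Im z0 / Re z0) \<le> Im u \<and> Im u \<le> 5 \<or> Im u = 5 \<and> 0 \<le> Re u \<and> Re u \<le> 5"
  shows "Re (phase u) < Re (phase z0)"
proof -
  have x0: "Re z0 > 0" using Re_z0_bounds by simp
  have "7/5 * Im z0 \<le> 5 * (Im z0 / Re z0)"
    using Re_z0_bounds Im_z0_bounds mult_right_mono[of "7/5 * Re z0" 5 "Im z0"] by (simp add: field_simps)
  moreover have "5 * (Im z0 / Re z0) \<le> 5"
    using Re_z0_bounds Im_z0_bounds by (simp add: field_simps)
  ultimately have y: "7/5 * Im z0 \<le> Im u" using assms by auto
  then have pos: "Im u > 0" using Im_z0_bounds by linarith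
  have e: "exp (- (2 * pi * Im u)) \<le> 12/100" using y by (rule exp_far_small)
  have R: "5 \<le> cmod u" using assms abs_Re_le_cmod[of u] abs_Im_le_cmod[of u] by auto
  have "Im u / (cmod u)\<^sup>2 \<le> 1/5"
  proof -
    have "5\<^sup>2 \<le> (cmod u)\<^sup>2" using R by (intro power_mono) auto
    then have "Im u / (cmod u)\<^sup>2 \<le> 5 / 5\<^sup>2" using assms pos by (intro frac_le) auto
    then show ?thesis by simp
  qed
  then have "Re (phase u) \<le> pi / 12 * (1/5) + (12/88) / (2 * pi * 5)"
    by (intro Re_phase_far pos e R) auto
  also have "\<dots> \<le> (3142/1000) / 12 * (1/5) + (12/88) / (2 * (3141/1000) * 5)"
    by (rule far_bound_numeric) auto
  also have "\<dots> < 583/10000" by simp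
  finally show ?thesis using Re_phase_z0 by simp
qed

lemma Re_phase_Re_1:
  assumes "0 < y"
  shows "Re (phase (Complex 1 y)) = y / (1 + y\<^sup>2) * ((pi ^ 2 / 6 - Re (dilog (of_real (exp (- (2 * pi * y)))))) / (2 * pi))"
proof -
  have e: "exp (2 * of_real pi * \<i> * Complex 1 y) = of_real (exp (- (2 * pi * y)))"
    by (simp add: complex_eq_iff Re_exp Im_exp)
  have I: "Im (dilog (of_real (exp (- (2 * pi * y))))) = 0" using assms by (intro Im_dilog_of_real) simp
  let ?D = "Re (dilog (of_real (exp (- (2 * pi * y)))))"
  have "dilog (of_real (exp (- (2 * pi * y)))) = of_real ?D" using I by (simp add: complex_eq_iff)
  then have "phase (Complex 1 y) = (of_real ?D - of_real (pi ^ 2 / 6)) / (2 * of_real pi * \<i> * Complex 1 y)"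
    unfolding phase_def e by (simp only:)
  also have "\<dots> = of_real ((pi ^ 2 / 6 - ?D) / (2 * pi)) * (\<i> * inverse (Complex 1 y))"
  proof -
    have "(d - P) / (2 * p * \<i> * z) = (P - d) / (2 * p) * (\<i> * inverse z)" for d P p z :: complex
      by (cases "p = 0 \<or> z = 0") (auto simp: field_simps)
    then show ?thesis by simp
  qed
  finally show ?thesis by (simp only: Re_of_real_i_inverse) (simp add: cmod_power2 mult_ac)
qed

text \<open>On Re u = 1 both y / (1 + y^2) and pi^2 / 6 - Re dilog are nonnegative and nondecreasing
  for 0 < y \<le> 1. The value is therefore largest at the top end, which lies on the ray through
  \<open>z0\<close>.\<close>

lemma Re_phase_vertical:
  assumes y: "0 < y" "y \<le> Im z0 / Re z0"
  shows "Re (phase (Complex 1 y)) < Re (phase z0)"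
proof -
  let ?k = "Im z0 / Re z0"
  have x0: "Re z0 > 0" using Re_z0_bounds by simp
  have k: "0 < ?k" "?k \<le> 1" using Re_z0_bounds Im_z0_bounds by (simp_all add: field_simps)
  have y1: "y \<le> 1" using y k by linarith
  let ?P = "\<lambda>y. (pi ^ 2 / 6 - Re (dilog (of_real (exp (- (2 * pi * y)))))) / (2 * pi)"
  have d1: "Re (dilog (of_real 1)) = pi ^ 2 / 6" by (simp add: dilog_1)
  have "y / (1 + y\<^sup>2) \<le> ?k / (1 + ?k\<^sup>2)"
  proof -
    have "y * ?k \<le> 1 * 1" using y k y1 by (intro mult_mono) auto
    then have n: "0 \<le> (?k - y) * (1 - y * ?k)" using y by (intro mult_nonneg_nonneg) auto
    have "k * (1 + y\<^sup>2) - y * (1 + k\<^sup>2) = (k - y) * (1 - y * k)" for k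
      by (simp add: power2_eq_square algebra_simps)
    then have c: "y * (1 + ?k\<^sup>2) \<le> ?k * (1 + y\<^sup>2)" using n by (metis diff_ge_0_iff_ge)
    have p: "0 < 1 + x\<^sup>2" for x :: real by (simp add: add_pos_nonneg)
    show ?thesis using c by (simp only: pos_le_divide_eq[OF p] times_divide_eq_left pos_divide_le_eq[OF p])
  qed
  moreover have "?P y \<le> ?P ?k"
  proof -
    have "2 * pi * y \<le> 2 * pi * ?k" using y by (intro mult_left_mono) auto
    then have "exp (- (2 * pi * ?k)) \<le> exp (- (2 * pi * y))" by (simp only: exp_le_cancel_iff neg_le_iff_le)
    then have "Re (dilog (of_real (exp (- (2 * pi * ?k))))) \<le> Re (dilog (of_real (exp (- (2 * pi * y)))))"
      using y by (intro dilog_of_real_mono) auto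
    then show ?thesis by (intro divide_right_mono diff_left_mono) auto
  qed
  moreover have "0 \<le> ?k / (1 + ?k\<^sup>2)"
    by (rule divide_nonneg_nonneg[OF less_imp_le[OF k(1)]]) simp
  moreover have "0 \<le> ?P y"
    using y dilog_of_real_mono[of "exp (- (2 * pi * y))" 1] d1 by simp
  ultimately have "Re (phase (Complex 1 y)) \<le> Re (phase (Complex 1 ?k))"
    unfolding Re_phase_Re_1[OF y(1)] Re_phase_Re_1[OF k(1)] by (rule mult_mono)
  also have "Complex 1 ?k = of_real (1 / Re z0) * z0" using x0 by (simp add: complex_eq_iff)
  also have "Re (phase \<dots>) < Re (phase z0)" using Re_z0_bounds by (intro Re_phase_ray) auto
  finally show ?thesis .
qed

text \<open>\<open>phase 1 = 0\<close> is below the positive saddle value, and \<open>phase\<close>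
  is continuous on the closed upper half plane away from 0. The remaining bounds on \<eta> keep the
  starting point positive and leave room for the vertical piece.\<close>

lemma Re_phase_near_1:
  "\<exists>\<eta>>0. \<eta> < 1/2 \<and> \<eta> < Im z0 / Re z0 \<and> (\<forall>u. Im u \<ge> 0 \<and> cmod (u - 1) \<le> \<eta> \<longrightarrow> Re (phase u) < Re (phase z0))"
proof -
  have k: "0 < Im z0 / Re z0" using Re_z0_bounds Im_z0_bounds by simp
  have p1: "phase 1 = 0" by (simp add: phase_def dilog_1)
  have cont: "continuous (at 1 within {u. Im u \<ge> 0 \<and> u \<noteq> 0}) phase"
    using continuous_on_phase by (auto simp: continuous_on_eq_continuous_within)
  have "\<exists>d>0. \<forall>u\<in>{u. Im u \<ge> 0 \<and> u \<noteq> 0}. dist u 1 < d \<longrightarrow> dist (phase u) 0 < 583/10000"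
    using cont[unfolded continuous_within_eps_delta, THEN spec, of "583/10000"] unfolding p1 by simp
  then obtain d where d: "d > 0" and d': "\<forall>u\<in>{u. Im u \<ge> 0 \<and> u \<noteq> 0}. dist u 1 < d \<longrightarrow> dist (phase u) 0 < 583/10000"
    by blast
  define \<eta> where "\<eta> = min (d/2) (min (1/4) (Im z0 / Re z0 / 2))"
  show ?thesis
  proof (rule exI[of _ \<eta>], intro conjI allI impI)
    fix u :: complex assume u: "0 \<le> Im u \<and> cmod (u - 1) \<le> \<eta>"
    have "u \<noteq> 0" using u by (auto simp: \<eta>_def)
    moreover have "dist u 1 < d" using u d by (auto simp: \<eta>_def dist_norm)
    ultimately have "cmod (phase u) < 583/10000" using bspec[OF d', of u] u by (simp add: dist_norm)
    then show "Re (phase u) < Re (phase z0)" using complex_Re_le_cmod[of "phase u"] Re_phase_z0 by linarith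
  qed (use d k in \<open>auto simp: \<eta>_def\<close>)
qed

section \<open>Products at other roots of unity\<close>

lemma compact_norm_bound:
  fixes f :: "'a::topological_space \<Rightarrow> 'b::real_normed_vector"
  assumes "compact K" "continuous_on K f"
  obtains B where "\<And>x. x \<in> K \<Longrightarrow> norm (f x) \<le> B"
proof -
  have "bounded (f ` K)" using assms by (intro compact_imp_bounded compact_continuous_image)
  then obtain B where "\<forall>y\<in>f ` K. norm y \<le> B" unfolding bounded_iff ..
  then show ?thesis by (intro that) auto
qed

lemma farey_self:
  assumes "(h, k) \<in> farey N"
  shows "(h, k) \<in> farey k" "k \<ge> 1"
  using assms by (auto simp: farey_def)

text \<open>Consecutive exponents of a root of exact order \<open>k\<close> give distinct values, so
  a block of length \<open>k\<close> meets every k-th root of unity once.\<close>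

lemma prod_block_roots_unity:
  assumes hk: "(h, k) \<in> farey k" and k: "k \<ge> 1" and Y: "Y \<noteq> 0"
  shows "(\<Prod>i\<in>{m*k..<m*k+k}. 1 - farey_root (h, k) ^ Suc i * Y) = 1 - Y ^ k"
proof -
  let ?z = "farey_root (h, k)"
  let ?A = "{m*k..<m*k+k}"
  have z0: "?z \<noteq> 0" by (simp add: farey_root_def)
  have le: "i = j" if "i \<in> ?A" "j \<in> ?A" "i \<le> j" "?z ^ Suc i = ?z ^ Suc j" for i j
  proof -
    have "?z ^ Suc j = ?z ^ Suc i * ?z ^ (j - i)" using that(3) by (simp add: power_add[symmetric])
    then have "?z ^ (j - i) = 1" using that(4) z0 by simp
    then have "k dvd j - i" using farey_root_power_eq_1_iff[OF hk] by simp
    moreover have "j - i < k" using that by auto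
    ultimately show "i = j" using that(3) by (metis dvd_imp_le le_antisym diff_is_0_eq not_le neq0_conv)
  qed
  have inj: "inj_on (\<lambda>i. ?z ^ Suc i) ?A"
    by (rule inj_onI) (metis le nle_le)
  have "(\<lambda>i. ?z ^ Suc i) ` ?A \<subseteq> {r. r ^ k = 1}"
  proof
    fix r assume "r \<in> (\<lambda>i. ?z ^ Suc i) ` ?A"
    then obtain i where "r = ?z ^ Suc i" by blast
    then have "r ^ k = (?z ^ k) ^ Suc i" by (simp only: power_mult[symmetric] mult.commute)
    moreover have "?z ^ k = 1" using farey_root_power_eq_1_iff[OF hk, of k] by simp
    ultimately show "r \<in> {r. r ^ k = 1}" by simp
  qed
  moreover have "card ((\<lambda>i. ?z ^ Suc i) ` ?A) = card {r::complex. r ^ k = 1}"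
    using card_image[OF inj] card_complex_roots_unity[OF k] by simp
  ultimately have img: "(\<lambda>i. ?z ^ Suc i) ` ?A = {r. r ^ k = 1}"
    using k by (intro card_subset_eq finite_roots_unity) auto
  have "(\<Prod>i\<in>?A. 1 - ?z ^ Suc i * Y) = (\<Prod>r\<in>{r. r ^ k = 1}. 1 - r * Y)"
    unfolding img[symmetric] by (simp only: prod.reindex[OF inj] o_def)
  also have "\<dots> = (\<Prod>r\<in>{r::complex. r ^ k = 1}. Y * (1 / Y - r))"
    using Y by (intro prod.cong refl) (simp add: field_simps)
  also have "\<dots> = Y ^ k * ((1 / Y) ^ k - 1)"
    by (simp only: prod.distrib prod_constant card_complex_roots_unity[OF k] prod_roots_unity[OF k])
  also have "\<dots> = 1 - Y ^ k" using Y by (simp add: field_simps)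
  finally show ?thesis .
qed

lemma cmod_exp_minus_1_le: "cmod (exp w - 1) \<le> cmod w * exp (cmod w)"
proof -
  have "cmod (exp w - (\<Sum>k\<le>0. w ^ k / fact k)) \<le> exp \<bar>Re w\<bar> * cmod w ^ Suc 0 / fact 0"
    by (rule Taylor_exp)
  then have "cmod (exp w - 1) \<le> exp \<bar>Re w\<bar> * cmod w" by simp
  also have "\<dots> \<le> exp (cmod w) * cmod w" by (intro mult_right_mono) (auto simp: abs_Re_le_cmod)
  finally show ?thesis by (simp add: mult.commute)
qed

lemma cmod_exp_le: "cmod (exp w) \<le> exp (cmod w)"
  using complex_Re_le_cmod by simp

text \<open>If the factor vanished, taking k-th powers would give exp (2 pi i s u) = 1, hence s u =
  0 and a trivial a-th power of the root, although k does not divide a. Compactness bounds each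
  reciprocal, and only a modulo k matters. The variable s stands for j / (k M); it may exceed 1, and
  1/c bounds it.\<close>

lemma farey_root_factor_bound:
  assumes hk: "(h, k) \<in> farey k" and K: "compact K" "K \<subseteq> slit_plane c" and c: "0 < c" "c < 1"
  shows "\<exists>B\<ge>0. \<forall>s\<in>{0..1/c}. \<forall>u\<in>K. \<forall>a. \<not> k dvd a \<longrightarrow>
           1 - farey_root (h, k) ^ a * exp (2 * of_real pi * \<i> * (of_real s * u / of_nat k)) \<noteq> 0 \<and>
           cmod (1 / (1 - farey_root (h, k) ^ a * exp (2 * of_real pi * \<i> * (of_real s * u / of_nat k)))) \<le> B"
proof -
  let ?z = "farey_root (h, k)"
  have k: "k \<ge> 1" using hk by (simp add: farey_def)
  let ?f = "\<lambda>a. \<lambda>p::real \<times> complex. 1 - ?z ^ a * exp (2 * of_real pi * \<i> * (of_real (fst p) * snd p / of_nat k))"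
  have nz: "?f a p \<noteq> 0" if p: "p \<in> {0..1/c} \<times> K" and a: "\<not> k dvd a" for a p
  proof
    assume "?f a p = 0"
    then have e: "?z ^ a * exp (2 * of_real pi * \<i> * (of_real (fst p) * snd p / of_nat k)) = 1" by simp
    then have "(?z ^ a * exp (2 * of_real pi * \<i> * (of_real (fst p) * snd p / of_nat k))) ^ k = 1" by simp
    then have "(?z ^ k) ^ a * exp (of_nat k * (2 * of_real pi * \<i> * (of_real (fst p) * snd p / of_nat k))) = 1"
      by (simp only: power_mult_distrib exp_of_nat_mult power_mult[symmetric] mult.commute[of a k])
    moreover have "?z ^ k = 1" using farey_root_power_eq_1_iff[OF hk, of k] by simp
    moreover have "of_nat k * (2 * of_real pi * \<i> * (of_real (fst p) * snd p / of_nat k)) = 2 * of_real pi * \<i> * (of_real (fst p) * snd p)"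
      using k by simp
    ultimately have "exp (2 * of_real pi * \<i> * (of_real (fst p) * snd p)) = 1" by simp
    moreover have "of_real (fst p) * snd p \<in> slit_plane 1"
    proof -
      have s: "0 \<le> fst p" "fst p \<le> 1 / c" and u: "snd p \<in> slit_plane c" using p K by auto
      have l1: "fst p * \<bar>Re (snd p)\<bar> \<le> (1 / c) * \<bar>Re (snd p)\<bar>" using s by (intro mult_right_mono) auto
      have l2: "(1 / c) * \<bar>Re (snd p)\<bar> < 1" if "\<bar>Re (snd p)\<bar> < c" using that c by simp
      have lt: "fst p * \<bar>Re (snd p)\<bar> < 1" if "\<bar>Re (snd p)\<bar> < c" using l1 l2[OF that] by (rule le_less_trans)
      show ?thesis
      proof (cases "fst p = 0 \<or> Im (snd p) = 0")
        case True
        then show ?thesis using u lt s by (auto simp: slit_plane_def abs_mult)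
      qed (simp add: slit_plane_def)
    qed
    ultimately have z: "of_real (fst p) * snd p = 0" by (intro exp_2pi_i_eq_1_slit)
    have "?z ^ a = 1" using e unfolding z by simp
    then show False using farey_root_power_eq_1_iff[OF hk] a by simp
  qed
  have ex: "\<exists>B. \<forall>p\<in>{0..1/c} \<times> K. cmod (1 / ?f a p) \<le> B" if a: "\<not> k dvd a" for a
  proof -
    have "continuous_on ({0..1/c} \<times> K) (\<lambda>p. 1 / ?f a p)"
      using nz[OF _ a] k by (intro continuous_intros) auto
    with compact_Times[OF compact_Icc K(1)] show ?thesis
    proof (rule compact_norm_bound)
      fix B assume "\<And>p. p \<in> {0..1/c} \<times> K \<Longrightarrow> cmod (1 / ?f a p) \<le> B"
      then show ?thesis by (intro exI[of _ B] ballI)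
    qed
  qed
  define B where "B = (\<lambda>a. SOME B. \<forall>p\<in>{0..1/c} \<times> K. cmod (1 / ?f a p) \<le> B)"
  have B: "cmod (1 / ?f a p) \<le> B a" if a: "\<not> k dvd a" and p: "p \<in> {0..1/c} \<times> K" for a p
    using someI_ex[OF ex[OF a]] p unfolding B_def by (rule bspec)
  show ?thesis
  proof (rule exI[of _ "\<Sum>a<k. \<bar>B a\<bar>"], intro conjI ballI allI impI)
    fix s u a assume s: "s \<in> {0..1/c}" and u: "u \<in> K" and a: "\<not> k dvd a"
    show "1 - ?z ^ a * exp (2 * of_real pi * \<i> * (of_real s * u / of_nat k)) \<noteq> 0"
      using nz[of "(s, u)" a] s u a by (simp only: fst_conv snd_conv mem_Times_iff simp_thms)
    have "?z ^ a = ?z ^ (a mod k)"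
    proof -
      have "?z ^ a = ?z ^ (k * (a div k) + a mod k)" by simp
      also have "\<dots> = (?z ^ k) ^ (a div k) * ?z ^ (a mod k)" by (simp only: power_add power_mult)
      also have "?z ^ k = 1" using farey_root_power_eq_1_iff[OF hk, of k] by simp
      finally show ?thesis by simp
    qed
    moreover have "\<not> k dvd a mod k" using a by (simp add: dvd_mod_iff)
    then have "cmod (1 / ?f (a mod k) (s, u)) \<le> B (a mod k)" using s u by (intro B) auto
    also have "\<dots> \<le> \<bar>B (a mod k)\<bar>" by simp
    also have "\<dots> \<le> (\<Sum>a<k. \<bar>B a\<bar>)" using k by (intro member_le_sum) auto
    ultimately show "cmod (1 / (1 - ?z ^ a * exp (2 * of_real pi * \<i> * (of_real s * u / of_nat k)))) \<le> (\<Sum>a<k. \<bar>B a\<bar>)"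
      by simp
  qed (simp add: sum_nonneg)
qed

text \<open>Within a block the slowly varying exponential is frozen at the last index. The factor
  with k dividing j sits at that index and does not change. Any other factor stays away from 0 and
  costs at most 1 + L/M. In total (1 + L/M)^(k M) \<le> exp (L k), independent of N.\<close>

lemma local_prod_bound:
  assumes hk: "(h, k) \<in> farey k" and K: "compact K" "K \<subseteq> slit_plane c" and c: "0 < c" "c < 1"
  shows "\<exists>C\<ge>0. \<forall>N u. N div k \<ge> 1 \<and> c * real N \<le> real (k * (N div k)) \<and> u \<in> K \<longrightarrow>
     cmod (\<Prod>j=1..N. 1 / (1 - local_param (h, k) (real (k\<^sup>2 * (N div k))) u ^ j)) \<le> C * cmod (euler_prod (N div k) u)"
proof -
  let ?z = "farey_root (h, k)"
  have k: "k \<ge> 1" using hk by (simp add: farey_def)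
  obtain B where B: "B \<ge> 0" "\<And>s u a. s \<in> {0..1/c} \<Longrightarrow> u \<in> K \<Longrightarrow> \<not> k dvd a \<Longrightarrow>
      1 - ?z ^ a * exp (2 * of_real pi * \<i> * (of_real s * u / of_nat k)) \<noteq> 0 \<and>
      cmod (1 / (1 - ?z ^ a * exp (2 * of_real pi * \<i> * (of_real s * u / of_nat k)))) \<le> B"
    using farey_root_factor_bound[OF hk K c] by blast
  obtain U where U: "U > 0" "\<And>u. u \<in> K \<Longrightarrow> cmod u \<le> U" using compact_imp_bounded[OF K(1)] unfolding bounded_pos by blast
  define E where "E = exp (2 * pi * (1 / c) * U)"
  define L where "L = B * (E * (2 * pi * U * exp (2 * pi * U)))"
  have L: "L \<ge> 0" using B U by (simp add: L_def E_def)
  let ?C = "(B + 1) ^ k * exp (L * real k)"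
  show ?thesis
  proof (rule exI[of _ ?C], intro conjI allI impI)
    show "0 \<le> ?C" using B by simp
    fix N u assume "N div k \<ge> 1 \<and> c * real N \<le> real (k * (N div k)) \<and> u \<in> K"
    then have M1: "N div k \<ge> 1" and cN: "c * real N \<le> real (k * (N div k))" and u: "u \<in> K" by auto
    define M where "M = N div k"
    have M: "M \<ge> 1" using M1 by (simp add: M_def)
    have "N = k * M + N mod k" by (simp add: M_def)
    moreover have "N mod k < k" using k by simp
    ultimately have kM: "k * M \<le> N" "N < k * M + k" by linarith+
    define e where "e = (\<lambda>j. exp (2 * of_real pi * \<i> * (of_real (real j / real (k * M)) * u / of_nat k)))"
    have q: "local_param (h, k) (real (k\<^sup>2 * M)) u ^ j = ?z ^ j * e j" for j
    proof -
      have "of_nat j * (2 * of_real pi * \<i> * u / of_real (real (k\<^sup>2 * M))) = 2 * of_real pi * \<i> * (of_real (real j / real (k * M)) * u / of_nat k)"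
        by (simp add: power2_eq_square mult_ac)
      then show ?thesis unfolding local_param_def e_def by (simp only: power_mult_distrib exp_of_nat_mult[symmetric])
    qed
    define b where "b = (\<lambda>j. cmod (1 / (1 - ?z ^ j * e j)))"
    have sj: "real j / real (k * M) \<in> {0..1/c}" if "j \<le> N" for j
    proof -
      have "c * real j \<le> c * real N" using that c by (intro mult_left_mono) auto
      then have "real j * c \<le> real (k * M)" using cN by (simp add: M_def mult.commute)
      moreover have "real (k * M) > 0" using k M by simp
      ultimately show ?thesis using c by (simp add: field_simps)
    qed
    have bB: "b j \<le> B" if "j \<le> N" "\<not> k dvd j" for j
      unfolding b_def e_def using that by (intro conjunct2[OF B(2)] sj u)
    have step: "b j \<le> (1 + L / real M) * cmod (1 / (1 - ?z ^ j * e (k * Suc m)))"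
      if j: "m * k < j" "j \<le> m * k + k" and m: "m < M" for j m
    proof (cases "k dvd j")
      case True
      then obtain t where t: "j = k * t" by blast
      have "k * m < k * t" using j(1) unfolding t by (simp only: mult.commute)
      then have "m < t" by simp
      have "k * t < k * Suc (Suc m)" using j(2) k unfolding t by (simp add: mult.commute)
      then have "t < Suc (Suc m)" by (simp only: mult_less_cancel1)
      then have "t = Suc m" using \<open>m < t\<close> by simp
      then have "b j = cmod (1 / (1 - ?z ^ j * e (k * Suc m)))" unfolding b_def t by simp
      moreover have "1 * cmod (1 / (1 - ?z ^ j * e (k * Suc m))) \<le> (1 + L / real M) * cmod (1 / (1 - ?z ^ j * e (k * Suc m)))"
        using L by (intro mult_right_mono) auto
      ultimately show ?thesis by simp
    next
      case False
      let ?A = "1 - ?z ^ j * e j" and ?A' = "1 - ?z ^ j * e (k * Suc m)"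
      have "k * Suc m \<le> k * M" using m by (intro mult_le_mono2) auto
      then have jN: "j \<le> N" "k * Suc m \<le> N" using j kM by (auto simp: algebra_simps)
      have n1: "cmod (?z ^ j) = 1" by (simp add: norm_power farey_root_def)
      have "cmod (e j) \<le> E"
      proof -
        have "cmod (2 * of_real pi * \<i> * (of_real (real j / real (k * M)) * u / of_nat k)) = 2 * pi * (real j / real (k * M)) * (cmod u / real k)"
          by (simp add: norm_mult norm_divide)
        also have "\<dots> \<le> 2 * pi * (1 / c) * U"
        proof (intro mult_mono)
          have "cmod u / real k \<le> cmod u / 1" using k by (intro divide_left_mono) auto
          then show "cmod u / real k \<le> U" using U(2)[OF u] by simp
        qed (use sj[OF jN(1)] c in auto)
        finally show ?thesis unfolding e_def E_def using cmod_exp_le order_trans exp_le_cancel_iff by blast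
      qed
      moreover have "cmod (exp (2 * of_real pi * \<i> * (of_real ((real (k * Suc m) - real j) / real (k * M)) * u / of_nat k)) - 1) \<le> 2 * pi * U * exp (2 * pi * U) / real M"
      proof -
        let ?w = "2 * of_real pi * \<i> * (of_real ((real (k * Suc m) - real j) / real (k * M)) * u / of_nat k)"
        have d: "0 \<le> real (k * Suc m) - real j" "real (k * Suc m) - real j \<le> real k"
          using j by (simp_all add: mult.commute flip: of_nat_mult)
        have "cmod ?w = 2 * pi * ((real (k * Suc m) - real j) / real (k * M)) * (cmod u / real k)"
          using abs_of_nonneg[OF d(1)] by (simp only: norm_mult norm_divide norm_of_real norm_of_nat norm_ii abs_divide abs_of_nat abs_numeral norm_numeral) simp
        also have "\<dots> \<le> 2 * pi * (real k / real (k * M)) * (U / 1)"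
          using d k U(2)[OF u] U by (intro mult_mono divide_right_mono frac_le) auto
        also have "\<dots> = 2 * pi * U / real M" using k by simp
        finally have w: "cmod ?w \<le> 2 * pi * U / real M" .
        also have "\<dots> \<le> 2 * pi * U / 1" using M U by (intro divide_left_mono) auto
        finally have w2: "cmod ?w \<le> 2 * pi * U" by simp
        have "cmod (exp ?w - 1) \<le> cmod ?w * exp (cmod ?w)" by (rule cmod_exp_minus_1_le)
        also have "\<dots> \<le> (2 * pi * U / real M) * exp (2 * pi * U)" using w w2 U by (intro mult_mono) auto
        finally show ?thesis by simp
      qed
      moreover have "e (k * Suc m) - e j = e j * (exp (2 * of_real pi * \<i> * (of_real ((real (k * Suc m) - real j) / real (k * M)) * u / of_nat k)) - 1)"
      proof -
        have "2 * of_real pi * \<i> * (of_real (real (k * Suc m) / real (k * M)) * u / of_nat k) =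
          2 * of_real pi * \<i> * (of_real (real j / real (k * M)) * u / of_nat k) +
          2 * of_real pi * \<i> * (of_real ((real (k * Suc m) - real j) / real (k * M)) * u / of_nat k)"
        proof -
          have "complex_of_real (real (k * Suc m) / real (k * M)) = of_real (real j / real (k * M)) + of_real ((real (k * Suc m) - real j) / real (k * M))"
            by (simp only: of_real_add[symmetric] add_divide_distrib[symmetric]) simp
          then show ?thesis by (simp only: distrib_right distrib_left add_divide_distrib)
        qed
        then have "e (k * Suc m) = e j * exp (2 * of_real pi * \<i> * (of_real ((real (k * Suc m) - real j) / real (k * M)) * u / of_nat k))"
          unfolding e_def by (simp only: exp_add)
        then show ?thesis by (simp add: right_diff_distrib)
      qed
      ultimately have ed: "cmod (e (k * Suc m) - e j) \<le> E * (2 * pi * U * exp (2 * pi * U) / real M)"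
        by (simp only: norm_mult) (intro mult_mono; simp add: E_def)
      have "cmod ?A' \<le> cmod ?A + cmod (?z ^ j * (e j - e (k * Suc m)))"
        using norm_triangle_ineq[of ?A "?z ^ j * (e j - e (k * Suc m))"] by (simp add: algebra_simps)
      also have "cmod (?z ^ j * (e j - e (k * Suc m))) = cmod (e (k * Suc m) - e j)"
        by (simp add: norm_mult n1 norm_minus_commute)
      finally have A': "cmod ?A' \<le> cmod ?A + E * (2 * pi * U * exp (2 * pi * U) / real M)" using ed by linarith
      have bj: "cmod (1 / ?A) \<le> B" using bB[OF jN(1) False] by (simp only: b_def)
      have nz: "?A \<noteq> 0" "?A' \<noteq> 0"
        unfolding e_def using B(2)[OF sj[OF jN(1)] u False] B(2)[OF sj[OF jN(2)] u False] by blast+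
      show ?thesis
      proof -
        have "cmod ?A' * cmod (1 / ?A) \<le> (cmod ?A + E * (2 * pi * U * exp (2 * pi * U) / real M)) * cmod (1 / ?A)"
          using A' by (intro mult_right_mono) auto
        also have "\<dots> = 1 + E * (2 * pi * U * exp (2 * pi * U) / real M) * cmod (1 / ?A)"
          using nz by (simp add: norm_divide field_simps)
        also have "\<dots> \<le> 1 + E * (2 * pi * U * exp (2 * pi * U) / real M) * B"
          using bj U by (intro add_left_mono mult_left_mono) (auto simp: E_def)
        also have "\<dots> = 1 + L / real M" by (simp add: L_def)
        finally have "cmod ?A' * cmod (1 / ?A) \<le> 1 + L / real M" .
        then have "cmod (1 / ?A) \<le> (1 + L / real M) / cmod ?A'" using nz by (simp add: pos_le_divide_eq mult.commute)
        then show ?thesis unfolding b_def by (simp add: norm_divide)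
      qed
    qed
    have "(\<Prod>i<M*k. b (Suc i)) = (\<Prod>m<M. \<Prod>i\<in>{m*k..<m*k+k}. b (Suc i))"
      by (rule prod.nat_group[symmetric])
    also have "\<dots> \<le> (\<Prod>m<M. (1 + L / real M) ^ k * cmod (1 / (1 - exp (2 * of_real pi * \<i> * (of_nat (Suc m) * u / of_nat M)))))"
    proof (intro prod_mono conjI)
      fix m assume m: "m \<in> {..<M}"
      show "0 \<le> (\<Prod>i\<in>{m*k..<m*k+k}. b (Suc i))" by (intro prod_nonneg) (simp add: b_def)
      have "(\<Prod>i\<in>{m*k..<m*k+k}. b (Suc i)) \<le> (\<Prod>i\<in>{m*k..<m*k+k}. (1 + L / real M) * cmod (1 / (1 - ?z ^ Suc i * e (k * Suc m))))"
        using m by (intro prod_mono conjI step) (auto simp: b_def)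
      also have "\<dots> = (1 + L / real M) ^ k * cmod (1 / (\<Prod>i\<in>{m*k..<m*k+k}. 1 - ?z ^ Suc i * e (k * Suc m)))"
        by (simp add: prod.distrib prod_dividef prod_norm[symmetric] norm_divide)
      also have "(\<Prod>i\<in>{m*k..<m*k+k}. 1 - ?z ^ Suc i * e (k * Suc m)) = 1 - e (k * Suc m) ^ k"
        by (rule prod_block_roots_unity[OF hk k]) (simp add: e_def)
      also have "e (k * Suc m) ^ k = exp (2 * of_real pi * \<i> * (of_nat (Suc m) * u / of_nat M))"
      proof -
        have "of_nat k * (2 * of_real pi * \<i> * (of_real (real (k * Suc m) / real (k * M)) * u / of_nat k)) = 2 * of_real pi * \<i> * (of_nat (Suc m) * u / of_nat M)"
          using k by (simp del: of_nat_Suc mult_Suc_right)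
        then show ?thesis unfolding e_def by (simp only: exp_of_nat_mult[symmetric])
      qed
      finally show "(\<Prod>i\<in>{m*k..<m*k+k}. b (Suc i)) \<le> (1 + L / real M) ^ k * cmod (1 / (1 - exp (2 * of_real pi * \<i> * (of_nat (Suc m) * u / of_nat M))))" .
    qed
    also have "\<dots> = ((1 + L / real M) ^ k) ^ M * cmod (euler_prod M u)"
    proof -
      have "(\<Prod>m<M. cmod (1 / (1 - exp (2 * of_real pi * \<i> * (of_nat (Suc m) * u / of_nat M))))) = cmod (euler_prod M u)"
        unfolding euler_prod_def prod_norm[symmetric]
        by (rule prod.reindex_bij_witness[of _ "\<lambda>j. j - 1" Suc]) auto
      then show ?thesis by (simp only: prod.distrib prod_constant card_lessThan)
    qed
    also have "\<dots> \<le> exp (L * real k) * cmod (euler_prod M u)"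
    proof (intro mult_right_mono)
      have "((1 + L / real M) ^ k) ^ M = ((1 + L / real M) ^ M) ^ k" by (simp only: power_mult[symmetric] mult.commute)
      also have "\<dots> \<le> (exp L) ^ k"
      proof (intro power_mono)
        have "(1 + L / real M) ^ M \<le> exp (L / real M) ^ M" using L by (intro power_mono exp_ge_add_one_self) auto
        also have "\<dots> = exp L" using M by (simp add: exp_of_nat_mult[symmetric])
        finally show "(1 + L / real M) ^ M \<le> exp L" .
      qed (use L in auto)
      also have "\<dots> = exp (L * real k)" by (simp add: exp_of_nat_mult[symmetric] mult.commute)
      finally show "((1 + L / real M) ^ k) ^ M \<le> exp (L * real k)" .
    qed simp
    finally have p1: "(\<Prod>i<M*k. b (Suc i)) \<le> exp (L * real k) * cmod (euler_prod M u)" .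
    \<comment> \<open>The incomplete last block has fewer than \<open>k\<close> factors, and none of
      its indices is divisible by \<open>k\<close>.\<close>
    have p2: "(\<Prod>j\<in>{Suc (M*k)..N}. b j) \<le> (B + 1) ^ k"
    proof -
      have "(\<Prod>j\<in>{Suc (M*k)..N}. b j) \<le> (\<Prod>j\<in>{Suc (M*k)..N}. B + 1)"
      proof (intro prod_mono conjI)
        fix j assume j: "j \<in> {Suc (M*k)..N}"
        have "\<not> k dvd j"
        proof
          assume "k dvd j"
          then obtain t where "j = k * t" by blast
          then have "Suc (M * k) \<le> k * t" "k * t \<le> N" using j by auto
          moreover have "k * Suc M = k * M + k" by simp
          ultimately have "k * M < k * t" "k * t < k * Suc M" using kM mult.commute[of M k] by linarith+
          then have "M < t" "t < Suc M" by (simp_all only: mult_less_cancel1)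
          then show False by simp
        qed
        then show "b j \<le> B + 1" using bB[of j] j by simp
      qed (simp add: b_def)
      also have "\<dots> = (B + 1) ^ (N - M * k)" by simp
      also have "\<dots> \<le> (B + 1) ^ k" using kM B by (intro power_increasing) (auto simp: mult.commute)
      finally show ?thesis .
    qed
    have "cmod (\<Prod>j=1..N. 1 / (1 - local_param (h, k) (real (k\<^sup>2 * M)) u ^ j)) = (\<Prod>j=1..N. b j)"
      unfolding q b_def prod_norm ..
    also have "\<dots> = (\<Prod>j=1..M*k. b j) * (\<Prod>j\<in>{Suc (M*k)..N}. b j)"
      using kM by (subst prod.union_disjoint[symmetric]) (auto intro!: prod.cong simp: mult.commute)
    also have "(\<Prod>j=1..M*k. b j) = (\<Prod>i<M*k. b (Suc i))"
      by (rule prod.reindex_bij_witness[of _ Suc "\<lambda>j. j - 1"]) auto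
    also have "(\<Prod>i<M*k. b (Suc i)) * (\<Prod>j\<in>{Suc (M*k)..N}. b j) \<le> (exp (L * real k) * cmod (euler_prod M u)) * (B + 1) ^ k"
      using B by (intro mult_mono p1 p2 prod_nonneg) (auto simp: b_def)
    finally show "cmod (\<Prod>j=1..N. 1 / (1 - local_param (h, k) (real (k\<^sup>2 * (N div k))) u ^ j)) \<le> ?C * cmod (euler_prod (N div k) u)"
      unfolding M_def[symmetric] by (simp only: mult_ac)
  qed
qed

section \<open>Symmetric loops\<close>

text \<open>\<open>L\<close> plays the part of the length of \<open>g\<close>. Taking the integral
  estimate itself as the definition makes it stable under joining, reversal and reflection without
  differentiating the path.\<close>

definition path_bound :: "complex set \<Rightarrow> (real \<Rightarrow> complex) \<Rightarrow> real \<Rightarrow> bool" where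
  "path_bound S g L \<longleftrightarrow> valid_path g \<and> path_image g \<subseteq> S \<and> L \<ge> 0 \<and>
     (\<forall>f B. f holomorphic_on S \<longrightarrow> (\<forall>z\<in>path_image g. cmod (f z) \<le> B) \<longrightarrow> cmod (contour_integral g f) \<le> L * B)"

lemma path_boundD:
  assumes "path_bound S g L" "f holomorphic_on S" "\<And>z. z \<in> path_image g \<Longrightarrow> cmod (f z) \<le> B"
  shows "cmod (contour_integral g f) \<le> L * B"
  using assms unfolding path_bound_def by blast

lemma path_bound_linepath:
  assumes "closed_segment a b \<subseteq> S"
  shows "path_bound S (linepath a b) (cmod (b - a))"
  unfolding path_bound_def
proof (intro conjI allI impI)
  fix f B assume f: "f holomorphic_on S" and B: "\<forall>z\<in>path_image (linepath a b). cmod (f z) \<le> B"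
  have "f contour_integrable_on linepath a b"
    by (intro contour_integrable_continuous_linepath continuous_on_subset[OF holomorphic_on_imp_continuous_on[OF f] assms])
  moreover have "0 \<le> B" using B order_trans[OF norm_ge_zero] by force
  ultimately have "cmod (contour_integral (linepath a b) f) \<le> B * cmod (b - a)"
    using B by (intro contour_integral_bound_linepath) auto
  then show "cmod (contour_integral (linepath a b) f) \<le> cmod (b - a) * B" by (simp add: mult.commute)
qed (use assms in auto)

lemma path_bound_join:
  assumes S: "open S" and g: "path_bound S g1 L1" "path_bound S g2 L2" "pathfinish g1 = pathstart g2"
  shows "path_bound S (g1 +++ g2) (L1 + L2)"
  unfolding path_bound_def
proof (intro conjI allI impI)
  have v: "valid_path g1" "valid_path g2" "path_image g1 \<subseteq> S" "path_image g2 \<subseteq> S"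
    using g unfolding path_bound_def by auto
  show "valid_path (g1 +++ g2)" using v g by (intro valid_path_join)
  show "path_image (g1 +++ g2) \<subseteq> S" using v path_image_join_subset by blast
  show "0 \<le> L1 + L2" using g unfolding path_bound_def by auto
  fix f B assume f: "f holomorphic_on S" and B: "\<forall>z\<in>path_image (g1 +++ g2). cmod (f z) \<le> B"
  have "contour_integral (g1 +++ g2) f = contour_integral g1 f + contour_integral g2 f"
    by (intro contour_integral_join contour_integrable_holomorphic_simple[OF f S] v)
  moreover have "cmod (contour_integral g1 f) \<le> L1 * B" "cmod (contour_integral g2 f) \<le> L2 * B"
    using B g(3) by (auto intro!: path_boundD[OF g(1) f] path_boundD[OF g(2) f] simp: path_image_join)
  ultimately show "cmod (contour_integral (g1 +++ g2) f) \<le> (L1 + L2) * B"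
    using norm_triangle_ineq[of "contour_integral g1 f" "contour_integral g2 f"] by (simp add: distrib_right)
qed

lemma path_bound_reversepath:
  assumes "path_bound S g L"
  shows "path_bound S (reversepath g) L"
  using assms unfolding path_bound_def by (auto simp: contour_integral_reversepath)

lemma path_bound_negate:
  assumes g: "path_bound S g L" and S: "\<And>z. z \<in> S \<Longrightarrow> - z \<in> S"
  shows "path_bound S (uminus \<circ> g) L"
  unfolding path_bound_def
proof (intro conjI allI impI)
  have v: "valid_path g" "path_image g \<subseteq> S" "L \<ge> 0" using g unfolding path_bound_def by auto
  show "valid_path (uminus \<circ> g)" using v by (intro valid_path_negatepath)
  show "path_image (uminus \<circ> g) \<subseteq> S" using v S by (auto simp: path_image_compose)
  fix f B assume f: "f holomorphic_on S" and B: "\<forall>z\<in>path_image (uminus \<circ> g). cmod (f z) \<le> B"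
  have "(f \<circ> uminus) holomorphic_on S"
    by (rule holomorphic_on_compose_gen[OF _ f]) (use S in \<open>auto intro!: holomorphic_intros\<close>)
  then have h: "(\<lambda>x. f (- x)) holomorphic_on S" by (simp add: o_def)
  have "cmod (contour_integral g (\<lambda>x. f (- x))) \<le> L * B"
    using B by (intro path_boundD[OF g h]) (auto simp: path_image_compose)
  then show "cmod (contour_integral (uminus \<circ> g) f) \<le> L * B"
    using v(1) by (simp add: contour_integral_negatepath)
qed (use g in \<open>auto simp: path_bound_def\<close>)

lemma path_bound_cnj:
  assumes g: "path_bound S g L" and S: "open S" "cnj ` S = S"
  shows "path_bound S (cnj \<circ> g) L"
  unfolding path_bound_def
proof (intro conjI allI impI)
  have v: "valid_path g" "path_image g \<subseteq> S" "L \<ge> 0" using g unfolding path_bound_def by auto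
  show "valid_path (cnj \<circ> g)" using v by (simp add: valid_path_cnj)
  show "path_image (cnj \<circ> g) \<subseteq> S" using v S by (auto simp: path_image_compose)
  fix f B assume f: "f holomorphic_on S" and B: "\<forall>z\<in>path_image (cnj \<circ> g). cmod (f z) \<le> B"
  have h: "(cnj \<circ> f \<circ> cnj) holomorphic_on S"
    using f S by (intro holomorphic_on_compose_cnj_cnj) auto
  have "cmod (contour_integral g (cnj \<circ> f \<circ> cnj)) \<le> L * B"
    using B by (intro path_boundD[OF g h]) (auto simp: path_image_compose)
  then show "cmod (contour_integral (cnj \<circ> g) f) \<le> L * B"
    by (simp only: contour_integral_cnj[OF v(1)] complex_mod_cnj)
qed (use g in \<open>auto simp: path_bound_def\<close>)

definition mirror_path :: "(real \<Rightarrow> complex) \<Rightarrow> real \<Rightarrow> complex" where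
  "mirror_path g = reversepath (uminus \<circ> (cnj \<circ> g))"

definition upper_path :: "(real \<Rightarrow> complex) \<Rightarrow> real \<Rightarrow> complex" where
  "upper_path g = g +++ mirror_path g"

definition loop_path :: "(real \<Rightarrow> complex) \<Rightarrow> real \<Rightarrow> complex" where
  "loop_path g = upper_path g +++ (uminus \<circ> upper_path g)"

lemma path_image_mirror: "path_image (mirror_path g) = (\<lambda>z. - cnj z) ` path_image g"
  by (simp add: mirror_path_def path_image_compose image_image)

locale symmetric_loop =
  fixes S :: "complex set" and g :: "real \<Rightarrow> complex" and L :: real
  assumes S: "open S" "\<And>z. z \<in> S \<Longrightarrow> - z \<in> S" "cnj ` S = S"
    and g: "path_bound S g L" and fin: "Re (pathfinish g) = 0" and st: "Im (pathstart g) = 0"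
begin

lemma vg: "valid_path g" "path_image g \<subseteq> S"
  using g by (auto simp: path_bound_def)

lemma mirror: "path_bound S (mirror_path g) L"
  unfolding mirror_path_def by (intro path_bound_reversepath path_bound_negate path_bound_cnj g S)

lemma ends: "pathfinish g = pathstart (mirror_path g)" "pathfinish (mirror_path g) = - pathstart g"
  using fin st by (simp_all add: mirror_path_def pathstart_compose pathfinish_compose complex_eq_iff)

lemma upper: "path_bound S (upper_path g) (L + L)"
  unfolding upper_path_def by (intro path_bound_join S g mirror ends)

lemma upper_ends: "pathstart (upper_path g) = pathstart g" "pathfinish (upper_path g) = - pathstart g"
  using ends by (simp_all add: upper_path_def)

lemma loop: "path_bound S (loop_path g) ((L + L) + (L + L))"
proof -
  have "pathfinish (upper_path g) = pathstart (uminus \<circ> upper_path g)"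
    by (simp only: pathstart_compose upper_ends)
  then show ?thesis unfolding loop_path_def by (intro path_bound_join path_bound_negate S upper)
qed

lemma loop_closed: "pathfinish (loop_path g) = pathstart (loop_path g)"
  by (simp add: loop_path_def pathfinish_compose upper_ends)

lemma path_image_upper: "path_image (upper_path g) = path_image g \<union> (\<lambda>z. - cnj z) ` path_image g"
  by (simp add: upper_path_def path_image_join ends(1) path_image_mirror)

lemma path_image_loop: "path_image (loop_path g) = path_image (upper_path g) \<union> uminus ` path_image (upper_path g)"
  by (simp add: loop_path_def path_image_join pathstart_compose upper_ends path_image_compose)

text \<open>Reversal and negation each change the sign of the integral and cancel; what remains of
  the mirrored half is the conjugation.\<close>

lemma contour_integral_upper_sym:
  assumes f: "f holomorphic_on S" and sym: "\<And>z. f (- cnj z) = cnj (f z)"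
  shows "contour_integral (upper_path g) f = contour_integral g f + cnj (contour_integral g f)"
proof -
  have vm: "valid_path (mirror_path g)" "path_image (mirror_path g) \<subseteq> S" using mirror by (auto simp: path_bound_def)
  have vc: "valid_path (cnj \<circ> g)" using vg by (simp add: valid_path_cnj)
  have "contour_integral (upper_path g) f = contour_integral g f + contour_integral (mirror_path g) f"
    unfolding upper_path_def by (intro contour_integral_join contour_integrable_holomorphic_simple[OF f S(1)] vg vm)
  also have "contour_integral (mirror_path g) f = - contour_integral (uminus \<circ> (cnj \<circ> g)) f"
    unfolding mirror_path_def by (intro contour_integral_reversepath valid_path_negatepath vc)
  also have "contour_integral (uminus \<circ> (cnj \<circ> g)) f = - contour_integral (cnj \<circ> g) (\<lambda>x. f (- x))"
    by (rule contour_integral_negatepath[OF vc])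
  also have "contour_integral (cnj \<circ> g) (\<lambda>x. f (- x)) = cnj (contour_integral g (cnj \<circ> (\<lambda>x. f (- x)) \<circ> cnj))"
    by (rule contour_integral_cnj[OF vg(1)])
  also have "cnj \<circ> (\<lambda>x. f (- x)) \<circ> cnj = f" using sym by (auto simp: fun_eq_iff)
  finally show ?thesis by simp
qed

lemma contour_integral_loop:
  assumes f: "f holomorphic_on S"
  shows "contour_integral (loop_path g) f = contour_integral (upper_path g) f - contour_integral (upper_path g) (\<lambda>z. f (- z))"
proof -
  have vu: "valid_path (upper_path g)" "path_image (upper_path g) \<subseteq> S" using upper by (auto simp: path_bound_def)
  have vn: "valid_path (uminus \<circ> upper_path g)" "path_image (uminus \<circ> upper_path g) \<subseteq> S"
    using path_bound_negate[OF upper S(2)] by (auto simp: path_bound_def)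
  have "contour_integral (loop_path g) f = contour_integral (upper_path g) f + contour_integral (uminus \<circ> upper_path g) f"
    unfolding loop_path_def by (intro contour_integral_join contour_integrable_holomorphic_simple[OF f S(1)] vu vn)
  then show ?thesis by (simp add: contour_integral_negatepath[OF vu(1)])
qed

text \<open>For nonzero u in the closed upper half plane - i u has nonnegative real part, so Ln (- i
  u) is a primitive of 1/u. The upper half of the loop contributes i pi, and the negated half the
  same.\<close>

lemma has_contour_integral_loop_inverse:
  assumes im: "\<And>z. z \<in> path_image g \<Longrightarrow> Im z \<ge> 0" and z: "0 \<notin> S" and pos: "Re (pathstart g) > 0"
  shows "((\<lambda>u. 1 / u) has_contour_integral (2 * of_real pi * \<i>)) (loop_path g)"
proof -
  have f: "(\<lambda>u. 1 / u) holomorphic_on S" using z by (intro holomorphic_intros) auto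
  have vu: "valid_path (upper_path g)" "path_image (upper_path g) \<subseteq> S" using upper by (auto simp: path_bound_def)
  have vl: "valid_path (loop_path g)" "path_image (loop_path g) \<subseteq> S" using loop by (auto simp: path_bound_def)
  let ?b = "pathstart g"
  have b: "?b = of_real (Re ?b)" using st by (simp add: complex_eq_iff)
  have "((\<lambda>u. 1 / u) has_contour_integral Ln (- \<i> * pathfinish (upper_path g)) - Ln (- \<i> * pathstart (upper_path g))) (upper_path g)"
  proof (rule contour_integral_primitive[OF _ vu(1) subset_refl])
    fix x assume x: "x \<in> path_image (upper_path g)"
    have "Im x \<ge> 0" using x im unfolding path_image_upper by auto
    moreover have "x \<noteq> 0" using x vu(2) z by auto
    ultimately have "- \<i> * x \<notin> \<real>\<^sub>\<le>\<^sub>0" by (auto simp: complex_nonpos_Reals_iff complex_eq_iff)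
    then show "((\<lambda>u. Ln (- \<i> * u)) has_field_derivative 1 / x) (at x within path_image (upper_path g))"
      using \<open>x \<noteq> 0\<close> by (auto intro!: derivative_eq_intros simp: field_simps)
  qed
  moreover have "Ln (- \<i> * pathfinish (upper_path g)) - Ln (- \<i> * pathstart (upper_path g)) = \<i> * of_real pi"
  proof -
    have "Ln (of_real (Re ?b) * \<i>) = of_real (ln (Re ?b)) + Ln \<i>"
      using Ln_times_of_real[OF pos, of \<i>] pos by (simp add: Ln_of_real)
    moreover have "Ln (of_real (Re ?b) * (- \<i>)) = of_real (ln (Re ?b)) + Ln (- \<i>)"
      using Ln_times_of_real[OF pos, of "- \<i>"] pos by (simp add: Ln_of_real)
    moreover have "- \<i> * pathfinish (upper_path g) = of_real (Re ?b) * \<i>" "- \<i> * pathstart (upper_path g) = of_real (Re ?b) * (- \<i>)"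
      unfolding upper_ends using b by (simp_all add: complex_eq_iff)
    ultimately have "Ln (- \<i> * pathfinish (upper_path g)) - Ln (- \<i> * pathstart (upper_path g)) = Ln \<i> - Ln (- \<i>)"
      by (simp only: add_diff_cancel_left)
    then show ?thesis by (simp add: field_simps)
  qed
  ultimately have "contour_integral (upper_path g) (\<lambda>u. 1 / u) = \<i> * of_real pi"
    using contour_integral_unique by metis
  moreover have "contour_integral (upper_path g) (\<lambda>u. 1 / - u) = - contour_integral (upper_path g) (\<lambda>u. 1 / u)"
    using contour_integral_neg[of "upper_path g" "\<lambda>u. 1 / u"] by simp
  ultimately have "contour_integral (loop_path g) (\<lambda>u. 1 / u) = 2 * of_real pi * \<i>"
    using contour_integral_loop[OF f] by simp
  moreover have "(\<lambda>u. 1 / u) contour_integrable_on (loop_path g)"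
    by (rule contour_integrable_holomorphic_simple[OF f S(1) vl])
  ultimately show ?thesis using has_contour_integral_integral by metis
qed

end

lemma closed_segment_ray:
  assumes "a \<le> b" "x \<in> closed_segment (of_real a * z) (of_real b * z)"
  shows "\<exists>r\<in>{a..b}. x = of_real r * (z::complex)"
proof -
  obtain t where t: "0 \<le> t" "t \<le> 1" "x = (1 - t) *\<^sub>R (of_real a * z) + t *\<^sub>R (of_real b * z)"
    using assms(2) unfolding in_segment by blast
  have "x = of_real (a + t * (b - a)) * z" unfolding t(3) by (simp add: scaleR_conv_of_real algebra_simps)
  moreover have "t * (b - a) \<le> 1 * (b - a)" using t assms(1) by (intro mult_right_mono) auto
  moreover have "0 \<le> t * (b - a)" using t assms(1) by simp
  ultimately have "a + t * (b - a) \<in> {a..b}" "x = of_real (a + t * (b - a)) * z" by simp_all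
  then show ?thesis by blast
qed

definition low_phase :: "complex set" where
  "low_phase = {u. Im u \<ge> 0 \<and> Re (phase u) < Re (phase z0)}"

text \<open>The head goes from 1 - \<eta> to 1 + i \<eta>, up the line Re u = 1 to the ray through
  \<open>z0\<close>, then along the ray. The tail follows the ray to Re u = 5 and two sides of a
  square to 5 i. The gap around \<open>z0\<close> is left to Laplace's method.\<close>

lemma saddle_contour:
  assumes d0: "d0 > 0"
  shows "\<exists>c \<delta> head tail L1 L2. 0 < c \<and> c < 1 \<and> 0 < \<delta> \<and> \<delta> < d0 \<and> \<delta> < 1 \<and>
     path_bound (slit_plane c - {0}) head L1 \<and> path_bound (slit_plane c - {0}) tail L2 \<and>
     Im (pathstart head) = 0 \<and> Re (pathstart head) > 0 \<and> pathfinish head = of_real (1 - \<delta>) * z0 \<and>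
     pathstart tail = of_real (1 + \<delta>) * z0 \<and> Re (pathfinish tail) = 0 \<and>
     path_image head \<subseteq> low_phase \<and> path_image tail \<subseteq> low_phase"
proof -
  obtain \<eta> where \<eta>: "0 < \<eta>" "\<eta> < 1/2" "\<eta> < Im z0 / Re z0"
      "\<And>u. Im u \<ge> 0 \<Longrightarrow> cmod (u - 1) \<le> \<eta> \<Longrightarrow> Re (phase u) < Re (phase z0)"
    using Re_phase_near_1 by blast
  define \<kappa> where "\<kappa> = Im z0 / Re z0"
  \<comment> \<open>A value strictly between the starting point 1 - \<eta> and the first pole 1. The
    slack below 1 also allows for N that are not multiples of k.\<close>
  define c where "c = 1 - \<eta> / 2"
  \<comment> \<open>The last entry keeps (1 - \<delta>) z0 from falling left of the line Re u = 1,
    where \<open>Re_phase_ray\<close> stops.\<close>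
  define \<delta> where "\<delta> = min (1/2) (min (d0 / 2) (1 - 1 / Re z0))"
  have x0: "1 < Re z0" "Re z0 < 5/4" by (fact Re_z0_bounds)+
  have y0: "0 < Im z0" "Im z0 \<le> 265/1000" by (fact Im_z0_bounds)+
  have \<kappa>: "0 < \<kappa>" "\<kappa> \<le> 1" using x0 y0 by (simp_all add: \<kappa>_def field_simps)
  have c: "0 < c" "c < 1" using \<eta> by (simp_all add: c_def)
  have "1 - 1 / Re z0 > 0" using x0 by simp
  then have \<delta>: "0 < \<delta>" "\<delta> < d0" "\<delta> \<le> 1/2" "\<delta> \<le> 1 - 1 / Re z0"
    using d0 unfolding \<delta>_def by linarith+
  let ?S = "slit_plane c - {0}"
  have S: "open ?S" using open_slit_plane by (intro open_delete)
  have upS: "u \<in> ?S" if "Im u > 0" for u using that in_slit_plane_upper[OF that] by auto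
  have ray: "closed_segment (of_real a * z0) (of_real b * z0) \<subseteq> ?S \<inter> low_phase"
    if ab: "1 / Re z0 \<le> a" "a \<le> b" "1 \<notin> {a..b}" for a b
  proof
    fix u assume "u \<in> closed_segment (of_real a * z0) (of_real b * z0)"
    then obtain r where r: "r \<in> {a..b}" "u = of_real r * z0" using closed_segment_ray ab by blast
    have "1 / Re z0 \<le> r" using r ab by simp
    then have r1: "1 \<le> r * Re z0" using x0 by (simp add: field_simps)
    have "0 < 1 / Re z0" using x0 by simp
    then have "r > 0" using \<open>1 / Re z0 \<le> r\<close> by linarith
    then have "Im u > 0" using y0 r by simp
    moreover have "r \<noteq> 1" using r ab by auto
    then have "Re (phase u) < Re (phase z0)" unfolding r(2) using r1 by (intro Re_phase_ray)
    ultimately show "u \<in> ?S \<inter> low_phase" using upS by (auto simp: low_phase_def)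
  qed
  have k1: "of_real (1 / Re z0) * z0 = Complex 1 \<kappa>" "of_real (5 / Re z0) * z0 = Complex 5 (5 * \<kappa>)"
    using x0 by (simp_all add: complex_eq_iff \<kappa>_def)
  have s1: "closed_segment (of_real (1 - \<eta>)) (Complex 1 \<eta>) \<subseteq> ?S \<inter> low_phase"
  proof
    fix u assume "u \<in> closed_segment (of_real (1 - \<eta>)) (Complex 1 \<eta>)"
    then obtain t where t: "0 \<le> t" "t \<le> 1" "u = (1 - t) *\<^sub>R of_real (1 - \<eta>) + t *\<^sub>R Complex 1 \<eta>"
      unfolding in_segment by blast
    have u: "Re u = 1 - \<eta> + t * \<eta>" "Im u = t * \<eta>" unfolding t(3) by (simp_all add: algebra_simps)
    have "u - 1 = of_real ((t - 1) * \<eta>) + \<i> * of_real (t * \<eta>)" using u by (simp add: complex_eq_iff algebra_simps)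
    then have "cmod (u - 1) \<le> \<bar>(t - 1) * \<eta>\<bar> + \<bar>t * \<eta>\<bar>"
      using norm_triangle_ineq[of "complex_of_real ((t - 1) * \<eta>)" "\<i> * of_real (t * \<eta>)"]
      by (simp only: norm_mult norm_of_real norm_ii mult_1)
    also have "\<dots> = \<eta>" using t \<eta> by (simp add: abs_mult algebra_simps)
    finally have "Re (phase u) < Re (phase z0)" using t \<eta> u by (intro \<eta>(4)) auto
    moreover have "u \<in> ?S"
    proof (cases "t = 0")
      case True
      then have "u = of_real (1 - \<eta>)" using t by simp
      moreover have "0 < 1 - \<eta>" "1 - \<eta> < c" using \<eta> by (simp_all add: c_def)
      ultimately show ?thesis by (simp add: slit_plane_def)
    qed (use t \<eta> u in \<open>intro upS; simp\<close>)
    ultimately show "u \<in> ?S \<inter> low_phase" using u t \<eta> by (simp add: low_phase_def)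
  qed
  have s2: "closed_segment (Complex 1 \<eta>) (Complex 1 \<kappa>) \<subseteq> ?S \<inter> low_phase"
  proof
    fix u assume "u \<in> closed_segment (Complex 1 \<eta>) (Complex 1 \<kappa>)"
    then have "Re u = 1" "Im u \<in> closed_segment \<eta> \<kappa>" by (simp_all add: closed_segment_same_Re)
    then have "u = Complex 1 (Im u)" "\<eta> \<le> Im u" "Im u \<le> \<kappa>"
      using \<eta>(3) by (auto simp: complex_eq_iff closed_segment_eq_real_ivl \<kappa>_def)
    then show "u \<in> ?S \<inter> low_phase"
      using Re_phase_vertical[of "Im u"] upS[of u] \<eta> unfolding low_phase_def \<kappa>_def by auto
  qed
  have s4: "closed_segment (Complex 5 (5 * \<kappa>)) (Complex 5 5) \<subseteq> ?S \<inter> low_phase"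
  proof
    fix u assume "u \<in> closed_segment (Complex 5 (5 * \<kappa>)) (Complex 5 5)"
    then have "Re u = 5" "Im u \<in> closed_segment (5 * \<kappa>) 5" by (simp_all add: closed_segment_same_Re)
    then have "Re u = 5" "5 * \<kappa> \<le> Im u" "Im u \<le> 5"
      using \<kappa> by (auto simp: closed_segment_eq_real_ivl)
    then show "u \<in> ?S \<inter> low_phase"
      using Re_phase_outer[of u] upS[of u] \<kappa> unfolding low_phase_def \<kappa>_def by auto
  qed
  have s5: "closed_segment (Complex 5 5) (Complex 0 5) \<subseteq> ?S \<inter> low_phase"
  proof
    fix u assume "u \<in> closed_segment (Complex 5 5) (Complex 0 5)"
    then have "Im u = 5" "Re u \<in> closed_segment 5 0" by (simp_all add: closed_segment_same_Im)
    then have "Im u = 5" "0 \<le> Re u" "Re u \<le> 5"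
      by (auto simp: closed_segment_eq_real_ivl)
    then show "u \<in> ?S \<inter> low_phase"
      using Re_phase_outer[of u] upS[of u] unfolding low_phase_def by auto
  qed
  define head where "head = linepath (of_real (1 - \<eta>)) (Complex 1 \<eta>) +++ (linepath (Complex 1 \<eta>) (Complex 1 \<kappa>) +++ linepath (Complex 1 \<kappa>) (of_real (1 - \<delta>) * z0))"
  define tail where "tail = linepath (of_real (1 + \<delta>) * z0) (Complex 5 (5 * \<kappa>)) +++ (linepath (Complex 5 (5 * \<kappa>)) (Complex 5 5) +++ linepath (Complex 5 5) (Complex 0 5))"
  have r1: "closed_segment (Complex 1 \<kappa>) (of_real (1 - \<delta>) * z0) \<subseteq> ?S \<inter> low_phase"
    unfolding k1[symmetric] using \<delta> by (intro ray) auto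
  have "4 \<le> 5 / Re z0" using x0 by (simp add: field_simps)
  moreover have "1 / Re z0 \<le> 1" using x0 by simp
  ultimately have r2: "closed_segment (of_real (1 + \<delta>) * z0) (Complex 5 (5 * \<kappa>)) \<subseteq> ?S \<inter> low_phase"
    unfolding k1[symmetric] using \<delta> by (intro ray) auto
  have "\<exists>L1. path_bound ?S head L1" unfolding head_def
    by (rule exI, rule path_bound_join[OF S path_bound_linepath path_bound_join[OF S path_bound_linepath path_bound_linepath]])
       (use s1 s2 r1 in simp_all)
  moreover have "\<exists>L2. path_bound ?S tail L2" unfolding tail_def
    by (rule exI, rule path_bound_join[OF S path_bound_linepath path_bound_join[OF S path_bound_linepath path_bound_linepath]])
       (use s4 s5 r2 in simp_all)
  moreover have "path_image head \<subseteq> low_phase" "path_image tail \<subseteq> low_phase"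
    using s1 s2 r1 s4 s5 r2 by (simp_all add: head_def tail_def path_image_join)
  moreover have "Im (pathstart head) = 0" "Re (pathstart head) > 0" "pathfinish head = of_real (1 - \<delta>) * z0"
     "pathstart tail = of_real (1 + \<delta>) * z0" "Re (pathfinish tail) = 0" "\<delta> < 1"
    using \<eta> \<delta> by (simp_all add: head_def tail_def)
  ultimately show ?thesis using c \<delta> by blast
qed

section \<open>The saddle point\<close>

text \<open>Below this radius |x z0| < Im z0, so (1 + x) z0 stays in the open upper half
  plane.\<close>

definition saddle_radius :: real where
  "saddle_radius = Im z0 / cmod z0"

lemma saddle_radius_pos: "0 < saddle_radius"
  using Im_z0_bounds z0_nonzero by (simp add: saddle_radius_def)

lemma Im_saddle_ball:
  assumes "x \<in> ball 0 saddle_radius"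
  shows "0 < Im ((1 + x) * z0)"
proof -
  have "cmod (x * z0) < saddle_radius * cmod z0"
    using assms z0_nonzero by (simp add: norm_mult)
  then have "cmod (x * z0) < Im z0" using z0_nonzero by (simp add: saddle_radius_def)
  then have "- Im z0 < Im (x * z0)" using abs_Im_le_cmod[of "x * z0"] by linarith
  then show ?thesis by (simp add: distrib_right)
qed

text \<open>With 1 - w0 = a + i b in the first quadrant and z0 = x + i y, the sign is that of - (x b
  + y (a - a^2) - y b^2); here a < 1 and y b^2 \<le> b < x b.\<close>

lemma saddle_coeff_negative: "Re (of_real pi * \<i> * z0 * (1 - w0) / w0) < 0"
proof -
  define a b where "a = Re (1 - w0)" and "b = Im (1 - w0)"
  have ab: "0 < a" "0 < b" using one_minus_w0_bounds by (auto simp: a_def b_def)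
  have lt: "a < 1" "b < 1"
    using one_minus_w0_bounds(2) complex_Re_le_cmod[of "1 - w0"] abs_Im_le_cmod[of "1 - w0"]
    by (simp_all add: a_def b_def)
  have w: "w0 = Complex (1 - a) (- b)" by (simp add: complex_eq_iff a_def b_def)
  define q where "q = z0 * (1 - w0) * cnj w0"
  have "z0 * (1 - w0) / w0 = q / of_real ((cmod w0)\<^sup>2)"
    using complex_div_cnj[of "z0 * (1 - w0)" w0] by (simp add: q_def)
  then have "of_real pi * \<i> * (z0 * (1 - w0) / w0) = of_real (pi / (cmod w0)\<^sup>2) * (\<i> * q)"
    by simp
  then have "of_real pi * \<i> * z0 * (1 - w0) / w0 = of_real (pi / (cmod w0)\<^sup>2) * (\<i> * q)"
    by (simp add: mult.assoc)
  then have "Re (of_real pi * \<i> * z0 * (1 - w0) / w0) = Re (of_real (pi / (cmod w0)\<^sup>2) * (\<i> * q))"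
    by (rule arg_cong)
  also have "\<dots> = - (pi * (Im q / (cmod w0)\<^sup>2))" by simp
  finally have "Re (of_real pi * \<i> * z0 * (1 - w0) / w0) = - (pi * (Im (z0 * (1 - w0) * cnj w0) / (cmod w0)\<^sup>2))"
    unfolding q_def .
  moreover have "0 < Im (z0 * (1 - w0) * cnj w0)"
  proof -
    have "Im (z0 * (1 - w0) * cnj w0) = Re z0 * b + Im z0 * (a - a * a) - Im z0 * (b * b)"
      unfolding w by (simp add: algebra_simps)
    moreover have "a * a \<le> a * 1" using ab lt by (intro mult_left_mono) auto
    then have "0 \<le> Im z0 * (a - a * a)" using Im_z0_bounds by simp
    moreover have "Im z0 * (b * b) \<le> 1 * (b * 1)" using Im_z0_bounds ab lt by (intro mult_mono) auto
    moreover have "1 * b < Re z0 * b" using Re_z0_bounds ab by (intro mult_strict_right_mono) auto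
    ultimately show ?thesis by linarith
  qed
  then have "0 < pi * (Im (z0 * (1 - w0) * cnj w0) / (cmod w0)\<^sup>2)"
    using one_minus_w0_nonzero by simp
  ultimately show ?thesis by linarith
qed

text \<open>The function E x = (1 + x) (phase ((1 + x) z0) - phase z0) has a logarithm as
  derivative, and this vanishes at 0 because phase z0 = - Ln w0. Using \<open>E\<close> avoids
  differentiating the quotient in \<open>phase\<close>; half its second derivative at 0 is the
  coefficient.\<close>

lemma phase_near_saddle:
  obtains k where "k holomorphic_on ball 0 saddle_radius" "k 0 = of_real pi * \<i> * z0 * (1 - w0) / w0"
    "\<And>x. x \<in> ball 0 saddle_radius \<Longrightarrow> phase ((1 + x) * z0) = phase z0 + x\<^sup>2 * k x"
proof -
  define c where "c = 2 * of_real pi * \<i> * z0"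
  have c0: "c \<noteq> 0" using z0_nonzero by (simp add: c_def)
  have ec: "exp c = 1 - w0" unfolding c_def by (rule exp_z0)
  let ?B = "ball (0::complex) saddle_radius"
  define E where "E = (\<lambda>x. (dilog (exp (c * (1 + x))) - of_real (pi^2/6)) / c - (1 + x) * phase z0)"
  define E' where "E' = (\<lambda>x. - Ln (1 - exp (c * (1 + x))) - phase z0)"
  have ez: "exp (c * (1 + x)) = exp (2 * of_real pi * \<i> * ((1 + x) * z0))" for x
    by (simp add: c_def mult_ac)
  have zB: "0 \<in> ?B" using saddle_radius_pos by simp
  have x1: "1 + x \<noteq> 0" if "x \<in> ?B" for x
  proof
    assume "1 + x = 0"
    then show False using Im_saddle_ball[OF that] by simp
  qed
  have phaseE: "phase ((1 + x) * z0) = phase z0 + E x / (1 + x)" if "x \<in> ?B" for x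
  proof -
    have "phase ((1 + x) * z0) = (dilog (exp (c * (1 + x))) - of_real (pi^2/6)) / (c * (1 + x))"
      unfolding phase_def ez by (simp add: c_def mult_ac)
    also have "\<dots> = ((dilog (exp (c * (1 + x))) - of_real (pi^2/6)) / c) / (1 + x)" by simp
    also have "(dilog (exp (c * (1 + x))) - of_real (pi^2/6)) / c = E x + (1 + x) * phase z0" by (simp add: E_def)
    finally show ?thesis using x1[OF that] by (simp add: add_divide_distrib)
  qed
  have dE: "(E has_field_derivative E' x) (at x)" if x: "x \<in> ?B" for x
  proof -
    have "Im ((1 + x) * z0) > 0" using x by (rule Im_saddle_ball)
    then have d: "exp (c * (1 + x)) \<in> dilog_dom" unfolding ez by (rule one_minus_exp_upper)
    have "((\<lambda>x. dilog (exp (c * (1 + x)))) has_field_derivative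
       (- Ln (1 - exp (c * (1 + x))) / exp (c * (1 + x))) * (exp (c * (1 + x)) * c)) (at x)"
      by (rule DERIV_chain2[where f = dilog and g = "\<lambda>x. exp (c * (1 + x))", OF has_field_derivative_dilog[OF d]]) (auto intro!: derivative_eq_intros)
    then have "((\<lambda>x. dilog (exp (c * (1 + x)))) has_field_derivative - Ln (1 - exp (c * (1 + x))) * c) (at x)"
      by simp
    from DERIV_diff[OF DERIV_cdivide[OF DERIV_diff[OF this DERIV_const[of "of_real (pi^2/6)"]], of c]
        DERIV_mult[OF DERIV_add[OF DERIV_const[of 1] DERIV_ident] DERIV_const[of "phase z0"]]]
    show ?thesis unfolding E_def E'_def using c0 by simp
  qed
  have E0: "E 0 = 0" using phaseE[OF zB] by simp
  have E'0: "E' 0 = 0" by (simp add: E'_def ec phase_z0)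
  have dE': "(E' has_field_derivative c * (1 - w0) / w0) (at 0)"
  proof -
    have "Im ((1 + 0) * z0) > 0" using zB by (rule Im_saddle_ball)
    then have "1 - exp (c * (1 + 0)) \<notin> \<real>\<^sub>\<le>\<^sub>0" unfolding ez by (rule one_minus_exp_upper)
    then have "(E' has_field_derivative - (inverse (1 - exp (c * (1 + 0))) * (0 - exp (c * (1 + 0)) * c)) - 0) (at 0)"
      unfolding E'_def by (auto intro!: derivative_eq_intros)
    then show ?thesis by (simp add: ec divide_inverse mult_ac)
  qed
  have hE: "E holomorphic_on ?B"
    unfolding holomorphic_on_open[OF open_ball] using dE by blast
  obtain \<theta> where \<theta>: "\<theta> holomorphic_on ?B" "\<And>x. x \<in> ?B \<Longrightarrow> E x = E 0 + deriv E 0 * x + x\<^sup>2 * \<theta> x"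
    using quadratic_remainder[OF hE saddle_radius_pos] by blast
  have "deriv E 0 = 0" using DERIV_imp_deriv[OF dE[OF zB]] E'0 by simp
  then have \<theta>E: "E x = x\<^sup>2 * \<theta> x" if "x \<in> ?B" for x using \<theta>(2)[OF that] E0 by simp
  have \<theta>0: "2 * \<theta> 0 = c * (1 - w0) / w0"
  proof -
    have d\<theta>: "(\<theta> has_field_derivative deriv \<theta> x) (at x)" if "x \<in> ?B" for x
      using holomorphic_derivI[OF \<theta>(1) open_ball that] .
    have eq: "E' x = 2 * x * \<theta> x + x\<^sup>2 * deriv \<theta> x" if x: "x \<in> ?B" for x
    proof -
      have "((\<lambda>x. x\<^sup>2 * \<theta> x) has_field_derivative 2 * x * \<theta> x + x\<^sup>2 * deriv \<theta> x) (at x)"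
        using d\<theta>[OF x] by (auto intro!: derivative_eq_intros)
      then have "(E has_field_derivative 2 * x * \<theta> x + x\<^sup>2 * deriv \<theta> x) (at x)"
        by (rule has_field_derivative_transform_within_open[OF _ open_ball x]) (simp add: \<theta>E)
      then show ?thesis using dE[OF x] DERIV_unique by blast
    qed
    have "(deriv \<theta> has_field_derivative deriv (deriv \<theta>) 0) (at 0)"
      by (rule holomorphic_derivI[OF holomorphic_deriv[OF \<theta>(1) open_ball] open_ball zB])
    then have "((\<lambda>x. 2 * x * \<theta> x + x\<^sup>2 * deriv \<theta> x) has_field_derivative 2 * \<theta> 0) (at 0)"
      using d\<theta>[OF zB] by (auto intro!: derivative_eq_intros)
    then have "(E' has_field_derivative 2 * \<theta> 0) (at 0)"
      by (rule has_field_derivative_transform_within_open[OF _ open_ball zB]) (simp add: eq)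
    then show ?thesis using dE' DERIV_unique by blast
  qed
  show ?thesis
  proof (rule that)
    show "(\<lambda>x. \<theta> x / (1 + x)) holomorphic_on ?B" by (intro holomorphic_intros \<theta>) (use x1 in auto)
    show "\<theta> 0 / (1 + 0) = of_real pi * \<i> * z0 * (1 - w0) / w0" 
    proof -
      have "\<theta> 0 = c * (1 - w0) / w0 / 2"
        unfolding \<theta>0[symmetric] by (rule nonzero_mult_div_cancel_left[symmetric]) simp
      then show ?thesis by (simp add: c_def)
    qed
    show "phase ((1 + x) * z0) = phase z0 + x\<^sup>2 * (\<theta> x / (1 + x))" if "x \<in> ?B" for x
      using phaseE[OF that] \<theta>E[OF that] by simp
  qed
qed

text \<open>Only the sign of the square root is at stake. The signs and sizes of the three arguments
  in \<open>l\<close> give |Im l| < pi/2, so exp l is the principal square root of - 2 k. The minus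
  sign on the right is exp (i pi), from the summand 1 in the definition of
  \<open>z0\<close>.\<close>

lemma saddle_constant:
  assumes "k = of_real pi * \<i> * z0 * (1 - w0) / w0"
  shows "exp (log_sinc z0 / 2) / (csqrt (- k) * of_real (sqrt 2)) = - exp (- (of_real pi * \<i> * z0))"
proof -
  define l where "l = (Ln (- 2 * of_real pi * \<i> * z0) + Ln (1 - w0) - Ln w0) / 2"
  have nz: "- 2 * of_real pi * \<i> * z0 \<noteq> 0" using z0_nonzero by simp
  have w1: "1 - w0 \<noteq> 0" and w00: "w0 \<noteq> 0" by (fact one_minus_w0_nonzero)+
  have ls: "log_sinc z0 = Ln (- 2 * of_real pi * \<i> * z0) - Ln w0"
    using log_sinc_upper[OF Im_z0_bounds(1)] by (simp add: exp_z0)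
  have "exp l ^ 2 = exp (Ln (- 2 * of_real pi * \<i> * z0) + Ln (1 - w0) - Ln w0)"
    by (simp add: l_def power2_eq_square flip: exp_add)
  also have "\<dots> = - 2 * of_real pi * \<i> * z0 * (1 - w0) / w0"
    by (simp only: exp_add exp_diff exp_Ln[OF nz] exp_Ln[OF w1] exp_Ln[OF w00])
  also have "\<dots> = - 2 * k" by (simp add: assms)
  finally have sq: "exp l ^ 2 = - 2 * k" .
  have Im: "\<bar>Im l\<bar> < pi / 2"
  proof -
    have "\<bar>Im (Ln (- 2 * of_real pi * \<i> * z0))\<bar> < pi / 2"
      using nz Im_z0_bounds by (intro Re_Ln_pos_lt_imp) simp_all
    moreover have "Im (Ln (- 2 * of_real pi * \<i> * z0)) < 0"
    proof -
      have "0 < pi * Re z0" using Re_z0_bounds by simp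
      then have "\<not> 0 \<le> Im (Ln (- 2 * of_real pi * \<i> * z0))"
        using Im_Ln_pos_le[OF nz] Im_Ln_le_pi[OF nz] by auto
      then show ?thesis by simp
    qed
    moreover have "\<bar>Im (Ln (1 - w0))\<bar> < pi / 2" "0 < Im (Ln (1 - w0))"
      using Re_Ln_pos_lt_imp[of "1 - w0"] Im_Ln_pos_lt_imp one_minus_w0_bounds w1 by auto
    moreover have "\<bar>Im (Ln w0)\<bar> < pi / 2"
    proof (rule Re_Ln_pos_lt_imp)
      show "0 < Re w0" using one_minus_w0_bounds(2) complex_Re_le_cmod[of "1 - w0"] by simp
    qed
    moreover have "Im (Ln w0) < 0"
    proof -
      have "\<not> 0 \<le> Im (Ln w0)" using Im_Ln_pos_le[OF w00] Im_Ln_le_pi[OF w00] one_minus_w0_bounds(4) by auto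
      then show ?thesis by simp
    qed
    ultimately show ?thesis unfolding l_def by (simp add: abs_less_iff)
  qed
  then have "0 < Re (exp l)" unfolding Re_exp by (intro mult_pos_pos cos_gt_zero_pi) auto
  then have "csqrt (- k) = exp l / of_real (sqrt 2)"
    using sq by (intro csqrt_unique) (simp_all add: power_divide flip: of_real_power)
  then have "csqrt (- k) * of_real (sqrt 2) = exp l" by simp
  moreover have "exp (log_sinc z0 / 2) = exp l * exp (- (Ln (1 - w0) / 2))"
  proof -
    have "log_sinc z0 / 2 = l + - (Ln (1 - w0) / 2)"
      unfolding l_def ls by (simp add: add_divide_distrib diff_divide_distrib)
    then show ?thesis by (simp only: exp_add)
  qed
  moreover have "- (Ln (1 - w0) / 2) = of_real pi * \<i> - of_real pi * \<i> * z0"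
    by (simp add: z0_def field_simps)
  moreover have "exp (of_real pi * \<i> - of_real pi * \<i> * z0) = - exp (- (of_real pi * \<i> * z0))"
    by (simp add: exp_diff exp_minus divide_inverse)
  ultimately show ?thesis by simp
qed

lemma exp_phase_z0:
  "exp (of_nat N * phase z0) = w0 powi (- int N)" "exp (real N * Re (phase z0)) = cmod w0 powi (- int N)"
proof -
  have "exp (phase z0) = inverse w0" "exp (Re (phase z0)) = inverse (cmod w0)"
    using one_minus_w0_nonzero unfolding Re_phase_z0(2) phase_z0 by (simp_all add: exp_minus)
  then show "exp (of_nat N * phase z0) = w0 powi (- int N)" "exp (real N * Re (phase z0)) = cmod w0 powi (- int N)"
    by (simp_all add: exp_of_nat_mult power_int_minus power_inverse)
qed

lemma compact_uniform_gap:
  fixes f :: "'a::topological_space \<Rightarrow> real"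
  assumes "compact K" "continuous_on K f" "\<And>x. x \<in> K \<Longrightarrow> f x < m"
  obtains \<epsilon> where "\<epsilon> > 0" "\<And>x. x \<in> K \<Longrightarrow> f x \<le> m - \<epsilon>"
proof (cases "K = {}")
  case False
  then obtain x where x: "x \<in> K" "\<And>y. y \<in> K \<Longrightarrow> f y \<le> f x"
    using continuous_attains_sup[OF assms(1) _ assms(2)] by blast
  show ?thesis using x assms(3) by (intro that[of "m - f x"]) auto
qed (auto intro: that[of 1])

lemma euler_prod_le_phase:
  assumes K: "compact K" "K \<subseteq> {u. Im u \<ge> 0} \<inter> slit_plane 1 - {0}"
  obtains C where "C \<ge> 0" "\<And>N u. N \<ge> 1 \<Longrightarrow> u \<in> K \<Longrightarrow> cmod (euler_prod N u) \<le> C * exp (real N * Re (phase u))"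
proof -
  obtain C1 where C1: "C1 \<ge> 0" "\<And>N u. N \<ge> 1 \<Longrightarrow> u \<in> K \<Longrightarrow> \<exists>\<rho>. cmod \<rho> \<le> C1 / real N \<and>
     euler_prod N u = exp (of_nat N * phase u) * exp (log_sinc u / 2) * exp \<rho> / of_real (sqrt (2 * pi * real N))"
    using euler_prod_asymp[OF K] by blast
  have "K \<subseteq> slit_plane 1" using K by auto
  then have "continuous_on K log_sinc"
    using holomorphic_on_imp_continuous_on[OF holomorphic_log_sinc] continuous_on_subset by blast
  then obtain B where B: "\<And>u. u \<in> K \<Longrightarrow> cmod (log_sinc u) \<le> B"
    using compact_norm_bound[OF K(1)] by metis
  show ?thesis
  proof (rule that[of "exp (B / 2) * exp C1"])
    fix N u assume N: "(N::nat) \<ge> 1" and u: "u \<in> K"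
    obtain \<rho> where \<rho>: "cmod \<rho> \<le> C1 / real N"
     "euler_prod N u = exp (of_nat N * phase u) * exp (log_sinc u / 2) * exp \<rho> / of_real (sqrt (2 * pi * real N))"
      using C1(2)[OF N u] by blast
    have "C1 / real N \<le> C1 / 1" using C1 N by (intro divide_left_mono) auto
    then have "Re \<rho> \<le> C1" using \<rho>(1) complex_Re_le_cmod[of \<rho>] by linarith
    have "Re (log_sinc u / 2) \<le> B / 2" using B[OF u] complex_Re_le_cmod[of "log_sinc u"] by simp
    have "1 * 1 \<le> 2 * pi * real N" using N pi_ge_two by (intro mult_mono) auto
    then have sq: "1 \<le> sqrt (2 * pi * real N)" by simp
    have "cmod (euler_prod N u) = exp (real N * Re (phase u)) * exp (Re (log_sinc u / 2)) * exp (Re \<rho>) / sqrt (2 * pi * real N)"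
      unfolding \<rho>(2) by (simp add: norm_mult norm_divide)
    also have "\<dots> \<le> exp (real N * Re (phase u)) * exp (Re (log_sinc u / 2)) * exp (Re \<rho>) / 1"
      using sq by (intro divide_left_mono) auto
    also have "\<dots> \<le> exp (real N * Re (phase u)) * exp (B / 2) * exp C1 / 1"
      using \<open>Re \<rho> \<le> C1\<close> \<open>Re (log_sinc u / 2) \<le> B / 2\<close> by (intro divide_right_mono mult_mono) auto
    finally show "cmod (euler_prod N u) \<le> exp (B / 2) * exp C1 * exp (real N * Re (phase u))"
      by (simp add: mult_ac)
  qed simp
qed

section \<open>The integral along the segment through the saddle point\<close>

lemma contour_integral_saddle_segment:
  "contour_integral (linepath (of_real (1 - \<delta>) * z) (of_real (1 + \<delta>) * z)) f
     = z * contour_integral (linepath (- of_real \<delta>) (of_real \<delta>)) (\<lambda>x. f ((1 + x) * z))"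
proof -
  let ?l = "linepath (- of_real \<delta>) (of_real \<delta>) :: real \<Rightarrow> complex"
  have l: "linepath (of_real (1 - \<delta>) * z) (of_real (1 + \<delta>) * z) t = (1 + ?l t) * z" for t
    by (simp add: linepath_def scaleR_conv_of_real algebra_simps)
  have "contour_integral (linepath (of_real (1 - \<delta>) * z) (of_real (1 + \<delta>) * z)) f
     = integral {0..1} (\<lambda>t. f ((1 + ?l t) * z) * (of_real (1 + \<delta>) * z - of_real (1 - \<delta>) * z))"
    unfolding contour_integral_integral vector_derivative_linepath_at l ..
  also have "\<dots> = integral {0..1} (\<lambda>t. z * (f ((1 + ?l t) * z) * (of_real \<delta> - - of_real \<delta>)))"
    by (simp add: algebra_simps)
  also have "\<dots> = z * integral {0..1} (\<lambda>t. f ((1 + ?l t) * z) * (of_real \<delta> - - of_real \<delta>))"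
    by (rule integral_mult_right)
  also have "integral {0..1} (\<lambda>t. f ((1 + ?l t) * z) * (of_real \<delta> - - of_real \<delta>))
      = contour_integral ?l (\<lambda>x. f ((1 + x) * z))"
    unfolding contour_integral_integral vector_derivative_linepath_at ..
  finally show ?thesis .
qed

definition saddle_integrand :: "nat \<Rightarrow> complex \<Rightarrow> complex" where
  "saddle_integrand N u = exp (2 * of_real pi * \<i> * u / of_nat N) * euler_prod N u"

lemma holomorphic_saddle_integrand:
  assumes N: "N \<ge> 1"
  shows "saddle_integrand N holomorphic_on slit_plane 1 - {0}"
proof -
  have nz: "1 - exp (2 * of_real pi * \<i> * (of_nat j * u / of_nat N)) \<noteq> 0"
    if u: "u \<in> slit_plane 1 - {0}" and j: "j \<in> {1..N}" for u j
  proof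
    assume "1 - exp (2 * of_real pi * \<i> * (of_nat j * u / of_nat N)) = 0"
    then have e: "exp (2 * of_real pi * \<i> * (of_nat j * u / of_nat N)) = 1" by simp
    have eq: "of_nat j * u / of_nat N = of_real (real j / real N) * u" by simp
    have "of_nat j * u / of_nat N \<in> slit_plane 1" unfolding eq
      using u j by (intro slit_plane_scale) auto
    then have "of_nat j * u / of_nat N = 0" using e by (intro exp_2pi_i_eq_1_slit)
    then show False using u j by auto
  qed
  show ?thesis unfolding saddle_integrand_def euler_prod_def
    by (intro holomorphic_intros nz) (use N in auto)
qed

lemma saddle_segment_asymp:
  "\<exists>d0>0. \<forall>\<delta>. 0 < \<delta> \<and> \<delta> < d0 \<longrightarrow>
     (\<forall>u\<in>closed_segment (of_real (1 - \<delta>) * z0) (of_real (1 + \<delta>) * z0). 0 < Im u \<and> Re (phase u) \<le> Re (phase z0)) \<and>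
     (\<exists>C. \<forall>N\<ge>1. cmod (contour_integral (linepath (of_real (1 - \<delta>) * z0) (of_real (1 + \<delta>) * z0)) (saddle_integrand N)
         - z0 * (- exp (- (of_real pi * \<i> * z0))) * (w0 powi (- int N) / of_nat N)) \<le> C * (cmod w0 powi (- int N) / (real N)\<^sup>2))"
proof -
  obtain k where k: "k holomorphic_on ball 0 saddle_radius" "k 0 = of_real pi * \<i> * z0 * (1 - w0) / w0"
    "\<And>x. x \<in> ball 0 saddle_radius \<Longrightarrow> phase ((1 + x) * z0) = phase z0 + x\<^sup>2 * k x"
    using phase_near_saddle by blast
  have k0: "Re (k 0) < 0" unfolding k(2) by (rule saddle_coeff_negative)
  define \<psi> where "\<psi> = (\<lambda>x. exp (log_sinc ((1 + x) * z0) / 2))"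
  have h\<psi>: "\<psi> holomorphic_on ball 0 saddle_radius"
  proof -
    have "(log_sinc \<circ> (\<lambda>x. (1 + x) * z0)) holomorphic_on ball 0 saddle_radius"
      by (rule holomorphic_on_compose_gen[OF _ holomorphic_log_sinc])
         (use Im_saddle_ball in_slit_plane_upper in \<open>auto intro!: holomorphic_intros\<close>)
    then show ?thesis unfolding \<psi>_def o_def by (intro holomorphic_intros) auto
  qed
  obtain d0 where d0: "d0 > 0"
    "\<And>\<delta>. 0 < \<delta> \<Longrightarrow> \<delta> < d0 \<Longrightarrow> (\<forall>z\<in>cball 0 \<delta>. Re (k z) \<le> Re (k 0) / 2) \<and>
      (\<exists>C. \<forall>N\<ge>1. cmod (contour_integral (linepath (- of_real \<delta>) (of_real \<delta>)) (\<lambda>z. exp (of_real N * (z\<^sup>2 * k z)) * \<psi> z)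
            - \<psi> 0 / csqrt (- k 0) * of_real (sqrt (pi / N))) \<le> C / (N * sqrt N))"
    using laplace_segment[OF saddle_radius_pos k(1) h\<psi> k0] by blast
  show ?thesis
  proof (rule exI[of _ "min d0 saddle_radius"], rule conjI, use d0 saddle_radius_pos in simp, rule allI, rule impI)
    fix \<delta> assume "0 < \<delta> \<and> \<delta> < min d0 saddle_radius"
    then have \<delta>: "0 < \<delta>" "\<delta> < d0" "\<delta> < saddle_radius" by auto
    have kn: "Re (k z) \<le> Re (k 0) / 2" if "z \<in> cball 0 \<delta>" for z using d0(2)[OF \<delta>(1,2)] that by blast
    obtain C1 where C1: "\<And>N. N \<ge> 1 \<Longrightarrow> cmod (contour_integral (linepath (- of_real \<delta>) (of_real \<delta>)) (\<lambda>z. exp (of_real N * (z\<^sup>2 * k z)) * \<psi> z)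
            - \<psi> 0 / csqrt (- k 0) * of_real (sqrt (pi / N))) \<le> C1 / (N * sqrt N)"
      using d0(2)[OF \<delta>(1,2)] by blast
    let ?seg = "closed_segment (of_real (1 - \<delta>) * z0) (of_real (1 + \<delta>) * z0)"
    have seg: "\<exists>x\<in>{-\<delta>..\<delta>}. u = (1 + of_real x) * z0" if u: "u \<in> ?seg" for u
    proof -
      obtain t where t: "0 \<le> t" "t \<le> 1" "u = (1 - t) *\<^sub>R (of_real (1 - \<delta>) * z0) + t *\<^sub>R (of_real (1 + \<delta>) * z0)"
        using u unfolding in_segment by blast
      have "u = (1 + of_real ((2 * t - 1) * \<delta>)) * z0" unfolding t(3) by (simp add: scaleR_conv_of_real algebra_simps)
      moreover have "(2 * t - 1) * \<delta> \<le> 1 * \<delta>" "(-1) * \<delta> \<le> (2 * t - 1) * \<delta>" using t \<delta> by (intro mult_right_mono; simp)+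
      ultimately show ?thesis by (intro bexI[of _ "(2 * t - 1) * \<delta>"]) auto
    qed
    have xb: "of_real x \<in> ball (0::complex) saddle_radius" "of_real x \<in> cball (0::complex) \<delta>" if "x \<in> {-\<delta>..\<delta>}" for x
      using that \<delta> by auto
    have x2: "Re ((of_real x)\<^sup>2 * k (of_real x)) \<le> x\<^sup>2 * (Re (k 0) / 2)" if "x \<in> {-\<delta>..\<delta>}" for x
    proof -
      have "Re ((of_real x)\<^sup>2 * k (of_real x)) = x\<^sup>2 * Re (k (of_real x))" by (simp flip: of_real_power)
      also have "\<dots> \<le> x\<^sup>2 * (Re (k 0) / 2)" using kn[OF xb(2)[OF that]] by (intro mult_left_mono) auto
      finally show ?thesis .
    qed
    have up: "0 < Im u \<and> Re (phase u) \<le> Re (phase z0)" if u: "u \<in> ?seg" for u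
    proof -
      obtain x where x: "x \<in> {-\<delta>..\<delta>}" "u = (1 + of_real x) * z0" using seg[OF u] by blast
      have "x\<^sup>2 * (Re (k 0) / 2) \<le> 0" using k0 by (intro mult_nonneg_nonpos) auto
      then show ?thesis
        using Im_saddle_ball[OF xb(1)[OF x(1)]] k(3)[OF xb(1)[OF x(1)]] x2[OF x(1)] unfolding x(2) by simp
    qed
    have Ks: "compact ?seg" "?seg \<subseteq> {u. Im u \<ge> 0} \<inter> slit_plane 1 - {0}"
      using up in_slit_plane_upper by (auto simp: less_imp_le) (metis less_irrefl zero_complex.simps(2))
    obtain C2 where C2: "C2 \<ge> 0" "\<And>N u. N \<ge> 1 \<Longrightarrow> u \<in> ?seg \<Longrightarrow> \<exists>\<rho>. cmod \<rho> \<le> C2 / real N \<and>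
     euler_prod N u = exp (of_nat N * phase u) * exp (log_sinc u / 2) * exp \<rho> / of_real (sqrt (2 * pi * real N))"
      using euler_prod_asymp[OF Ks] by blast
    have "continuous_on (cball 0 \<delta>) \<psi>"
      by (intro holomorphic_on_imp_continuous_on holomorphic_on_subset[OF h\<psi>]) (use \<delta> in auto)
    then obtain M where M: "\<And>x. x \<in> cball 0 \<delta> \<Longrightarrow> cmod (\<psi> x) \<le> M"
      using compact_norm_bound[OF compact_cball] by metis
    have M0: "M \<ge> 0" using M[of 0] \<delta> norm_ge_zero[of "\<psi> 0"] by (simp del: norm_ge_zero)
    define C3 where "C3 = C2 + 2 * pi * (2 * cmod z0)"
    have C3: "C3 \<ge> 0" using C2 by (simp add: C3_def)
    have dr1: "\<delta> < 1" using \<delta>(3) Im_z0_bounds abs_Im_le_cmod[of z0] z0_nonzero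
      by (simp add: saddle_radius_def) (metis abs_of_pos divide_le_eq_1_pos less_le_trans zero_less_norm_iff order.trans less_eq_real_def)
    define a where "a = - (Re (k 0) / 2)"
    have a: "a > 0" using k0 by (simp add: a_def)
    define C4 where "C4 = M * (C3 * exp C3) * sqrt (pi / a)"
    have main: "cmod (contour_integral (linepath (of_real (1 - \<delta>) * z0) (of_real (1 + \<delta>) * z0)) (saddle_integrand N)
         - z0 * (- exp (- (of_real pi * \<i> * z0))) * (w0 powi (- int N) / of_nat N))
         \<le> (cmod z0 * (C1 + C4)) * (cmod w0 powi (- int N) / (real N)\<^sup>2)" if N: "N \<ge> 1" for N
    proof -
      define W where "W = w0 powi (- int N) / of_real (sqrt (2 * pi * real N))"
      define G where "G = (\<lambda>x. exp (of_real (real N) * (x\<^sup>2 * k x)) * \<psi> x)"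
      let ?l = "linepath (- of_real \<delta>) (of_real \<delta>) :: real \<Rightarrow> complex"
      let ?I = "\<lambda>x. saddle_integrand N ((1 + x) * z0)"
      have pt: "cmod (?I (of_real x) - W * G (of_real x)) \<le> cmod W * (M * (C3 * exp C3) / real N) * exp (- (real N * a * x\<^sup>2))"
        if x: "x \<in> {-\<delta>..\<delta>}" for x
      proof -
        let ?u = "(1 + of_real x) * z0"
        have "?u \<in> ?seg"
        proof -
          have "?u = (1 - (x + \<delta>) / (2 * \<delta>)) *\<^sub>R (of_real (1 - \<delta>) * z0) + ((x + \<delta>) / (2 * \<delta>)) *\<^sub>R (of_real (1 + \<delta>) * z0)"
          proof -
            have "(1 - (x + \<delta>) / (2 * \<delta>)) * (1 - \<delta>) + ((x + \<delta>) / (2 * \<delta>)) * (1 + \<delta>) = 1 + x"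
              using \<delta> by (simp add: field_simps)
            then have "complex_of_real (1 - (x + \<delta>) / (2 * \<delta>)) * of_real (1 - \<delta>) + of_real ((x + \<delta>) / (2 * \<delta>)) * of_real (1 + \<delta>) = of_real (1 + x)"
              by (simp only: of_real_mult[symmetric] of_real_add[symmetric])
            then have "of_real (1 + x) * z0 = complex_of_real (1 - (x + \<delta>) / (2 * \<delta>)) * (of_real (1 - \<delta>) * z0) + of_real ((x + \<delta>) / (2 * \<delta>)) * (of_real (1 + \<delta>) * z0)"
              by (metis distrib_right mult.assoc)
            then show ?thesis by (simp only: scaleR_conv_of_real of_real_add of_real_1)
          qed
          moreover have "0 \<le> (x + \<delta>) / (2 * \<delta>)" "(x + \<delta>) / (2 * \<delta>) \<le> 1" using x \<delta> by (auto simp: field_simps)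
          ultimately show ?thesis unfolding in_segment by blast
        qed
        then obtain \<rho> where \<rho>: "cmod \<rho> \<le> C2 / real N"
          "euler_prod N ?u = exp (of_nat N * phase ?u) * exp (log_sinc ?u / 2) * exp \<rho> / of_real (sqrt (2 * pi * real N))"
          using C2(2)[OF N] by blast
        define \<rho>' where "\<rho>' = \<rho> + 2 * of_real pi * \<i> * ?u / of_nat N"
        have r': "cmod \<rho>' \<le> C3 / real N"
        proof -
          have "\<bar>x\<bar> \<le> 1" using x dr1 by auto
          then have "cmod (1 + of_real x :: complex) \<le> 2" using norm_triangle_ineq[of 1 "complex_of_real x"] by simp
          then have "2 * pi * (cmod (1 + of_real x :: complex) * cmod z0) \<le> 2 * pi * (2 * cmod z0)"
            by (intro mult_left_mono mult_right_mono) auto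
          then have "cmod (2 * of_real pi * \<i> * ?u / of_nat N) \<le> 2 * pi * (2 * cmod z0) / real N"
            by (simp add: norm_mult norm_divide divide_right_mono)
          then show ?thesis unfolding \<rho>'_def C3_def add_divide_distrib using \<rho>(1) norm_triangle_le add_mono by blast
        qed
        have "C3 / real N \<le> C3 / 1" using C3 N by (intro divide_left_mono) auto
        then have r'': "cmod \<rho>' \<le> C3" using r' by simp
        have "?I (of_real x) = W * G (of_real x) * exp \<rho>'"
          unfolding saddle_integrand_def \<rho>(2) W_def G_def \<psi>_def \<rho>'_def k(3)[OF xb(1)[OF x]] exp_phase_z0(1)[symmetric]
          by (simp add: exp_add distrib_left)
        then have "?I (of_real x) - W * G (of_real x) = W * (G (of_real x) * (exp \<rho>' - 1))" by (simp add: algebra_simps)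
        then have "cmod (?I (of_real x) - W * G (of_real x)) = cmod W * (cmod (G (of_real x)) * cmod (exp \<rho>' - 1))"
          by (simp only: norm_mult)
        also have "\<dots> \<le> cmod W * ((exp (- (real N * a * x\<^sup>2)) * M) * (C3 / real N * exp C3))"
        proof (intro mult_left_mono mult_mono)
          have "Re (of_real (real N) * ((of_real x)\<^sup>2 * k (of_real x))) = real N * Re ((of_real x)\<^sup>2 * k (of_real x))" by simp
          also have "\<dots> \<le> real N * (x\<^sup>2 * (Re (k 0) / 2))" using x2[OF x] by (intro mult_left_mono) auto
          also have "\<dots> = - (real N * a * x\<^sup>2)" by (simp add: a_def)
          finally have "cmod (exp (of_real (real N) * ((of_real x)\<^sup>2 * k (of_real x)))) \<le> exp (- (real N * a * x\<^sup>2))"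
            by (simp only: norm_exp_eq_Re exp_le_cancel_iff)
          then show "cmod (G (of_real x)) \<le> exp (- (real N * a * x\<^sup>2)) * M"
            unfolding G_def norm_mult using M[OF xb(2)[OF x]] by (intro mult_mono) auto
          show "cmod (exp \<rho>' - 1) \<le> C3 / real N * exp C3"
            using cmod_exp_minus_1_le[of \<rho>'] r' r'' C3 by (elim order_trans, intro mult_mono) auto
        qed (use M0 in auto)
        finally show ?thesis by (simp add: mult_ac)
      qed
      have cI: "continuous_on {-\<delta>..\<delta>} (\<lambda>x. ?I (of_real x))"
      proof -
        have "continuous_on (slit_plane 1 - {0}) (saddle_integrand N)"
          by (rule holomorphic_on_imp_continuous_on[OF holomorphic_saddle_integrand[OF N]])
        note cs = this
        have mem: "(1 + of_real x) * z0 \<in> slit_plane 1 - {0}" if "x \<in> {-\<delta>..\<delta>}" for x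
          using Im_saddle_ball[OF xb(1)[OF that]] in_slit_plane_upper by fastforce
        show ?thesis
          by (rule continuous_on_compose2[OF cs]) (use mem in \<open>auto intro!: continuous_intros\<close>)
      qed
      have cG: "continuous_on {-\<delta>..\<delta>} (\<lambda>x. G (of_real x))"
      proof -
        have "G holomorphic_on ball 0 saddle_radius" unfolding G_def by (intro holomorphic_intros k(1) h\<psi>)
        then have "continuous_on (ball 0 saddle_radius) G" by (rule holomorphic_on_imp_continuous_on)
        then show ?thesis by (rule continuous_on_compose2) (use xb in \<open>auto intro!: continuous_intros\<close>)
      qed
      have lin: "contour_integral ?l f = integral {-\<delta>..\<delta>} (\<lambda>x. f (of_real x))" for f
        using contour_integral_linepath_Reals_eq[of "- of_real \<delta>" "of_real \<delta>" f] \<delta> by simp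
      have "cmod (integral {-\<delta>..\<delta>} (\<lambda>x. ?I (of_real x) - W * G (of_real x)))
          \<le> integral {-\<delta>..\<delta>} (\<lambda>x. cmod W * (M * (C3 * exp C3) / real N) * exp (- (real N * a * x\<^sup>2)))"
        by (intro integral_norm_bound_integral integrable_continuous_interval continuous_intros cI cG pt)
      also have "\<dots> = cmod W * (M * (C3 * exp C3) / real N) * integral {-\<delta>..\<delta>} (\<lambda>x. exp (- (real N * a * x\<^sup>2)))"
        by (rule integral_mult_right)
      also have "\<dots> \<le> cmod W * (M * (C3 * exp C3) / real N) * sqrt (pi / (real N * a))"
      proof (intro mult_left_mono)
        have Na: "real N * a > 0" using N a by simp
        have "((\<lambda>t. exp (- (real N * a * t\<^sup>2))) has_integral sqrt (pi / (real N * a))) UNIV"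
          by (rule gaussian_moment_integrals[OF Na])
        then show "integral {-\<delta>..\<delta>} (\<lambda>x. exp (- (real N * a * x\<^sup>2))) \<le> sqrt (pi / (real N * a))"
          by (intro has_integral_subset_le[OF subset_UNIV integrable_integral]) 
             (auto intro!: integrable_continuous_interval continuous_intros)
        show "0 \<le> cmod W * (M * (C3 * exp C3) / real N)" using M0 C3 by simp
      qed
      also have "\<dots> = cmod W * (C4 / (real N * sqrt (real N)))"
        unfolding C4_def by (simp add: real_sqrt_divide real_sqrt_mult field_simps)
      also have "integral {-\<delta>..\<delta>} (\<lambda>x. ?I (of_real x) - W * G (of_real x)) = contour_integral ?l ?I - W * contour_integral ?l G"
        unfolding lin
        by (subst integral_diff) (auto intro!: integrable_continuous_interval continuous_intros cI cG)
      finally have e1: "cmod (contour_integral ?l ?I - W * contour_integral ?l G) \<le> cmod W * (C4 / (real N * sqrt (real N)))" .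
      have "cmod (contour_integral ?l G - \<psi> 0 / csqrt (- k 0) * of_real (sqrt (pi / real N))) \<le> C1 / (real N * sqrt (real N))"
        unfolding G_def using C1[of "real N"] N by simp
      then have "cmod W * cmod (contour_integral ?l G - \<psi> 0 / csqrt (- k 0) * of_real (sqrt (pi / real N))) \<le> cmod W * (C1 / (real N * sqrt (real N)))"
        by (intro mult_left_mono) auto
      then have e2: "cmod (W * contour_integral ?l G - W * (\<psi> 0 / csqrt (- k 0) * of_real (sqrt (pi / real N)))) \<le> cmod W * (C1 / (real N * sqrt (real N)))"
        by (simp only: norm_mult[symmetric] right_diff_distrib)
      have "cmod (contour_integral ?l ?I - W * (\<psi> 0 / csqrt (- k 0) * of_real (sqrt (pi / real N)))) \<le> cmod W * ((C1 + C4) / (real N * sqrt (real N)))"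
        using norm_triangle_le[OF add_mono[OF e1 e2]] by (simp add: add_divide_distrib distrib_left)
      also have "W * (\<psi> 0 / csqrt (- k 0) * of_real (sqrt (pi / real N))) = - exp (- (of_real pi * \<i> * z0)) * (w0 powi (- int N) / of_nat N)"
      proof -
        have "sqrt (pi / real N) / sqrt (2 * pi * real N) = 1 / (sqrt 2 * real N)"
        proof -
          have "sqrt (pi / real N) / sqrt (2 * pi * real N) = sqrt (1 / (2 * (real N)\<^sup>2))"
            using N by (simp add: real_sqrt_divide[symmetric] power2_eq_square)
          then show ?thesis by (simp add: real_sqrt_divide real_sqrt_mult)
        qed
        then have s: "complex_of_real (sqrt (pi / real N)) / of_real (sqrt (2 * pi * real N)) = 1 / (of_real (sqrt 2) * of_nat N)"
          by (simp only: of_real_divide[symmetric]) simp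
        have "W * (\<psi> 0 / csqrt (- k 0) * of_real (sqrt (pi / real N))) = w0 powi (- int N) * (\<psi> 0 / csqrt (- k 0)) * (of_real (sqrt (pi / real N)) / of_real (sqrt (2 * pi * real N)))"
          by (simp add: W_def mult_ac)
        also have "\<dots> = (\<psi> 0 / (csqrt (- k 0) * of_real (sqrt 2))) * (w0 powi (- int N) / of_nat N)"
          unfolding s by (simp add: mult_ac)
        also have "\<psi> 0 / (csqrt (- k 0) * of_real (sqrt 2)) = - exp (- (of_real pi * \<i> * z0))"
          using saddle_constant[OF k(2)] by (simp add: \<psi>_def)
        finally show ?thesis .
      qed
      also have "cmod W * ((C1 + C4) / (real N * sqrt (real N))) = (C1 + C4) * (cmod w0 powi (- int N) / (real N)\<^sup>2) / sqrt (2 * pi)"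
      proof -
        define s r where "s = sqrt (2 * pi)" and "r = sqrt (real N)"
        have r: "real N = r * r" "r > 0" "s > 0" using N by (simp_all add: r_def s_def)
        have "\<bar>sqrt (2 * pi * real N)\<bar> = s * r" by (simp add: real_sqrt_mult s_def r_def)
        then have "cmod W = cmod w0 powi (- int N) / (s * r)"
          unfolding W_def by (simp only: norm_divide norm_of_real norm_power_int)
        then show ?thesis
          unfolding r_def[symmetric] s_def[symmetric] r(1) using r by (simp add: power2_eq_square mult_ac)
      qed
      finally have e3: "cmod (contour_integral ?l ?I - - exp (- (of_real pi * \<i> * z0)) * (w0 powi (- int N) / of_nat N)) \<le> (C1 + C4) * (cmod w0 powi (- int N) / (real N)\<^sup>2) / sqrt (2 * pi)" .
      have P: "cmod w0 powi (- int N) / (real N)\<^sup>2 \<ge> 0" by (simp add: zero_le_power_int)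
      \<comment> \<open>The sign of \<open>C1\<close> is not known. That the bound is nonnegative
        follows from the estimate itself, and this allows dropping the division by sqrt (2 pi) \<ge>
        1.\<close>
      have "0 \<le> (C1 + C4) * (cmod w0 powi (- int N) / (real N)\<^sup>2) / sqrt (2 * pi)" using e3 norm_ge_zero order_trans by blast
      moreover have "0 < sqrt (2 * pi)" by simp
      ultimately have "0 \<le> (C1 + C4) * (cmod w0 powi (- int N) / (real N)\<^sup>2)"
        using pos_le_divide_eq mult_zero_left by metis
      moreover have "1 \<le> sqrt (2 * pi)" using pi_ge_two by simp
      ultimately have "(C1 + C4) * (cmod w0 powi (- int N) / (real N)\<^sup>2) / sqrt (2 * pi) \<le> (C1 + C4) * (cmod w0 powi (- int N) / (real N)\<^sup>2) / 1"
        by (intro divide_left_mono) auto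
      then have "cmod z0 * cmod (contour_integral ?l ?I - - exp (- (of_real pi * \<i> * z0)) * (w0 powi (- int N) / of_nat N)) \<le> cmod z0 * ((C1 + C4) * (cmod w0 powi (- int N) / (real N)\<^sup>2))"
        using e3 by (intro mult_left_mono) auto
      then show ?thesis
        unfolding contour_integral_saddle_segment by (simp only: norm_mult[symmetric] right_diff_distrib mult.assoc)
    qed
    show "(\<forall>u\<in>?seg. 0 < Im u \<and> Re (phase u) \<le> Re (phase z0)) \<and>
     (\<exists>C. \<forall>N\<ge>1. cmod (contour_integral (linepath (of_real (1 - \<delta>) * z0) (of_real (1 + \<delta>) * z0)) (saddle_integrand N)
         - z0 * (- exp (- (of_real pi * \<i> * z0))) * (w0 powi (- int N) / of_nat N)) \<le> C * (cmod w0 powi (- int N) / (real N)\<^sup>2))"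
      using up main by blast
  qed
qed

lemma exp_minus_le_inverse_cube:
  assumes "x > (0::real)"
  shows "exp (- x) \<le> 27 / x ^ 3"
proof -
  have "x / 3 \<le> exp (x / 3)" using exp_ge_add_one_self[of "x / 3"] by linarith
  then have "(x / 3) ^ 3 \<le> exp (x / 3) ^ 3" using assms by (intro power_mono) auto
  also have "\<dots> = exp x" by (simp add: exp_of_nat_mult[symmetric])
  finally have "x ^ 3 / 27 \<le> exp x" by (simp add: power_divide)
  then have "exp (- x) \<le> inverse (x ^ 3 / 27)"
    unfolding exp_minus using assms by (intro le_imp_inverse_le) auto
  then show ?thesis by simp
qed

text \<open>An exponentially smaller quantity is rewritten on the common scale exp (N m) / N^3, so
  that all error terms can be added.\<close>

lemma exp_shift_le:
  assumes "\<epsilon> > 0" "N \<ge> (1::nat)"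
  shows "exp (real N * (m - \<epsilon>)) \<le> 27 / \<epsilon> ^ 3 * (exp (real N * m) / real N ^ 3)"
proof -
  have "exp (real N * (m - \<epsilon>)) = exp (real N * m) * exp (- (real N * \<epsilon>))"
    by (simp add: algebra_simps flip: exp_add)
  also have "\<dots> \<le> exp (real N * m) * (27 / (real N * \<epsilon>) ^ 3)"
    using assms by (intro mult_left_mono exp_minus_le_inverse_cube) auto
  finally show ?thesis by (simp add: power_mult_distrib mult_ac)
qed

text \<open>Each of the finitely many n below \<open>n0\<close> is covered by adding its quotient a
  n / b n to the constant, which uses b n > 0.\<close>

lemma eventually_bound_imp_bound:
  fixes a b :: "nat \<Rightarrow> real"
  assumes "\<And>n. n \<ge> n0 \<Longrightarrow> a n \<le> C * b n" and pos: "\<And>n. n \<ge> 1 \<Longrightarrow> b n > 0"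
  shows "\<exists>K\<ge>0. \<forall>n\<ge>1. a n \<le> K * b n"
proof (rule exI[of _ "\<bar>C\<bar> + (\<Sum>n<n0. \<bar>a n / b n\<bar>)"], intro conjI allI impI)
  fix n :: nat assume n: "n \<ge> 1"
  note b = pos[OF n]
  show "a n \<le> (\<bar>C\<bar> + (\<Sum>n<n0. \<bar>a n / b n\<bar>)) * b n"
  proof (cases "n < n0")
    case True
    have "a n / b n \<le> \<bar>a n / b n\<bar>" by (rule abs_ge_self)
    also have "\<dots> \<le> (\<Sum>n<n0. \<bar>a n / b n\<bar>)" using True by (intro member_le_sum) auto
    also have "\<dots> \<le> \<bar>C\<bar> + (\<Sum>n<n0. \<bar>a n / b n\<bar>)" by simp
    finally show ?thesis using b by (simp add: pos_divide_le_eq)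
  next
    case False
    then have "a n \<le> C * b n" using assms(1) by simp
    also have "\<dots> \<le> (\<bar>C\<bar> + (\<Sum>n<n0. \<bar>a n / b n\<bar>)) * b n"
      using b sum_nonneg[of "{..<n0}" "\<lambda>n. \<bar>a n / b n\<bar>"] by (intro mult_right_mono) auto
    finally show ?thesis .
  qed
qed (simp add: sum_nonneg)

section \<open>The complete loop and the estimates of the coefficients on it\<close>

locale saddle_loop =
  fixes c :: real and \<delta> :: real and head tail :: "real \<Rightarrow> complex" and L1 L2 C0 :: real
  assumes c: "0 < c" "c < 1"
    and head: "path_bound (slit_plane c - {0}) head L1" and tail: "path_bound (slit_plane c - {0}) tail L2"
    and start: "Im (pathstart head) = 0" "Re (pathstart head) > 0" and finish: "Re (pathfinish tail) = 0"
    and join: "pathfinish head = of_real (1 - \<delta>) * z0" "pathstart tail = of_real (1 + \<delta>) * z0"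
    and low: "path_image head \<subseteq> low_phase" "path_image tail \<subseteq> low_phase"
    and seg: "\<And>u. u \<in> closed_segment (of_real (1 - \<delta>) * z0) (of_real (1 + \<delta>) * z0) \<Longrightarrow> 0 < Im u \<and> Re (phase u) \<le> Re (phase z0)"
    and mid: "\<And>N. N \<ge> 1 \<Longrightarrow> cmod (contour_integral (linepath (of_real (1 - \<delta>) * z0) (of_real (1 + \<delta>) * z0)) (saddle_integrand N)
         - z0 * (- exp (- (of_real pi * \<i> * z0))) * (w0 powi (- int N) / of_nat N)) \<le> C0 * (cmod w0 powi (- int N) / (real N)\<^sup>2)"
begin

abbreviation "S \<equiv> slit_plane c - {0}"

definition "middle = linepath (of_real (1 - \<delta>) * z0) (of_real (1 + \<delta>) * z0)"

definition "g = head +++ (middle +++ tail)"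

definition "L = L1 + (cmod (of_real (1 + \<delta>) * z0 - of_real (1 - \<delta>) * z0) + L2)"

lemma open_S: "open S"
  using open_slit_plane by (intro open_delete)

lemma S_subset: "S \<subseteq> slit_plane 1 - {0}"
  using slit_plane_mono[of c 1] c by auto

lemma middle: "path_bound S middle (cmod (of_real (1 + \<delta>) * z0 - of_real (1 - \<delta>) * z0))"
  unfolding middle_def
proof (rule path_bound_linepath, rule subsetI)
  fix u assume "u \<in> closed_segment (of_real (1 - \<delta>) * z0) (of_real (1 + \<delta>) * z0)"
  then have "0 < Im u" using seg by blast
  then show "u \<in> S" using in_slit_plane_upper by auto
qed

lemma joins: "pathfinish head = pathstart (middle +++ tail)" "pathfinish middle = pathstart tail"
  by (simp_all add: middle_def join)

lemma path_bound_g: "path_bound S g L"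
  unfolding g_def L_def by (intro path_bound_join open_S head middle tail joins)

sublocale symmetric_loop S g L
proof
  show "cnj ` S = S"
  proof -
    have *: "cnj u \<in> S" if "u \<in> S" for u using that by (auto simp: slit_plane_def)
    then have "cnj ` S \<subseteq> S" by (rule image_subsetI)
    moreover have "S \<subseteq> cnj ` S"
    proof
      fix u assume "u \<in> S"
      then have "cnj u \<in> S" using * by blast
      then show "u \<in> cnj ` S" by (intro image_eqI[of _ cnj "cnj u"]) simp_all
    qed
    ultimately show ?thesis by (rule equalityI)
  qed
qed (use open_S path_bound_g finish start in \<open>auto simp: slit_plane_def g_def\<close>)

lemma path_image_g: "path_image g = path_image head \<union> (path_image middle \<union> path_image tail)"
  unfolding g_def using joins by (simp add: path_image_join)

text \<open>The third inequality is strict even at \<open>z0\<close>, because Im u > 0 on the middle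
  segment. It makes the product on the negated path exponentially smaller.\<close>

lemma image_phase:
  assumes "u \<in> path_image g"
  shows "0 \<le> Im u" "Re (phase u) \<le> Re (phase z0)" "Re (phase u) - pi * Im u < Re (phase z0)"
proof -
  consider "u \<in> low_phase" | "u \<in> path_image middle" using assms low unfolding path_image_g by blast
  then have "0 \<le> Im u \<and> Re (phase u) \<le> Re (phase z0) \<and> Re (phase u) - pi * Im u < Re (phase z0)"
  proof cases
    case 1
    then have u: "0 \<le> Im u" "Re (phase u) < Re (phase z0)" by (auto simp: low_phase_def)
    then have "0 \<le> pi * Im u" by simp
    then show ?thesis using u by linarith
  next
    case 2
    then have u: "0 < Im u \<and> Re (phase u) \<le> Re (phase z0)" using seg by (simp add: middle_def)
    then have "0 < pi * Im u" by simp
    then show ?thesis using u by linarith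
  qed
  then show "0 \<le> Im u" "Re (phase u) \<le> Re (phase z0)" "Re (phase u) - pi * Im u < Re (phase z0)" by auto
qed

lemma compact_g: "compact (path_image g)" "path_image g \<subseteq> {u. Im u \<ge> 0} \<inter> slit_plane 1 - {0}"
  using vg image_phase(1) S_subset by (auto intro!: compact_path_image valid_path_imp_path)

lemma continuous_phase_g: "continuous_on (path_image g) (\<lambda>u. Re (phase u))"
  using compact_g by (intro continuous_intros continuous_on_subset[OF continuous_on_phase]) auto

text \<open>The mirror image has the same moduli and imaginary parts, so only \<open>g\<close>
  matters. At - u the factor exp (- pi (N + 1) Im u) turns the exponent Re phase u into Re phase u -
  pi Im u, and compactness gives a uniform gap.\<close>

lemma upper_bounds:
  obtains C \<epsilon> where "C \<ge> 0" "\<epsilon> > 0"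
    "\<And>N u. N \<ge> 1 \<Longrightarrow> u \<in> path_image (upper_path g) \<Longrightarrow> cmod (euler_prod N u) \<le> C * exp (real N * Re (phase z0))"
    "\<And>N u. N \<ge> 1 \<Longrightarrow> u \<in> path_image (upper_path g) \<Longrightarrow> cmod (euler_prod N (- u)) \<le> C * exp (real N * (Re (phase z0) - \<epsilon>))"
proof -
  obtain C where C: "C \<ge> 0" "\<And>N u. N \<ge> 1 \<Longrightarrow> u \<in> path_image g \<Longrightarrow> cmod (euler_prod N u) \<le> C * exp (real N * Re (phase u))"
    using euler_prod_le_phase[OF compact_g] by blast
  obtain \<epsilon> where \<epsilon>: "\<epsilon> > 0" "\<And>u. u \<in> path_image g \<Longrightarrow> Re (phase u) - pi * Im u \<le> Re (phase z0) - \<epsilon>"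
  proof (rule compact_uniform_gap[OF compact_g(1)])
    show "continuous_on (path_image g) (\<lambda>u. Re (phase u) - pi * Im u)"
      by (intro continuous_intros continuous_phase_g)
  qed (use image_phase(3) in auto)
  have mirror_eq: "\<exists>v\<in>path_image g. cmod (euler_prod N u) = cmod (euler_prod N v) \<and> Im u = Im v"
    if u: "u \<in> path_image (upper_path g)" for u N
  proof -
    consider "u \<in> path_image g" | v where "v \<in> path_image g" "u = - cnj v"
      using u unfolding path_image_upper by blast
    then show ?thesis
    proof cases
      case (2 v)
      then show ?thesis by (intro bexI[of _ v]) (simp_all add: euler_prod_cnj)
    qed blast
  qed
  show ?thesis
  proof (rule that[OF C(1) \<epsilon>(1)])
    fix N u assume N: "(N::nat) \<ge> 1" and u: "u \<in> path_image (upper_path g)"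
    obtain v where v: "v \<in> path_image g" "cmod (euler_prod N u) = cmod (euler_prod N v)" "Im u = Im v"
      using mirror_eq[OF u] by blast
    show "cmod (euler_prod N u) \<le> C * exp (real N * Re (phase z0))"
    proof -
      have "C * exp (real N * Re (phase v)) \<le> C * exp (real N * Re (phase z0))"
        using C(1) image_phase(2)[OF v(1)] by (intro mult_left_mono) (auto intro!: mult_left_mono)
      then show ?thesis using C(2)[OF N v(1)] v(2) by linarith
    qed
    have "cmod (euler_prod N (- u)) = exp (- (pi * Im v * (real N + 1))) * cmod (euler_prod N v)"
      using cmod_euler_prod_minus[OF N, of u] v by simp
    also have "\<dots> \<le> exp (- (pi * Im v * (real N + 1))) * (C * exp (real N * Re (phase v)))"
      using C(2)[OF N v(1)] by (intro mult_left_mono) auto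
    also have "\<dots> = C * exp (real N * (Re (phase v) - pi * Im v) - pi * Im v)"
      by (simp add: algebra_simps flip: exp_add)
    also have "\<dots> \<le> C * exp (real N * (Re (phase z0) - \<epsilon>))"
    proof -
      have "real N * (Re (phase v) - pi * Im v) \<le> real N * (Re (phase z0) - \<epsilon>)"
        using \<epsilon>(2)[OF v(1)] by (intro mult_left_mono) auto
      moreover have "0 \<le> pi * Im v" using image_phase(1)[OF v(1)] by simp
      ultimately have "real N * (Re (phase v) - pi * Im v) - pi * Im v \<le> real N * (Re (phase z0) - \<epsilon>)" by linarith
      then show ?thesis using C(1) by (intro mult_left_mono) auto
    qed
    finally show "cmod (euler_prod N (- u)) \<le> C * exp (real N * (Re (phase z0) - \<epsilon>))" .
  qed
qed

lemma loop_bound: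
  obtains C where "C \<ge> 0"
    "\<And>N u. N \<ge> 1 \<Longrightarrow> u \<in> path_image (loop_path g) \<Longrightarrow> cmod (euler_prod N u) \<le> C * exp (real N * Re (phase z0))"
proof -
  obtain C \<epsilon> where C: "C \<ge> 0" "\<epsilon> > 0"
    "\<And>N u. N \<ge> 1 \<Longrightarrow> u \<in> path_image (upper_path g) \<Longrightarrow> cmod (euler_prod N u) \<le> C * exp (real N * Re (phase z0))"
    "\<And>N u. N \<ge> 1 \<Longrightarrow> u \<in> path_image (upper_path g) \<Longrightarrow> cmod (euler_prod N (- u)) \<le> C * exp (real N * (Re (phase z0) - \<epsilon>))"
    using upper_bounds by blast
  show ?thesis
  proof (rule that[OF C(1)])
    fix N u assume N: "(N::nat) \<ge> 1" and u: "u \<in> path_image (loop_path g)"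
    consider "u \<in> path_image (upper_path g)" | v where "v \<in> path_image (upper_path g)" "u = - v"
      using u unfolding path_image_loop by blast
    then show "cmod (euler_prod N u) \<le> C * exp (real N * Re (phase z0))"
    proof cases
      case (2 v)
      have "real N * (Re (phase z0) - \<epsilon>) \<le> real N * Re (phase z0)" using C(2) by (intro mult_left_mono) auto
      then have "C * exp (real N * (Re (phase z0) - \<epsilon>)) \<le> C * exp (real N * Re (phase z0))" using C(1) by (intro mult_left_mono) auto
      then show ?thesis using C(4)[OF N 2(1)] 2 by simp
    qed (use C N in blast)
  qed
qed

lemma has_integral_inverse_loop:
  "((\<lambda>u. 1 / u) has_contour_integral (2 * of_real pi * \<i>)) (loop_path g)"
  by (rule has_contour_integral_loop_inverse) (use image_phase(1) start in \<open>auto simp: g_def\<close>)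

lemma loop_in_S: "valid_path (loop_path g)" "path_image (loop_path g) \<subseteq> S"
  using loop by (auto simp: path_bound_def)

lemma compact_loop: "compact (path_image (loop_path g))"
  using loop_in_S by (intro compact_path_image valid_path_imp_path)

lemma rademacher_coeff_loop:
  assumes "(h, k) \<in> farey N" "T > 0" "c * (real N * real k) \<le> T"
  shows "((\<lambda>u. 2 * of_real pi * \<i> / of_real T * local_param (h, k) T u * (\<Prod>j=1..N. 1 / (1 - local_param (h, k) T u ^ j)))
    has_contour_integral (2 * of_real pi * \<i> * rademacher_coeff N h k 1)) (loop_path g)"
  using rademacher_coeff_contour_integral[OF assms(1,2) c(1) assms(3) loop_in_S loop_closed has_integral_inverse_loop] .

end

lemma cmod_exp_2pi_i_le:
  assumes "cmod u \<le> U" "T \<ge> 1"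
  shows "cmod (exp (2 * of_real pi * \<i> * u / of_real T)) \<le> exp (2 * pi * U)"
proof -
  have "cmod u / T \<le> cmod u / 1" using assms by (intro divide_left_mono) auto
  then have "2 * pi * (cmod u / T) \<le> 2 * pi * U" using assms by (intro mult_left_mono) auto
  then have "cmod (2 * of_real pi * \<i> * u / of_real T) \<le> 2 * pi * U"
    using assms by (simp add: norm_mult norm_divide)
  then show ?thesis using cmod_exp_le exp_le_cancel_iff order_trans by blast
qed

lemma saddle_integrand_le:
  assumes "cmod u \<le> U" "N \<ge> 1"
  shows "cmod (saddle_integrand N u) \<le> exp (2 * pi * U) * cmod (euler_prod N u)"
  using cmod_exp_2pi_i_le[OF assms(1), of "real N"] assms(2)
  unfolding saddle_integrand_def norm_mult by (intro mult_right_mono) auto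

lemma saddle_integrand_cnj: "saddle_integrand N (- cnj u) = cnj (saddle_integrand N u)"
  unfolding saddle_integrand_def by (simp add: euler_prod_cnj exp_cnj)

context saddle_loop
begin

lemma rademacher_coeff_exponentially_smaller:
  assumes hk: "(h, k) \<in> farey k" "k \<ge> 2"
  shows "\<exists>K\<ge>0. \<forall>N\<ge>1. cmod (rademacher_coeff N h k 1) \<le> K * (exp (real N * Re (phase z0)) / real N ^ 3)"
proof -
  define m where "m = Re (phase z0)"
  have m: "m > 0" using Re_phase_z0 by (simp add: m_def)
  obtain C1 where C1: "C1 \<ge> 0"
    "\<And>N u. N \<ge> 1 \<Longrightarrow> u \<in> path_image (loop_path g) \<Longrightarrow> cmod (euler_prod N u) \<le> C1 * exp (real N * m)"
    using loop_bound unfolding m_def by blast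
  have sub: "path_image (loop_path g) \<subseteq> slit_plane c" using loop_in_S by auto
  obtain C2 where C2: "C2 \<ge> 0" "\<And>N u. N div k \<ge> 1 \<Longrightarrow> c * real N \<le> real (k * (N div k)) \<Longrightarrow> u \<in> path_image (loop_path g) \<Longrightarrow>
     cmod (\<Prod>j=1..N. 1 / (1 - local_param (h, k) (real (k\<^sup>2 * (N div k))) u ^ j)) \<le> C2 * cmod (euler_prod (N div k) u)"
    using local_prod_bound[OF hk(1) compact_loop sub c] by blast
  obtain U where U: "\<And>u. u \<in> path_image (loop_path g) \<Longrightarrow> cmod u \<le> U"
    using compact_norm_bound[OF compact_loop continuous_on_id] by metis
  \<comment> \<open>From here on k \<le> N, and c N \<le> k (N div k) since N exceeds k (N div k) by
    less than k \<le> (1 - c) N.\<close>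
  define n0 where "n0 = k + nat \<lceil>real k / (1 - c)\<rceil>"
  define B where "B = 2 * pi * (exp (2 * pi * U) * (C2 * (C1 * (27 / (m / 2) ^ 3))))"
  have "cmod (rademacher_coeff N h k 1) \<le> ((L + L) + (L + L)) * B / (2 * pi) * (exp (real N * m) / real N ^ 3)" if N: "N \<ge> n0" for N
  proof -
    define M where "M = N div k"
    define T where "T = real (k\<^sup>2 * M)"
    have k0: "k > 0" using hk by simp
    have Nk: "N \<ge> k" using N by (simp add: n0_def)
    have M: "M \<ge> 1" using div_le_mono[OF Nk, of k] k0 by (simp add: M_def)
    have "N = k * M + N mod k" "N mod k < k" using k0 by (simp_all add: M_def)
    then have "N < k * M + k" "k * M \<le> N" by linarith+
    then have kM: "real N < real (k * M) + real k" "real (k * M) \<le> real N" by linarith+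
    have "real k / (1 - c) \<le> real n0" unfolding n0_def by linarith
    also have "\<dots> \<le> real N" using N by simp
    finally have "real k \<le> (1 - c) * real N" using c by (simp add: field_simps)
    then have cN: "c * real N \<le> real (k * M)" using kM by (simp add: algebra_simps)
    have "c * real N * real k \<le> real (k * M) * real k" using cN by (intro mult_right_mono) auto
    then have cT: "c * (real N * real k) \<le> T" by (simp add: T_def power2_eq_square mult_ac)
    have "1 \<le> k\<^sup>2 * M" using k0 M by simp
    then have T: "T \<ge> 1" unfolding T_def by linarith
    have N1: "N \<ge> 1" using Nk k0 by simp
    have farey: "(h, k) \<in> farey N" using hk Nk by (auto simp: farey_def)
    let ?f = "\<lambda>u. 2 * of_real pi * \<i> / of_real T * local_param (h, k) T u * (\<Prod>j=1..N. 1 / (1 - local_param (h, k) T u ^ j))"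
    have hol: "?f holomorphic_on S"
    proof -
      have "1 - local_param (h, k) T u ^ j \<noteq> 0" if "u \<in> S" "j \<in> {1..N}" for u j
        using local_param_power_neq_1[OF farey _ cT _ _ that(2)] that(1) T by auto
      then show ?thesis by (intro holomorphic_intros holomorphic_on_local_param) (use T in auto)
    qed
    have "cmod (?f u) \<le> B * (exp (real N * m) / real N ^ 3)" if u: "u \<in> path_image (loop_path g)" for u
    proof -
      have lp: "cmod (local_param (h, k) T u) \<le> exp (2 * pi * U)"
        using cmod_exp_2pi_i_le[OF U[OF u] T] unfolding local_param_def by (simp add: norm_mult farey_root_def)
      \<comment> \<open>Here k \<ge> 2 enters: M \<le> N/2, so the exponent M m falls short of N m
        by a gap of m/2 per unit of N.\<close>
      have "real M * 2 \<le> real M * real k" using hk by (intro mult_left_mono) auto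
      then have "real M * m \<le> real N / 2 * m" using kM m by (intro mult_right_mono) (auto simp: mult.commute)
      also have "\<dots> = real N * (m - m / 2)" by (simp add: field_simps)
      finally have "exp (real M * m) \<le> exp (real N * (m - m / 2))" by simp
      also have "\<dots> \<le> 27 / (m / 2) ^ 3 * (exp (real N * m) / real N ^ 3)"
        by (rule exp_shift_le) (use m N1 in auto)
      finally have ex: "exp (real M * m) \<le> 27 / (m / 2) ^ 3 * (exp (real N * m) / real N ^ 3)" .
      have "cmod (\<Prod>j=1..N. 1 / (1 - local_param (h, k) T u ^ j)) \<le> C2 * cmod (euler_prod M u)"
        using C2(2)[of N u] M cN u unfolding M_def T_def by simp
      also have "\<dots> \<le> C2 * (C1 * exp (real M * m))" using C2(1) C1(2)[OF M u] by (intro mult_left_mono)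
      also have "\<dots> \<le> C2 * (C1 * (27 / (m / 2) ^ 3 * (exp (real N * m) / real N ^ 3)))"
        using ex C1(1) C2(1) by (intro mult_left_mono)
      finally have pr: "cmod (\<Prod>j=1..N. 1 / (1 - local_param (h, k) T u ^ j)) \<le> C2 * (C1 * (27 / (m / 2) ^ 3 * (exp (real N * m) / real N ^ 3)))" .
      have "2 * pi / T \<le> 2 * pi / 1" using T by (intro divide_left_mono) auto
      then have p2: "cmod (2 * of_real pi * \<i> / of_real T) \<le> 2 * pi" using T by (simp add: norm_mult norm_divide)
      have "cmod (?f u) = cmod (2 * of_real pi * \<i> / of_real T) * (cmod (local_param (h, k) T u) * cmod (\<Prod>j=1..N. 1 / (1 - local_param (h, k) T u ^ j)))"
        by (simp only: norm_mult mult.assoc)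
      also have "\<dots> \<le> 2 * pi * (exp (2 * pi * U) * (C2 * (C1 * (27 / (m / 2) ^ 3 * (exp (real N * m) / real N ^ 3)))))"
        by (intro mult_mono p2 lp pr) auto
      finally show ?thesis unfolding B_def by (simp only: mult.assoc)
    qed
    then have "cmod (contour_integral (loop_path g) ?f) \<le> ((L + L) + (L + L)) * (B * (exp (real N * m) / real N ^ 3))"
      by (intro path_boundD[OF loop hol])
    moreover have "contour_integral (loop_path g) ?f = 2 * of_real pi * \<i> * rademacher_coeff N h k 1"
      by (rule contour_integral_unique[OF rademacher_coeff_loop[OF farey _ cT]]) (use T in simp)
    ultimately have "cmod (rademacher_coeff N h k 1) * (2 * pi) \<le> ((L + L) + (L + L)) * (B * (exp (real N * m) / real N ^ 3))"
      by (simp add: norm_mult mult.commute)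
    then have "cmod (rademacher_coeff N h k 1) \<le> ((L + L) + (L + L)) * (B * (exp (real N * m) / real N ^ 3)) / (2 * pi)"
      by (simp only: pos_le_divide_eq pi_gt_zero zero_less_mult_iff zero_less_numeral simp_thms)
    then show ?thesis by (simp add: mult_ac)
  qed
  then show ?thesis unfolding m_def[symmetric] by (rule eventually_bound_imp_bound) auto
qed

text \<open>Off the middle segment the phase is strictly below the saddle value, and on the compact
  head and tail this becomes a uniform gap. Only the middle segment then needs an asymptotic
  formula.\<close>

lemma head_tail_bound:
  obtains C \<epsilon> where "C \<ge> 0" "\<epsilon> > 0"
    "\<And>N u. N \<ge> 1 \<Longrightarrow> u \<in> path_image head \<union> path_image tail \<Longrightarrow> cmod (euler_prod N u) \<le> C * exp (real N * (Re (phase z0) - \<epsilon>))"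
proof -
  let ?K = "path_image head \<union> path_image tail"
  have sub: "?K \<subseteq> path_image g" unfolding path_image_g by blast
  have K: "compact ?K"
    using head tail by (intro compact_Un compact_path_image valid_path_imp_path) (auto simp: path_bound_def)
  have K': "?K \<subseteq> {u. Im u \<ge> 0} \<inter> slit_plane 1 - {0}" using sub compact_g(2) by (rule subset_trans)
  obtain C where C: "C \<ge> 0" "\<And>N u. N \<ge> 1 \<Longrightarrow> u \<in> ?K \<Longrightarrow> cmod (euler_prod N u) \<le> C * exp (real N * Re (phase u))"
    using euler_prod_le_phase[OF K K'] by blast
  obtain \<epsilon> where \<epsilon>: "\<epsilon> > 0" "\<And>u. u \<in> ?K \<Longrightarrow> Re (phase u) \<le> Re (phase z0) - \<epsilon>"
  proof (rule compact_uniform_gap[OF K continuous_on_subset[OF continuous_phase_g sub]])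
    show "Re (phase u) < Re (phase z0)" if "u \<in> ?K" for u
      using that low unfolding low_phase_def by blast
  qed auto
  show ?thesis
  proof (rule that[OF C(1) \<epsilon>(1)])
    fix N u assume N: "(N::nat) \<ge> 1" and u: "u \<in> ?K"
    have "real N * Re (phase u) \<le> real N * (Re (phase z0) - \<epsilon>)" using \<epsilon>(2)[OF u] by (intro mult_left_mono) auto
    then have "C * exp (real N * Re (phase u)) \<le> C * exp (real N * (Re (phase z0) - \<epsilon>))" using C(1) by (intro mult_left_mono) auto
    then show "cmod (euler_prod N u) \<le> C * exp (real N * (Re (phase z0) - \<epsilon>))" using C(2)[OF N u] by linarith
  qed
qed

text \<open>For k = 1 and T = N the contour formula reads N C = I + conj I - J, with I over
  \<open>g\<close> and J for the negated half. I is known up to O(exp (N m) / N^2), J is smaller,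
  and dividing by N gives the error exp (N m) / N^3.\<close>

lemma rademacher_coeff_0_1_asymp:
  "\<exists>K. \<forall>N\<ge>1. cmod (rademacher_coeff N 0 1 1 - of_real (Re ((- 2 * z0 * exp (- (of_real pi * \<i> * z0))) * (w0 powi (- int N) / of_nat N ^ 2))))
     \<le> K * (exp (real N * Re (phase z0)) / real N ^ 3)"
proof -
  define m where "m = Re (phase z0)"
  obtain C1 \<epsilon>1 where C1: "C1 \<ge> 0" "\<epsilon>1 > 0"
    "\<And>N u. N \<ge> 1 \<Longrightarrow> u \<in> path_image head \<union> path_image tail \<Longrightarrow> cmod (euler_prod N u) \<le> C1 * exp (real N * (m - \<epsilon>1))"
    using head_tail_bound unfolding m_def by blast
  obtain C2 \<epsilon>2 where C2: "C2 \<ge> 0" "\<epsilon>2 > 0"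
    "\<And>N u. N \<ge> 1 \<Longrightarrow> u \<in> path_image (upper_path g) \<Longrightarrow> cmod (euler_prod N u) \<le> C2 * exp (real N * m)"
    "\<And>N u. N \<ge> 1 \<Longrightarrow> u \<in> path_image (upper_path g) \<Longrightarrow> cmod (euler_prod N (- u)) \<le> C2 * exp (real N * (m - \<epsilon>2))"
    using upper_bounds unfolding m_def by blast
  obtain U where U: "\<And>u. u \<in> path_image (loop_path g) \<Longrightarrow> cmod u \<le> U"
    using compact_norm_bound[OF compact_loop continuous_on_id] by metis
  have U_upper: "cmod u \<le> U" if "u \<in> path_image (upper_path g)" for u
    using U that unfolding path_image_loop by blast
  have U_ht: "cmod u \<le> U" if "u \<in> path_image head \<union> path_image tail" for u
    using U_upper that unfolding path_image_upper path_image_g by blast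
  define B1 where "B1 = exp (2 * pi * U) * (C1 * (27 / \<epsilon>1 ^ 3))"
  define B2 where "B2 = exp (2 * pi * U) * (C2 * (27 / \<epsilon>2 ^ 3))"
  have main: "cmod (rademacher_coeff N 0 1 1 - of_real (Re ((- 2 * z0 * exp (- (of_real pi * \<i> * z0))) * (w0 powi (- int N) / of_nat N ^ 2))))
     \<le> (2 * (L1 * B1 + L2 * B1 + C0) + (L + L) * B2) * (exp (real N * m) / real N ^ 3)" if N: "N \<ge> 1" for N
  proof -
    let ?f = "saddle_integrand N"
    define P where "P = exp (real N * m)"
    have P: "P > 0" by (simp add: P_def)
    define X where "X = z0 * (- exp (- (of_real pi * \<i> * z0))) * (w0 powi (- int N) / of_nat N)"
    define I where "I = contour_integral g ?f"
    define J where "J = contour_integral (upper_path g) (\<lambda>u. ?f (- u))"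
    have hol: "?f holomorphic_on S"
      using holomorphic_saddle_integrand[OF N] S_subset holomorphic_on_subset by blast
    have holn: "(\<lambda>u. ?f (- u)) holomorphic_on S"
    proof -
      have "(?f \<circ> uminus) holomorphic_on S"
        by (rule holomorphic_on_compose_gen[OF _ hol]) (auto intro!: holomorphic_intros S(2))
      then show ?thesis by (simp add: o_def)
    qed
    have pw: "P / real N ^ 3 \<le> P / (real N)\<^sup>2"
    proof -
      have "(real N)\<^sup>2 \<le> real N ^ 3" using N by (intro power_increasing) auto
      then show ?thesis using N P by (intro divide_left_mono) auto
    qed
    have B0: "B1 \<ge> 0" "B2 \<ge> 0" using C1 C2 by (simp_all add: B1_def B2_def)
    have ht: "cmod (?f u) \<le> B1 * (P / (real N)\<^sup>2)" if u: "u \<in> path_image head \<union> path_image tail" for u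
    proof -
      have "cmod (?f u) \<le> exp (2 * pi * U) * cmod (euler_prod N u)" by (rule saddle_integrand_le[OF U_ht[OF u] N])
      also have "\<dots> \<le> exp (2 * pi * U) * (C1 * exp (real N * (m - \<epsilon>1)))" using C1(3)[OF N u] by (intro mult_left_mono) auto
      also have "\<dots> \<le> exp (2 * pi * U) * (C1 * (27 / \<epsilon>1 ^ 3 * (P / real N ^ 3)))"
        using C1(1) unfolding P_def by (intro mult_left_mono exp_shift_le C1(2) N) auto
      also have "\<dots> = B1 * (P / real N ^ 3)" by (simp only: B1_def mult.assoc)
      also have "\<dots> \<le> B1 * (P / (real N)\<^sup>2)" using B0 pw by (intro mult_left_mono)
      finally show ?thesis .
    qed
    have lo: "cmod (?f (- u)) \<le> B2 * (P / (real N)\<^sup>2)" if u: "u \<in> path_image (upper_path g)" for u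
    proof -
      have "cmod (- u) \<le> U" using U_upper[OF u] by simp
      then have "cmod (?f (- u)) \<le> exp (2 * pi * U) * cmod (euler_prod N (- u))" by (rule saddle_integrand_le[OF _ N])
      also have "\<dots> \<le> exp (2 * pi * U) * (C2 * exp (real N * (m - \<epsilon>2)))" using C2(4)[OF N u] by (intro mult_left_mono) auto
      also have "\<dots> \<le> exp (2 * pi * U) * (C2 * (27 / \<epsilon>2 ^ 3 * (P / real N ^ 3)))"
        using C2(1) unfolding P_def by (intro mult_left_mono exp_shift_le C2(2) N) auto
      also have "\<dots> = B2 * (P / real N ^ 3)" by (simp only: B2_def mult.assoc)
      also have "\<dots> \<le> B2 * (P / (real N)\<^sup>2)" using B0 pw by (intro mult_left_mono)
      finally show ?thesis .
    qed
    have Jb: "cmod J \<le> (L + L) * (B2 * (P / (real N)\<^sup>2))"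
      unfolding J_def by (rule path_boundD[OF upper holn lo])
    have vh: "valid_path head" "path_image head \<subseteq> S" and vt: "valid_path tail" "path_image tail \<subseteq> S"
      and vm: "valid_path middle" "path_image middle \<subseteq> S"
      using head tail middle by (auto simp: path_bound_def)
    have vmt: "valid_path (middle +++ tail)" "path_image (middle +++ tail) \<subseteq> S"
      using vm vt joins by (auto intro!: valid_path_join simp: path_image_join)
    have "I = contour_integral head ?f + contour_integral (middle +++ tail) ?f"
      unfolding I_def g_def by (intro contour_integral_join contour_integrable_holomorphic_simple[OF hol open_S] vh vmt)
    also have "contour_integral (middle +++ tail) ?f = contour_integral middle ?f + contour_integral tail ?f"
      by (intro contour_integral_join contour_integrable_holomorphic_simple[OF hol open_S] vm vt)
    finally have Isum: "I - X = contour_integral head ?f + (contour_integral middle ?f - X) + contour_integral tail ?f" by simp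
    have "cmod (contour_integral head ?f) \<le> L1 * (B1 * (P / (real N)\<^sup>2))"
      by (rule path_boundD[OF head hol]) (use ht in blast)
    moreover have "cmod (contour_integral tail ?f) \<le> L2 * (B1 * (P / (real N)\<^sup>2))"
      by (rule path_boundD[OF tail hol]) (use ht in blast)
    moreover have "cmod (contour_integral middle ?f - X) \<le> C0 * (P / (real N)\<^sup>2)"
      using mid[OF N] unfolding middle_def X_def P_def m_def exp_phase_z0(2) .
    ultimately have "cmod (I - X) \<le> L1 * (B1 * (P / (real N)\<^sup>2)) + C0 * (P / (real N)\<^sup>2) + L2 * (B1 * (P / (real N)\<^sup>2))"
      unfolding Isum by (intro norm_triangle_le add_mono)
    then have IX: "cmod (I - X) \<le> (L1 * B1 + L2 * B1 + C0) * (P / (real N)\<^sup>2)"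
      by (simp only: distrib_right mult.assoc add_ac)
    have fr: "(0, 1) \<in> farey N" using N by (simp add: farey_def)
    have integrand: "2 * of_real pi * \<i> / of_real (real N) * local_param (0, 1) (real N) u * (\<Prod>j=1..N. 1 / (1 - local_param (0, 1) (real N) u ^ j))
       = (2 * of_real pi * \<i> / of_nat N) * ?f u" for u
    proof -
      have "local_param (0, 1) (real N) u ^ j = exp (2 * of_real pi * \<i> * (of_nat j * u / of_nat N))" for j
      proof -
        have "of_nat j * (2 * of_real pi * \<i> * u / of_real (real N)) = 2 * of_real pi * \<i> * (of_nat j * u / of_nat N)" by simp
        then have "exp (2 * of_real pi * \<i> * u / of_real (real N)) ^ j = exp (2 * of_real pi * \<i> * (of_nat j * u / of_nat N))"
          by (simp only: exp_of_nat_mult[symmetric])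
        moreover have "local_param (0, 1) (real N) u = exp (2 * of_real pi * \<i> * u / of_real (real N))"
          by (simp add: local_param_def farey_root_def)
        ultimately show ?thesis by (simp only:)
      qed
      moreover have "local_param (0, 1) (real N) u = exp (2 * of_real pi * \<i> * u / of_nat N)"
        by (simp add: local_param_def farey_root_def)
      ultimately show ?thesis unfolding saddle_integrand_def euler_prod_def by simp
    qed
    have "((\<lambda>u. (2 * of_real pi * \<i> / of_nat N) * ?f u) has_contour_integral (2 * of_real pi * \<i> * rademacher_coeff N 0 1 1)) (loop_path g)"
      using rademacher_coeff_loop[OF fr, of "real N"] N c unfolding integrand by simp
    then have "contour_integral (loop_path g) (\<lambda>u. (2 * of_real pi * \<i> / of_nat N) * ?f u) = 2 * of_real pi * \<i> * rademacher_coeff N 0 1 1"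
      by (rule contour_integral_unique)
    moreover have "contour_integral (loop_path g) (\<lambda>u. (2 * of_real pi * \<i> / of_nat N) * ?f u) = (2 * of_real pi * \<i> / of_nat N) * contour_integral (loop_path g) ?f"
      by (intro contour_integral_lmul contour_integrable_holomorphic_simple[OF hol open_S] loop_in_S)
    ultimately have "contour_integral (loop_path g) ?f = of_nat N * rademacher_coeff N 0 1 1" using N by (simp add: field_simps)
    moreover have "contour_integral (loop_path g) ?f = I + cnj I - J"
      unfolding I_def J_def contour_integral_loop[OF hol] by (simp only: contour_integral_upper_sym[OF hol saddle_integrand_cnj])
    ultimately have NC: "of_nat N * rademacher_coeff N 0 1 1 = I + cnj I - J" by simp
    have XX: "of_nat N * complex_of_real (Re ((- 2 * z0 * exp (- (of_real pi * \<i> * z0))) * (w0 powi (- int N) / of_nat N ^ 2))) = X + cnj X"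
    proof -
      have "(- 2 * z0 * exp (- (of_real pi * \<i> * z0))) * (w0 powi (- int N) / of_nat N ^ 2) = of_real (2 / real N) * X"
        by (simp add: X_def power2_eq_square)
      then have "Re ((- 2 * z0 * exp (- (of_real pi * \<i> * z0))) * (w0 powi (- int N) / of_nat N ^ 2)) = 2 / real N * Re X" by simp
      then have "of_nat N * complex_of_real (Re ((- 2 * z0 * exp (- (of_real pi * \<i> * z0))) * (w0 powi (- int N) / of_nat N ^ 2))) = of_real (2 * Re X)"
        using N by simp
      then show ?thesis by (simp add: complex_add_cnj)
    qed
    have divide_N: "d \<le> Q * (P / real N ^ 3)" if "real N * d \<le> Q * (P / (real N)\<^sup>2)" for d Q
    proof -
      have "d \<le> Q * (P / (real N)\<^sup>2) / real N" using that N by (simp add: pos_le_divide_eq mult.commute)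
      then show ?thesis by (simp add: power3_eq_cube power2_eq_square mult_ac)
    qed
    let ?D = "rademacher_coeff N 0 1 1 - of_real (Re ((- 2 * z0 * exp (- (of_real pi * \<i> * z0))) * (w0 powi (- int N) / of_nat N ^ 2)))"
    have "of_nat N * ?D = (I - X) + cnj (I - X) - J"
      unfolding right_diff_distrib NC XX by simp
    then have "real N * cmod ?D = cmod ((I - X) + cnj (I - X) - J)" by (metis norm_mult norm_of_nat)
    also have "\<dots> \<le> cmod (I - X) + cmod (cnj (I - X)) + cmod J"
      by (rule order_trans[OF norm_triangle_ineq4 add_right_mono[OF norm_triangle_ineq]])
    also have "\<dots> \<le> (L1 * B1 + L2 * B1 + C0) * (P / (real N)\<^sup>2) + (L1 * B1 + L2 * B1 + C0) * (P / (real N)\<^sup>2) + (L + L) * (B2 * (P / (real N)\<^sup>2))"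
      unfolding complex_mod_cnj by (intro add_mono IX Jb)
    also have "\<dots> = (2 * (L1 * B1 + L2 * B1 + C0) + (L + L) * B2) * (P / (real N)\<^sup>2)"
      by (simp only: distrib_right mult.assoc mult_2)
    finally show ?thesis unfolding P_def[symmetric] by (rule divide_N)
  qed
  then show ?thesis unfolding m_def by blast
qed

end

lemma saddle_loop_exists: "\<exists>c \<delta> head tail L1 L2 C0. saddle_loop c \<delta> head tail L1 L2 C0"
proof -
  obtain d0 where d0: "d0 > 0" "\<And>\<delta>. 0 < \<delta> \<Longrightarrow> \<delta> < d0 \<Longrightarrow>
     (\<forall>u\<in>closed_segment (of_real (1 - \<delta>) * z0) (of_real (1 + \<delta>) * z0). 0 < Im u \<and> Re (phase u) \<le> Re (phase z0)) \<and>
     (\<exists>C. \<forall>N\<ge>1. cmod (contour_integral (linepath (of_real (1 - \<delta>) * z0) (of_real (1 + \<delta>) * z0)) (saddle_integrand N)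
         - z0 * (- exp (- (of_real pi * \<i> * z0))) * (w0 powi (- int N) / of_nat N)) \<le> C * (cmod w0 powi (- int N) / (real N)\<^sup>2))"
    using saddle_segment_asymp by blast
  obtain c \<delta> head tail L1 L2 where p: "0 < c" "c < 1" "0 < \<delta>" "\<delta> < d0"
     "path_bound (slit_plane c - {0}) head L1" "path_bound (slit_plane c - {0}) tail L2"
     "Im (pathstart head) = 0" "Re (pathstart head) > 0" "pathfinish head = of_real (1 - \<delta>) * z0"
     "pathstart tail = of_real (1 + \<delta>) * z0" "Re (pathfinish tail) = 0"
     "path_image head \<subseteq> low_phase" "path_image tail \<subseteq> low_phase"
    using saddle_contour[OF d0(1)] by blast
  note d = d0(2)[OF p(3,4)]
  obtain C0 where C0: "\<forall>N\<ge>1. cmod (contour_integral (linepath (of_real (1 - \<delta>) * z0) (of_real (1 + \<delta>) * z0)) (saddle_integrand N)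
         - z0 * (- exp (- (of_real pi * \<i> * z0))) * (w0 powi (- int N) / of_nat N)) \<le> C0 * (cmod w0 powi (- int N) / (real N)\<^sup>2)"
    using d by blast
  have "saddle_loop c \<delta> head tail L1 L2 C0"
    by unfold_locales (use p d C0 in blast)+
  then show ?thesis by blast
qed

theorem theorem1p2:
  shows "\<exists>K::real. K > 0 \<and> (\<forall>N::nat. N \<ge> 1 \<longrightarrow>
    cmod ((\<Sum>(h, k)\<in>farey 100. rademacher_coeff N h k 1)
          - complex_of_real (Re ((- 2 * z0 * exp (- (of_real pi * \<i> * z0)))
                                  * (w0 powi (- int N) / of_nat N ^ 2))))
      \<le> K * (cmod w0 powi (- int N) / real N ^ 3))"
proof -
  obtain c \<delta> head tail L1 L2 C0 where "saddle_loop c \<delta> head tail L1 L2 C0"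
    using saddle_loop_exists by blast
  then interpret saddle_loop c \<delta> head tail L1 L2 C0 .
  let ?b = "\<lambda>N. exp (real N * Re (phase z0)) / real N ^ 3"
  let ?F = "farey 100 - {(0, 1)}"
  obtain K0 where K0: "\<And>N. N \<ge> 1 \<Longrightarrow> cmod (rademacher_coeff N 0 1 1 - of_real (Re ((- 2 * z0 * exp (- (of_real pi * \<i> * z0))) * (w0 powi (- int N) / of_nat N ^ 2))))
     \<le> K0 * ?b N"
    using rademacher_coeff_0_1_asymp by blast
  \<comment> \<open>Every fraction other than 0/1 has denominator at least 2 and contributes only to
    the error. The constants depend on \<open>p\<close>, but they are summed over the fixed finite
    set \<open>farey 100\<close>.\<close>
  have "\<exists>K\<ge>0. \<forall>N\<ge>1. cmod (rademacher_coeff N (fst p) (snd p) 1) \<le> K * ?b N" if p: "p \<in> ?F" for p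
  proof (rule rademacher_coeff_exponentially_smaller)
    obtain h k where hk: "p = (h, k)" by (cases p)
    have "(h, k) \<in> farey k" using p farey_self(1)[of h k 100] unfolding hk by blast
    then show "(fst p, snd p) \<in> farey (snd p)" by (simp add: hk)
    have "1 \<le> k" "h < k" "(h, k) \<noteq> (0, 1)" using p unfolding hk by (auto simp: farey_def)
    then show "2 \<le> snd p" unfolding hk by (cases "k = 1") auto
  qed
  then obtain Kf where Kf: "\<And>p N. p \<in> ?F \<Longrightarrow> N \<ge> 1 \<Longrightarrow> cmod (rademacher_coeff N (fst p) (snd p) 1) \<le> Kf p * ?b N"
    by metis
  define K where "K = \<bar>K0 + (\<Sum>p\<in>?F. Kf p)\<bar> + 1"
  show ?thesis
  proof (rule exI[of _ K], intro conjI allI impI)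
    show "K > 0" by (simp add: K_def)
    fix N :: nat assume N: "N \<ge> 1"
    let ?t = "complex_of_real (Re ((- 2 * z0 * exp (- (of_real pi * \<i> * z0))) * (w0 powi (- int N) / of_nat N ^ 2)))"
    have mem: "(0, 1) \<in> farey 100" by (simp add: farey_def)
    have b: "?b N \<ge> 0" by simp
    have "(\<Sum>(h, k)\<in>farey 100. rademacher_coeff N h k 1) = rademacher_coeff N 0 1 1 + (\<Sum>p\<in>?F. rademacher_coeff N (fst p) (snd p) 1)"
      by (simp add: sum.remove[OF finite_farey mem] case_prod_beta)
    then have "cmod ((\<Sum>(h, k)\<in>farey 100. rademacher_coeff N h k 1) - ?t)
       = cmod ((rademacher_coeff N 0 1 1 - ?t) + (\<Sum>p\<in>?F. rademacher_coeff N (fst p) (snd p) 1))" by (simp add: algebra_simps)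
    also have "\<dots> \<le> K0 * ?b N + (\<Sum>p\<in>?F. Kf p * ?b N)"
      by (intro norm_triangle_le add_mono K0 N sum_norm_le Kf)
    also have "\<dots> = (K0 + (\<Sum>p\<in>?F. Kf p)) * ?b N" by (simp only: sum_distrib_right[symmetric] distrib_right)
    also have "\<dots> \<le> K * ?b N" using b by (intro mult_right_mono) (auto simp: K_def)
    finally show "cmod ((\<Sum>(h, k)\<in>farey 100. rademacher_coeff N h k 1) - ?t) \<le> K * (cmod w0 powi (- int N) / real N ^ 3)"
      unfolding exp_phase_z0(2) .
  qed
qed

end
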